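(* Let $d\ge 2$ and let $K\subset\mathbb{R}^d$ be a convex body. Then the value function $v$ is quasi-concave (its superlevel sets $\{v\ge c\}$, $c\in\mathbb{R}$, are convex), vanishes on all faces of $K$ of dimension zero and one, and is strictly positive elsewhere in $K$.
   Context: A convex body is a nonempty compact convex set (possibly with empty interior). A face of $K$ is a convex subset $F\subset K$ such that every closed line segment $L\subset K$ whose relative interior meets $F$ satisfies $L\subset F$; its dimension is the dimension of its affine span ($K$ itself is a face). Value function. Let $\Omega=C(\mathbb{R}_+,\mathbb{R}^d)$ with the locally uniform topology, $X$ the coordinate process $X(t,\omega)=\omega(t)$, and $\mathcal{P}(\Omega)$ the set of Borel probability measures on $\Omega$. For $x\in\mathbb{R}^d$, $\mathcal{P}_x$ is the set of $P\in\mathcal{P}(\Omega)$ such that $X$ is a $P$-martingale (with respect to the raw filtration generated by $X$), $P(X(0)=x)=1$, and $P(\operatorname{tr}\langle X\rangle(t)=t \text{ for all } t\ge 0)=1$. Let $\tau_K=\inf\{t\ge 0: X(t)\notin K\}$ and $v(x)=\sup_{P\in\mathcal{P}_x} P\text{-}\operatorname{ess\,inf}\tau_K$, where $P\text{-}\operatorname{ess\,inf} Z=\sup\{c: P(Z\ge c)=1\}$. *)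

theory Defs
  imports "HOL-Probability.Probability"
begin

section \<open>The space of continuous paths\<close>

text \<open>Paths are indexed by \<open>real\<close>; membership in \<open>extensional {0..}\<close> fixes the irrelevant values at
  negative times, so that elements of \<open>path_space\<close> correspond exactly to continuous functions on
  the half-line.\<close>

definition path_space :: "(real \<Rightarrow> 'a::metric_space) set" where
  "path_space = {\<omega> \<in> extensional {0..}. continuous_on {0..} \<omega>}"

definition path_nbhd :: "real \<Rightarrow> real \<Rightarrow> (real \<Rightarrow> 'a::metric_space) \<Rightarrow> (real \<Rightarrow> 'a) set" where
  "path_nbhd T e \<omega> = {\<eta> \<in> path_space. \<forall>t\<in>{0..T}. dist (\<eta> t) (\<omega> t) < e}"

text \<open>The topology of locally uniform convergence.\<close>

definition path_topology :: "(real \<Rightarrow> 'a::metric_space) topology" where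
  "path_topology = topology (\<lambda>U. U \<subseteq> path_space \<and>
     (\<forall>\<omega>\<in>U. \<exists>T\<ge>0. \<exists>e>0. path_nbhd T e \<omega> \<subseteq> U))"

lemma istopology_path:
  "istopology (\<lambda>U. U \<subseteq> (path_space :: (real \<Rightarrow> 'a::metric_space) set) \<and>
     (\<forall>\<omega>\<in>U. \<exists>T\<ge>0. \<exists>e>0. path_nbhd T e \<omega> \<subseteq> U))"
  unfolding istopology_def
proof (intro conjI allI impI)
  fix S U :: "(real \<Rightarrow> 'a) set"
  assume S: "S \<subseteq> path_space \<and> (\<forall>\<omega>\<in>S. \<exists>T\<ge>0. \<exists>e>0. path_nbhd T e \<omega> \<subseteq> S)"
    and U: "U \<subseteq> path_space \<and> (\<forall>\<omega>\<in>U. \<exists>T\<ge>0. \<exists>e>0. path_nbhd T e \<omega> \<subseteq> U)"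
  show "S \<inter> U \<subseteq> path_space" using S by blast
  show "\<forall>\<omega>\<in>S \<inter> U. \<exists>T\<ge>0. \<exists>e>0. path_nbhd T e \<omega> \<subseteq> S \<inter> U"
  proof
    fix \<omega> assume "\<omega> \<in> S \<inter> U"
    then obtain T e T' e' where *: "T \<ge> 0" "e > 0" "path_nbhd T e \<omega> \<subseteq> S"
      "T' \<ge> 0" "e' > 0" "path_nbhd T' e' \<omega> \<subseteq> U" using S U by (meson IntD1 IntD2)
    have "path_nbhd (max T T') (min e e') \<omega> \<subseteq> path_nbhd T e \<omega> \<inter> path_nbhd T' e' \<omega>"
      by (auto simp: path_nbhd_def)
    with * show "\<exists>T\<ge>0. \<exists>e>0. path_nbhd T e \<omega> \<subseteq> S \<inter> U"
      by (intro exI[of _ "max T T'"] conjI exI[of _ "min e e'"]) auto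
  qed
next
  fix \<K> :: "(real \<Rightarrow> 'a) set set"
  assume \<K>: "\<forall>U\<in>\<K>. U \<subseteq> path_space \<and> (\<forall>\<omega>\<in>U. \<exists>T\<ge>0. \<exists>e>0. path_nbhd T e \<omega> \<subseteq> U)"
  show "\<Union>\<K> \<subseteq> path_space" using \<K> by blast
  show "\<forall>\<omega>\<in>\<Union>\<K>. \<exists>T\<ge>0. \<exists>e>0. path_nbhd T e \<omega> \<subseteq> \<Union>\<K>"
  proof
    fix \<omega> assume "\<omega> \<in> \<Union>\<K>"
    then obtain U where U: "U \<in> \<K>" "\<omega> \<in> U" by blast
    then obtain T e where "T \<ge> 0" "e > 0" "path_nbhd T e \<omega> \<subseteq> U" using \<K> by meson
    with U show "\<exists>T\<ge>0. \<exists>e>0. path_nbhd T e \<omega> \<subseteq> \<Union>\<K>" by blast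
  qed
qed

lemma openin_path_topology:
  "openin path_topology U \<longleftrightarrow>
     U \<subseteq> path_space \<and> (\<forall>\<omega>\<in>U. \<exists>T\<ge>0. \<exists>e>0. path_nbhd T e \<omega> \<subseteq> U)"
  unfolding path_topology_def topology_inverse'[OF istopology_path] ..

lemma topspace_path_topology: "topspace path_topology = path_space"
proof (rule antisym)
  show "topspace path_topology \<subseteq> path_space"
    using openin_topspace openin_path_topology by blast
  have "openin path_topology path_space"
    unfolding openin_path_topology
    by (auto simp: path_nbhd_def intro!: exI[of _ "0::real"] exI[of _ "1::real"])
  then show "path_space \<subseteq> topspace path_topology" by (rule openin_subset)
qed

definition path_borel :: "(real \<Rightarrow> 'a::metric_space) measure" where
  "path_borel = sigma path_space {U. openin path_topology U}"

lemma space_path_borel [simp]: "space path_borel = path_space"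
  by (auto simp: path_borel_def openin_path_topology intro!: space_measure_of)

lemma sets_path_borel: "sets path_borel = sigma_sets path_space {U. openin path_topology U}"
  by (auto simp: path_borel_def openin_path_topology intro!: sets_measure_of)

text \<open>The raw (neither completed nor right-continuous) filtration generated by the coordinate
  process. It is indexed by all reals, as \<open>stopping_time\<close> demands, and is trivial at negative
  times.\<close>

definition raw_filtration :: "real \<Rightarrow> (real \<Rightarrow> 'a::metric_space) measure" where
  "raw_filtration t =
     sigma path_space {{\<omega> \<in> path_space. \<omega> s \<in> B} |s B. 0 \<le> s \<and> s \<le> t \<and> B \<in> sets borel}"

lemma coordinate_measurable:
  assumes "0 \<le> s"
  shows "(\<lambda>\<omega>::real \<Rightarrow> 'a::metric_space. \<omega> s) \<in> borel_measurable path_borel"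
proof (rule borel_measurableI)
  fix S :: "'a set" assume S: "open S"
  have "openin path_topology ((\<lambda>\<omega>. \<omega> s) -` S \<inter> path_space)"
    unfolding openin_path_topology
  proof (intro conjI ballI)
    fix \<omega> assume \<omega>: "\<omega> \<in> (\<lambda>\<omega>. \<omega> s) -` S \<inter> path_space"
    then obtain e where "e > 0" "\<And>y. dist y (\<omega> s) < e \<Longrightarrow> y \<in> S"
      using S unfolding open_dist by auto
    then show "\<exists>T\<ge>0. \<exists>e>0. path_nbhd T e \<omega> \<subseteq> (\<lambda>\<omega>. \<omega> s) -` S \<inter> path_space"
      using assms by (intro exI[of _ s] conjI exI[of _ e]) (auto simp: path_nbhd_def)
  qed auto
  then show "(\<lambda>\<omega>. \<omega> s) -` S \<inter> space path_borel \<in> sets path_borel"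
    by (auto simp: sets_path_borel)
qed

lemma subalgebra_raw_filtration:
  assumes "sets P = sets (path_borel :: (real \<Rightarrow> 'a::metric_space) measure)"
  shows "subalgebra P (raw_filtration t)"
proof -
  have sp: "space P = path_space" using sets_eq_imp_space_eq[OF assms] by simp
  have "{\<omega> \<in> path_space. \<omega> s \<in> B} \<in> sets P" if "0 \<le> s" "B \<in> sets borel" for s and B :: "'a set"
    using measurable_sets[OF coordinate_measurable[OF that(1)] that(2)] assms
    by (simp add: vimage_def Int_def conj_commute)
  then have "{{\<omega> \<in> path_space. \<omega> s \<in> B} |s B. 0 \<le> s \<and> s \<le> t \<and> B \<in> sets borel} \<subseteq> sets P"
    by blast
  from sets.sigma_sets_subset[OF this] show ?thesis
    unfolding subalgebra_def raw_filtration_def sp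
    by (subst sets_measure_of) (auto simp: space_measure_of_conv sp)
qed


section \<open>Martingales and the bracket of a continuous martingale\<close>

text \<open>All processes are indexed by \<open>real\<close>, only times \<open>t \<ge> 0\<close> being relevant. The filtration is
  meant to consist of subalgebras of \<open>P\<close>, as \<open>real_cond_exp\<close> requires.\<close>

definition adapted :: "(real \<Rightarrow> 's measure) \<Rightarrow> (real \<Rightarrow> 's \<Rightarrow> real) \<Rightarrow> bool" where
  "adapted F M \<longleftrightarrow> (\<forall>t\<ge>0. M t \<in> borel_measurable (F t))"

definition martingale :: "'s measure \<Rightarrow> (real \<Rightarrow> 's measure) \<Rightarrow> (real \<Rightarrow> 's \<Rightarrow> real) \<Rightarrow> bool" where
  "martingale P F M \<longleftrightarrow> adapted F M \<and> (\<forall>t\<ge>0. integrable P (M t)) \<and>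
     (\<forall>s t. 0 \<le> s \<and> s \<le> t \<longrightarrow> (AE \<omega> in P. real_cond_exp P (F s) (M t) \<omega> = M s \<omega>))"

text \<open>Real-valued localizing times suffice: a localizing sequence of extended stopping times
  \<open>T n\<close> may be replaced by \<open>min (T n) n\<close>.\<close>

definition local_martingale ::
    "'s measure \<Rightarrow> (real \<Rightarrow> 's measure) \<Rightarrow> (real \<Rightarrow> 's \<Rightarrow> real) \<Rightarrow> bool" where
  "local_martingale P F M \<longleftrightarrow> adapted F M \<and>
     (\<exists>T :: nat \<Rightarrow> 's \<Rightarrow> real.
        (\<forall>n. stopping_time F (T n) \<and> (\<forall>\<omega>\<in>space P. 0 \<le> T n \<omega>)) \<and>
        (AE \<omega> in P. incseq (\<lambda>n. T n \<omega>) \<and> filterlim (\<lambda>n. T n \<omega>) at_top sequentially) \<and>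
        (\<forall>n. martingale P F (\<lambda>t \<omega>. M (min t (T n \<omega>)) \<omega> - M 0 \<omega>)))"

definition finite_variation :: "(real \<Rightarrow> real) \<Rightarrow> bool" where
  "finite_variation f \<longleftrightarrow> (\<forall>T\<ge>0. \<exists>B. \<forall>n. \<forall>s :: nat \<Rightarrow> real.
     mono s \<and> range s \<subseteq> {0..T} \<longrightarrow> (\<Sum>k<n. \<bar>f (s (Suc k)) - f (s k)\<bar>) \<le> B)"

text \<open>\<open>is_bracket P F X A\<close>: the matrix-valued process \<open>A\<close> is a version of the bracket \<open>\<langle>X\<rangle>\<close> of the
  continuous process \<open>X\<close>, that is, its entries are adapted, almost surely continuous, null at zero
  and of locally finite variation, and they compensate the products of the components of \<open>X\<close>.
  Such an \<open>A\<close> is unique up to indistinguishability. Path regularity is only almost sure, so that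
  a version adapted to a filtration that is not completed exists.\<close>

definition is_bracket :: "'s measure \<Rightarrow> (real \<Rightarrow> 's measure) \<Rightarrow> (real \<Rightarrow> 's \<Rightarrow> real ^ 'n) \<Rightarrow>
    (real \<Rightarrow> 's \<Rightarrow> real ^ 'n ^ 'n) \<Rightarrow> bool" where
  "is_bracket P F X A \<longleftrightarrow> (\<forall>i j.
     adapted F (\<lambda>t \<omega>. A t \<omega> $ i $ j) \<and>
     (AE \<omega> in P. A 0 \<omega> $ i $ j = 0 \<and> continuous_on {0..} (\<lambda>t. A t \<omega> $ i $ j) \<and>
        finite_variation (\<lambda>t. A t \<omega> $ i $ j)) \<and>
     local_martingale P F (\<lambda>t \<omega>. X t \<omega> $ i * X t \<omega> $ j - A t \<omega> $ i $ j))"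


section \<open>The value function\<close>

definition martingale_laws :: "real ^ 'n \<Rightarrow> (real \<Rightarrow> real ^ 'n) measure set" where
  "martingale_laws x = {P. prob_space P \<and> sets P = sets path_borel \<and>
     (\<forall>i. martingale P raw_filtration (\<lambda>t \<omega>. \<omega> t $ i)) \<and>
     (AE \<omega> in P. \<omega> 0 = x) \<and>
     (\<exists>A. is_bracket P raw_filtration (\<lambda>t \<omega>. \<omega> t) A \<and> (AE \<omega> in P. \<forall>t\<ge>0. trace (A t \<omega>) = t))}"

definition exit_time :: "'a set \<Rightarrow> (real \<Rightarrow> 'a) \<Rightarrow> ereal" where
  "exit_time K \<omega> = Inf {ereal t |t. 0 \<le> t \<and> \<omega> t \<notin> K}"

definition ess_inf :: "'s measure \<Rightarrow> ('s \<Rightarrow> ereal) \<Rightarrow> ereal" where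
  "ess_inf P Z = Sup {c. measure P {\<omega> \<in> space P. c \<le> Z \<omega>} = 1}"

definition value_fun :: "(real ^ 'n) set \<Rightarrow> real ^ 'n \<Rightarrow> ereal" where
  "value_fun K x = (SUP P\<in>martingale_laws x. ess_inf P (exit_time K))"

end

theory Submission
  imports Defs
begin

text \<open>For \<open>c > 0\<close>, laws started at \<open>y\<close> and \<open>z\<close> that stay in \<open>K\<close> up to time \<open>c\<close> yield such a law started at any
  point between them: run a one-dimensional Brownian motion on the segment from \<open>y\<close> to \<open>z\<close> until it
  hits an endpoint and continue with the law belonging to that endpoint. This gives quasi-concavity.

  If \<open>x\<close> lies in the relative interior of a face of dimension at least two, that face contains a disc
  of radius \<open>R\<close> around \<open>x\<close>. A martingale that moves on a circle whose squared radius grows as \<open>r\<^sup>2 + t\<close>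
  stays in the disc for the time \<open>R\<^sup>2 - r\<^sup>2\<close>, and \<open>x\<close> is the midpoint of two of its starting points.

  A martingale started in a face and staying in \<open>K\<close> stays in that face, since its mean does not move. On
  a face of dimension at most one it would be a Brownian motion on a bounded segment, which leaves
  the segment before any positive time with positive probability.\<close>

section \<open>The path space\<close>

lemma path_space_continuous: "\<omega> \<in> path_space \<Longrightarrow> continuous_on {0..} \<omega>"
  by (simp add: path_space_def)

lemma path_space_eqI:
  assumes "\<omega> \<in> path_space" "\<eta> \<in> path_space" "\<And>s. 0 \<le> s \<Longrightarrow> \<omega> s = \<eta> s"
  shows "\<omega> = \<eta>"
proof
  fix s show "\<omega> s = \<eta> s"
    using assms by (cases "0 \<le> s") (auto simp: path_space_def extensional_def)
qed

definition cylinders :: "(real \<Rightarrow> 'a::metric_space) set set" where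
  "cylinders = {{\<omega> \<in> path_space. \<omega> s \<in> B} |s B. 0 \<le> s \<and> B \<in> sets borel}"

lemma cylinders_subset: "cylinders \<subseteq> Pow path_space"
  by (auto simp: cylinders_def)

text \<open>Separability of the path space: the tubes around step functions with values in a countable
  dense set, tested at rational times only, form a countable base made of cylinder events.\<close>

lemma openin_path_topology_cylinders:
  fixes U :: "(real \<Rightarrow> 'a::{metric_space, second_countable_topology}) set"
  assumes "openin path_topology U"
  shows "U \<in> sigma_sets path_space cylinders"
proof -
  obtain D :: "'a set" where D: "countable D" "\<And>X. open X \<Longrightarrow> X \<noteq> {} \<Longrightarrow> \<exists>d\<in>D. d \<in> X"
    using countable_dense_exists by blast
  define V where "V = (\<lambda>(N::nat, l::'a list, T::nat, q::nat).
    {\<eta> \<in> path_space. \<forall>t\<in>\<rat> \<inter> {0..real T}. dist (\<eta> t) (l ! nat \<lfloor>real (Suc N) * t\<rfloor>) \<le> 1 / real (Suc q)})"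
  define I where "I = (UNIV :: nat set) \<times> lists D \<times> (UNIV :: nat set) \<times> (UNIV :: nat set)"
  have cI: "countable I" unfolding I_def using D(1) by (intro countable_SIGMA) auto
  define C where "C = sigma path_space (cylinders :: (real \<Rightarrow> 'a) set set)"
  have spC: "space C = path_space" and stC: "sets C = sigma_sets path_space cylinders"
    unfolding C_def using cylinders_subset by (rule space_measure_of, rule sets_measure_of)
  have meas: "V i \<in> sets C" for i
  proof -
    obtain N l T q where i: "i = (N, l, T, q)" by (cases i) auto
    have z: "0 \<in> \<rat> \<inter> {0..real T}" by simp
    have "{\<eta> \<in> space C. \<forall>t\<in>\<rat> \<inter> {0..real T}. dist (\<eta> t) (l ! nat \<lfloor>real (Suc N) * t\<rfloor>) \<le> 1 / real (Suc q)} \<in> sets C"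
    proof -
      have "(\<Inter>t\<in>\<rat> \<inter> {0..real T}. {\<eta> \<in> space C. dist (\<eta> t) (l ! nat \<lfloor>real (Suc N) * t\<rfloor>) \<le> 1 / real (Suc q)}) \<in> sets C"
      proof (rule sets.countable_INT')
      show "countable (\<rat> \<inter> {0..real T})" by (intro countable_Int1 countable_rat)
      show "\<rat> \<inter> {0..real T} \<noteq> {}" using z by blast
      have "{\<eta> \<in> space C. dist (\<eta> t) (l ! nat \<lfloor>real (Suc N) * t\<rfloor>) \<le> 1 / real (Suc q)} \<in> sets C" if t: "t \<in> \<rat> \<inter> {0..real T}" for t
      proof -
      have "{\<eta> \<in> path_space. \<eta> t \<in> cball (l ! nat \<lfloor>real (Suc N) * t\<rfloor>) (1 / real (Suc q))} \<in> cylinders"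
        unfolding cylinders_def
        by (rule CollectI, rule exI[of _ t], rule exI[of _ "cball (l ! nat \<lfloor>real (Suc N) * t\<rfloor>) (1 / real (Suc q))"]) (use t in auto)
      moreover have "{\<eta> \<in> path_space. \<eta> t \<in> cball (l ! nat \<lfloor>real (Suc N) * t\<rfloor>) (1 / real (Suc q))} =
        {\<eta> \<in> path_space. dist (\<eta> t) (l ! nat \<lfloor>real (Suc N) * t\<rfloor>) \<le> 1 / real (Suc q)}"
        unfolding mem_cball by (subst dist_commute) (rule refl)
      ultimately show ?thesis unfolding spC stC by auto
      qed
      then show "(\<lambda>t. {\<eta> \<in> space C. dist (\<eta> t) (l ! nat \<lfloor>real (Suc N) * t\<rfloor>) \<le> 1 / real (Suc q)}) ` (\<rat> \<inter> {0..real T}) \<subseteq> sets C"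
        by blast
      qed
      also have "(\<Inter>t\<in>\<rat> \<inter> {0..real T}. {\<eta> \<in> space C. dist (\<eta> t) (l ! nat \<lfloor>real (Suc N) * t\<rfloor>) \<le> 1 / real (Suc q)}) =
        {\<eta> \<in> space C. \<forall>t\<in>\<rat> \<inter> {0..real T}. dist (\<eta> t) (l ! nat \<lfloor>real (Suc N) * t\<rfloor>) \<le> 1 / real (Suc q)}"
        using z by blast
      finally show ?thesis .
    qed
    then show ?thesis by (simp add: V_def i spC)
  qed
  have "U = (\<Union>i\<in>{i\<in>I. V i \<subseteq> U}. V i)"
  proof (intro equalityI subsetI)
    fix \<omega> assume \<omega>: "\<omega> \<in> U"
    with assms obtain T e where T: "T \<ge> 0" "e > 0" "path_nbhd T e \<omega> \<subseteq> U" and p: "\<omega> \<in> path_space"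
      unfolding openin_path_topology by blast
    define T' where "T' = Suc (nat \<lceil>T\<rceil>)"
    have T': "T < real T'" unfolding T'_def using T(1) by linarith
    obtain q :: nat where q: "1 / real (Suc q) < e / 4"
      using T(2) by (metis nat_approx_posE zero_less_divide_iff zero_less_numeral)
    have "uniformly_continuous_on {0..real T'} \<omega>"
      by (rule compact_uniformly_continuous)
        (auto intro: continuous_on_subset[OF path_space_continuous[OF p]])
    then obtain d where d: "d > 0" "\<And>t t'. t \<in> {0..real T'} \<Longrightarrow> t' \<in> {0..real T'} \<Longrightarrow> dist t' t < d \<Longrightarrow>
       dist (\<omega> t') (\<omega> t) < 1 / (2 * real (Suc q))"
      unfolding uniformly_continuous_on_def by (metis divide_pos_pos mult_pos_pos of_nat_0_less_iff zero_less_Suc zero_less_numeral zero_less_one)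
    obtain N :: nat where N: "1 / real (Suc N) < d" using d(1) nat_approx_posE by metis
    have "\<exists>x\<in>D. dist (\<omega> (real k / real (Suc N))) x < 1 / (2 * real (Suc q))" for k
      using D(2)[of "ball (\<omega> (real k / real (Suc N))) (1 / (2 * real (Suc q)))"] by auto
    then obtain f where f: "\<And>k. f k \<in> D" "\<And>k. dist (\<omega> (real k / real (Suc N))) (f k) < 1 / (2 * real (Suc q))"
      by metis
    define l where "l = map f [0..<Suc (Suc N * T')]"
    have key: "dist (\<omega> t) (l ! nat \<lfloor>real (Suc N) * t\<rfloor>) < 1 / real (Suc q)" if t: "t \<in> {0..real T'}" for t
    proof -
      define k where "k = nat \<lfloor>real (Suc N) * t\<rfloor>"
      have k: "real k \<le> real (Suc N) * t" "real (Suc N) * t < real k + 1"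
        unfolding k_def using t by (auto simp: of_nat_nat) 
      have "real (Suc N) * t \<le> real (Suc N * T')"
        unfolding of_nat_mult using t by (intro mult_left_mono) auto
      with k have kk: "k \<le> Suc N * T'" by linarith
      have a: "real k / real (Suc N) \<le> t" "t < real k / real (Suc N) + 1 / real (Suc N)"
        using k by (auto simp: field_simps)
      have "dist (\<omega> (real k / real (Suc N))) (\<omega> t) < 1 / (2 * real (Suc q))"
      proof (rule d(2))
        show "dist (real k / real (Suc N)) t < d" using a N by (auto simp: dist_real_def)
        show "real k / real (Suc N) \<in> {0..real T'}" using a t by auto
      qed (use t in auto)
      moreover have "l ! k = f k" unfolding l_def using kk by (simp del: upt_Suc)
      ultimately have "dist (\<omega> t) (l ! k) < 1 / (2 * real (Suc q)) + 1 / (2 * real (Suc q))"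
        using f(2)[of k] by (metis add_strict_mono dist_commute dist_triangle_lt)
      also have "\<dots> = 1 / real (Suc q)" by (simp add: field_simps)
      finally show ?thesis unfolding k_def .
    qed
    have "V (N, l, T', q) \<subseteq> U"
    proof
      fix \<eta> assume "\<eta> \<in> V (N, l, T', q)"
      then have \<eta>: "\<eta> \<in> path_space" "\<And>t. t \<in> \<rat> \<Longrightarrow> t \<in> {0..real T'} \<Longrightarrow> dist (\<eta> t) (l ! nat \<lfloor>real (Suc N) * t\<rfloor>) \<le> 1 / real (Suc q)"
        by (auto simp: V_def)
      have r: "dist (\<eta> t) (\<omega> t) < e / 2" if "t \<in> \<rat>" "t \<in> {0..real T'}" for t
        using \<eta>(2)[OF that] key[OF that(2)] q dist_triangle2[of "\<eta> t" "\<omega> t" "l ! nat \<lfloor>real (Suc N) * t\<rfloor>"] by linarith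
      have "dist (\<eta> t) (\<omega> t) < e" if t: "t \<in> {0..T}" for t
      proof (rule ccontr)
        assume n: "\<not> dist (\<eta> t) (\<omega> t) < e"
        have "continuous_on {0..} (\<lambda>t. dist (\<eta> t) (\<omega> t))"
          by (intro continuous_on_dist path_space_continuous \<eta> p)
        then obtain h where h: "h > 0" "\<And>t'. t' \<in> {0..} \<Longrightarrow> dist t' t < h \<Longrightarrow> dist (dist (\<eta> t') (\<omega> t')) (dist (\<eta> t) (\<omega> t)) < e / 2"
          using t T(2) unfolding continuous_on_iff by (metis atLeastAtMost_iff atLeast_iff half_gt_zero)
        obtain t' where t': "t' \<in> \<rat>" "t < t'" "t' < min (t + h) (real T')"
          using Rats_dense_in_real[of t "min (t + h) (real T')"] t T' h(1) by auto
        have "dist (\<eta> t') (\<omega> t') < e / 2" using r[OF t'(1)] t' t by auto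
        moreover have "dist (dist (\<eta> t') (\<omega> t')) (dist (\<eta> t) (\<omega> t)) < e / 2"
          by (rule h(2)) (use t t' in \<open>auto simp: dist_real_def\<close>)
        ultimately show False using n unfolding dist_real_def by linarith
      qed
      then have "\<eta> \<in> path_nbhd T e \<omega>" by (auto simp: path_nbhd_def \<eta>)
      with T show "\<eta> \<in> U" by auto
    qed
    moreover have "\<omega> \<in> V (N, l, T', q)" using key p by (force simp: V_def)
    moreover have "(N, l, T', q) \<in> I" using f by (auto simp: I_def l_def)
    ultimately show "\<omega> \<in> (\<Union>i\<in>{i\<in>I. V i \<subseteq> U}. V i)" by blast
  qed auto
  also have "\<dots> \<in> sets C" using cI meas by (intro sets.countable_UN'') (auto intro: countable_subset)
  finally show ?thesis by (simp add: stC)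
qed

lemma sets_path_borel_cylinders:
  "sets (path_borel :: (real \<Rightarrow> 'a::{metric_space, second_countable_topology}) measure) = sigma_sets path_space cylinders"
proof
  show "sets (path_borel :: (real \<Rightarrow> 'a) measure) \<subseteq> sigma_sets path_space cylinders"
    unfolding sets_path_borel
    by (rule sigma_sets_mono) (use openin_path_topology_cylinders in blast)
  have "{\<omega> \<in> path_space. \<omega> s \<in> B} \<in> sets path_borel" if "0 \<le> s" "B \<in> sets borel" for s and B :: "'a set"
    using measurable_sets[OF coordinate_measurable[OF that(1)] that(2)]
    by (simp add: vimage_def Int_def conj_commute)
  then have "cylinders \<subseteq> sets (path_borel :: (real \<Rightarrow> 'a) measure)" by (auto simp: cylinders_def)
  from sets.sigma_sets_subset[OF this]
  show "sigma_sets path_space cylinders \<subseteq> sets (path_borel :: (real \<Rightarrow> 'a) measure)" by simp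
qed

lemma path_measurableI:
  fixes X :: "'b \<Rightarrow> real \<Rightarrow> 'a::{metric_space, second_countable_topology}"
  assumes "\<And>x. x \<in> space M \<Longrightarrow> X x \<in> path_space"
    and "\<And>s. 0 \<le> s \<Longrightarrow> (\<lambda>x. X x s) \<in> borel_measurable M"
  shows "X \<in> measurable M path_borel"
proof (rule measurable_sigma_sets)
  show "sets path_borel = sigma_sets path_space (cylinders :: (real \<Rightarrow> 'a) set set)"
    by (rule sets_path_borel_cylinders)
  fix A :: "(real \<Rightarrow> 'a) set" assume "A \<in> cylinders"
  then obtain s B where A: "A = {\<omega> \<in> path_space. \<omega> s \<in> B}" "0 \<le> s" "B \<in> sets borel"
    by (auto simp: cylinders_def)
  have "X -` A \<inter> space M = (\<lambda>x. X x s) -` B \<inter> space M" using assms(1) by (auto simp: A)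
  also have "\<dots> \<in> sets M" by (rule measurable_sets[OF assms(2)[OF A(2)] A(3)])
  finally show "X -` A \<inter> space M \<in> sets M" .
qed (use assms(1) cylinders_subset in auto)

definition dyad :: "nat \<Rightarrow> real \<Rightarrow> real" where
  "dyad n r = real (nat \<lfloor>2 ^ n * r\<rfloor>) / 2 ^ n"

lemma dyad_bounds:
  assumes "0 \<le> r"
  shows "0 \<le> dyad n r" "dyad n r \<le> r" "r < dyad n r + 1 / 2 ^ n"
proof -
  have "0 \<le> 2 ^ n * r" using assms by simp
  then have "real (nat \<lfloor>2 ^ n * r\<rfloor>) \<le> 2 ^ n * r" "2 ^ n * r < real (nat \<lfloor>2 ^ n * r\<rfloor>) + 1"
    by (auto simp: of_nat_nat)
  then show "0 \<le> dyad n r" "dyad n r \<le> r" "r < dyad n r + 1 / 2 ^ n"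
    by (auto simp: dyad_def field_simps)
qed

lemma dyad_tendsto:
  assumes "0 \<le> r" shows "(\<lambda>n. dyad n r) \<longlonglongrightarrow> r"
proof (rule tendsto_sandwich[of "\<lambda>n. r - 1 / 2 ^ n" _ _ "\<lambda>n. r"])
  have "(\<lambda>n. r - (1 / 2) ^ n) \<longlonglongrightarrow> r - 0" by (intro tendsto_intros LIMSEQ_power_zero) auto
  then show "(\<lambda>n. r - 1 / 2 ^ n) \<longlonglongrightarrow> r" by (simp add: power_one_over)
qed (use dyad_bounds[OF assms] in \<open>auto intro!: always_eventually simp: less_imp_le algebra_simps\<close>)

lemma continuous_dyad_tendsto:
  fixes f :: "real \<Rightarrow> 'a::topological_space"
  assumes "continuous_on {0..} f" "0 \<le> r"
  shows "(\<lambda>n. f (dyad n r)) \<longlonglongrightarrow> f r"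
  using assms dyad_tendsto[OF assms(2)] dyad_bounds(1)[OF assms(2)]
  unfolding continuous_on_sequentially by (auto simp: comp_def)

lemma measurable_path_eval:
  fixes X :: "'b \<Rightarrow> real \<Rightarrow> 'a::{metric_space, second_countable_topology}"
  assumes X: "X \<in> measurable M path_borel" and f: "f \<in> borel_measurable M"
    and pos: "\<And>x. x \<in> space M \<Longrightarrow> 0 \<le> f x"
  shows "(\<lambda>x. X x (f x)) \<in> borel_measurable M"
proof (rule borel_measurable_LIMSEQ_metric)
  fix n
  have "(\<lambda>x. X x (real k / 2 ^ n)) \<in> borel_measurable M" for k :: nat
    using measurable_compose[OF X coordinate_measurable[of "real k / 2 ^ n"]] by simp
  moreover have "(\<lambda>x. nat \<lfloor>2 ^ n * f x\<rfloor>) \<in> measurable M (count_space UNIV)" using f by measurable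
  ultimately show "(\<lambda>x. X x (dyad n (f x))) \<in> borel_measurable M"
    unfolding dyad_def by (rule measurable_compose_countable)
next
  fix x assume x: "x \<in> space M"
  then have "X x \<in> path_space" using measurable_space[OF X] by simp
  from continuous_dyad_tendsto[OF path_space_continuous[OF this] pos[OF x]]
  show "(\<lambda>n. X x (dyad n (f x))) \<longlonglongrightarrow> X x (f x)" .
qed

section \<open>The raw filtration\<close>

lemma space_raw_filtration [simp]: "space (raw_filtration t) = path_space"
  unfolding raw_filtration_def by (subst space_measure_of) auto

lemma sets_raw_filtration:
  "sets (raw_filtration t) = sigma_sets path_space {{\<omega> \<in> path_space. \<omega> s \<in> B} |s B. 0 \<le> s \<and> s \<le> t \<and> B \<in> sets borel}"
  unfolding raw_filtration_def by (subst sets_measure_of) auto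

lemma raw_filtration_mono: "s \<le> t \<Longrightarrow> sets (raw_filtration s) \<subseteq> sets (raw_filtration t)"
  unfolding sets_raw_filtration by (intro sigma_sets_mono') fastforce

lemma raw_filtration_subset_path_borel:
  "sets (raw_filtration t :: (real \<Rightarrow> 'a::metric_space) measure) \<subseteq> sets path_borel"
  using subalgebra_raw_filtration[of path_borel t] by (auto simp: subalgebra_def)

definition agree :: "real \<Rightarrow> (real \<Rightarrow> 'a) \<Rightarrow> (real \<Rightarrow> 'a) \<Rightarrow> bool" where
  "agree t \<omega> \<eta> \<longleftrightarrow> (\<forall>s. 0 \<le> s \<and> s \<le> t \<longrightarrow> \<omega> s = \<eta> s)"

lemma agree_mono: "agree t \<omega> \<eta> \<Longrightarrow> s \<le> t \<Longrightarrow> agree s \<omega> \<eta>"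
  by (auto simp: agree_def)

lemma agree_sym: "agree t \<omega> \<eta> \<Longrightarrow> agree t \<eta> \<omega>"
  by (auto simp: agree_def)

lemma raw_filtration_agree:
  assumes "A \<in> sets (raw_filtration t)" "\<omega> \<in> path_space" "\<eta> \<in> path_space" "agree t \<omega> \<eta>"
  shows "\<omega> \<in> A \<longleftrightarrow> \<eta> \<in> A"
  using assms(1) unfolding sets_raw_filtration
proof (induction rule: sigma_sets.induct)
  case (Basic a)
  then show ?case using assms by (auto simp: agree_def)
qed (use assms in auto)

lemma raw_measurable_agree:
  fixes f :: "(real \<Rightarrow> 'a::metric_space) \<Rightarrow> 'b::t1_space"
  assumes "f \<in> borel_measurable (raw_filtration t)" "\<omega> \<in> path_space" "\<eta> \<in> path_space" "agree t \<omega> \<eta>"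
  shows "f \<omega> = f \<eta>"
proof -
  have "f -` {f \<omega>} \<inter> space (raw_filtration t) \<in> sets (raw_filtration t)"
    by (rule measurable_sets[OF assms(1)]) (rule borel_closed, simp)
  from raw_filtration_agree[OF this assms(2-4)] assms show ?thesis by auto
qed

definition stop_path :: "real \<Rightarrow> (real \<Rightarrow> 'a) \<Rightarrow> (real \<Rightarrow> 'a)" where
  "stop_path t \<omega> = (\<lambda>s. if s < 0 then undefined else \<omega> (min s t))"

lemma stop_path_in_path_space:
  assumes "\<omega> \<in> path_space" "0 \<le> t" shows "stop_path t \<omega> \<in> path_space"
proof -
  have "continuous_on {0..} (\<lambda>s. \<omega> (min s t))"
    by (rule continuous_on_compose2[OF path_space_continuous[OF assms(1)]])
      (use assms in \<open>auto intro!: continuous_intros\<close>)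
  then have "continuous_on {0..} (stop_path t \<omega>)"
    by (rule continuous_on_eq) (auto simp: stop_path_def)
  then show ?thesis by (auto simp: path_space_def extensional_def stop_path_def)
qed

lemma agree_stop_path: "agree t \<omega> (stop_path t \<omega>)"
  by (auto simp: agree_def stop_path_def)

lemma measurable_stop_path:
  assumes "0 \<le> t"
  shows "(stop_path t :: (real \<Rightarrow> 'a::{metric_space, second_countable_topology}) \<Rightarrow> _) \<in> measurable (raw_filtration t) path_borel"
proof (rule path_measurableI)
  fix s :: real assume s: "0 \<le> s"
  show "(\<lambda>\<omega>::real \<Rightarrow> 'a. stop_path t \<omega> s) \<in> borel_measurable (raw_filtration t)"
  proof (rule measurableI)
    fix B :: "'a set" assume "B \<in> sets borel"
    moreover have "(\<lambda>\<omega>::real \<Rightarrow> 'a. stop_path t \<omega> s) -` B \<inter> space (raw_filtration t) = {\<omega> \<in> path_space. \<omega> (min s t) \<in> B}"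
      using s by (auto simp: stop_path_def)
    ultimately show "(\<lambda>\<omega>::real \<Rightarrow> 'a. stop_path t \<omega> s) -` B \<inter> space (raw_filtration t) \<in> sets (raw_filtration t)"
      unfolding sets_raw_filtration using s assms
      by (auto intro!: sigma_sets.Basic exI[of _ "min s t"] exI[of _ B])
  qed auto
qed (use assms in \<open>auto intro: stop_path_in_path_space\<close>)

text \<open>Galmarino's test.\<close>

lemma raw_measurableI:
  fixes f :: "(real \<Rightarrow> 'a::{metric_space, second_countable_topology}) \<Rightarrow> 'b"
  assumes "f \<in> measurable path_borel N" "0 \<le> t"
    and "\<And>\<omega> \<eta>. \<omega> \<in> path_space \<Longrightarrow> \<eta> \<in> path_space \<Longrightarrow> agree t \<omega> \<eta> \<Longrightarrow> f \<omega> = f \<eta>"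
  shows "f \<in> measurable (raw_filtration t) N"
proof -
  have m: "(\<lambda>\<omega>. f (stop_path t \<omega>)) \<in> measurable (raw_filtration t) N"
    by (rule measurable_compose[OF measurable_stop_path assms(1)]) fact
  have "f (stop_path t \<omega>) = f \<omega>" if "\<omega> \<in> space (raw_filtration t)" for \<omega>
    using assms(3)[of \<omega> "stop_path t \<omega>"] that by (simp add: stop_path_in_path_space assms(2) agree_stop_path)
  from measurable_cong[THEN iffD1, OF this m] show ?thesis .
qed

lemma raw_filtrationI:
  fixes A :: "(real \<Rightarrow> 'a::{metric_space, second_countable_topology}) set"
  assumes "A \<in> sets path_borel" "0 \<le> t"
    and "\<And>\<omega> \<eta>. \<omega> \<in> A \<Longrightarrow> \<eta> \<in> path_space \<Longrightarrow> agree t \<omega> \<eta> \<Longrightarrow> \<eta> \<in> A"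
  shows "A \<in> sets (raw_filtration t)"
proof -
  have sub: "A \<subseteq> path_space" using sets.sets_into_space[OF assms(1)] by simp
  have "(\<lambda>\<omega>. \<omega> \<in> A) \<in> measurable (raw_filtration t) (count_space UNIV)"
  proof (rule raw_measurableI)
    show "(\<lambda>\<omega>. \<omega> \<in> A) \<in> measurable path_borel (count_space UNIV)"
    proof -
      have "{\<omega> \<in> space path_borel. \<omega> \<in> A} = A" using sub by auto
      then show ?thesis using assms(1) unfolding pred_def by simp
    qed
  qed (use assms in \<open>auto dest: agree_sym\<close>)
  then have "{\<omega> \<in> space (raw_filtration t). \<omega> \<in> A} \<in> sets (raw_filtration t)" by (simp add: pred_def)
  moreover have "{\<omega> \<in> space (raw_filtration t). \<omega> \<in> A} = A" using sub by auto
  ultimately show ?thesis by simp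
qed

lemma raw_stopping_timeI:
  fixes T :: "(real \<Rightarrow> 'a::{metric_space, second_countable_topology}) \<Rightarrow> real"
  assumes "T \<in> borel_measurable path_borel" "\<And>\<omega>. \<omega> \<in> path_space \<Longrightarrow> 0 \<le> T \<omega>"
    and "\<And>t \<omega> \<eta>. 0 \<le> t \<Longrightarrow> \<omega> \<in> path_space \<Longrightarrow> \<eta> \<in> path_space \<Longrightarrow> agree t \<omega> \<eta> \<Longrightarrow> T \<omega> \<le> t \<Longrightarrow> T \<eta> \<le> t"
  shows "stopping_time raw_filtration T"
proof
  fix t :: real
  show "Measurable.pred (raw_filtration t) (\<lambda>\<omega>. T \<omega> \<le> t)"
  proof (cases "0 \<le> t")
    case True
    have "{\<omega> \<in> space path_borel. T \<omega> \<le> t} \<in> sets path_borel" using assms(1) by measurable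
    then have "{\<omega> \<in> path_space. T \<omega> \<le> t} \<in> sets (raw_filtration t)"
      using True assms(3)[OF True] by (intro raw_filtrationI) auto
    then show ?thesis by (simp add: pred_def)
  next
    case False
    then have "{\<omega> \<in> path_space. T \<omega> \<le> t} = {}" using assms(2) by force
    then show ?thesis unfolding pred_def space_raw_filtration by (simp only: sets.empty_sets)
  qed
qed

lemma raw_stopping_time_agree:
  fixes T :: "(real \<Rightarrow> 'a::metric_space) \<Rightarrow> real"
  assumes "stopping_time raw_filtration T" "\<omega> \<in> path_space" "\<eta> \<in> path_space" "agree t \<omega> \<eta>" "T \<omega> \<le> t"
  shows "T \<eta> = T \<omega>"
proof -
  have le: "T \<eta> \<le> r \<longleftrightarrow> T \<omega> \<le> r" if "r \<le> t" for r
  proof -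
    have "{\<omega> \<in> space (raw_filtration r). T \<omega> \<le> r} \<in> sets (raw_filtration r)"
      using stopping_timeD[OF assms(1), of r] by (simp add: pred_def)
    from raw_filtration_agree[OF this assms(2,3) agree_mono[OF assms(4) that]] assms(2,3)
    show ?thesis by simp
  qed
  then have "T \<eta> \<le> T \<omega>" using assms(5) by blast
  moreover from this have "T \<omega> \<le> T \<eta>" using le[of "T \<eta>"] assms(5) by auto
  ultimately show ?thesis by simp
qed

lemma raw_stopping_time_borel:
  fixes T :: "(real \<Rightarrow> 'a::metric_space) \<Rightarrow> real"
  assumes "stopping_time raw_filtration T"
  shows "T \<in> borel_measurable path_borel"
proof (rule borel_measurable_iff_le[THEN iffD2], intro allI)
  fix a
  have "{\<omega> \<in> space (raw_filtration a). T \<omega> \<le> a} \<in> sets (raw_filtration a)"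
    using stopping_timeD[OF assms, of a] by (simp add: pred_def)
  then show "{\<omega> \<in> space path_borel. T \<omega> \<le> a} \<in> sets path_borel"
    using raw_filtration_subset_path_borel by auto
qed

section \<open>Hitting times\<close>

definition hit :: "'a set \<Rightarrow> real \<Rightarrow> (real \<Rightarrow> 'a) \<Rightarrow> real" where
  "hit C t w = Inf ({s. 0 \<le> s \<and> s \<le> t \<and> w s \<in> C} \<union> {t})"

lemma hit_agree: "agree t w w' \<Longrightarrow> hit C t w = hit C t w'"
  unfolding hit_def agree_def by (rule arg_cong[where f=Inf]) auto

lemma hit_cases:
  fixes w :: "real \<Rightarrow> 'a::metric_space"
  assumes "closed C" "w \<in> path_space"
  obtains (never) "\<And>t. 0 \<le> t \<Longrightarrow> w t \<notin> C" "\<And>t. 0 \<le> t \<Longrightarrow> hit C t w = t"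
  | (hits) \<sigma> where "0 \<le> \<sigma>" "w \<sigma> \<in> C" "\<And>s. 0 \<le> s \<Longrightarrow> s < \<sigma> \<Longrightarrow> w s \<notin> C"
      "\<And>t. 0 \<le> t \<Longrightarrow> hit C t w = min t \<sigma>"
proof (cases "\<exists>s\<ge>0. w s \<in> C")
  case False
  then have "{s. 0 \<le> s \<and> s \<le> t \<and> w s \<in> C} = {}" for t by blast
  then have "hit C t w = t" for t unfolding hit_def by (simp only: Un_empty_left cInf_singleton)
  then show ?thesis using False never by auto
next
  case True
  define S where "S = {s \<in> {0..}. w s \<in> C}"
  have "closed S"
    using continuous_closed_preimage[OF path_space_continuous[OF assms(2)] closed_atLeast assms(1)]
    by (simp add: S_def vimage_def Int_def)
  moreover have "S \<noteq> {}" using True by (auto simp: S_def)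
  moreover have bdd: "bdd_below S" by (rule bdd_belowI[of _ 0]) (auto simp: S_def)
  ultimately have I: "Inf S \<in> S" using closed_contains_Inf by blast
  have low: "Inf S \<le> s" if "s \<in> S" for s using cInf_lower[OF that bdd] .
  have "hit C t w = min t (Inf S)" if t: "0 \<le> t" for t
  proof (cases "Inf S \<le> t")
    case True
    have "hit C t w = Inf S" unfolding hit_def
      by (rule cInf_eq_minimum) (use I True low in \<open>auto simp: S_def\<close>)
    with True show ?thesis by simp
  next
    case False
    then have "{s. 0 \<le> s \<and> s \<le> t \<and> w s \<in> C} = {}" using low by (force simp: S_def)
    then show ?thesis using False unfolding hit_def by (simp only: Un_empty_left cInf_singleton)
  qed
  moreover have "w s \<notin> C" if "0 \<le> s" "s < Inf S" for s
    using low[of s] that by (auto simp: S_def)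
  ultimately show ?thesis using I hits[of "Inf S"] by (auto simp: S_def)
qed

lemma hit_bounds:
  fixes w :: "real \<Rightarrow> 'a::metric_space"
  assumes "closed C" "w \<in> path_space" "0 \<le> t"
  shows "0 \<le> hit C t w" "hit C t w \<le> t"
  using assms by (cases rule: hit_cases[OF assms(1,2)]; auto)+

lemma hit_min:
  fixes w :: "real \<Rightarrow> 'a::metric_space"
  assumes "closed C" "w \<in> path_space" "0 \<le> s" "s \<le> t"
  shows "hit C s w = min s (hit C t w)"
  using assms by (cases rule: hit_cases[OF assms(1,2)]) auto

lemma openin_avoid:
  fixes C :: "'a::heine_borel set"
  assumes "closed C"
  shows "openin path_topology {w \<in> path_space. \<forall>s. 0 \<le> s \<and> s \<le> a \<longrightarrow> w s \<notin> C}"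
  unfolding openin_path_topology
proof (intro conjI ballI)
  fix w assume w: "w \<in> {w \<in> path_space. \<forall>s. 0 \<le> s \<and> s \<le> a \<longrightarrow> w s \<notin> C}"
  have "compact (w ` {0..a})"
    using w by (intro compact_continuous_image continuous_on_subset[OF path_space_continuous]) auto
  moreover have "w ` {0..a} \<inter> C = {}" using w by auto
  ultimately have "\<exists>e>0. \<forall>x\<in>w ` {0..a}. \<forall>y\<in>C. e \<le> dist x y"
    by (intro separate_compact_closed assms)
  then obtain e where e: "e > 0" "\<And>x y. x \<in> w ` {0..a} \<Longrightarrow> y \<in> C \<Longrightarrow> e \<le> dist x y"
    by blast
  have "path_nbhd (max a 0) e w \<subseteq> {w \<in> path_space. \<forall>s. 0 \<le> s \<and> s \<le> a \<longrightarrow> w s \<notin> C}"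
  proof
    fix \<eta> assume \<eta>: "\<eta> \<in> path_nbhd (max a 0) e w"
    have "\<eta> s \<notin> C" if "0 \<le> s" "s \<le> a" for s
    proof
      assume "\<eta> s \<in> C"
      then have "e \<le> dist (w s) (\<eta> s)" using e(2) that by auto
      moreover have "dist (\<eta> s) (w s) < e" using \<eta> that by (auto simp: path_nbhd_def)
      ultimately show False by (simp add: dist_commute)
    qed
    then show "\<eta> \<in> {w \<in> path_space. \<forall>s. 0 \<le> s \<and> s \<le> a \<longrightarrow> w s \<notin> C}"
      using \<eta> by (auto simp: path_nbhd_def)
  qed
  then show "\<exists>T\<ge>0. \<exists>e>0. path_nbhd T e w \<subseteq> {w \<in> path_space. \<forall>s. 0 \<le> s \<and> s \<le> a \<longrightarrow> w s \<notin> C}"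
    using e(1) by (intro exI[of _ "max a 0"]) auto
qed auto

lemma measurable_hit:
  fixes C :: "'a::heine_borel set"
  assumes "closed C" "0 \<le> t"
  shows "hit C t \<in> borel_measurable path_borel"
proof (rule borel_measurable_iff_greater[THEN iffD2], intro allI)
  fix a
  have "{w \<in> path_space. a < hit C t w} \<in> sets path_borel"
  proof (cases "0 \<le> a \<and> a < t")
    case True
    have "{w \<in> path_space. a < hit C t w} = {w \<in> path_space. \<forall>s. 0 \<le> s \<and> s \<le> a \<longrightarrow> w s \<notin> C}"
    proof (intro Collect_cong conj_cong refl)
      fix w :: "real \<Rightarrow> 'a" assume w: "w \<in> path_space"
      show "a < hit C t w \<longleftrightarrow> (\<forall>s. 0 \<le> s \<and> s \<le> a \<longrightarrow> w s \<notin> C)"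
      proof (rule hit_cases[OF assms(1) w], goal_cases)
        case 1 then show ?case using True assms by auto
      next
        case (2 \<sigma>)
        have "a < hit C t w \<longleftrightarrow> a < \<sigma>" using 2(4)[OF assms(2)] True by auto
        also have "\<dots> \<longleftrightarrow> (\<forall>s. 0 \<le> s \<and> s \<le> a \<longrightarrow> w s \<notin> C)"
        proof
          assume "a < \<sigma>" then show "\<forall>s. 0 \<le> s \<and> s \<le> a \<longrightarrow> w s \<notin> C" using 2(3) by auto
        next
          assume "\<forall>s. 0 \<le> s \<and> s \<le> a \<longrightarrow> w s \<notin> C"
          then have "\<not> \<sigma> \<le> a" using 2(1,2) by blast
          then show "a < \<sigma>" by simp
        qed
        finally show ?case .
      qed
    qed
    then show ?thesis using openin_avoid[OF assms(1), of a] by (auto simp: sets_path_borel)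
  next
    case False
    show ?thesis
    proof (cases "a < 0")
      case True
      then have "{w \<in> path_space. a < hit C t w} = space path_borel"
        using hit_bounds(1)[OF assms(1) _ assms(2)] by (auto intro: less_le_trans)
      then show ?thesis by (simp only: sets.top)
    next
      case a: False
      have "{w \<in> path_space. a < hit C t w} = {}"
      proof (intro equals0I)
        fix w assume "w \<in> {w \<in> path_space. a < hit C t w}"
        with hit_bounds(2)[OF assms(1) _ assms(2), of w] a False show HOL.False by auto
      qed
      then show ?thesis by (simp only: sets.empty_sets)
    qed
  qed
  then show "{w \<in> space path_borel. a < hit C t w} \<in> sets path_borel" by simp
qed

lemma measurable_stays:
  fixes K :: "'a::metric_space set"
  assumes "closed K"
  shows "{w \<in> path_space. \<forall>s. 0 \<le> s \<and> s < c \<longrightarrow> w s \<in> K} \<in> sets path_borel"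
proof -
  have "openin path_topology {w \<in> path_space. \<exists>s. 0 \<le> s \<and> s < c \<and> w s \<notin> K}"
    unfolding openin_path_topology
  proof (intro conjI ballI)
    fix w assume "w \<in> {w \<in> path_space. \<exists>s. 0 \<le> s \<and> s < c \<and> w s \<notin> K}"
    then obtain s where s: "0 \<le> s" "s < c" "w s \<notin> K" by auto
    then obtain e where "e > 0" "\<And>y. dist y (w s) < e \<Longrightarrow> y \<notin> K"
      using assms unfolding closed_def open_dist by auto
    then show "\<exists>T\<ge>0. \<exists>e>0. path_nbhd T e w \<subseteq> {w \<in> path_space. \<exists>s. 0 \<le> s \<and> s < c \<and> w s \<notin> K}"
      using s by (intro exI[of _ s] conjI exI[of _ e]) (auto simp: path_nbhd_def)
  qed auto
  then have "space path_borel - {w \<in> path_space. \<exists>s. 0 \<le> s \<and> s < c \<and> w s \<notin> K} \<in> sets path_borel"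
    by (intro sets.compl_sets) (auto simp: sets_path_borel)
  also have "space path_borel - {w \<in> path_space. \<exists>s. 0 \<le> s \<and> s < c \<and> w s \<notin> K} =
    {w \<in> path_space. \<forall>s. 0 \<le> s \<and> s < c \<longrightarrow> w s \<in> K}" by auto
  finally show ?thesis .
qed

section \<open>Martingales and optional stopping\<close>

locale filtered_prob_space = prob_space P for P :: "'s measure" +
  fixes F :: "real \<Rightarrow> 's measure"
  assumes subalgebra_F: "\<And>t. subalgebra P (F t)"
    and F_mono: "\<And>s t. s \<le> t \<Longrightarrow> sets (F s) \<subseteq> sets (F t)"
begin

lemma sigma_finite_subalgebra_F: "sigma_finite_subalgebra P (F t)"
  by (rule finite_measure_subalgebra_is_sigma_finite)
    (simp add: finite_measure_subalgebra_def finite_measure_subalgebra_axioms_def finite_measure_axioms subalgebra_F)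

lemma space_F [simp]: "space (F t) = space P"
  using subalgebra_F by (simp add: subalgebra_def)

lemma sets_F_P: "A \<in> sets (F t) \<Longrightarrow> A \<in> sets P"
  using subalgebra_F by (auto simp: subalgebra_def)

lemma measurable_F_P: "f \<in> measurable (F t) N \<Longrightarrow> f \<in> measurable P N"
  using subalgebra_F measurable_from_subalg by blast

lemma martingaleI:
  assumes "\<And>t. 0 \<le> t \<Longrightarrow> M t \<in> borel_measurable (F t)" "\<And>t. 0 \<le> t \<Longrightarrow> integrable P (M t)"
    and "\<And>s t A. 0 \<le> s \<Longrightarrow> s \<le> t \<Longrightarrow> A \<in> sets (F s) \<Longrightarrow> (\<integral>\<omega>. indicator A \<omega> * (M t \<omega> - M s \<omega>) \<partial>P) = 0"
  shows "martingale P F M"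
  unfolding martingale_def adapted_def
proof (intro conjI allI impI)
  fix s t :: real assume st: "0 \<le> s \<and> s \<le> t"
  interpret sigma_finite_subalgebra P "F s" by (rule sigma_finite_subalgebra_F)
  show "AE \<omega> in P. real_cond_exp P (F s) (M t) \<omega> = M s \<omega>"
  proof (rule real_cond_exp_charact)
    fix A assume A: "A \<in> sets (F s)"
    then have AP: "A \<in> sets P" by (rule sets_F_P)
    have "(\<integral>\<omega>. indicator A \<omega> * M t \<omega> - indicator A \<omega> * M s \<omega> \<partial>P) = 0"
      using assms(3)[OF _ _ A, of t] st by (simp add: right_diff_distrib)
    moreover have "integrable P (\<lambda>\<omega>. indicator A \<omega> * M r \<omega>)" if "0 \<le> r" for r
      using integrable_mult_indicator[OF AP assms(2)[OF that]] by simp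
    ultimately show "(\<integral>x\<in>A. M t x \<partial>P) = (\<integral>x\<in>A. M s x \<partial>P)"
      unfolding set_lebesgue_integral_def using st by simp
  qed (use assms st in auto)
qed (use assms in auto)

lemma martingale_test:
  assumes M: "martingale P F M" and st: "0 \<le> s" "s \<le> t"
    and f: "f \<in> borel_measurable (F s)" "integrable P (\<lambda>\<omega>. f \<omega> * M t \<omega>)"
  shows "integrable P (\<lambda>\<omega>. f \<omega> * M s \<omega>)" "(\<integral>\<omega>. f \<omega> * M t \<omega> \<partial>P) = (\<integral>\<omega>. f \<omega> * M s \<omega> \<partial>P)"
proof -
  interpret sigma_finite_subalgebra P "F s" by (rule sigma_finite_subalgebra_F)
  have t: "0 \<le> t" using st by simp
  have int: "integrable P (M t)" and ms: "M s \<in> borel_measurable P"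
    using M st t unfolding martingale_def adapted_def by (auto intro: measurable_F_P)
  have ae: "AE \<omega> in P. f \<omega> * real_cond_exp P (F s) (M t) \<omega> = f \<omega> * M s \<omega>"
  proof -
    have "AE \<omega> in P. real_cond_exp P (F s) (M t) \<omega> = M s \<omega>" using M st unfolding martingale_def by auto
    then show ?thesis by eventually_elim simp
  qed
  have fm: "f \<in> borel_measurable P" using f(1) by (rule measurable_F_P)
  note I = real_cond_exp_intg[OF f(2,1) borel_measurable_integrable[OF int]]
  show "integrable P (\<lambda>\<omega>. f \<omega> * M s \<omega>)"
    by (rule integrable_cong_AE_imp[OF I(1)]) (use fm ms ae in auto)
  have "(\<integral>\<omega>. f \<omega> * real_cond_exp P (F s) (M t) \<omega> \<partial>P) = (\<integral>\<omega>. f \<omega> * M s \<omega> \<partial>P)"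
    by (rule integral_cong_AE) (use fm ms ae in auto)
  with I(2) show "(\<integral>\<omega>. f \<omega> * M t \<omega> \<partial>P) = (\<integral>\<omega>. f \<omega> * M s \<omega> \<partial>P)" by simp
qed

lemma martingale_set:
  assumes M: "martingale P F M" and st: "0 \<le> s" "s \<le> t" and A: "A \<in> sets (F s)"
  shows "(\<integral>\<omega>. indicator A \<omega> * M t \<omega> \<partial>P) = (\<integral>\<omega>. indicator A \<omega> * M s \<omega> \<partial>P)"
proof (rule martingale_test[OF M st])
  have "integrable P (M t)" using M st unfolding martingale_def by auto
  from integrable_mult_indicator[OF sets_F_P[OF A] this]
  show "integrable P (\<lambda>\<omega>. indicator A \<omega> * M t \<omega>)" by simp
qed (use A in auto)

lemma martingale_convex:
  assumes M: "martingale P F M" and st: "0 \<le> s" "s \<le> t" and A: "A \<in> sets (F s)"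
    and q: "convex_on UNIV q" "q \<in> borel_measurable borel" "\<And>x::real. 0 \<le> q x" "integrable P (\<lambda>\<omega>. q (M t \<omega>))"
  shows "integrable P (\<lambda>\<omega>. q (M s \<omega>))"
    "(\<integral>\<omega>. indicator A \<omega> * q (M s \<omega>) \<partial>P) \<le> (\<integral>\<omega>. indicator A \<omega> * q (M t \<omega>) \<partial>P)"
proof -
  interpret sigma_finite_subalgebra P "F s" by (rule sigma_finite_subalgebra_F)
  have t: "0 \<le> t" using st by simp
  have int: "integrable P (M t)" and ms: "M s \<in> borel_measurable P"
    using M st t unfolding martingale_def adapted_def by (auto intro: measurable_F_P)
  have ae: "AE \<omega> in P. real_cond_exp P (F s) (M t) \<omega> = M s \<omega>"
    using M st unfolding martingale_def by auto
  have "AE \<omega> in P. q (real_cond_exp P (F s) (M t) \<omega>) \<le> real_cond_exp P (F s) (\<lambda>\<omega>. q (M t \<omega>)) \<omega>"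
    by (rule real_cond_exp_jensens_inequality(2)[OF int _ _ q(4,1,2)]) auto
  with ae have le: "AE \<omega> in P. q (M s \<omega>) \<le> real_cond_exp P (F s) (\<lambda>\<omega>. q (M t \<omega>)) \<omega>" by eventually_elim simp
  have qs: "(\<lambda>\<omega>. q (M s \<omega>)) \<in> borel_measurable P" using ms q(2) by measurable
  note C = real_cond_exp_int(1)[OF q(4)]
  show i: "integrable P (\<lambda>\<omega>. q (M s \<omega>))"
    by (rule Bochner_Integration.integrable_bound[OF C qs]) (use le q(3) in \<open>auto elim!: eventually_mono\<close>)
  have AP: "A \<in> sets P" using A by (rule sets_F_P)
  have "(\<integral>\<omega>. indicator A \<omega> * q (M s \<omega>) \<partial>P) \<le> (\<integral>\<omega>. indicator A \<omega> * real_cond_exp P (F s) (\<lambda>\<omega>. q (M t \<omega>)) \<omega> \<partial>P)"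
    by (rule integral_mono_AE)
      (use integrable_mult_indicator[OF AP i] integrable_mult_indicator[OF AP C] le in
        \<open>auto elim!: eventually_mono simp: indicator_def\<close>)
  also have "\<dots> = (\<integral>\<omega>. indicator A \<omega> * q (M t \<omega>) \<partial>P)"
    by (rule real_cond_exp_intg(2))
      (use integrable_mult_indicator[OF AP q(4)] A borel_measurable_integrable[OF q(4)] in auto)
  finally show "(\<integral>\<omega>. indicator A \<omega> * q (M s \<omega>) \<partial>P) \<le> (\<integral>\<omega>. indicator A \<omega> * q (M t \<omega>) \<partial>P)" .
qed

end

definition excess :: "real \<Rightarrow> real \<Rightarrow> real" where
  "excess L x = max (\<bar>x\<bar> - L) 0"

definition clip :: "real \<Rightarrow> real \<Rightarrow> real" where
  "clip L x = max (- L) (min L x)"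

lemma convex_excess: "convex_on UNIV (excess L)"
proof (rule convex_onI)
  fix t x y :: real assume t: "0 < t" "t < 1"
  have "\<bar>(1 - t) * x + t * y\<bar> \<le> (1 - t) * \<bar>x\<bar> + t * \<bar>y\<bar>"
    using t abs_triangle_ineq[of "(1 - t) * x" "t * y"] by (simp add: abs_mult)
  then have "\<bar>(1 - t) * x + t * y\<bar> - L \<le> (1 - t) * (\<bar>x\<bar> - L) + t * (\<bar>y\<bar> - L)"
    by (simp add: algebra_simps)
  also have "\<dots> \<le> (1 - t) * excess L x + t * excess L y"
    using t by (intro add_mono mult_left_mono) (auto simp: excess_def)
  finally have "\<bar>(1 - t) * x + t * y\<bar> - L \<le> (1 - t) * excess L x + t * excess L y" .
  moreover have "0 \<le> (1 - t) * excess L x + t * excess L y"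
    using t by (intro add_nonneg_nonneg mult_nonneg_nonneg) (auto simp: excess_def)
  ultimately have "excess L ((1 - t) * x + t * y) \<le> (1 - t) * excess L x + t * excess L y"
    by (simp add: excess_def)
  then show "excess L ((1 - t) *\<^sub>R x + t *\<^sub>R y) \<le> (1 - t) * excess L x + t * excess L y" by simp
qed simp

lemma excess_simps:
  "0 \<le> excess L x" "0 \<le> L \<Longrightarrow> excess L x \<le> \<bar>x\<bar>" "0 \<le> L \<Longrightarrow> \<bar>x - clip L x\<bar> = excess L x"
  "0 \<le> L \<Longrightarrow> \<bar>clip L x\<bar> \<le> L"
  by (auto simp: excess_def clip_def)

lemma measurable_excess [measurable]: "excess L \<in> borel_measurable borel"
  unfolding excess_def by measurable

lemma measurable_clip [measurable]: "clip L \<in> borel_measurable borel"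
  unfolding clip_def by measurable

lemma continuous_clip: "continuous_on UNIV (clip L)"
  unfolding clip_def by (intro continuous_intros)

lemma continuous_excess: "continuous_on UNIV (excess L)"
  unfolding excess_def by (intro continuous_intros)

lemma ceil_dyad_tendsto:
  assumes "0 \<le> r" shows "(\<lambda>n. real (nat \<lceil>2 ^ n * r\<rceil>) / 2 ^ n) \<longlonglongrightarrow> r"
proof (rule tendsto_sandwich[of "\<lambda>n. r" _ _ "\<lambda>n. r + 1 / 2 ^ n"])
  have "(\<lambda>n. r + (1 / 2) ^ n) \<longlonglongrightarrow> r + 0" by (intro tendsto_intros LIMSEQ_power_zero) auto
  then show "(\<lambda>n. r + 1 / 2 ^ n) \<longlonglongrightarrow> r" by (simp add: power_one_over)
  have b: "2 ^ n * r \<le> real (nat \<lceil>2 ^ n * r\<rceil>)" "real (nat \<lceil>2 ^ n * r\<rceil>) \<le> 2 ^ n * r + 1" for n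
  proof -
    have "0 \<le> 2 ^ n * r" using assms by simp
    then show "2 ^ n * r \<le> real (nat \<lceil>2 ^ n * r\<rceil>)" "real (nat \<lceil>2 ^ n * r\<rceil>) \<le> 2 ^ n * r + 1"
      by linarith+
  qed
  show "\<forall>\<^sub>F n in sequentially. r \<le> real (nat \<lceil>2 ^ n * r\<rceil>) / 2 ^ n"
    using b by (intro always_eventually) (auto simp: field_simps)
  show "\<forall>\<^sub>F n in sequentially. real (nat \<lceil>2 ^ n * r\<rceil>) / 2 ^ n \<le> r + 1 / 2 ^ n"
    using b by (intro always_eventually) (auto simp: field_simps)
qed simp

context filtered_prob_space
begin

text \<open>Uniform integrability along the dyadic approximations \<open>T\<^sub>k\<close> of the stopping time comes from
  Jensen's inequality for the convex functions \<open>excess L\<close>: the mass of \<open>M\<^bsub>T\<^sub>k\<^esub>\<close> beyond level \<open>L\<close> is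
  at most that of the terminal value.\<close>

lemma optional_stopping:
  assumes M: "martingale P F M" and cont: "AE \<omega> in P. continuous_on {0..} (\<lambda>t. M t \<omega>)"
    and T: "stopping_time F T" "\<And>\<omega>. \<omega> \<in> space P \<Longrightarrow> 0 \<le> T \<omega> \<and> T \<omega> \<le> t"
    and meas: "(\<lambda>\<omega>. M (T \<omega>) \<omega>) \<in> borel_measurable P"
  shows "integrable P (\<lambda>\<omega>. M (T \<omega>) \<omega>)" "(\<integral>\<omega>. M (T \<omega>) \<omega> \<partial>P) = (\<integral>\<omega>. M t \<omega> \<partial>P)"
proof -
  have t: "0 \<le> t" using T(2) not_empty by fastforce
  have int: "integrable P (M r)" if "0 \<le> r" for r using M that unfolding martingale_def by auto
  define u where "u = (\<lambda>k::nat. \<lambda>j::nat. min t (real j / 2 ^ k))"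
  define J where "J = (\<lambda>k::nat. \<lambda>\<omega>. nat \<lceil>2 ^ k * T \<omega>\<rceil>)"
  define m where "m = (\<lambda>k::nat. nat \<lceil>2 ^ k * t\<rceil>)"
  define A where "A = (\<lambda>k j. {\<omega> \<in> space P. J k \<omega> = j})"
  define N where "N = (\<lambda>k \<omega>. M (u k (J k \<omega>)) \<omega>)"
  have u: "0 \<le> u k j" "u k j \<le> t" for k j using t by (auto simp: u_def)
  have Jm: "J k \<omega> \<le> m k" if "\<omega> \<in> space P" for k \<omega>
    unfolding J_def m_def using T(2)[OF that] by (intro nat_mono ceiling_mono mult_left_mono) auto
  have Jle: "J k \<omega> \<le> j \<longleftrightarrow> T \<omega> \<le> real j / 2 ^ k" for k j \<omega>
  proof -
    have "J k \<omega> \<le> j \<longleftrightarrow> 2 ^ k * T \<omega> \<le> real j"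
      unfolding J_def nat_le_iff ceiling_le_iff by simp
    then show ?thesis by (simp add: field_simps)
  qed
  have A: "A k j \<in> sets (F (u k j))" for k j
  proof -
    have 1: "{\<omega> \<in> space P. T \<omega> \<le> r} \<in> sets (F s)" if "r \<le> s" for r s
    proof -
      have "{\<omega> \<in> space (F r). T \<omega> \<le> r} \<in> sets (F r)"
        using stopping_timeD[OF T(1), of r] by (simp add: pred_def)
      then show ?thesis using F_mono[OF that] by auto
    qed
    have le: "{\<omega> \<in> space P. J k \<omega> \<le> j} \<in> sets (F (u k j))" for j
    proof -
      have "{\<omega> \<in> space P. J k \<omega> \<le> j} = {\<omega> \<in> space P. T \<omega> \<le> u k j}"
        using T(2) by (auto simp: Jle u_def)
      then show ?thesis using 1[of "u k j" "u k j"] by simp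
    qed
    show ?thesis
    proof (cases j)
      case 0
      then have "A k j = {\<omega> \<in> space P. J k \<omega> \<le> j}" by (auto simp: A_def)
      then show ?thesis using le[of j] by simp
    next
      case (Suc i)
      have "{\<omega> \<in> space P. J k \<omega> \<le> i} \<in> sets (F (u k j))"
      proof -
        have "u k i \<le> u k j" unfolding Suc u_def by (intro min.mono divide_right_mono) auto
        then show ?thesis using le[of i] F_mono by blast
      qed
      with le[of j] have "{\<omega> \<in> space P. J k \<omega> \<le> j} - {\<omega> \<in> space P. J k \<omega> \<le> i} \<in> sets (F (u k j))"
        by (rule sets.Diff)
      moreover have "A k j = {\<omega> \<in> space P. J k \<omega> \<le> j} - {\<omega> \<in> space P. J k \<omega> \<le> i}"
        by (auto simp: A_def Suc)
      ultimately show ?thesis by simp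
    qed
  qed
  have sumN: "(\<Sum>j\<le>m k. indicator (A k j) \<omega> * f j) = f (J k \<omega>)" if "\<omega> \<in> space P" for k \<omega> and f :: "nat \<Rightarrow> real"
  proof -
    have "(\<Sum>j\<le>m k. indicator (A k j) \<omega> * f j) = (\<Sum>j\<le>m k. if j = J k \<omega> then f j else 0)"
      by (rule sum.cong) (use that in \<open>auto simp: A_def indicator_def\<close>)
    also have "\<dots> = f (J k \<omega>)" using Jm[OF that] by simp
    finally show ?thesis .
  qed
  have iA: "integrable P (\<lambda>\<omega>. indicator (A k j) \<omega> * f \<omega>)" if "integrable P f" for k j and f :: "'s \<Rightarrow> real"
    using integrable_mult_indicator[OF sets_F_P[OF A] that] by simp
  have qN: "integrable P (\<lambda>\<omega>. q (N k \<omega>))" "(\<integral>\<omega>. q (N k \<omega>) \<partial>P) \<le> (\<integral>\<omega>. q (M t \<omega>) \<partial>P)"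
    if q: "convex_on UNIV q" "q \<in> borel_measurable borel" "\<And>x::real. 0 \<le> q x" "integrable P (\<lambda>\<omega>. q (M t \<omega>))" for q k
  proof -
    have eq: "q (N k \<omega>) = (\<Sum>j\<le>m k. indicator (A k j) \<omega> * q (M (u k j) \<omega>))" if "\<omega> \<in> space P" for \<omega>
      using sumN[OF that, of k "\<lambda>j. q (M (u k j) \<omega>)"] by (simp add: N_def)
    have ij: "integrable P (\<lambda>\<omega>. q (M (u k j) \<omega>))" for j
      by (rule martingale_convex(1)[OF M u A q])
    show "integrable P (\<lambda>\<omega>. q (N k \<omega>))"
      by (subst Bochner_Integration.integrable_cong[OF refl eq])
        (assumption, rule Bochner_Integration.integrable_sum[OF iA[OF ij]])
    have "(\<integral>\<omega>. q (N k \<omega>) \<partial>P) = (\<Sum>j\<le>m k. \<integral>\<omega>. indicator (A k j) \<omega> * q (M (u k j) \<omega>) \<partial>P)"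
      by (subst Bochner_Integration.integral_cong[OF refl eq])
        (assumption, rule Bochner_Integration.integral_sum[OF iA[OF ij]])
    also have "\<dots> \<le> (\<Sum>j\<le>m k. \<integral>\<omega>. indicator (A k j) \<omega> * q (M t \<omega>) \<partial>P)"
      by (intro sum_mono martingale_convex(2)[OF M u A q])
    also have "\<dots> = (\<integral>\<omega>. (\<Sum>j\<le>m k. indicator (A k j) \<omega> * q (M t \<omega>)) \<partial>P)"
      by (rule Bochner_Integration.integral_sum[symmetric, OF iA[OF q(4)]])
    also have "\<dots> = (\<integral>\<omega>. q (M t \<omega>) \<partial>P)"
      by (rule Bochner_Integration.integral_cong[OF refl sumN])
    finally show "(\<integral>\<omega>. q (N k \<omega>) \<partial>P) \<le> (\<integral>\<omega>. q (M t \<omega>) \<partial>P)" .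
  qed
  have eqN: "N k \<omega> = (\<Sum>j\<le>m k. indicator (A k j) \<omega> * M (u k j) \<omega>)" if "\<omega> \<in> space P" for k \<omega>
    using sumN[OF that, of k "\<lambda>j. M (u k j) \<omega>"] by (simp add: N_def)
  have iN: "integrable P (N k)" for k
    by (subst Bochner_Integration.integrable_cong[OF refl eqN])
      (assumption, rule Bochner_Integration.integrable_sum[OF iA[OF int[OF u(1)]]])
  have EN: "(\<integral>\<omega>. N k \<omega> \<partial>P) = (\<integral>\<omega>. M t \<omega> \<partial>P)" for k
  proof -
    have "(\<integral>\<omega>. N k \<omega> \<partial>P) = (\<Sum>j\<le>m k. \<integral>\<omega>. indicator (A k j) \<omega> * M (u k j) \<omega> \<partial>P)"
      by (subst Bochner_Integration.integral_cong[OF refl eqN])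
        (assumption, rule Bochner_Integration.integral_sum[OF iA[OF int[OF u(1)]]])
    also have "\<dots> = (\<Sum>j\<le>m k. \<integral>\<omega>. indicator (A k j) \<omega> * M t \<omega> \<partial>P)"
      by (intro sum.cong refl martingale_set[OF M u A, symmetric])
    also have "\<dots> = (\<integral>\<omega>. (\<Sum>j\<le>m k. indicator (A k j) \<omega> * M t \<omega>) \<partial>P)"
      by (rule Bochner_Integration.integral_sum[symmetric, OF iA[OF int[OF t]]])
    also have "\<dots> = (\<integral>\<omega>. M t \<omega> \<partial>P)"
      by (rule Bochner_Integration.integral_cong[OF refl sumN])
    finally show ?thesis .
  qed
  have lim: "AE \<omega> in P. (\<lambda>k. N k \<omega>) \<longlonglongrightarrow> M (T \<omega>) \<omega>"
    using cont AE_space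
  proof eventually_elim
    case (elim \<omega>)
    have "(\<lambda>k. u k (J k \<omega>)) \<longlonglongrightarrow> min t (T \<omega>)"
      unfolding u_def J_def by (intro tendsto_min tendsto_const ceil_dyad_tendsto) (use T(2) elim in auto)
    then have "(\<lambda>k. u k (J k \<omega>)) \<longlonglongrightarrow> T \<omega>" using T(2)[of \<omega>] elim by (simp add: min_absorb2)
    then show ?case using elim u T(2) unfolding N_def continuous_on_sequentially by (auto simp: comp_def)
  qed
  have iq: "integrable P (\<lambda>\<omega>. excess L (M t \<omega>))" if "0 \<le> L" for L
    by (rule Bochner_Integration.integrable_bound[OF int[OF t]])
      (use int[OF t] excess_simps(1,2) that in \<open>auto intro!: always_eventually\<close>)
  define e where "e = (\<lambda>L. \<integral>\<omega>. excess L (M t \<omega>) \<partial>P)"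
  have fat: "(\<integral>\<^sup>+\<omega>. ennreal (excess L (M (T \<omega>) \<omega>)) \<partial>P) \<le> ennreal (e L)" if L: "0 \<le> L" for L
  proof -
    have "(\<integral>\<^sup>+\<omega>. ennreal (excess L (M (T \<omega>) \<omega>)) \<partial>P) = (\<integral>\<^sup>+\<omega>. liminf (\<lambda>k. ennreal (excess L (N k \<omega>))) \<partial>P)"
    proof (rule nn_integral_cong_AE, use lim in eventually_elim)
      case (elim \<omega>)
      have "(\<lambda>k. excess L (N k \<omega>)) \<longlonglongrightarrow> excess L (M (T \<omega>) \<omega>)"
        by (rule continuous_on_tendsto_compose[OF continuous_excess elim]) auto
      then show ?case by (intro lim_imp_Liminf[symmetric] tendsto_ennrealI) auto
    qed
    also have "\<dots> \<le> liminf (\<lambda>k. \<integral>\<^sup>+\<omega>. ennreal (excess L (N k \<omega>)) \<partial>P)"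
      by (rule nn_integral_liminf) (use iN in \<open>auto intro!: borel_measurable_integrable\<close>)
    also have "\<dots> \<le> liminf (\<lambda>k::nat. ennreal (e L))"
    proof (rule Liminf_mono, rule always_eventually, intro allI)
      fix k
      note qq = qN[OF convex_excess measurable_excess excess_simps(1) iq[OF L], of k]
      have "(\<integral>\<^sup>+\<omega>. ennreal (excess L (N k \<omega>)) \<partial>P) = ennreal (\<integral>\<omega>. excess L (N k \<omega>) \<partial>P)"
        by (rule nn_integral_eq_integral[OF qq(1)]) (auto simp: excess_simps(1))
      also have "\<dots> \<le> ennreal (e L)" unfolding e_def by (rule ennreal_leI[OF qq(2)])
      finally show "(\<integral>\<^sup>+\<omega>. ennreal (excess L (N k \<omega>)) \<partial>P) \<le> ennreal (e L)" .
    qed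
    also have "\<dots> = ennreal (e L)" by (simp add: Liminf_const)
    finally show ?thesis .
  qed
  have e0: "0 \<le> e L" for L unfolding e_def by (intro Bochner_Integration.integral_nonneg excess_simps)
  show iT: "integrable P (\<lambda>\<omega>. M (T \<omega>) \<omega>)"
  proof (rule integrableI_bounded[OF meas])
    have "(\<integral>\<^sup>+\<omega>. ennreal (norm (M (T \<omega>) \<omega>)) \<partial>P) = (\<integral>\<^sup>+\<omega>. ennreal (excess 0 (M (T \<omega>) \<omega>)) \<partial>P)"
      by (intro nn_integral_cong) (simp add: excess_def)
    also have "\<dots> \<le> ennreal (e 0)" by (rule fat) simp
    finally show "(\<integral>\<^sup>+\<omega>. ennreal (norm (M (T \<omega>) \<omega>)) \<partial>P) < \<infinity>"
      by (rule le_less_trans) simp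
  qed
  have main: "\<bar>(\<integral>\<omega>. M (T \<omega>) \<omega> \<partial>P) - (\<integral>\<omega>. M t \<omega> \<partial>P)\<bar> \<le> 2 * e L" if L: "0 \<le> L" for L
  proof -
    have clim: "(\<lambda>k. \<integral>\<omega>. clip L (N k \<omega>) \<partial>P) \<longlonglongrightarrow> (\<integral>\<omega>. clip L (M (T \<omega>) \<omega>) \<partial>P)"
    proof (rule integral_dominated_convergence[where w="\<lambda>_. L"])
      show "AE \<omega> in P. (\<lambda>k. clip L (N k \<omega>)) \<longlonglongrightarrow> clip L (M (T \<omega>) \<omega>)"
        using lim by eventually_elim (rule continuous_on_tendsto_compose[OF continuous_clip], auto)
    qed (use meas iN excess_simps(4)[OF L] in \<open>auto intro!: borel_measurable_integrable\<close>)
    have iclip: "integrable P (\<lambda>\<omega>. clip L (f \<omega>))" if "f \<in> borel_measurable P" for f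
      by (rule integrable_const_bound[of _ L]) (use that excess_simps(4)[OF L] in auto)
    have "\<bar>(\<integral>\<omega>. clip L (N k \<omega>) \<partial>P) - (\<integral>\<omega>. M t \<omega> \<partial>P)\<bar> \<le> e L" for k
    proof -
      note qq = qN[OF convex_excess measurable_excess excess_simps(1) iq[OF L], of k]
      have ic: "integrable P (\<lambda>\<omega>. clip L (N k \<omega>))" by (rule iclip) (use iN in auto)
      have "\<bar>(\<integral>\<omega>. clip L (N k \<omega>) \<partial>P) - (\<integral>\<omega>. M t \<omega> \<partial>P)\<bar> = \<bar>\<integral>\<omega>. clip L (N k \<omega>) - N k \<omega> \<partial>P\<bar>"
        using ic iN[of k] EN[of k] by simp
      also have "\<dots> \<le> (\<integral>\<omega>. \<bar>clip L (N k \<omega>) - N k \<omega>\<bar> \<partial>P)" by (rule integral_abs_bound)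
      also have "\<dots> = (\<integral>\<omega>. excess L (N k \<omega>) \<partial>P)"
        using excess_simps(3)[OF L] by (simp add: abs_minus_commute)
      also have "\<dots> \<le> e L" using qq(2) by (simp add: e_def)
      finally show ?thesis .
    qed
    then have 1: "\<bar>(\<integral>\<omega>. clip L (M (T \<omega>) \<omega>) \<partial>P) - (\<integral>\<omega>. M t \<omega> \<partial>P)\<bar> \<le> e L"
      by (intro tendsto_upperbound[OF tendsto_rabs[OF tendsto_diff[OF clim tendsto_const]]]) auto
    have iex: "integrable P (\<lambda>\<omega>. excess L (M (T \<omega>) \<omega>))"
      by (rule Bochner_Integration.integrable_bound[OF iT])
        (use meas excess_simps(1,2) L in \<open>auto intro!: always_eventually\<close>)
    have "ennreal (\<integral>\<omega>. excess L (M (T \<omega>) \<omega>) \<partial>P) \<le> ennreal (e L)"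
      using fat[OF L] nn_integral_eq_integral[OF iex] excess_simps(1) by simp
    then have "(\<integral>\<omega>. excess L (M (T \<omega>) \<omega>) \<partial>P) \<le> e L" using e0 by simp
    moreover have "\<bar>(\<integral>\<omega>. M (T \<omega>) \<omega> \<partial>P) - (\<integral>\<omega>. clip L (M (T \<omega>) \<omega>) \<partial>P)\<bar> \<le> (\<integral>\<omega>. excess L (M (T \<omega>) \<omega>) \<partial>P)"
    proof -
      have "(\<integral>\<omega>. M (T \<omega>) \<omega> \<partial>P) - (\<integral>\<omega>. clip L (M (T \<omega>) \<omega>) \<partial>P) = (\<integral>\<omega>. M (T \<omega>) \<omega> - clip L (M (T \<omega>) \<omega>) \<partial>P)"
        using iT iclip[OF meas] by simp
      also have "\<bar>\<dots>\<bar> \<le> (\<integral>\<omega>. \<bar>M (T \<omega>) \<omega> - clip L (M (T \<omega>) \<omega>)\<bar> \<partial>P)" by (rule integral_abs_bound)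
      finally show ?thesis using excess_simps(3)[OF L] by simp
    qed
    ultimately show ?thesis using 1 by linarith
  qed
  have "(\<lambda>n. e (real n)) \<longlonglongrightarrow> (\<integral>\<omega>. 0 \<partial>P)"
    unfolding e_def
  proof (rule integral_dominated_convergence[where w="\<lambda>\<omega>. \<bar>M t \<omega>\<bar>"])
    show "AE \<omega> in P. (\<lambda>n. excess (real n) (M t \<omega>)) \<longlonglongrightarrow> 0"
    proof (rule AE_I2, rule tendsto_eventually)
      fix \<omega>
      show "\<forall>\<^sub>F n in sequentially. excess (real n) (M t \<omega>) = 0"
        using eventually_ge_at_top[of "nat \<lceil>\<bar>M t \<omega>\<bar>\<rceil>"]
      proof eventually_elim
        case (elim n)
        then have "\<bar>M t \<omega>\<bar> \<le> real n" by linarith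
        then show ?case by (simp add: excess_def)
      qed
    qed
  qed (use int[OF t] excess_simps(1,2) in auto)
  then have "(\<lambda>n. 2 * e (real n)) \<longlonglongrightarrow> 2 * 0" by (intro tendsto_mult_left) simp
  then have "\<bar>(\<integral>\<omega>. M (T \<omega>) \<omega> \<partial>P) - (\<integral>\<omega>. M t \<omega> \<partial>P)\<bar> \<le> 2 * 0"
    by (rule tendsto_lowerbound) (use main in auto)
  then show "(\<integral>\<omega>. M (T \<omega>) \<omega> \<partial>P) = (\<integral>\<omega>. M t \<omega> \<partial>P)" by simp
qed

lemma stopped_martingale_set:
  assumes M: "martingale P F M" and cont: "AE \<omega> in P. continuous_on {0..} (\<lambda>t. M t \<omega>)"
    and T: "stopping_time F T" "\<And>\<omega>. \<omega> \<in> space P \<Longrightarrow> 0 \<le> T \<omega>"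
    and meas: "\<And>r. 0 \<le> r \<Longrightarrow> (\<lambda>\<omega>. M (min r (T \<omega>)) \<omega>) \<in> borel_measurable P"
    and st: "0 \<le> s" "s \<le> t" and B: "B \<in> sets (F s)"
  shows "integrable P (\<lambda>\<omega>. M (min t (T \<omega>)) \<omega>)"
    "(\<integral>\<omega>. indicator B \<omega> * (M (min t (T \<omega>)) \<omega> - M (min s (T \<omega>)) \<omega>) \<partial>P) = 0"
proof -
  have t: "0 \<le> t" using st by simp
  have int: "integrable P (M r)" if "0 \<le> r" for r using M that unfolding martingale_def by auto
  have i: "integrable P (\<lambda>\<omega>. M (min r (T \<omega>)) \<omega>)" if r: "0 \<le> r" for r
  proof (rule optional_stopping(1)[OF M cont, where t=r])
    show "stopping_time F (\<lambda>\<omega>. min r (T \<omega>))" by (intro stopping_time_min stopping_time_const T)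
  qed (use T r meas in auto)
  from i[OF t] show "integrable P (\<lambda>\<omega>. M (min t (T \<omega>)) \<omega>)" .
  define D where "D = {\<omega> \<in> B. s < T \<omega>}"
  have BP: "B \<subseteq> space P" using sets.sets_into_space[OF B] by simp
  have Ds: "D \<in> sets (F s)"
  proof -
    have "{\<omega> \<in> space (F s). T \<omega> \<le> s} \<in> sets (F s)" using stopping_timeD[OF T(1), of s] by (simp add: pred_def)
    then have "B - {\<omega> \<in> space (F s). T \<omega> \<le> s} \<in> sets (F s)" using B by blast
    moreover have "B - {\<omega> \<in> space (F s). T \<omega> \<le> s} = D" using BP by (auto simp: D_def)
    ultimately show ?thesis by simp
  qed
  have DP: "D \<in> sets P" using Ds by (rule sets_F_P)
  have st1: "stopping_time F (\<lambda>\<omega>. if \<omega> \<in> D then min t (T \<omega>) else t)"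
  proof
    fix r
    have "{\<omega> \<in> space P. (if \<omega> \<in> D then min t (T \<omega>) else t) \<le> r} \<in> sets (F r)"
    proof (cases "t \<le> r \<or> r < s")
      case True
      then have "{\<omega> \<in> space P. (if \<omega> \<in> D then min t (T \<omega>) else t) \<le> r} = (if t \<le> r then space (F r) else {})"
        using st by (auto simp: D_def)
      then show ?thesis by (metis sets.top sets.empty_sets)
    next
      case False
      then have "{\<omega> \<in> space P. (if \<omega> \<in> D then min t (T \<omega>) else t) \<le> r} = D \<inter> {\<omega> \<in> space (F r). T \<omega> \<le> r}"
        using BP by (auto simp: D_def)
      moreover have "{\<omega> \<in> space (F r). T \<omega> \<le> r} \<in> sets (F r)" using stopping_timeD[OF T(1), of r] by (simp add: pred_def)
      moreover have "D \<in> sets (F r)" using Ds F_mono[of s r] False by auto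
      ultimately show ?thesis by simp
    qed
    then show "Measurable.pred (F r) (\<lambda>\<omega>. (if \<omega> \<in> D then min t (T \<omega>) else t) \<le> r)" by (simp add: pred_def)
  qed
  have st2: "stopping_time F (\<lambda>\<omega>. if \<omega> \<in> D then s else t)"
  proof
    fix r
    have "{\<omega> \<in> space P. (if \<omega> \<in> D then s else t) \<le> r} \<in> sets (F r)"
    proof (cases "t \<le> r \<or> r < s")
      case True
      then have "{\<omega> \<in> space P. (if \<omega> \<in> D then s else t) \<le> r} = (if t \<le> r then space (F r) else {})"
        using st by auto
      then show ?thesis by (metis sets.top sets.empty_sets)
    next
      case False
      then have "{\<omega> \<in> space P. (if \<omega> \<in> D then s else t) \<le> r} = D"
        using BP by (auto simp: D_def)
      moreover have "D \<in> sets (F r)" using Ds F_mono[of s r] False by auto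
      ultimately show ?thesis by simp
    qed
    then show "Measurable.pred (F r) (\<lambda>\<omega>. (if \<omega> \<in> D then s else t) \<le> r)" by (simp add: pred_def)
  qed
  have m1: "(\<lambda>\<omega>. M (if \<omega> \<in> D then min t (T \<omega>) else t) \<omega>) \<in> borel_measurable P"
  proof -
    have "(\<lambda>\<omega>. if \<omega> \<in> D then M (min t (T \<omega>)) \<omega> else M t \<omega>) \<in> borel_measurable P"
      using DP meas[OF t] int[OF t] by (intro measurable_If_set) auto
    then show ?thesis by (rule subst[where P="\<lambda>f. f \<in> borel_measurable P", rotated]) auto
  qed
  have m2: "(\<lambda>\<omega>. M (if \<omega> \<in> D then s else t) \<omega>) \<in> borel_measurable P"
  proof -
    have "(\<lambda>\<omega>. if \<omega> \<in> D then M s \<omega> else M t \<omega>) \<in> borel_measurable P"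
      using DP int[OF st(1)] int[OF t] by (intro measurable_If_set) auto
    then show ?thesis by (rule subst[where P="\<lambda>f. f \<in> borel_measurable P", rotated]) auto
  qed
  have b1: "0 \<le> (if \<omega> \<in> D then min t (T \<omega>) else t) \<and> (if \<omega> \<in> D then min t (T \<omega>) else t) \<le> t" if "\<omega> \<in> space P" for \<omega>
    using T(2)[OF that] t by auto
  have b2: "0 \<le> (if \<omega> \<in> D then s else t) \<and> (if \<omega> \<in> D then s else t) \<le> t" if "\<omega> \<in> space P" for \<omega>
    using st by auto
  note o1 = optional_stopping[OF M cont st1 b1 m1] and o2 = optional_stopping[OF M cont st2 b2 m2]
  have "(\<integral>\<omega>. indicator B \<omega> * (M (min t (T \<omega>)) \<omega> - M (min s (T \<omega>)) \<omega>) \<partial>P) =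
    (\<integral>\<omega>. M (if \<omega> \<in> D then min t (T \<omega>) else t) \<omega> - M (if \<omega> \<in> D then s else t) \<omega> \<partial>P)"
  proof (rule Bochner_Integration.integral_cong[OF refl])
    fix \<omega> assume "\<omega> \<in> space P"
    show "indicator B \<omega> * (M (min t (T \<omega>)) \<omega> - M (min s (T \<omega>)) \<omega>) =
      M (if \<omega> \<in> D then min t (T \<omega>) else t) \<omega> - M (if \<omega> \<in> D then s else t) \<omega>"
    proof (cases "s < T \<omega>")
      case False
      then have "min t (T \<omega>) = min s (T \<omega>)" using st by auto
      with False show ?thesis by (simp add: D_def)
    qed (use st in \<open>auto simp: D_def indicator_def\<close>)
  qed
  also have "\<dots> = 0" using o1 o2 by simp
  finally show "(\<integral>\<omega>. indicator B \<omega> * (M (min t (T \<omega>)) \<omega> - M (min s (T \<omega>)) \<omega>) \<partial>P) = 0" .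
qed

end

lemma filtered_path:
  fixes P :: "(real \<Rightarrow> 'a::metric_space) measure"
  assumes "prob_space P" "sets P = sets path_borel"
  shows "filtered_prob_space P raw_filtration"
  unfolding filtered_prob_space_def filtered_prob_space_axioms_def
  using assms subalgebra_raw_filtration raw_filtration_mono by blast

section \<open>Brownian motion\<close>

subsection \<open>Independent standard normal variables\<close>

abbreviation sn :: "real measure" where "sn \<equiv> std_normal_distribution"

lemma prob_space_sn: "prob_space sn"
  using real_dist_normal_dist by (simp add: real_distribution_def)

lemma emeasure_sn: "emeasure sn A = ennreal (measure sn A)"
proof -
  interpret S: prob_space sn by (rule prob_space_sn)
  show ?thesis by (rule S.emeasure_eq_measure)
qed

definition rot :: "real \<times> real \<Rightarrow> real \<times> real" where
  "rot p = ((fst p + snd p) / sqrt 2, (fst p - snd p) / sqrt 2)"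

lemma measurable_rot [measurable]: "rot \<in> measurable (borel \<Otimes>\<^sub>M borel) (borel \<Otimes>\<^sub>M borel)"
  unfolding rot_def by measurable

lemma std_normal_density_rot:
  "std_normal_density ((u + v) / sqrt 2) * std_normal_density ((u - v) / sqrt 2) =
   std_normal_density u * std_normal_density v"
proof -
  have "((u + v) / sqrt 2)\<^sup>2 + ((u - v) / sqrt 2)\<^sup>2 = u\<^sup>2 + v\<^sup>2"
    by (simp add: power_divide power2_eq_square field_simps)
  then have "exp (- ((u + v) / sqrt 2)\<^sup>2 / 2) * exp (- ((u - v) / sqrt 2)\<^sup>2 / 2) = exp (- u\<^sup>2 / 2) * exp (- v\<^sup>2 / 2)"
    unfolding exp_add[symmetric] by (simp add: field_simps)
  then show ?thesis unfolding std_normal_density_def by (simp add: field_simps)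
qed

lemma nn_integral_sn_pair:
  assumes [measurable]: "f \<in> borel_measurable (borel \<Otimes>\<^sub>M borel)"
  shows "(\<integral>\<^sup>+p. f p \<partial>(sn \<Otimes>\<^sub>M sn)) =
    (\<integral>\<^sup>+x. \<integral>\<^sup>+y. f (x, y) * ennreal (std_normal_density x * std_normal_density y) \<partial>lborel \<partial>lborel)"
proof -
  interpret S: prob_space sn by (rule prob_space_sn)
  have "(\<integral>\<^sup>+p. f p \<partial>(sn \<Otimes>\<^sub>M sn)) = (\<integral>\<^sup>+x. \<integral>\<^sup>+y. f (x, y) \<partial>sn \<partial>sn)"
    by (rule S.nn_integral_fst[symmetric]) simp
  also have "\<dots> = (\<integral>\<^sup>+x. ennreal (std_normal_density x) * (\<integral>\<^sup>+y. ennreal (std_normal_density y) * f (x, y) \<partial>lborel) \<partial>lborel)"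
    by (subst nn_integral_density; (simp add: nn_integral_density cong: nn_integral_cong)?) 
  also have "\<dots> = (\<integral>\<^sup>+x. \<integral>\<^sup>+y. f (x, y) * ennreal (std_normal_density x * std_normal_density y) \<partial>lborel \<partial>lborel)"
    by (simp add: nn_integral_cmult[symmetric] ennreal_mult' mult_ac)
  finally show ?thesis .
qed

text \<open>Rotation by 45 degrees preserves the standard Gaussian measure of the plane; the two
  substitutions below replace first \<open>y\<close> and then \<open>x\<close> by the rotated coordinates.\<close>

lemma distr_rot: "distr (sn \<Otimes>\<^sub>M sn) (borel \<Otimes>\<^sub>M borel) rot = sn \<Otimes>\<^sub>M sn"
proof (rule measure_eqI)
  fix A :: "(real \<times> real) set" assume "A \<in> sets (distr (sn \<Otimes>\<^sub>M sn) (borel \<Otimes>\<^sub>M borel) rot)"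
  then have A [measurable]: "A \<in> sets (borel \<Otimes>\<^sub>M borel)" by simp
  define f where "f = (indicator A :: _ \<Rightarrow> ennreal)"
  have f [measurable]: "f \<in> borel_measurable (borel \<Otimes>\<^sub>M borel)" unfolding f_def by measurable
  let ?n = "std_normal_density"
  have "emeasure (distr (sn \<Otimes>\<^sub>M sn) (borel \<Otimes>\<^sub>M borel) rot) A = (\<integral>\<^sup>+p. f (rot p) \<partial>(sn \<Otimes>\<^sub>M sn))"
  proof -
    have "emeasure (distr (sn \<Otimes>\<^sub>M sn) (borel \<Otimes>\<^sub>M borel) rot) A = (\<integral>\<^sup>+p. f p \<partial>distr (sn \<Otimes>\<^sub>M sn) (borel \<Otimes>\<^sub>M borel) rot)"
      unfolding f_def by (rule nn_integral_indicator[symmetric]) simp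
    also have "\<dots> = (\<integral>\<^sup>+p. f (rot p) \<partial>(sn \<Otimes>\<^sub>M sn))" by (rule nn_integral_distr) measurable
    finally show ?thesis .
  qed
  also have "\<dots> = (\<integral>\<^sup>+x. \<integral>\<^sup>+y. f (rot (x, y)) * ennreal (?n x * ?n y) \<partial>lborel \<partial>lborel)"
    by (rule nn_integral_sn_pair) measurable
  also have "\<dots> = (\<integral>\<^sup>+x. \<integral>\<^sup>+u. ennreal (sqrt 2) * (f (u, sqrt 2 * x - u) * ennreal (?n x * ?n (sqrt 2 * u - x))) \<partial>lborel \<partial>lborel)"
  proof (rule nn_integral_cong)
    fix x :: real
    have "(\<lambda>y. (x, y)) \<in> measurable borel (borel \<Otimes>\<^sub>M borel)" by simp
    from measurable_compose[OF measurable_compose[OF this measurable_rot] f]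
    have [measurable]: "(\<lambda>y. f (rot (x, y))) \<in> borel_measurable borel" .
    have "(\<integral>\<^sup>+y. f (rot (x, y)) * ennreal (?n x * ?n y) \<partial>lborel) =
      ennreal \<bar>sqrt 2\<bar> * (\<integral>\<^sup>+u. f (rot (x, - x + sqrt 2 * u)) * ennreal (?n x * ?n (- x + sqrt 2 * u)) \<partial>lborel)"
      by (rule nn_integral_real_affine) simp_all
    also have "\<dots> = (\<integral>\<^sup>+u. ennreal (sqrt 2) * (f (rot (x, - x + sqrt 2 * u)) * ennreal (?n x * ?n (- x + sqrt 2 * u))) \<partial>lborel)"
    proof (subst nn_integral_cmult)
      have "(\<lambda>u. - x + sqrt 2 * u) \<in> borel_measurable borel" by simp
      from measurable_compose[OF this \<open>(\<lambda>y. f (rot (x, y))) \<in> borel_measurable borel\<close>]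
      show "(\<lambda>u. f (rot (x, - x + sqrt 2 * u)) * ennreal (?n x * ?n (- x + sqrt 2 * u))) \<in> borel_measurable lborel"
        by simp
    qed simp
    also have "\<dots> = (\<integral>\<^sup>+u. ennreal (sqrt 2) * (f (u, sqrt 2 * x - u) * ennreal (?n x * ?n (sqrt 2 * u - x))) \<partial>lborel)"
    proof (rule nn_integral_cong)
      fix u :: real
      have "rot (x, - x + sqrt 2 * u) = (u, sqrt 2 * x - u)"
        by (simp add: rot_def field_simps)
      then show "ennreal (sqrt 2) * (f (rot (x, - x + sqrt 2 * u)) * ennreal (?n x * ?n (- x + sqrt 2 * u))) =
        ennreal (sqrt 2) * (f (u, sqrt 2 * x - u) * ennreal (?n x * ?n (sqrt 2 * u - x)))" by simp
    qed
    finally show "(\<integral>\<^sup>+y. f (rot (x, y)) * ennreal (?n x * ?n y) \<partial>lborel) =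
      (\<integral>\<^sup>+u. ennreal (sqrt 2) * (f (u, sqrt 2 * x - u) * ennreal (?n x * ?n (sqrt 2 * u - x))) \<partial>lborel)" .
  qed
  also have "\<dots> = (\<integral>\<^sup>+u. \<integral>\<^sup>+x. ennreal (sqrt 2) * (f (u, sqrt 2 * x - u) * ennreal (?n x * ?n (sqrt 2 * u - x))) \<partial>lborel \<partial>lborel)"
    by (rule lborel_pair.Fubini') measurable
  also have "\<dots> = (\<integral>\<^sup>+u. \<integral>\<^sup>+v. f (u, v) * ennreal (?n u * ?n v) \<partial>lborel \<partial>lborel)"
  proof (rule nn_integral_cong)
    fix u :: real
    have abs: "\<bar>1 / sqrt 2\<bar> = 1 / sqrt (2::real)" by simp
    let ?h = "\<lambda>x. ennreal (sqrt 2) * (f (u, sqrt 2 * x - u) * ennreal (?n x * ?n (sqrt 2 * u - x)))"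
    have "(\<integral>\<^sup>+x. ?h x \<partial>lborel) = ennreal \<bar>1 / sqrt 2\<bar> * (\<integral>\<^sup>+v. ?h (u / sqrt 2 + 1 / sqrt 2 * v) \<partial>lborel)"
    proof (rule nn_integral_real_affine)
      have "(\<lambda>x. (u, sqrt 2 * x - u)) \<in> measurable borel (borel \<Otimes>\<^sub>M borel)" by simp
      from measurable_compose[OF this f] show "?h \<in> borel_measurable borel" by simp
    qed simp
    also have "\<dots> = (\<integral>\<^sup>+v. ennreal (1 / sqrt 2) * ?h (u / sqrt 2 + 1 / sqrt 2 * v) \<partial>lborel)"
      unfolding abs
    proof (rule nn_integral_cmult[symmetric])
      have "(\<lambda>v. (u, sqrt 2 * (u / sqrt 2 + 1 / sqrt 2 * v) - u)) \<in> measurable borel (borel \<Otimes>\<^sub>M borel)" by measurable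
      from measurable_compose[OF this f]
      show "(\<lambda>v. ?h (u / sqrt 2 + 1 / sqrt 2 * v)) \<in> borel_measurable lborel" by simp
    qed
    also have "\<dots> = (\<integral>\<^sup>+v. f (u, v) * ennreal (?n u * ?n v) \<partial>lborel)"
    proof (rule nn_integral_cong)
      fix v :: real
      have 1: "u / sqrt 2 + 1 / sqrt 2 * v = (u + v) / sqrt 2" by (simp add: add_divide_distrib)
      have s2: "sqrt 2 * sqrt 2 = (2::real)" by simp
      have "sqrt 2 * u = 2 * u / sqrt 2" using s2 by (simp add: field_simps)
      then have 2: "sqrt 2 * u - (u + v) / sqrt 2 = (u - v) / sqrt 2"
        by (simp add: field_simps)
      have 3: "sqrt 2 * ((u + v) / sqrt 2) - u = v" by simp
      have 4: "ennreal (1 / sqrt 2) * (ennreal (sqrt 2) * c) = c" for c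
        by (simp add: mult.assoc[symmetric] ennreal_mult'[symmetric])
      show "ennreal (1 / sqrt 2) * ?h (u / sqrt 2 + 1 / sqrt 2 * v) = f (u, v) * ennreal (?n u * ?n v)"
        unfolding 1 2 3 4 std_normal_density_rot ..
    qed
    finally show "(\<integral>\<^sup>+x. ?h x \<partial>lborel) = (\<integral>\<^sup>+v. f (u, v) * ennreal (?n u * ?n v) \<partial>lborel)" .
  qed
  also have "\<dots> = (\<integral>\<^sup>+p. f p \<partial>(sn \<Otimes>\<^sub>M sn))" by (rule nn_integral_sn_pair[symmetric]) measurable
  also have "\<dots> = emeasure (sn \<Otimes>\<^sub>M sn) A" unfolding f_def by (rule nn_integral_indicator) simp
  finally show "emeasure (distr (sn \<Otimes>\<^sub>M sn) (borel \<Otimes>\<^sub>M borel) rot) A = emeasure (sn \<Otimes>\<^sub>M sn) A" .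
qed simp

lemma measure_rot_rect:
  assumes [measurable]: "A \<in> sets borel" "B \<in> sets borel"
  shows "measure (sn \<Otimes>\<^sub>M sn) (rot -` (A \<times> B)) = measure sn A * measure sn B"
proof -
  interpret S: prob_space sn by (rule prob_space_sn)
  interpret SS: pair_prob_space sn sn ..
  have "measure (sn \<Otimes>\<^sub>M sn) (rot -` (A \<times> B)) = measure (distr (sn \<Otimes>\<^sub>M sn) (borel \<Otimes>\<^sub>M borel) rot) (A \<times> B)"
    by (subst measure_distr) (auto simp: space_pair_measure)
  also have "\<dots> = measure (sn \<Otimes>\<^sub>M sn) (A \<times> B)" by (simp only: distr_rot)
  also have "\<dots> = measure sn A * measure sn B"
    by (simp add: measure_def S.emeasure_pair_measure_Times enn2real_mult)
  finally show ?thesis .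
qed

definition (in prob_space) std_iid :: "('i \<Rightarrow> 'a \<Rightarrow> real) \<Rightarrow> bool" where
  "std_iid X \<longleftrightarrow> (\<forall>i. X i \<in> borel_measurable M) \<and>
    (\<forall>J A. finite J \<longrightarrow> (\<forall>i. A i \<in> sets borel) \<longrightarrow>
      prob {\<omega> \<in> space M. \<forall>i\<in>J. X i \<omega> \<in> A i} = (\<Prod>i\<in>J. measure sn (A i)))"

context prob_space
begin

lemma std_iid_measurable: "std_iid X \<Longrightarrow> X i \<in> borel_measurable M"
  by (simp add: std_iid_def)

lemma std_iid_prob: "std_iid X \<Longrightarrow> finite J \<Longrightarrow> (\<And>i. A i \<in> sets borel) \<Longrightarrow>
  prob {\<omega> \<in> space M. \<forall>i\<in>J. X i \<omega> \<in> A i} = (\<Prod>i\<in>J. measure sn (A i))"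
  by (simp add: std_iid_def)

lemma std_iid_single:
  assumes "std_iid X" "B \<in> sets borel"
  shows "prob {\<omega> \<in> space M. X i \<omega> \<in> B} = measure sn B"
  using std_iid_prob[OF assms(1), of "{i}" "\<lambda>_. B"] assms(2) by simp

lemma std_iid_distr:
  assumes "std_iid X" shows "distr M borel (X i) = sn"
proof (rule measure_eqI)
  interpret S: prob_space sn by (rule prob_space_sn)
  fix A assume "A \<in> sets (distr M borel (X i))"
  then have A: "A \<in> sets borel" by simp
  have "emeasure (distr M borel (X i)) A = emeasure M {\<omega> \<in> space M. X i \<omega> \<in> A}"
    using std_iid_measurable[OF assms] A by (subst emeasure_distr) (auto intro!: arg_cong2[where f=emeasure])
  also have "\<dots> = emeasure sn A"
    unfolding emeasure_eq_measure emeasure_sn std_iid_single[OF assms A] ..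
  finally show "emeasure (distr M borel (X i)) A = emeasure sn A" .
qed simp

lemma std_iidI:
  fixes X :: "'b \<Rightarrow> 'a \<Rightarrow> real"
  assumes "\<And>i. X i \<in> borel_measurable M"
    and "\<And>J. finite J \<Longrightarrow> \<exists>J'. finite J' \<and> J \<subseteq> J' \<and> (\<forall>A. (\<forall>i. A i \<in> sets borel) \<longrightarrow>
      prob {\<omega> \<in> space M. \<forall>i\<in>J'. X i \<omega> \<in> A i} = (\<Prod>i\<in>J'. measure sn (A i)))"
  shows "std_iid X"
  unfolding std_iid_def
proof (intro conjI allI impI assms(1))
  interpret S: prob_space sn by (rule prob_space_sn)
  fix J :: "'b set" and A :: "'b \<Rightarrow> real set" assume J: "finite J" and A: "\<forall>i. A i \<in> sets borel"
  obtain J' where J': "finite J'" "J \<subseteq> J'" and eq: "\<And>A :: 'b \<Rightarrow> real set. (\<forall>i. A i \<in> sets borel) \<Longrightarrow>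
      prob {\<omega> \<in> space M. \<forall>i\<in>J'. X i \<omega> \<in> A i} = (\<Prod>i\<in>J'. measure sn (A i))"
    using assms(2)[OF J] by blast
  define A' where "A' = (\<lambda>i. if i \<in> J then A i else UNIV)"
  have "{\<omega> \<in> space M. \<forall>i\<in>J. X i \<omega> \<in> A i} = {\<omega> \<in> space M. \<forall>i\<in>J'. X i \<omega> \<in> A' i}"
    using J'(2) by (auto simp: A'_def)
  then have "prob {\<omega> \<in> space M. \<forall>i\<in>J. X i \<omega> \<in> A i} = (\<Prod>i\<in>J'. measure sn (A' i))"
    using eq[of A'] A by (simp add: A'_def)
  also have "\<dots> = (\<Prod>i\<in>J. measure sn (A i))"
    using J' S.prob_space by (intro prod.mono_neutral_cong_right) (auto simp: A'_def)
  finally show "prob {\<omega> \<in> space M. \<forall>i\<in>J. X i \<omega> \<in> A i} = (\<Prod>i\<in>J. measure sn (A i))" .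
qed

lemma std_iid_indep_vars:
  assumes X: "std_iid X" shows "indep_vars (\<lambda>_. borel) X UNIV"
  unfolding indep_vars_def2
proof (intro conjI ballI indep_setsI)
  fix i show "random_variable borel (X i)" by (rule std_iid_measurable[OF X])
  then show "{X i -` A \<inter> space M |A. A \<in> sets borel} \<subseteq> events" by (auto intro: measurable_sets)
next
  fix A J assume J: "J \<noteq> {}" "finite J" and A: "\<forall>j\<in>J. A j \<in> {X j -` A \<inter> space M |A. A \<in> sets borel}"
  then have "\<forall>j\<in>J. \<exists>B. A j = X j -` B \<inter> space M \<and> B \<in> sets borel" by auto
  then obtain B where B: "\<And>j. j \<in> J \<Longrightarrow> A j = X j -` B j \<inter> space M" "\<And>j. j \<in> J \<Longrightarrow> B j \<in> sets borel"
    by metis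
  define B' where "B' = (\<lambda>j. if j \<in> J then B j else UNIV)"
  have B': "B' j \<in> sets borel" for j using B by (simp add: B'_def)
  have "(\<Inter>j\<in>J. A j) = {\<omega> \<in> space M. \<forall>j\<in>J. X j \<omega> \<in> B' j}" using J B by (auto simp: B'_def)
  then have "prob (\<Inter>j\<in>J. A j) = (\<Prod>j\<in>J. measure sn (B' j))"
    using std_iid_prob[OF X J(2) B'] by simp
  also have "\<dots> = (\<Prod>j\<in>J. prob (A j))"
  proof (rule prod.cong[OF refl])
    fix j assume j: "j \<in> J"
    then have "A j = {\<omega> \<in> space M. X j \<omega> \<in> B' j}" using B by (auto simp: B'_def)
    then show "measure sn (B' j) = prob (A j)" using std_iid_single[OF X B'] by simp
  qed
  finally show "prob (\<Inter>j\<in>J. A j) = (\<Prod>j\<in>J. prob (A j))" .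
qed

end

subsection \<open>Dyadic increments by midpoint refinement\<close>

definition gauss :: "(nat \<times> nat \<Rightarrow> real) measure" where
  "gauss = PiM UNIV (\<lambda>_. sn)"

interpretation gauss: product_prob_space "\<lambda>_::nat \<times> nat. sn" UNIV
  by (intro product_prob_spaceI prob_space_sn)

interpretation G: prob_space gauss
  unfolding gauss_def by (rule gauss.prob_space_axioms)

lemma space_gauss [simp]: "space gauss = UNIV"
  by (simp add: gauss_def space_PiM PiE_def)

lemma sets_gauss: "sets gauss = sets (PiM UNIV (\<lambda>_. borel))"
  unfolding gauss_def by (rule sets_PiM_cong) auto

lemma measurable_gauss: "measurable gauss N = measurable (PiM UNIV (\<lambda>_. borel)) N"
  by (rule measurable_cong_sets[OF sets_gauss refl])

lemma gauss_iid: "G.std_iid (\<lambda>i z. z i)"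
  unfolding G.std_iid_def
proof (intro conjI allI impI)
  fix i show "(\<lambda>z. z i) \<in> borel_measurable gauss" unfolding measurable_gauss by measurable
next
  interpret S: prob_space sn by (rule prob_space_sn)
  fix J :: "(nat \<times> nat) set" and A :: "nat \<times> nat \<Rightarrow> real set"
  assume "finite J" "\<forall>i. A i \<in> sets borel"
  then have "emeasure gauss {z \<in> space gauss. \<forall>i\<in>J. z i \<in> A i} = (\<Prod>i\<in>J. emeasure sn (A i))"
    unfolding gauss_def by (intro gauss.emeasure_PiM_Collect) auto
  then show "G.prob {z \<in> space gauss. \<forall>i\<in>J. z i \<in> A i} = (\<Prod>i\<in>J. measure sn (A i))"
    unfolding G.emeasure_eq_measure emeasure_sn
    by (simp add: prod_ennreal prod_nonneg)
qed

text \<open>\<open>lev m k\<close> is the normalized increment of the Brownian motion over the \<open>k\<close>-th dyadic interval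
  of length \<open>2\<^sup>-\<^sup>m\<close>: its two halves are obtained from it and from a fresh normal variable by a
  rotation.\<close>

fun lev :: "nat \<Rightarrow> nat \<Rightarrow> (nat \<times> nat \<Rightarrow> real) \<Rightarrow> real" where
  "lev 0 k z = z (0, k)"
| "lev (Suc m) k z = (lev m (k div 2) z + (if even k then 1 else - 1) * z (Suc m, k div 2)) / sqrt 2"

lemma lev_restrict: "{..m} \<times> UNIV \<subseteq> K \<Longrightarrow> lev m k (restrict z K) = lev m k z"
proof (induction m arbitrary: k)
  case (Suc m)
  have "{..m} \<times> UNIV \<subseteq> K" using Suc.prems by auto
  moreover have "(Suc m, k div 2) \<in> K" using Suc.prems by auto
  ultimately show ?case using Suc.IH by simp
qed auto

lemma lev_measurable: "{..m} \<times> UNIV \<subseteq> K \<Longrightarrow> lev m k \<in> borel_measurable (PiM K (\<lambda>_. borel))"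
proof (induction m arbitrary: k)
  case 0
  have "(0, k) \<in> K" using 0 by auto
  then show ?case by (simp add: measurable_component_singleton)
next
  case (Suc m)
  have "{..m} \<times> UNIV \<subseteq> K" using Suc.prems by auto
  then have [measurable]: "lev m (k div 2) \<in> borel_measurable (PiM K (\<lambda>_. borel))" by (rule Suc.IH)
  have "(Suc m, k div 2) \<in> K" using Suc.prems by auto
  then have [measurable]: "(\<lambda>z. z (Suc m, k div 2)) \<in> borel_measurable (PiM K (\<lambda>_. borel))"
    by (rule measurable_component_singleton)
  show ?case by simp
qed

lemma lev_gauss [measurable]: "lev m k \<in> borel_measurable gauss"
  unfolding measurable_gauss by (rule lev_measurable) simp

lemma prod_even_odd: "(\<Prod>i<2 * n. f i) = (\<Prod>k<n. f (2 * k) * f (2 * k + 1 :: nat) :: real)"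
  by (induction n) (auto simp: mult_ac)

lemma lev_coord_iid:
  assumes "G.std_iid (lev m)"
  shows "G.std_iid (\<lambda>(b, k) z. if b then lev m k z else z (Suc m, k))"
  unfolding G.std_iid_def
proof (intro conjI allI impI)
  fix i :: "bool \<times> nat"
  show "(case i of (b, k) \<Rightarrow> \<lambda>z. if b then lev m k z else z (Suc m, k)) \<in> borel_measurable gauss"
    using G.std_iid_measurable[OF gauss_iid] lev_gauss by (cases i; cases "fst i") (auto simp: case_prod_beta)
next
  fix J :: "(bool \<times> nat) set" and A :: "bool \<times> nat \<Rightarrow> real set"
  assume J: "finite J" and A: "\<forall>i. A i \<in> sets borel"
  define J1 where "J1 = {k. (True, k) \<in> J}"
  define J2 where "J2 = {k. (False, k) \<in> J}"
  have JJ: "J = Pair True ` J1 \<union> Pair False ` J2"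
  proof (rule set_eqI)
    fix i show "i \<in> J \<longleftrightarrow> i \<in> Pair True ` J1 \<union> Pair False ` J2"
      by (cases i; cases "fst i") (auto simp: J1_def J2_def)
  qed
  have fin: "finite J1" "finite J2"
    using finite_vimageI[OF J, of "Pair True"] finite_vimageI[OF J, of "Pair False"]
    by (auto simp: J1_def J2_def vimage_def inj_on_def)
  define K1 :: "(nat \<times> nat) set" where "K1 = {..m} \<times> UNIV"
  define K2 :: "(nat \<times> nat) set" where "K2 = {Suc m} \<times> UNIV"
  have iv: "G.indep_var (PiM K1 (\<lambda>_. borel)) (\<lambda>z. restrict (\<lambda>i. z i) K1) (PiM K2 (\<lambda>_. borel)) (\<lambda>z. restrict (\<lambda>i. z i) K2)"
    by (rule G.indep_var_restrict[OF G.std_iid_indep_vars[OF gauss_iid]]) (auto simp: K1_def K2_def)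
  define Xa where "Xa = {x \<in> space (PiM K1 (\<lambda>_. borel)). \<forall>k\<in>J1. lev m k x \<in> A (True, k)}"
  define Xb where "Xb = {x \<in> space (PiM K2 (\<lambda>_. borel)). \<forall>k\<in>J2. x (Suc m, k) \<in> A (False, k)}"
  have Xa: "Xa \<in> sets (PiM K1 (\<lambda>_. borel))"
    unfolding Xa_def
  proof (rule sets.sets_Collect_finite_All[OF _ fin(1)])
    fix k
    have "lev m k -` A (True, k) \<inter> space (PiM K1 (\<lambda>_. borel)) \<in> sets (PiM K1 (\<lambda>_. borel))"
      using lev_measurable[of m K1 k] A by (intro measurable_sets[where A=borel]) (auto simp: K1_def)
    then show "{x \<in> space (PiM K1 (\<lambda>_. borel)). lev m k x \<in> A (True, k)} \<in> sets (PiM K1 (\<lambda>_. borel))"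
      by (simp add: vimage_def Int_def conj_commute)
  qed
  have Xb: "Xb \<in> sets (PiM K2 (\<lambda>_. borel))"
    unfolding Xb_def
  proof (rule sets.sets_Collect_finite_All[OF _ fin(2)])
    fix k
    have "(\<lambda>x. x (Suc m, k)) -` A (False, k) \<inter> space (PiM K2 (\<lambda>_. borel)) \<in> sets (PiM K2 (\<lambda>_. borel))"
      using A by (intro measurable_sets[where A=borel] measurable_component_singleton) (auto simp: K2_def)
    then show "{x \<in> space (PiM K2 (\<lambda>_. borel)). x (Suc m, k) \<in> A (False, k)} \<in> sets (PiM K2 (\<lambda>_. borel))"
      by (simp add: vimage_def Int_def conj_commute)
  qed
  have r1: "restrict z K1 \<in> Xa \<longleftrightarrow> (\<forall>k\<in>J1. lev m k z \<in> A (True, k))" for z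
    by (simp add: Xa_def space_PiM PiE_def lev_restrict K1_def)
  have r2: "restrict z K2 \<in> Xb \<longleftrightarrow> (\<forall>k\<in>J2. z (Suc m, k) \<in> A (False, k))" for z
    by (simp add: Xb_def space_PiM PiE_def K2_def)
  have "{z \<in> space gauss. \<forall>i\<in>J. (case i of (b, k) \<Rightarrow> \<lambda>z. if b then lev m k z else z (Suc m, k)) z \<in> A i} =
    (\<lambda>z. (restrict z K1, restrict z K2)) -` (Xa \<times> Xb) \<inter> space gauss"
  proof (intro set_eqI)
    fix z
    have "(\<forall>i\<in>J. (case i of (b, k) \<Rightarrow> \<lambda>z. if b then lev m k z else z (Suc m, k)) z \<in> A i) \<longleftrightarrow>
      (\<forall>k\<in>J1. lev m k z \<in> A (True, k)) \<and> (\<forall>k\<in>J2. z (Suc m, k) \<in> A (False, k))"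
      unfolding JJ ball_Un ball_simps by simp
    then show "z \<in> {z \<in> space gauss. \<forall>i\<in>J. (case i of (b, k) \<Rightarrow> \<lambda>z. if b then lev m k z else z (Suc m, k)) z \<in> A i} \<longleftrightarrow>
      z \<in> (\<lambda>z. (restrict z K1, restrict z K2)) -` (Xa \<times> Xb) \<inter> space gauss"
      by (simp add: r1 r2)
  qed
  then have "G.prob {z \<in> space gauss. \<forall>i\<in>J. (case i of (b, k) \<Rightarrow> \<lambda>z. if b then lev m k z else z (Suc m, k)) z \<in> A i} =
    G.prob ((\<lambda>z. restrict z K1) -` Xa \<inter> space gauss) * G.prob ((\<lambda>z. restrict z K2) -` Xb \<inter> space gauss)"
    using G.indep_varD[OF iv Xa Xb] by simp
  also have "(\<lambda>z. restrict z K1) -` Xa \<inter> space gauss = {z \<in> space gauss. \<forall>k\<in>J1. lev m k z \<in> A (True, k)}"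
    by (auto simp: r1)
  also have "G.prob \<dots> = (\<Prod>k\<in>J1. measure sn (A (True, k)))"
    by (rule G.std_iid_prob[OF assms fin(1)]) (use A in auto)
  also have "(\<lambda>z. restrict z K2) -` Xb \<inter> space gauss = {z \<in> space gauss. \<forall>i\<in>Pair (Suc m) ` J2. z i \<in> A (False, snd i)}"
    by (auto simp: r2)
  also have "G.prob \<dots> = (\<Prod>i\<in>Pair (Suc m) ` J2. measure sn (A (False, snd i)))"
    by (rule G.std_iid_prob[OF gauss_iid]) (use A fin in auto)
  also have "\<dots> = (\<Prod>k\<in>J2. measure sn (A (False, k)))"
    by (subst prod.reindex) (auto simp: inj_on_def)
  also have "(\<Prod>k\<in>J1. measure sn (A (True, k))) * (\<Prod>k\<in>J2. measure sn (A (False, k))) = (\<Prod>i\<in>J. measure sn (A i))"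
    unfolding JJ using fin by (subst prod.union_disjoint) (auto simp: prod.reindex inj_on_def)
  finally show "G.prob {z \<in> space gauss. \<forall>i\<in>J. (case i of (b, k) \<Rightarrow> \<lambda>z. if b then lev m k z else z (Suc m, k)) z \<in> A i} =
    (\<Prod>i\<in>J. measure sn (A i))" .
qed

lemma lev_Suc_iid:
  assumes "G.std_iid (lev m)" shows "G.std_iid (lev (Suc m))"
proof (rule G.std_iidI)
  interpret S: prob_space sn by (rule prob_space_sn)
  define Y where "Y = (\<lambda>(b, k) z. if b then lev m k z else z (Suc m, k))"
  have Y: "G.std_iid Y" unfolding Y_def by (rule lev_coord_iid[OF assms])
  note Ym [measurable] = G.std_iid_measurable[OF Y]
  define V where "V = (\<lambda>k z. (Y (True, k) z, Y (False, k) z))"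
  have Vm [measurable]: "V k \<in> measurable gauss (borel \<Otimes>\<^sub>M borel)" for k unfolding V_def by measurable
  have VD: "distr gauss (borel \<Otimes>\<^sub>M borel) (V k) = sn \<Otimes>\<^sub>M sn" for k
  proof (rule pair_measure_eqI[symmetric])
    fix A B assume AB: "A \<in> sets sn" "B \<in> sets sn"
    have "emeasure (distr gauss (borel \<Otimes>\<^sub>M borel) (V k)) (A \<times> B) =
      emeasure gauss {z \<in> space gauss. \<forall>i\<in>{(True, k), (False, k)}. Y i z \<in> (if fst i then A else B)}"
      using AB by (subst emeasure_distr) (auto simp: V_def intro!: arg_cong2[where f=emeasure])
    also have "\<dots> = ennreal (\<Prod>i\<in>{(True, k), (False, k)}. measure sn (if fst i then A else B))"
      unfolding G.emeasure_eq_measure using AB by (subst G.std_iid_prob[OF Y]) auto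
    also have "\<dots> = emeasure sn A * emeasure sn B"
      by (simp add: emeasure_sn ennreal_mult')
    finally show "emeasure sn A * emeasure sn B = emeasure (distr gauss (borel \<Otimes>\<^sub>M borel) (V k)) (A \<times> B)" by simp
  qed (auto intro: prob_space_imp_sigma_finite prob_space_sn)
  define K :: "nat \<Rightarrow> (bool \<times> nat) set" where "K = (\<lambda>k. {(True, k), (False, k)})"
  have iv: "G.indep_vars (\<lambda>k. PiM (K k) (\<lambda>_. borel)) (\<lambda>k z. restrict (\<lambda>i. Y i z) (K k)) UNIV"
    by (rule G.indep_vars_restrict[OF G.std_iid_indep_vars[OF Y]]) (auto simp: K_def disjoint_family_on_def)
  have prodV: "G.prob {z. \<forall>k<n. V k z \<in> E k} = (\<Prod>k<n. measure (sn \<Otimes>\<^sub>M sn) (E k))"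
    if E: "\<And>k. E k \<in> sets (borel \<Otimes>\<^sub>M borel)" for n and E :: "nat \<Rightarrow> (real \<times> real) set"
  proof (cases "n = 0")
    case True then show ?thesis using G.prob_space by simp
  next
    case False
    define D where "D = (\<lambda>k. {x \<in> space (PiM (K k) (\<lambda>_. borel :: real measure)). (x (True, k), x (False, k)) \<in> E k})"
    have D: "D k \<in> sets (PiM (K k) (\<lambda>_. borel))" for k
    proof -
      have "(\<lambda>x. (x (True, k), x (False, k))) \<in> measurable (PiM (K k) (\<lambda>_. borel)) (borel \<Otimes>\<^sub>M borel)"
        by (intro measurable_Pair measurable_component_singleton) (auto simp: K_def)
      from measurable_sets[OF this E[of k]] show ?thesis
        by (simp add: D_def vimage_def Int_def conj_commute)
    qed
    have DV: "(\<lambda>z. restrict (\<lambda>i. Y i z) (K k)) -` D k \<inter> space gauss = {z. V k z \<in> E k}" for k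
      by (auto simp: D_def V_def K_def space_PiM PiE_def)
    have "{z. \<forall>k<n. V k z \<in> E k} = (\<Inter>k\<in>{..<n}. {z. V k z \<in> E k})" by auto
    then have "G.prob {z. \<forall>k<n. V k z \<in> E k} = (\<Prod>k<n. G.prob {z. V k z \<in> E k})"
      using G.indep_varsD[OF iv, of "{..<n}" D] False D unfolding DV by (simp add: lessThan_empty_iff)
    also have "\<dots> = (\<Prod>k<n. measure (sn \<Otimes>\<^sub>M sn) (E k))"
    proof (rule prod.cong[OF refl])
      fix k
      have "measure (sn \<Otimes>\<^sub>M sn) (E k) = measure (distr gauss (borel \<Otimes>\<^sub>M borel) (V k)) (E k)" by (simp only: VD)
      also have "\<dots> = G.prob {z. V k z \<in> E k}" using E by (subst measure_distr) (auto simp: vimage_def)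
      finally show "G.prob {z. V k z \<in> E k} = measure (sn \<Otimes>\<^sub>M sn) (E k)" by simp
    qed
    finally show ?thesis .
  qed
  fix J :: "nat set" assume "finite J"
  then obtain n where n: "J \<subseteq> {..<n}" by (metis finite_nat_iff_bounded)
  have "G.prob {\<omega> \<in> space gauss. \<forall>i\<in>{..<2 * n}. lev (Suc m) i \<omega> \<in> A i} = (\<Prod>i\<in>{..<2 * n}. measure sn (A i))"
    if A: "\<forall>i. A i \<in> sets borel" for A
  proof -
    have lv: "(lev (Suc m) (2 * k) z, lev (Suc m) (2 * k + 1) z) = rot (V k z)" for k z
      by (simp add: V_def Y_def rot_def)
    have "{\<omega> \<in> space gauss. \<forall>i\<in>{..<2 * n}. lev (Suc m) i \<omega> \<in> A i} =
      {z. \<forall>k<n. V k z \<in> rot -` (A (2 * k) \<times> A (2 * k + 1))}"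
    proof (intro set_eqI iffI)
      fix z assume z: "z \<in> {\<omega> \<in> space gauss. \<forall>i\<in>{..<2 * n}. lev (Suc m) i \<omega> \<in> A i}"
      show "z \<in> {z. \<forall>k<n. V k z \<in> rot -` (A (2 * k) \<times> A (2 * k + 1))}"
      proof (rule CollectI, intro allI impI)
        fix k assume "k < n"
        then have "2 * k \<in> {..<2 * n}" "2 * k + 1 \<in> {..<2 * n}" by auto
        then have "lev (Suc m) (2 * k) z \<in> A (2 * k) \<and> lev (Suc m) (2 * k + 1) z \<in> A (2 * k + 1)" using z by blast
        then show "V k z \<in> rot -` (A (2 * k) \<times> A (2 * k + 1))"
          unfolding vimage_eq lv[symmetric] by (simp only: mem_Times_iff fst_conv snd_conv)
      qed
    next
      fix z assume z: "z \<in> {z. \<forall>k<n. V k z \<in> rot -` (A (2 * k) \<times> A (2 * k + 1))}"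
      have "lev (Suc m) i z \<in> A i" if "i < 2 * n" for i
      proof -
        have "i div 2 < n" using that by auto
        then have "rot (V (i div 2) z) \<in> A (2 * (i div 2)) \<times> A (2 * (i div 2) + 1)" using z by auto
        then have "lev (Suc m) (2 * (i div 2)) z \<in> A (2 * (i div 2)) \<and> lev (Suc m) (2 * (i div 2) + 1) z \<in> A (2 * (i div 2) + 1)"
          unfolding lv[symmetric] by (simp only: mem_Times_iff fst_conv snd_conv)
        moreover have "i = 2 * (i div 2) \<or> i = 2 * (i div 2) + 1" by presburger
        ultimately show ?thesis by metis
      qed
      then show "z \<in> {\<omega> \<in> space gauss. \<forall>i\<in>{..<2 * n}. lev (Suc m) i \<omega> \<in> A i}" by (simp del: lev.simps)
    qed
    then have "G.prob {\<omega> \<in> space gauss. \<forall>i\<in>{..<2 * n}. lev (Suc m) i \<omega> \<in> A i} =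
      (\<Prod>k<n. measure (sn \<Otimes>\<^sub>M sn) (rot -` (A (2 * k) \<times> A (2 * k + 1))))"
    proof -
      have "rot -` (A (2 * k) \<times> A (2 * k + 1)) \<in> sets (borel \<Otimes>\<^sub>M borel)" for k
        using measurable_sets[OF measurable_rot, of "A (2 * k) \<times> A (2 * k + 1)"] A by (simp add: space_pair_measure)
      from prodV[OF this] \<open>{\<omega> \<in> space gauss. _ \<omega>} = _\<close> show ?thesis by simp
    qed
    also have "\<dots> = (\<Prod>k<n. measure sn (A (2 * k)) * measure sn (A (2 * k + 1)))"
      using A by (intro prod.cong refl measure_rot_rect) auto
    also have "\<dots> = (\<Prod>i\<in>{..<2 * n}. measure sn (A i))" by (rule prod_even_odd[symmetric])
    finally show ?thesis .
  qed
  then show "\<exists>J'. finite J' \<and> J \<subseteq> J' \<and> (\<forall>A. (\<forall>i. A i \<in> sets borel) \<longrightarrow>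
      G.prob {\<omega> \<in> space gauss. \<forall>i\<in>J'. lev (Suc m) i \<omega> \<in> A i} = (\<Prod>i\<in>J'. measure sn (A i)))"
    using n by (intro exI[of _ "{..<2 * n}"]) auto
qed (rule lev_gauss)

lemma lev_iid: "G.std_iid (lev m)"
proof (induction m)
  case 0
  show ?case
  proof (rule G.std_iidI)
    fix J :: "nat set" assume J: "finite J"
    have "G.prob {\<omega> \<in> space gauss. \<forall>i\<in>J. lev 0 i \<omega> \<in> A i} = (\<Prod>i\<in>J. measure sn (A i))"
      if A: "\<forall>i. A i \<in> sets borel" for A
    proof -
      have "{\<omega> \<in> space gauss. \<forall>i\<in>J. lev 0 i \<omega> \<in> A i} = {\<omega> \<in> space gauss. \<forall>i\<in>Pair 0 ` J. \<omega> i \<in> A (snd i)}"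
        by auto
      then have "G.prob {\<omega> \<in> space gauss. \<forall>i\<in>J. lev 0 i \<omega> \<in> A i} = (\<Prod>i\<in>Pair (0::nat) ` J. measure sn (A (snd i)))"
        using G.std_iid_prob[OF gauss_iid, of "Pair 0 ` J" "\<lambda>i. A (snd i)"] J A by simp
      also have "\<dots> = (\<Prod>i\<in>J. measure sn (A i))" by (subst prod.reindex) (auto simp: inj_on_def)
      finally show ?thesis .
    qed
    then show "\<exists>J'. finite J' \<and> J \<subseteq> J' \<and> (\<forall>A. (\<forall>i. A i \<in> sets borel) \<longrightarrow>
      G.prob {\<omega> \<in> space gauss. \<forall>i\<in>J'. lev 0 i \<omega> \<in> A i} = (\<Prod>i\<in>J'. measure sn (A i)))"
      using J by blast
  qed (rule lev_gauss)
qed (rule lev_Suc_iid)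

subsection \<open>Construction of the paths\<close>

definition sd :: "nat \<Rightarrow> real" where "sd m = 1 / sqrt (2 ^ m)"

definition wsum :: "nat \<Rightarrow> nat \<Rightarrow> (nat \<times> nat \<Rightarrow> real) \<Rightarrow> real" where
  "wsum m j z = (\<Sum>k<j. lev m k z * sd m)"

lemma sd_Suc: "sd (Suc m) = sd m / sqrt 2"
  by (simp add: sd_def real_sqrt_mult)

lemma wsum_measurable [measurable]: "wsum m j \<in> borel_measurable gauss"
  unfolding wsum_def by measurable

lemma wsum_refine: "wsum (Suc m) (2 * j) z = wsum m j z"
proof (induction j)
  case (Suc j)
  have "wsum (Suc m) (2 * Suc j) z = wsum (Suc m) (2 * j) z + lev (Suc m) (2 * j) z * sd (Suc m) + lev (Suc m) (2 * j + 1) z * sd (Suc m)"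
    by (simp add: wsum_def)
  also have "lev (Suc m) (2 * j) z * sd (Suc m) + lev (Suc m) (2 * j + 1) z * sd (Suc m) = lev m j z * sd m"
    by (simp add: sd_Suc field_simps)
  then have "wsum (Suc m) (2 * j) z + lev (Suc m) (2 * j) z * sd (Suc m) + lev (Suc m) (2 * j + 1) z * sd (Suc m) = wsum m (Suc j) z"
    using Suc by (simp add: wsum_def)
  finally show ?case .
qed (simp add: wsum_def)

lemma wsum_refine_power: "wsum (m + d) (2 ^ d * j) z = wsum m j z"
proof (induction d arbitrary: j)
  case (Suc d)
  have "wsum (m + Suc d) (2 ^ Suc d * j) z = wsum (Suc (m + d)) (2 * (2 ^ d * j)) z" by (simp add: mult.assoc)
  then show ?case using Suc wsum_refine by simp
qed simp

definition rr :: real where "rr = 2 powr (- 1 / 8)"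

lemma rr: "0 < rr" "rr < 1" "rr ^ 4 = 1 / sqrt 2"
proof -
  show "0 < rr" "rr < 1" by (auto simp: rr_def powr_minus_divide powr_less_one)
  have "rr ^ 4 = 2 powr (- 1 / 2)" unfolding rr_def by (simp add: powr_realpow[symmetric] powr_powr)
  also have "\<dots> = 1 / sqrt 2" by (simp add: powr_minus_divide powr_half_sqrt)
  finally show "rr ^ 4 = 1 / sqrt 2" .
qed

definition good :: "(nat \<times> nat \<Rightarrow> real) \<Rightarrow> bool" where
  "good z \<longleftrightarrow> (\<forall>T. \<exists>C::nat. \<forall>m k. k < T * 2 ^ m \<longrightarrow> \<bar>lev m k z\<bar> * sd m \<le> real C * rr ^ m)"

lemma good_measurable [measurable]: "Measurable.pred gauss good"
  unfolding good_def by measurable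

text \<open>The fourth moments of the increments at level \<open>m\<close>, weighted by \<open>2\<^bsup>m/2\<^esup>\<close>, are summable over
  all dyadic intervals of a bounded time interval, so these weighted powers are almost surely bounded.\<close>

lemma AE_good: "AE z in gauss. good z"
proof -
  have "AE z in gauss. \<exists>C::nat. \<forall>m k. k < T * 2 ^ m \<longrightarrow> \<bar>lev m k z\<bar> * sd m \<le> real C * rr ^ m" for T :: nat
  proof -
    define h where "h = (\<lambda>m (x::real). (x * sd m) ^ 4 * sqrt 2 ^ m)"
    have h0: "0 \<le> h m x" for m x by (simp add: h_def)
    have hm [measurable]: "h m \<in> borel_measurable borel" for m unfolding h_def by measurable
    have mom: "(\<integral>\<^sup>+z. ennreal (h m (lev m k z)) \<partial>gauss) = ennreal (3 * (sd m ^ 4 * sqrt 2 ^ m))" for m k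
    proof -
      have "(\<integral>\<^sup>+z. ennreal (h m (lev m k z)) \<partial>gauss) = (\<integral>\<^sup>+x. ennreal (h m x) \<partial>distr gauss borel (lev m k))"
        by (subst nn_integral_distr) auto
      also have "\<dots> = (\<integral>\<^sup>+x. ennreal (h m x) \<partial>sn)" by (simp only: G.std_iid_distr[OF lev_iid])
      also have "\<dots> = (\<integral>\<^sup>+x. ennreal (x ^ 4 * (sd m ^ 4 * sqrt 2 ^ m)) \<partial>sn)"
        by (simp add: h_def power_mult_distrib mult_ac)
      also have "\<dots> = ennreal (LINT x|sn. x ^ 4 * (sd m ^ 4 * sqrt 2 ^ m))"
        using integrable_std_normal_distribution_moment[of 4]
        by (intro nn_integral_eq_integral) (auto simp: sd_def)
      also have "(LINT x|sn. x ^ 4 * (sd m ^ 4 * sqrt 2 ^ m)) = (LINT x|sn. x ^ 4) * (sd m ^ 4 * sqrt 2 ^ m)"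
        by (rule integral_mult_left_zero)
      also have "(LINT x|sn. x ^ 4) = 3"
        using std_normal_distribution_even_moments(1)[of 2] by (simp add: fact_numeral)
      finally show ?thesis .
    qed
    define S where "S = (\<lambda>z. \<Sum>m. \<Sum>k<T * 2 ^ m. ennreal (h m (lev m k z)))"
    have [measurable]: "S \<in> borel_measurable gauss" unfolding S_def by measurable
    have "(\<integral>\<^sup>+z. S z \<partial>gauss) = (\<Sum>m. \<integral>\<^sup>+z. (\<Sum>k<T * 2 ^ m. ennreal (h m (lev m k z))) \<partial>gauss)"
      unfolding S_def by (rule nn_integral_suminf) measurable
    also have "\<dots> = (\<Sum>m. \<Sum>k<T * 2 ^ m. ennreal (3 * (sd m ^ 4 * sqrt 2 ^ m)))"
      by (subst nn_integral_sum) (measurable, simp only: mom)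
    also have "\<dots> = (\<Sum>m. ennreal (3 * real T * (1 / sqrt 2) ^ m))"
    proof (rule suminf_cong)
      fix m
      have "sd m ^ 4 = 1 / (2 ^ m * 2 ^ m)"
      proof -
        have "sqrt (2 ^ m) ^ 4 = ((sqrt (2 ^ m))\<^sup>2)\<^sup>2" by (simp only: power_mult[symmetric]) simp
        also have "\<dots> = 2 ^ m * 2 ^ m" by (simp add: power2_eq_square)
        finally show ?thesis by (simp add: sd_def power_divide)
      qed
      moreover have "sqrt 2 ^ m / 2 ^ m = (1 / sqrt 2) ^ m"
      proof -
        have "sqrt 2 / 2 = 1 / sqrt (2::real)" by (simp add: real_div_sqrt field_simps)
        then show ?thesis by (simp only: power_divide[symmetric])
      qed
      ultimately have "real (T * 2 ^ m) * (3 * (sd m ^ 4 * sqrt 2 ^ m)) = 3 * real T * (1 / sqrt 2) ^ m"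
        by (simp add: field_simps)
      then show "(\<Sum>k<T * 2 ^ m. ennreal (3 * (sd m ^ 4 * sqrt 2 ^ m))) = ennreal (3 * real T * (1 / sqrt 2) ^ m)"
        by (subst sum_ennreal) (auto simp: sd_def)
    qed
    also have "\<dots> = ennreal (\<Sum>m. 3 * real T * (1 / sqrt 2) ^ m)"
      by (rule suminf_ennreal2) (auto intro!: summable_mult summable_geometric)
    finally have "(\<integral>\<^sup>+z. S z \<partial>gauss) \<noteq> \<infinity>" by simp
    then have "AE z in gauss. S z \<noteq> \<infinity>" by (intro nn_integral_PInf_AE) auto
    then show ?thesis
    proof eventually_elim
      case (elim z)
      then obtain c where c: "0 \<le> c" "S z = ennreal c" by (cases "S z") auto
      obtain C :: nat where C: "c \<le> real C" using real_arch_simple by blast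
      have "\<bar>lev m k z\<bar> * sd m \<le> real (Suc C) * rr ^ m" if k: "k < T * 2 ^ m" for m k
      proof -
        have "ennreal (h m (lev m k z)) \<le> (\<Sum>k<T * 2 ^ m. ennreal (h m (lev m k z)))"
          using k by (intro member_le_sum) auto
        also have "\<dots> \<le> S z"
          unfolding S_def using sum_le_suminf[of "\<lambda>m. \<Sum>k<T * 2 ^ m. ennreal (h m (lev m k z))" "{m}"] by simp
        finally have "h m (lev m k z) \<le> c" using c by (simp add: h0)
        then have "(\<bar>lev m k z\<bar> * sd m) ^ 4 * sqrt 2 ^ m \<le> real C"
          using C by (simp add: h_def power_mult_distrib)
        then have "(\<bar>lev m k z\<bar> * sd m) ^ 4 \<le> real C * (1 / sqrt 2) ^ m"
          by (simp add: power_divide field_simps)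
        also have "\<dots> \<le> real (Suc C) ^ 4 * (1 / sqrt 2) ^ m"
        proof (rule mult_right_mono)
          have "real C \<le> real (Suc C) ^ 1" by simp
          also have "\<dots> \<le> real (Suc C) ^ 4" by (rule power_increasing) auto
          finally show "real C \<le> real (Suc C) ^ 4" .
        qed simp
        also have "\<dots> = (real (Suc C) * rr ^ m) ^ 4"
          unfolding power_mult_distrib rr(3)[symmetric] by (simp only: power_mult[symmetric] mult.commute)
        finally show ?thesis using rr(1) by (subst (asm) power_mono_iff) (auto simp: sd_def)
      qed
      then show ?case by blast
    qed
  qed
  then have "AE z in gauss. \<forall>T. \<exists>C::nat. \<forall>m k. k < T * 2 ^ m \<longrightarrow> \<bar>lev m k z\<bar> * sd m \<le> real C * rr ^ m"
    by (simp add: AE_all_countable)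
  then show ?thesis by (simp add: good_def)
qed

lemma geometric_steps_limit:
  fixes x :: "nat \<Rightarrow> real"
  assumes r: "0 \<le> r" "r < 1" and C: "0 \<le> C" and step: "\<And>m. \<bar>x (Suc m) - x m\<bar> \<le> C * r ^ Suc m"
  shows "x \<longlonglongrightarrow> lim x" "\<bar>lim x - x m\<bar> \<le> C * r ^ Suc m / (1 - r)"
proof -
  have sum: "(\<Sum>i<d. r ^ i) \<le> 1 / (1 - r)" for d
    using r sum_le_suminf[of "\<lambda>i. r ^ i" "{..<d}"] by (simp add: suminf_geometric summable_geometric)
  have b: "\<bar>x (m + d) - x m\<bar> \<le> C * r ^ Suc m * (\<Sum>i<d. r ^ i)" for m d
  proof (induction d)
    case (Suc d)
    have "\<bar>x (m + Suc d) - x m\<bar> \<le> \<bar>x (Suc (m + d)) - x (m + d)\<bar> + \<bar>x (m + d) - x m\<bar>" by simp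
    also have "\<dots> \<le> C * r ^ Suc (m + d) + C * r ^ Suc m * (\<Sum>i<d. r ^ i)" using step Suc by (intro add_mono) auto
    also have "\<dots> = C * r ^ Suc m * (\<Sum>i<Suc d. r ^ i)" by (simp add: algebra_simps power_add)
    finally show ?case .
  qed simp
  have b': "\<bar>x (m + d) - x m\<bar> \<le> C * r ^ Suc m / (1 - r)" for m d
  proof -
    have "C * r ^ Suc m * (\<Sum>i<d. r ^ i) \<le> C * r ^ Suc m * (1 / (1 - r))"
      using C r by (intro mult_left_mono sum) auto
    then show ?thesis using b[of m d] by simp
  qed
  have "Cauchy x"
  proof (rule metric_CauchyI)
    fix e :: real assume e: "0 < e"
    have "(\<lambda>m. C * r ^ Suc m / (1 - r)) \<longlonglongrightarrow> C * 0 / (1 - r)"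
      using r LIMSEQ_Suc[OF LIMSEQ_power_zero[of r]] by (intro tendsto_intros) auto
    then have "\<forall>\<^sub>F m in sequentially. C * r ^ Suc m / (1 - r) < e / 2"
      using e by (intro order_tendstoD) auto
    then obtain M where M: "C * r ^ Suc M / (1 - r) < e / 2" by (auto simp: eventually_sequentially)
    have "dist (x m) (x n) < e" if "M \<le> m" "M \<le> n" for m n
    proof -
      have "\<bar>x m - x M\<bar> < e / 2" "\<bar>x n - x M\<bar> < e / 2"
        using le_less_trans[OF b'[of M "m - M"] M] le_less_trans[OF b'[of M "n - M"] M] that by auto
      then show ?thesis unfolding dist_real_def by linarith
    qed
    then show "\<exists>M. \<forall>m\<ge>M. \<forall>n\<ge>M. dist (x m) (x n) < e" by blast
  qed
  then show L: "x \<longlonglongrightarrow> lim x" by (simp add: Cauchy_convergent_iff convergent_LIMSEQ_iff)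
  have "(\<lambda>d. \<bar>x (m + d) - x m\<bar>) \<longlonglongrightarrow> \<bar>lim x - x m\<bar>"
    using LIMSEQ_ignore_initial_segment[OF L, of m] by (intro tendsto_intros) (simp add: add.commute)
  then show "\<bar>lim x - x m\<bar> \<le> C * r ^ Suc m / (1 - r)"
    by (rule tendsto_upperbound) (use b' in auto)
qed

definition W :: "real \<Rightarrow> (nat \<times> nat \<Rightarrow> real) \<Rightarrow> real" where
  "W t z = (if good z then lim (\<lambda>m. wsum m (nat \<lfloor>2 ^ m * t\<rfloor>) z) else 0)"

lemma W_measurable [measurable]: "W t \<in> borel_measurable gauss"
proof -
  have "(\<lambda>z. lim (\<lambda>m. wsum m (nat \<lfloor>2 ^ m * t\<rfloor>) z)) \<in> borel_measurable gauss"
    by (rule borel_measurable_lim_metric) measurable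
  then show ?thesis unfolding W_def by measurable
qed

lemma floor_double:
  fixes t :: real assumes "0 \<le> t"
  shows "nat \<lfloor>2 ^ Suc m * t\<rfloor> = 2 * nat \<lfloor>2 ^ m * t\<rfloor> \<or> nat \<lfloor>2 ^ Suc m * t\<rfloor> = 2 * nat \<lfloor>2 ^ m * t\<rfloor> + 1"
proof -
  have e: "2 ^ Suc m * t = 2 * (2 ^ m * t)" by simp
  have "0 \<le> 2 ^ m * t" using assms by simp
  then show ?thesis unfolding e by linarith
qed

lemma wsum_step:
  assumes C: "\<And>m k. k < T * 2 ^ m \<Longrightarrow> \<bar>lev m k z\<bar> * sd m \<le> C * rr ^ m" "0 \<le> C"
    and t: "0 \<le> t" "t < real T"
  shows "\<bar>wsum (Suc m) (nat \<lfloor>2 ^ Suc m * t\<rfloor>) z - wsum m (nat \<lfloor>2 ^ m * t\<rfloor>) z\<bar> \<le> C * rr ^ Suc m"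
proof -
  define j where "j = nat \<lfloor>2 ^ m * t\<rfloor>"
  have "real j \<le> 2 ^ m * t" using t unfolding j_def by (simp add: of_nat_nat)
  also have "\<dots> < 2 ^ m * real T" using t by simp
  finally have "real j < real (2 ^ m * T)" by simp
  then have j: "2 * j < T * 2 ^ Suc m" by (simp only: of_nat_less_iff) (simp add: mult.commute)
  have "\<bar>wsum (Suc m) (2 * j + 1) z - wsum m j z\<bar> = \<bar>lev (Suc m) (2 * j) z\<bar> * sd (Suc m)"
    using wsum_refine[of m j z] by (simp add: wsum_def abs_mult sd_def del: lev.simps)
  also have "\<dots> \<le> C * rr ^ Suc m" by (rule C(1)[OF j])
  finally show ?thesis
    using floor_double[OF t(1), of m] wsum_refine[of m j z] C(2) rr unfolding j_def[symmetric] by auto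
qed

lemma good_bound:
  assumes "good z"
  obtains C where "0 \<le> C" "\<And>m k. k < T * 2 ^ m \<Longrightarrow> \<bar>lev m k z\<bar> * sd m \<le> C * rr ^ m"
  using assms unfolding good_def by (metis of_nat_0_le_iff)

lemma W_dyadic:
  assumes z: "good z"
  shows "W (real j / 2 ^ m) z = wsum m j z"
proof -
  have "wsum n (nat \<lfloor>2 ^ n * (real j / 2 ^ m)\<rfloor>) z = wsum m j z" if n: "m \<le> n" for n
  proof -
    obtain d where d: "n = m + d" using n le_Suc_ex by blast
    have "2 ^ n * (real j / 2 ^ m) = real (2 ^ d * j)" by (simp add: d power_add)
    then have "nat \<lfloor>2 ^ n * (real j / 2 ^ m)\<rfloor> = 2 ^ d * j" by (simp only: floor_of_nat nat_int)
    then show ?thesis using wsum_refine_power[of m d j z] by (simp add: d)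
  qed
  then have "(\<lambda>n. wsum n (nat \<lfloor>2 ^ n * (real j / 2 ^ m)\<rfloor>) z) \<longlonglongrightarrow> wsum m j z"
    by (intro tendsto_eventually) (auto simp: eventually_sequentially)
  then show ?thesis using z by (simp add: W_def limI)
qed

lemma W_0: "W 0 z = 0"
  using W_dyadic[of z 0 0] by (cases "good z") (auto simp: W_def wsum_def)

lemma W_continuous: "continuous_on {0..} (\<lambda>t. W t z)"
proof (cases "good z")
  case False then show ?thesis by (simp add: W_def)
next
  case z: True
  have "continuous (at t within {0..}) (\<lambda>t. W t z)" if t: "t \<in> {0..}" for t
  proof -
    obtain T :: nat where T: "t + 1 < real T" using reals_Archimedean2 by blast
    obtain C where C: "0 \<le> C" "\<And>m k. k < T * 2 ^ m \<Longrightarrow> \<bar>lev m k z\<bar> * sd m \<le> C * rr ^ m"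
      using good_bound[OF z] by blast
    have near: "\<bar>W s z - wsum m (nat \<lfloor>2 ^ m * s\<rfloor>) z\<bar> \<le> C * rr ^ Suc m / (1 - rr)" if "0 \<le> s" "s < real T" for s m
      unfolding W_def using z
      by (simp del: power_Suc, intro geometric_steps_limit(2)[where x="\<lambda>m. wsum m (nat \<lfloor>2 ^ m * s\<rfloor>) z"] wsum_step[OF C(2) C(1) that])
        (use rr C(1) in auto)
    define B where "B = (\<lambda>m. 2 * (C * rr ^ Suc m / (1 - rr)) + C * rr ^ m)"
    have close: "\<bar>W s z - W t z\<bar> \<le> B m" if s: "0 \<le> s" "\<bar>s - t\<bar> < 1 / 2 ^ m" for s m
    proof -
      have "(1::real) / 2 ^ m \<le> 1" by simp
      then have "s < real T" using s T by linarith
      then have sT: "s < real T" "t < real T" "0 \<le> t" using T t by auto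
      have floor1: "\<bar>wsum m (nat \<lfloor>2 ^ m * a\<rfloor>) z - wsum m (nat \<lfloor>2 ^ m * b\<rfloor>) z\<bar> \<le> C * rr ^ m"
        if ab: "0 \<le> b" "b \<le> a" "a - b < 1 / 2 ^ m" "a < real T" for a b
      proof -
        have "2 ^ m * a < 2 ^ m * b + 1" using ab(3) by (simp add: field_simps)
        moreover have "2 ^ m * b \<le> 2 ^ m * a" using ab by simp
        moreover have "0 \<le> 2 ^ m * b" using ab by simp
        ultimately have "nat \<lfloor>2 ^ m * a\<rfloor> = nat \<lfloor>2 ^ m * b\<rfloor> \<or> nat \<lfloor>2 ^ m * a\<rfloor> = nat \<lfloor>2 ^ m * b\<rfloor> + 1"
          by linarith
        then show ?thesis
        proof
          assume "nat \<lfloor>2 ^ m * a\<rfloor> = nat \<lfloor>2 ^ m * b\<rfloor>"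
          then show ?thesis using C(1) rr by simp
        next
          assume e: "nat \<lfloor>2 ^ m * a\<rfloor> = nat \<lfloor>2 ^ m * b\<rfloor> + 1"
          have "real (nat \<lfloor>2 ^ m * b\<rfloor>) < 2 ^ m * real T"
          proof -
            have "real (nat \<lfloor>2 ^ m * b\<rfloor>) \<le> 2 ^ m * b" using \<open>0 \<le> 2 ^ m * b\<close> by (simp add: of_nat_nat)
            also have "\<dots> < 2 ^ m * real T" using ab by simp
            finally show ?thesis .
          qed
          then have "real (nat \<lfloor>2 ^ m * b\<rfloor>) < real (T * 2 ^ m)" by (simp add: mult.commute)
          then have "nat \<lfloor>2 ^ m * b\<rfloor> < T * 2 ^ m" by (simp only: of_nat_less_iff)
          from C(2)[OF this] show ?thesis unfolding e by (simp add: wsum_def abs_mult sd_def)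
        qed
      qed
      have "\<bar>wsum m (nat \<lfloor>2 ^ m * s\<rfloor>) z - wsum m (nat \<lfloor>2 ^ m * t\<rfloor>) z\<bar> \<le> C * rr ^ m"
        using floor1[of t s] floor1[of s t] s sT by (cases "t \<le> s") (auto simp: abs_minus_commute)
      then show ?thesis using near[OF s(1) sT(1), of m] near[OF sT(3,2), of m] unfolding B_def by linarith
    qed
    have "B \<longlonglongrightarrow> 2 * (C * 0 / (1 - rr)) + C * 0"
      unfolding B_def using rr LIMSEQ_Suc[OF LIMSEQ_power_zero[of rr]] LIMSEQ_power_zero[of rr]
      by (intro tendsto_intros) auto
    then have B0: "B \<longlonglongrightarrow> 0" by simp
    show ?thesis
      unfolding continuous_within_eps_delta
    proof (intro allI impI)
      fix e :: real assume "0 < e"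
      then have "\<forall>\<^sub>F m in sequentially. B m < e" using B0 by (intro order_tendstoD) auto
      then obtain m where m: "B m < e" by (auto simp: eventually_sequentially)
      show "\<exists>d>0. \<forall>x'\<in>{0..}. dist x' t < d \<longrightarrow> dist (W x' z) (W t z) < e"
        using close[of _ m] m by (intro exI[of _ "1 / 2 ^ m"]) (auto simp: dist_real_def intro: le_less_trans)
    qed
  qed
  then show ?thesis by (simp add: continuous_on_eq_continuous_within)
qed

subsection \<open>Independence of the increments\<close>

lemma Int_stable_vimage: "Int_stable {f -` A \<inter> S |A. A \<in> sets N}"
proof (rule Int_stableI)
  fix a b assume "a \<in> {f -` A \<inter> S |A. A \<in> sets N}" "b \<in> {f -` A \<inter> S |A. A \<in> sets N}"
  then obtain A B where "a = f -` A \<inter> S" "A \<in> sets N" "b = f -` B \<inter> S" "B \<in> sets N" by auto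
  then have "a \<inter> b = f -` (A \<inter> B) \<inter> S" "A \<inter> B \<in> sets N" by auto
  then show "a \<inter> b \<in> {f -` A \<inter> S |A. A \<in> sets N}" by blast
qed

definition hist_gen :: "real \<Rightarrow> (nat \<times> nat \<Rightarrow> real) set set" where
  "hist_gen s = {W r -` A |r A. 0 \<le> r \<and> r \<le> s \<and> A \<in> sets borel}"

definition hist :: "real \<Rightarrow> (nat \<times> nat \<Rightarrow> real) measure" where
  "hist s = sigma UNIV (hist_gen s)"

lemma space_hist [simp]: "space (hist s) = UNIV"
  by (simp add: hist_def space_measure_of)

lemma sets_hist: "sets (hist s) = sigma_sets UNIV (hist_gen s)"
  by (simp add: hist_def sets_measure_of)

lemma hist_mono: "s \<le> t \<Longrightarrow> sets (hist s) \<subseteq> sets (hist t)"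
  unfolding sets_hist hist_gen_def by (intro sigma_sets_mono') fastforce

lemma W_hist: "0 \<le> r \<Longrightarrow> r \<le> s \<Longrightarrow> W r \<in> borel_measurable (hist s)"
  by (rule measurableI) (auto simp: sets_hist hist_gen_def intro!: sigma_sets.Basic)

lemma hist_gauss: "sets (hist s) \<subseteq> sets gauss"
proof -
  have "hist_gen s \<subseteq> sets gauss"
    unfolding hist_gen_def using measurable_sets[OF W_measurable] by fastforce
  from sets.sigma_sets_subset[OF this] show ?thesis by (simp add: sets_hist)
qed

definition dyadic_events :: "real \<Rightarrow> (nat \<times> nat \<Rightarrow> real) set set" where
  "dyadic_events s = {{z. \<forall>r\<in>R. W r z \<in> A r} |R A. finite R \<and>
     (\<forall>r\<in>R. r \<le> s \<and> (\<exists>n j. r = real j / 2 ^ n)) \<and> (\<forall>r. A r \<in> sets borel)}"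

lemma dyadic_eventsI:
  assumes "finite R" "\<And>r. r \<in> R \<Longrightarrow> r \<le> s" "\<And>r. r \<in> R \<Longrightarrow> \<exists>n j. r = real j / 2 ^ n" "\<And>r. A r \<in> sets borel"
  shows "{z. \<forall>r\<in>R. W r z \<in> A r} \<in> dyadic_events s"
  unfolding dyadic_events_def
  by (rule CollectI, rule exI[of _ R], rule exI[of _ A]) (simp add: assms)

lemma dyadic_eventsE:
  assumes "a \<in> dyadic_events s"
  obtains R A where "a = {z. \<forall>r\<in>R. W r z \<in> A r}" "finite R" "\<forall>r\<in>R. r \<le> s"
    "\<forall>r\<in>R. \<exists>n j. r = real j / 2 ^ n" "\<forall>r. A r \<in> sets borel"
proof -
  from assms obtain R A where *: "a = {z. \<forall>r\<in>R. W r z \<in> A r} \<and> finite R \<and>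
     (\<forall>r\<in>R. r \<le> s \<and> (\<exists>n j. r = real j / 2 ^ n)) \<and> (\<forall>r. A r \<in> sets borel)"
    unfolding dyadic_events_def mem_Collect_eq by (elim exE)
  show thesis
  proof (rule that[of R A])
    show "\<forall>r\<in>R. r \<le> s" "\<forall>r\<in>R. \<exists>n j. r = real j / 2 ^ n" using * by simp_all
  qed (use * in simp_all)
qed

lemma Int_stable_dyadic_events: "Int_stable (dyadic_events s)"
proof (rule Int_stableI)
  fix a b assume "a \<in> dyadic_events s" "b \<in> dyadic_events s"
  from this(1) obtain R1 A1 where a: "a = {z. \<forall>r\<in>R1. W r z \<in> A1 r}"
    and R1: "finite R1" "\<forall>r\<in>R1. r \<le> s" "\<forall>r\<in>R1. \<exists>n j. r = real j / 2 ^ n"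
    and A1: "\<forall>r. A1 r \<in> sets borel" by (rule dyadic_eventsE)
  from \<open>b \<in> dyadic_events s\<close> obtain R2 A2 where b: "b = {z. \<forall>r\<in>R2. W r z \<in> A2 r}"
    and R2: "finite R2" "\<forall>r\<in>R2. r \<le> s" "\<forall>r\<in>R2. \<exists>n j. r = real j / 2 ^ n"
    and A2: "\<forall>r. A2 r \<in> sets borel" by (rule dyadic_eventsE)
  define A where "A = (\<lambda>r. (if r \<in> R1 then A1 r else UNIV) \<inter> (if r \<in> R2 then A2 r else UNIV))"
  have "a \<inter> b = {z. \<forall>r\<in>R1 \<union> R2. W r z \<in> A r}" unfolding a b A_def by auto
  moreover have "A r \<in> sets borel" for r using A1 A2 by (auto simp: A_def)
  then have "{z. \<forall>r\<in>R1 \<union> R2. W r z \<in> A r} \<in> dyadic_events s"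
    using R1 R2 by (intro dyadic_eventsI) (simp, (erule UnE; simp)+)
  ultimately show "a \<inter> b \<in> dyadic_events s" by simp
qed

lemma dyadic_events_gauss: "dyadic_events s \<subseteq> sets gauss"
proof
  fix a assume "a \<in> dyadic_events s"
  then obtain R A where "a = {z. \<forall>r\<in>R. W r z \<in> A r}" and R: "finite R" and "\<forall>r\<in>R. r \<le> s"
    "\<forall>r\<in>R. \<exists>n j. r = real j / 2 ^ n" and A: "\<forall>r. A r \<in> sets borel"
    by (rule dyadic_eventsE)
  then have a: "a = {z \<in> space gauss. \<forall>r\<in>R. W r z \<in> A r}" by simp
  show "a \<in> sets gauss" unfolding a
  proof (rule sets.sets_Collect_finite_All[OF _ R])
    fix r show "{z \<in> space gauss. W r z \<in> A r} \<in> sets gauss"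
      using measurable_sets[OF W_measurable, of "A r"] A by (simp add: vimage_def)
  qed
qed

lemma hist_dyadic_events: "0 \<le> s \<Longrightarrow> sets (hist s) \<subseteq> sigma_sets UNIV (dyadic_events s)"
proof -
  define N where "N = sigma UNIV (dyadic_events s)"
  have sN: "sets N = sigma_sets UNIV (dyadic_events s)" "space N = UNIV" by (simp_all add: N_def sets_measure_of space_measure_of)
  have dy: "W r \<in> borel_measurable N" if "r \<le> s" "r = real j / 2 ^ n" for r j n
  proof (rule measurableI)
    fix A :: "real set" assume A: "A \<in> sets borel"
    have "W r -` A = {z. \<forall>q\<in>{r}. W q z \<in> (\<lambda>_. A) q}" by auto
    moreover have "{z. \<forall>q\<in>{r}. W q z \<in> (\<lambda>_. A) q} \<in> dyadic_events s"
      by (rule dyadic_eventsI) (use that A in auto)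
    ultimately show "W r -` A \<inter> space N \<in> sets N" by (simp add: sN sigma_sets.Basic)
  qed simp
  have "W r \<in> borel_measurable N" if r: "0 \<le> r" "r \<le> s" for r
  proof (rule borel_measurable_LIMSEQ_real)
    fix z show "(\<lambda>n. W (dyad n r) z) \<longlonglongrightarrow> W r z"
      by (rule continuous_dyad_tendsto[OF W_continuous r(1)])
  next
    fix n show "W (dyad n r) \<in> borel_measurable N"
      by (rule dy[of _ "nat \<lfloor>2 ^ n * r\<rfloor>" n]) (use dyad_bounds(2)[OF r(1), of n] r in \<open>auto simp: dyad_def\<close>)
  qed
  then have "hist_gen s \<subseteq> sets N"
    unfolding hist_gen_def using measurable_sets[of "W _" N borel] sN(2) by fastforce
  from sets.sigma_sets_subset[OF this] show ?thesis by (simp add: sets_hist sN)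
qed

lemma dyadic_common_level:
  assumes "finite R" "\<forall>r\<in>R. \<exists>n j. r = real j / 2 ^ n"
  shows "\<exists>m\<ge>m0. \<forall>r\<in>R. \<exists>j. r = real j / 2 ^ m"
  using assms
proof (induction R rule: finite_induct)
  case (insert x R)
  then obtain m where m: "m \<ge> m0" "\<forall>r\<in>R. \<exists>j. r = real j / 2 ^ m" by auto
  obtain n i where x: "x = real i / 2 ^ n" using insert by auto
  have lift: "\<exists>j'. real j / 2 ^ k = real j' / 2 ^ (k + d)" for j k d :: nat
    by (rule exI[of _ "j * 2 ^ d"]) (simp add: power_add)
  have "\<exists>j. r = real j / 2 ^ (m + n)" if r: "r \<in> insert x R" for r
  proof (cases "r = x")
    case True
    then show ?thesis using lift[of i n m] x by (simp add: add.commute)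
  next
    case False
    then obtain j where "r = real j / 2 ^ m" using r m(2) by auto
    then show ?thesis using lift[of j m n] by simp
  qed
  then show ?case using m(1) by (intro exI[of _ "m + n"]) auto
qed auto

lemma dyadic_increment_indep:
  assumes F: "F \<in> dyadic_events (real a / 2 ^ m0)" and ab: "a \<le> b" and C: "C \<in> sets borel"
  shows "G.prob (F \<inter> {z. W (real b / 2 ^ m0) z - W (real a / 2 ^ m0) z \<in> C}) =
    G.prob F * G.prob {z. W (real b / 2 ^ m0) z - W (real a / 2 ^ m0) z \<in> C}"
proof -
  define s where "s = real a / 2 ^ m0"
  define t where "t = real b / 2 ^ m0"
  obtain R A where F': "F = {z. \<forall>r\<in>R. W r z \<in> A r}" and R: "finite R" "\<forall>r\<in>R. r \<le> s"
    "\<forall>r\<in>R. \<exists>n j. r = real j / 2 ^ n" and A': "\<forall>r. A r \<in> sets borel"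
    using F unfolding s_def by (rule dyadic_eventsE)
  have A: "A r \<in> sets borel" for r using A' by simp
  obtain m where m: "m0 \<le> m" "\<forall>r\<in>R. \<exists>j. r = real j / 2 ^ m"
    using dyadic_common_level[OF R(1,3), of m0] by (elim exE conjE) (rule that)
  then obtain j where j: "\<And>r. r \<in> R \<Longrightarrow> r = real (j r) / 2 ^ m" by metis
  obtain d where d: "m = m0 + d" using m(1) le_Suc_ex by blast
  define a' where "a' = a * 2 ^ d"
  define b' where "b' = b * 2 ^ d"
  have st: "s = real a' / 2 ^ m" "t = real b' / 2 ^ m" "a' \<le> b'"
    using ab by (auto simp: s_def t_def a'_def b'_def d power_add)
  have ja: "j r \<le> a'" if "r \<in> R" for r
  proof -
    have "real (j r) / 2 ^ m \<le> real a' / 2 ^ m" using R(2) that j[OF that] st(1) by auto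
    then show ?thesis by (simp add: divide_le_cancel)
  qed
  define X1 where "X1 = {x \<in> space (PiM {..<a'} (\<lambda>_. borel :: real measure)). \<forall>r\<in>R. (\<Sum>k<j r. x k * sd m) \<in> A r}"
  define X2 where "X2 = {x \<in> space (PiM {a'..<b'} (\<lambda>_. borel :: real measure)). (\<Sum>k\<in>{a'..<b'}. x k * sd m) \<in> C}"
  have X1: "X1 \<in> sets (PiM {..<a'} (\<lambda>_. borel))"
    unfolding X1_def
  proof (rule sets.sets_Collect_finite_All[OF _ R(1)])
    fix r assume r: "r \<in> R"
    have "(\<lambda>x. \<Sum>k<j r. x k * sd m) \<in> borel_measurable (PiM {..<a'} (\<lambda>_. borel))"
      using ja[OF r] by (intro borel_measurable_sum borel_measurable_times measurable_component_singleton) auto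
    from measurable_sets[OF this A[of r]]
    show "{x \<in> space (PiM {..<a'} (\<lambda>_. borel)). (\<Sum>k<j r. x k * sd m) \<in> A r} \<in> sets (PiM {..<a'} (\<lambda>_. borel))"
      by (simp add: vimage_def Int_def conj_commute)
  qed
  have X2: "X2 \<in> sets (PiM {a'..<b'} (\<lambda>_. borel))"
  proof -
    have "(\<lambda>x. \<Sum>k\<in>{a'..<b'}. x k * sd m) \<in> borel_measurable (PiM {a'..<b'} (\<lambda>_. borel))"
      by (intro borel_measurable_sum borel_measurable_times measurable_component_singleton) auto
    from measurable_sets[OF this C] show ?thesis
      by (simp add: X2_def vimage_def Int_def conj_commute)
  qed
  have iv: "G.indep_var (PiM {..<a'} (\<lambda>_. borel)) (\<lambda>z. restrict (\<lambda>k. lev m k z) {..<a'})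
      (PiM {a'..<b'} (\<lambda>_. borel)) (\<lambda>z. restrict (\<lambda>k. lev m k z) {a'..<b'})"
    by (rule G.indep_var_restrict[OF G.std_iid_indep_vars[OF lev_iid]]) auto
  define E1 where "E1 = {z. \<forall>r\<in>R. wsum m (j r) z \<in> A r}"
  define E2 where "E2 = {z. wsum m b' z - wsum m a' z \<in> C}"
  have e1: "(\<lambda>z. restrict (\<lambda>k. lev m k z) {..<a'}) -` X1 \<inter> space gauss = E1"
  proof -
    have "(\<Sum>k<j r. restrict (\<lambda>k. lev m k z) {..<a'} k * sd m) = wsum m (j r) z" if "r \<in> R" for r z
      unfolding wsum_def using ja[OF that] by (intro sum.cong) auto
    then show ?thesis by (auto simp: X1_def E1_def space_PiM PiE_def)
  qed
  have e2: "(\<lambda>z. restrict (\<lambda>k. lev m k z) {a'..<b'}) -` X2 \<inter> space gauss = E2"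
  proof -
    have "(\<Sum>k\<in>{a'..<b'}. restrict (\<lambda>k. lev m k z) {a'..<b'} k * sd m) = wsum m b' z - wsum m a' z" for z
    proof -
      have "{..<b'} = {..<a'} \<union> {a'..<b'}" using st(3) by auto
      then have "wsum m b' z = wsum m a' z + (\<Sum>k\<in>{a'..<b'}. lev m k z * sd m)"
        unfolding wsum_def by (simp add: sum.union_disjoint[symmetric] ivl_disj_int)
      then show ?thesis by simp
    qed
    then show ?thesis by (auto simp: X2_def E2_def space_PiM PiE_def)
  qed
  have "G.prob (E1 \<inter> E2) = G.prob E1 * G.prob E2"
  proof -
    have "(\<lambda>z. (restrict (\<lambda>k. lev m k z) {..<a'}, restrict (\<lambda>k. lev m k z) {a'..<b'})) -` (X1 \<times> X2) \<inter> space gauss = E1 \<inter> E2"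
      unfolding e1[symmetric] e2[symmetric] by auto
    then show ?thesis using G.indep_varD[OF iv X1 X2] unfolding e1 e2 by metis
  qed
  moreover have E: "E1 \<in> sets gauss" "E2 \<in> sets gauss"
  proof -
    have r: "(\<lambda>z. restrict (\<lambda>k. lev m k z) K) \<in> measurable gauss (PiM K (\<lambda>_. borel))" for K
      by (intro measurable_restrict) measurable
    show "E1 \<in> sets gauss" "E2 \<in> sets gauss"
      using measurable_sets[OF r X1] measurable_sets[OF r X2] e1 e2 by auto
  qed
  have W: "AE z in gauss. (\<forall>r\<in>R. W r z = wsum m (j r) z) \<and> W t z = wsum m b' z \<and> W s z = wsum m a' z"
    using AE_good
  proof eventually_elim
    case (elim z)
    show ?case using W_dyadic[OF elim] j st(1,2) by metis
  qed
  have D: "{z. W t z - W s z \<in> C} \<in> sets gauss"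
  proof -
    have "(\<lambda>z. W t z - W s z) -` C \<inter> space gauss \<in> sets gauss" by (rule measurable_sets[OF _ C]) measurable
    then show ?thesis by (simp add: vimage_def)
  qed
  have Fs: "F \<in> sets gauss" using F dyadic_events_gauss by auto
  have 1: "G.prob F = G.prob E1"
    by (rule G.finite_measure_eq_AE[OF _ Fs E(1)]) (use W in eventually_elim, auto simp: F' E1_def)
  have 2: "G.prob {z. W t z - W s z \<in> C} = G.prob E2"
    by (rule G.finite_measure_eq_AE[OF _ D E(2)]) (use W in eventually_elim, auto simp: E2_def)
  have 3: "G.prob (F \<inter> {z. W t z - W s z \<in> C}) = G.prob (E1 \<inter> E2)"
  proof (rule G.finite_measure_eq_AE)
    show "AE z in gauss. (z \<in> F \<inter> {z. W t z - W s z \<in> C}) = (z \<in> E1 \<inter> E2)"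
      using W by eventually_elim (auto simp: F' E1_def E2_def)
  qed (use Fs D E in auto)
  ultimately show ?thesis using 1 2 3 unfolding s_def t_def by simp
qed

lemma dyadic_increment_char:
  assumes ab: "a \<le> b"
  shows "char (distr gauss borel (\<lambda>z. W (real b / 2 ^ m) z - W (real a / 2 ^ m) z)) u =
    of_real (exp (- u\<^sup>2 * (real b / 2 ^ m - real a / 2 ^ m) / 2))"
proof -
  have AEW: "AE z in gauss. W (real b / 2 ^ m) z - W (real a / 2 ^ m) z = (\<Sum>k\<in>{a..<b}. lev m k z * sd m)"
    using AE_good
  proof eventually_elim
    case (elim z)
    have "{..<b} = {..<a} \<union> {a..<b}" using ab by auto
    then have "wsum m b z = wsum m a z + (\<Sum>k\<in>{a..<b}. lev m k z * sd m)"
      unfolding wsum_def by (simp add: sum.union_disjoint[symmetric] ivl_disj_int)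
    then show ?case by (simp add: W_dyadic[OF elim])
  qed
  have "distr gauss borel (\<lambda>z. W (real b / 2 ^ m) z - W (real a / 2 ^ m) z) = distr gauss borel (\<lambda>z. \<Sum>k\<in>{a..<b}. lev m k z * sd m)"
    by (rule distr_cong_AE[OF refl _ AEW]) auto
  moreover have "G.indep_vars (\<lambda>_. borel) (\<lambda>k z. lev m k z * sd m) {a..<b}"
  proof -
    have "G.indep_vars (\<lambda>_. borel) (lev m) {a..<b}"
      by (rule G.indep_vars_subset[OF G.std_iid_indep_vars[OF lev_iid]]) simp
    from G.indep_vars_compose2[OF this, of "\<lambda>_ x. x * sd m" "\<lambda>_. borel"] show ?thesis by simp
  qed
  ultimately have "char (distr gauss borel (\<lambda>z. W (real b / 2 ^ m) z - W (real a / 2 ^ m) z)) u =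
      (\<Prod>k\<in>{a..<b}. char (distr gauss borel (\<lambda>z. lev m k z * sd m)) u)"
    using G.char_distr_sum by simp
  also have "\<dots> = (\<Prod>k\<in>{a..<b}. of_real (exp (- (u * sd m)\<^sup>2 / 2)))"
  proof (rule prod.cong[OF refl])
    fix k
    have "char (distr gauss borel (\<lambda>z. lev m k z * sd m)) u = (CLINT z|gauss. iexp (u * (lev m k z * sd m)))"
      unfolding char_def by (subst integral_distr) auto
    also have "\<dots> = (CLINT z|gauss. iexp ((u * sd m) * lev m k z))" by (simp add: mult_ac)
    also have "\<dots> = char (distr gauss borel (lev m k)) (u * sd m)"
      unfolding char_def by (subst integral_distr) auto
    also have "\<dots> = of_real (exp (- (u * sd m)\<^sup>2 / 2))"
      by (simp only: G.std_iid_distr[OF lev_iid] char_std_normal_distribution)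
    finally show "char (distr gauss borel (\<lambda>z. lev m k z * sd m)) u = of_real (exp (- (u * sd m)\<^sup>2 / 2))" .
  qed
  also have "\<dots> = of_real (exp (real (b - a) * (- (u * sd m)\<^sup>2 / 2)))"
    by (simp only: prod_constant card_atLeastLessThan exp_of_nat_mult of_real_power)
  also have "real (b - a) * (- (u * sd m)\<^sup>2 / 2) = - u\<^sup>2 * (real b / 2 ^ m - real a / 2 ^ m) / 2"
    using ab by (simp add: sd_def power_mult_distrib power_divide of_nat_diff field_simps)
  finally show ?thesis .
qed

text \<open>The conditional law of an increment given a past event is identified through its
  characteristic function, by approximating the time interval from the right by dyadic ones.\<close>

lemma W_increment_conditional:
  assumes st: "0 \<le> s" "s \<le> t" and F: "F \<in> sets (hist s)" "G.prob F \<noteq> 0"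
  shows "distr (uniform_measure gauss F) borel (\<lambda>z. W t z - W s z) = distr sn borel (\<lambda>x. sqrt (t - s) * x)"
proof (rule Levy_uniqueness)
  define U where "U = uniform_measure gauss F"
  have Fs: "F \<in> sets gauss" using F(1) hist_gauss by auto
  have eF: "emeasure gauss F \<noteq> 0" "emeasure gauss F \<noteq> \<infinity>" using F(2) by (auto simp: G.emeasure_eq_measure)
  interpret U: prob_space U unfolding U_def by (rule prob_space_uniform_measure[OF eF])
  interpret S: prob_space sn by (rule prob_space_sn)
  have Um: "X \<in> borel_measurable U" if "X \<in> borel_measurable gauss" for X :: "_ \<Rightarrow> real"
    using that by (simp add: U_def)
  have Wm: "(\<lambda>z. W b z - W a z) \<in> borel_measurable U" for a b by (rule Um) measurable
  show "real_distribution (distr (uniform_measure gauss F) borel (\<lambda>z. W t z - W s z))"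
    unfolding U_def[symmetric] by (rule U.real_distribution_distr[OF Wm])
  show "real_distribution (distr sn borel (\<lambda>x. sqrt (t - s) * x))"
    by (rule prob_space.real_distribution_distr[OF prob_space_sn]) simp
  show "char (distr (uniform_measure gauss F) borel (\<lambda>z. W t z - W s z)) = char (distr sn borel (\<lambda>x. sqrt (t - s) * x))"
    unfolding U_def[symmetric]
  proof
    fix u :: real
    define a where "a = (\<lambda>n::nat. nat \<lfloor>2 ^ n * s\<rfloor> + 1)"
    define b where "b = (\<lambda>n::nat. nat \<lfloor>2 ^ n * t\<rfloor> + 1)"
    define sn' where "sn' = (\<lambda>n. real (a n) / 2 ^ n)"
    define tn where "tn = (\<lambda>n. real (b n) / 2 ^ n)"
    have ab: "a n \<le> b n" for n unfolding a_def b_def using st by (intro add_right_mono nat_mono floor_mono) auto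
    have e: "sn' n = dyad n s + 1 / 2 ^ n" "tn n = dyad n t + 1 / 2 ^ n" for n
      by (simp_all add: sn'_def tn_def a_def b_def dyad_def add_divide_distrib)
    have p0: "(\<lambda>n. 1 / 2 ^ n :: real) \<longlonglongrightarrow> 0"
      using LIMSEQ_power_zero[of "1 / 2 :: real"] by (simp add: power_one_over)
    have lims: "sn' \<longlonglongrightarrow> s" "tn \<longlonglongrightarrow> t"
      using tendsto_add[OF dyad_tendsto[of s] p0] tendsto_add[OF dyad_tendsto[of t] p0] st by (simp_all add: e[abs_def])
    have sge: "s \<le> sn' n" "0 \<le> sn' n" "0 \<le> tn n" for n
      using dyad_bounds(3)[OF st(1), of n] unfolding e(1)[symmetric] by (auto simp: sn'_def tn_def)
    have eq: "distr U borel (\<lambda>z. W (tn n) z - W (sn' n) z) = distr gauss borel (\<lambda>z. W (tn n) z - W (sn' n) z)" for n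
    proof (rule measure_eqI)
      fix C assume "C \<in> sets (distr U borel (\<lambda>z. W (tn n) z - W (sn' n) z))"
      then have C: "C \<in> sets borel" by simp
      let ?D = "{{z. W (tn n) z - W (sn' n) z \<in> B} |B. B \<in> sets borel}"
      have Dm: "{z. W (tn n) z - W (sn' n) z \<in> B} \<in> sets gauss" if "B \<in> sets borel" for B
      proof -
        have "(\<lambda>z. W (tn n) z - W (sn' n) z) -` B \<inter> space gauss \<in> sets gauss" by (rule measurable_sets[OF _ that]) measurable
        then show ?thesis by (simp add: vimage_def)
      qed
      have "G.indep_set (sigma_sets (space gauss) (dyadic_events (sn' n))) (sigma_sets (space gauss) ?D)"
      proof (rule G.indep_set_sigma_sets)
        show "G.indep_set (dyadic_events (sn' n)) ?D"
          by (rule G.indep_setI)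
            (use dyadic_events_gauss Dm dyadic_increment_indep[OF _ ab] in \<open>auto simp: sn'_def tn_def\<close>)
        show "Int_stable ?D"
          using Int_stable_vimage[of "\<lambda>z. W (tn n) z - W (sn' n) z" UNIV borel] by (simp add: vimage_def)
      qed (rule Int_stable_dyadic_events)
      moreover have "F \<in> sigma_sets (space gauss) (dyadic_events (sn' n))"
        using F(1) hist_mono[OF sge(1)] hist_dyadic_events[OF sge(2)] by auto
      moreover have "{z. W (tn n) z - W (sn' n) z \<in> C} \<in> sigma_sets (space gauss) ?D"
        using C by (intro sigma_sets.Basic) auto
      ultimately have ind: "G.prob (F \<inter> {z. W (tn n) z - W (sn' n) z \<in> C}) = G.prob F * G.prob {z. W (tn n) z - W (sn' n) z \<in> C}"
        by (rule G.indep_setD)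
      have "emeasure (distr U borel (\<lambda>z. W (tn n) z - W (sn' n) z)) C = emeasure U {z. W (tn n) z - W (sn' n) z \<in> C}"
        using C Wm by (subst emeasure_distr) (auto simp: U_def vimage_def)
      also have "\<dots> = emeasure gauss (F \<inter> {z. W (tn n) z - W (sn' n) z \<in> C}) / emeasure gauss F"
        unfolding U_def by (rule emeasure_uniform_measure[OF Fs Dm[OF C]])
      also have "\<dots> = ennreal (G.prob F * G.prob {z. W (tn n) z - W (sn' n) z \<in> C} / G.prob F)"
        using F(2) unfolding G.emeasure_eq_measure ind by (intro divide_ennreal) (auto simp: zero_less_measure_iff)
      also have "\<dots> = ennreal (G.prob {z. W (tn n) z - W (sn' n) z \<in> C})" using F(2) by simp
      also have "\<dots> = emeasure (distr gauss borel (\<lambda>z. W (tn n) z - W (sn' n) z)) C"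
        using C by (subst emeasure_distr) (auto simp: vimage_def G.emeasure_eq_measure)
      finally show "emeasure (distr U borel (\<lambda>z. W (tn n) z - W (sn' n) z)) C = emeasure (distr gauss borel (\<lambda>z. W (tn n) z - W (sn' n) z)) C" .
    qed simp
    have ch: "(CLINT z|U. iexp (u * (W (tn n) z - W (sn' n) z))) = of_real (exp (- u\<^sup>2 * (tn n - sn' n) / 2))" for n
    proof -
      have "(CLINT z|U. iexp (u * (W (tn n) z - W (sn' n) z))) = char (distr U borel (\<lambda>z. W (tn n) z - W (sn' n) z)) u"
        unfolding char_def using Wm by (subst integral_distr) auto
      then show ?thesis unfolding eq using dyadic_increment_char[OF ab] by (simp add: sn'_def tn_def)
    qed
    have "(\<lambda>n. CLINT z|U. iexp (u * (W (tn n) z - W (sn' n) z))) \<longlonglongrightarrow> (CLINT z|U. iexp (u * (W t z - W s z)))"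
    proof (rule integral_dominated_convergence[where w="\<lambda>_. 1"])
      show "AE z in U. (\<lambda>n. iexp (u * (W (tn n) z - W (sn' n) z))) \<longlonglongrightarrow> iexp (u * (W t z - W s z))"
      proof (rule AE_I2)
        fix z
        have "(\<lambda>n. W (tn n) z) \<longlonglongrightarrow> W t z" "(\<lambda>n. W (sn' n) z) \<longlonglongrightarrow> W s z"
          using W_continuous[of z] lims sge st unfolding continuous_on_sequentially by (auto simp: comp_def)
        then show "(\<lambda>n. iexp (u * (W (tn n) z - W (sn' n) z))) \<longlonglongrightarrow> iexp (u * (W t z - W s z))"
          by (intro tendsto_intros)
      qed
      have im: "(\<lambda>z. iexp (u * (W b z - W a z))) \<in> borel_measurable U" for a b
        using Wm[of b a] by measurable
      show "(\<lambda>z. iexp (u * (W t z - W s z))) \<in> borel_measurable U" by (rule im)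
      show "(\<lambda>z. iexp (u * (W (tn n) z - W (sn' n) z))) \<in> borel_measurable U" for n by (rule im)
      show "integrable U (\<lambda>_. 1::real)" by simp
      show "AE z in U. cmod (iexp (u * (W (tn n) z - W (sn' n) z))) \<le> 1" for n
        by (rule AE_I2) (simp del: of_real_mult of_real_diff)
    qed
    moreover have "(\<lambda>n. complex_of_real (exp (- u\<^sup>2 * (tn n - sn' n) / 2))) \<longlonglongrightarrow> of_real (exp (- u\<^sup>2 * (t - s) / 2))"
      using lims by (intro tendsto_intros) auto
    ultimately have "(CLINT z|U. iexp (u * (W t z - W s z))) = of_real (exp (- u\<^sup>2 * (t - s) / 2))"
      unfolding ch using LIMSEQ_unique by blast
    moreover have "char (distr sn borel (\<lambda>x. sqrt (t - s) * x)) u = of_real (exp (- u\<^sup>2 * (t - s) / 2))"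
    proof -
      have "char (distr sn borel (\<lambda>x. sqrt (t - s) * x)) u = (CLINT x|sn. iexp ((u * sqrt (t - s)) * x))"
        unfolding char_def by (subst integral_distr) (auto simp: mult_ac)
      also have "\<dots> = char sn (u * sqrt (t - s))" by (simp add: char_def)
      also have "\<dots> = of_real (exp (- u\<^sup>2 * (t - s) / 2))"
        using st by (simp add: char_std_normal_distribution power_mult_distrib)
      finally show ?thesis .
    qed
    moreover have "char (distr U borel (\<lambda>z. W t z - W s z)) u = (CLINT z|U. iexp (u * (W t z - W s z)))"
      unfolding char_def using Wm by (subst integral_distr) auto
    ultimately show "char (distr U borel (\<lambda>z. W t z - W s z)) u = char (distr sn borel (\<lambda>x. sqrt (t - s) * x)) u"
      by simp
  qed
qed

lemma W_increment_prob:
  assumes st: "0 \<le> s" "s \<le> t" and F: "F \<in> sets (hist s)" and C: "C \<in> sets borel"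
  shows "G.prob (F \<inter> {z. W t z - W s z \<in> C}) = G.prob F * measure (distr sn borel (\<lambda>x. sqrt (t - s) * x)) C"
proof (cases "G.prob F = 0")
  case True
  have "G.prob (F \<inter> {z. W t z - W s z \<in> C}) \<le> G.prob F"
    using F hist_gauss by (intro G.finite_measure_mono) auto
  then show ?thesis using True by (simp add: measure_le_0_iff)
next
  case False
  have Fs: "F \<in> sets gauss" using F hist_gauss by auto
  have D: "{z. W t z - W s z \<in> C} \<in> sets gauss"
  proof -
    have "(\<lambda>z. W t z - W s z) -` C \<inter> space gauss \<in> sets gauss" by (rule measurable_sets[OF _ C]) measurable
    then show ?thesis by (simp add: vimage_def)
  qed
  have "measure (distr sn borel (\<lambda>x. sqrt (t - s) * x)) C = measure (distr (uniform_measure gauss F) borel (\<lambda>z. W t z - W s z)) C"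
    by (simp only: W_increment_conditional[OF st F False])
  also have "\<dots> = measure (uniform_measure gauss F) {z. W t z - W s z \<in> C}"
    using C by (subst measure_distr) (auto simp: vimage_def)
  also have "\<dots> = G.prob (F \<inter> {z. W t z - W s z \<in> C}) / G.prob F"
    using False D by (intro measure_uniform_measure) (auto simp: G.emeasure_eq_measure)
  finally show ?thesis using False by simp
qed

lemma W_increment_expectation:
  fixes f :: "(nat \<times> nat \<Rightarrow> real) \<Rightarrow> real" and h :: "real \<Rightarrow> real"
  assumes st: "0 \<le> s" "s \<le> t" and f: "f \<in> borel_measurable (hist s)" "integrable gauss f"
    and h: "h \<in> borel_measurable borel" "integrable sn (\<lambda>x. h (sqrt (t - s) * x))"
  shows "integrable gauss (\<lambda>z. f z * h (W t z - W s z))"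
    "(\<integral>z. f z * h (W t z - W s z) \<partial>gauss) = (\<integral>z. f z \<partial>gauss) * (\<integral>x. h (sqrt (t - s) * x) \<partial>sn)"
proof -
  have D: "distr gauss borel (\<lambda>z. W t z - W s z) = distr sn borel (\<lambda>x. sqrt (t - s) * x)"
  proof (rule measure_eqI)
    fix C assume "C \<in> sets (distr gauss borel (\<lambda>z. W t z - W s z))"
    then have C: "C \<in> sets borel" by simp
    interpret N: prob_space "distr sn borel (\<lambda>x. sqrt (t - s) * x)"
      by (rule prob_space.prob_space_distr[OF prob_space_sn]) simp
    have u: "UNIV \<in> sets (hist s)" using sets.top[of "hist s"] by simp
    have "emeasure (distr gauss borel (\<lambda>z. W t z - W s z)) C = ennreal (G.prob {z. W t z - W s z \<in> C})"
      using C by (subst emeasure_distr) (auto simp: vimage_def G.emeasure_eq_measure)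
    also have "G.prob {z. W t z - W s z \<in> C} = measure (distr sn borel (\<lambda>x. sqrt (t - s) * x)) C"
      using W_increment_prob[OF st u C] G.prob_space by simp
    finally show "emeasure (distr gauss borel (\<lambda>z. W t z - W s z)) C = emeasure (distr sn borel (\<lambda>x. sqrt (t - s) * x)) C"
      by (simp only: N.emeasure_eq_measure)
  qed simp
  have [measurable]: "h \<in> borel_measurable borel" by fact
  have ih: "integrable gauss (\<lambda>z. h (W t z - W s z))"
  proof -
    have "integrable (distr sn borel (\<lambda>x. sqrt (t - s) * x)) h" using h by (subst integrable_distr_eq) auto
    then have "integrable (distr gauss borel (\<lambda>z. W t z - W s z)) h" by (simp only: D)
    then show ?thesis by (subst (asm) integrable_distr_eq) auto
  qed
  have eh: "(\<integral>z. h (W t z - W s z) \<partial>gauss) = (\<integral>x. h (sqrt (t - s) * x) \<partial>sn)"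
  proof -
    have "(\<integral>z. h (W t z - W s z) \<partial>gauss) = (\<integral>y. h y \<partial>distr gauss borel (\<lambda>z. W t z - W s z))"
      by (subst integral_distr) auto
    also have "\<dots> = (\<integral>x. h (sqrt (t - s) * x) \<partial>sn)" unfolding D by (subst integral_distr) auto
    finally show ?thesis .
  qed
  have fm: "f \<in> borel_measurable gauss" using f(2) by auto
  have "G.indep_var borel f borel (\<lambda>z. W t z - W s z)"
    unfolding G.indep_var_eq
  proof (intro conjI G.indep_set_sigma_sets G.indep_setI)
    show "G.random_variable borel f" by fact
    show "G.random_variable borel (\<lambda>z. W t z - W s z)" by measurable
    show "Int_stable {f -` A \<inter> space gauss |A. A \<in> sets borel}" by (rule Int_stable_vimage)
    show "Int_stable {(\<lambda>z. W t z - W s z) -` A \<inter> space gauss |A. A \<in> sets borel}" by (rule Int_stable_vimage)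
    show "{f -` A \<inter> space gauss |A. A \<in> sets borel} \<subseteq> sets gauss"
      using measurable_sets[OF fm] by auto
    show "{(\<lambda>z. W t z - W s z) -` A \<inter> space gauss |A. A \<in> sets borel} \<subseteq> sets gauss"
    proof safe
      fix A :: "real set" assume "A \<in> sets borel"
      then show "(\<lambda>z. W t z - W s z) -` A \<inter> space gauss \<in> sets gauss" by (rule measurable_sets[rotated]) measurable
    qed
    fix a b assume "a \<in> {f -` A \<inter> space gauss |A. A \<in> sets borel}" "b \<in> {(\<lambda>z. W t z - W s z) -` A \<inter> space gauss |A. A \<in> sets borel}"
    then obtain A C where a: "a = f -` A" "A \<in> sets borel" and b: "b = {z. W t z - W s z \<in> C}" "C \<in> sets borel"
      by (auto simp: vimage_def)
    have as: "a \<in> sets (hist s)" using measurable_sets[OF f(1) a(2)] by (simp add: a)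
    have "G.prob b = measure (distr sn borel (\<lambda>x. sqrt (t - s) * x)) C"
      using W_increment_prob[OF st, of UNIV C] sets.top[of "hist s"] b(2) G.prob_space by (simp add: b)
    then show "G.prob (a \<inter> b) = G.prob a * G.prob b"
      using W_increment_prob[OF st as b(2)] by (simp add: b)
  qed
  from G.indep_var_compose[OF this, of "\<lambda>x. x" borel h borel]
  have iv: "G.indep_var borel f borel (\<lambda>z. h (W t z - W s z))" by (simp add: comp_def)
  show "integrable gauss (\<lambda>z. f z * h (W t z - W s z))" by (rule G.indep_var_integrable[OF iv f(2) ih])
  show "(\<integral>z. f z * h (W t z - W s z) \<partial>gauss) = (\<integral>z. f z \<partial>gauss) * (\<integral>x. h (sqrt (t - s) * x) \<partial>sn)"
    using G.indep_var_lebesgue_integral[OF iv f(2) ih] eh by simp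
qed

section \<open>Two families of martingale laws\<close>

subsection \<open>Martingales driven by the Brownian motion\<close>

lemma char_sn_parts:
  "(\<integral>x. cos (c * x) \<partial>sn) = exp (- c\<^sup>2 / 2)" "(\<integral>x. sin (c * x) \<partial>sn) = 0"
  "integrable sn (\<lambda>x. cos (c * x))" "integrable sn (\<lambda>x. sin (c * x))"
proof -
  interpret S: prob_space sn by (rule prob_space_sn)
  have i: "integrable sn (\<lambda>x. iexp (c * x))"
    by (rule prob_space.integrable_iexp[OF prob_space_sn]) auto
  have e: "(CLINT x|sn. iexp (c * x)) = of_real (exp (- c\<^sup>2 / 2))"
    using char_std_normal_distribution unfolding char_def by (auto dest: fun_cong[of _ _ c])
  have r: "Re (iexp (c * x)) = cos (c * x)" "Im (iexp (c * x)) = sin (c * x)" for x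
    by (simp_all add: exp_Euler cos_of_real sin_of_real del: of_real_mult)
  show "integrable sn (\<lambda>x. cos (c * x))" "integrable sn (\<lambda>x. sin (c * x))"
    using integrable_Re[OF i] integrable_Im[OF i] by (simp_all only: r)
  show "(\<integral>x. cos (c * x) \<partial>sn) = exp (- c\<^sup>2 / 2)" "(\<integral>x. sin (c * x) \<partial>sn) = 0"
    using integral_Re[OF i] integral_Im[OF i] unfolding r e by simp_all
qed

lemma indicator_hist:
  assumes "F \<in> sets (hist s)"
  shows "indicator F \<in> borel_measurable (hist s)" "integrable gauss (indicator F :: _ \<Rightarrow> real)"
proof -
  have F: "F \<in> sets gauss" using assms hist_gauss by auto
  show "indicator F \<in> borel_measurable (hist s)" using assms by simp
  show "integrable gauss (indicator F :: _ \<Rightarrow> real)" using F by (simp add: G.emeasure_eq_measure less_top[symmetric])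
qed

lemma sn_moments: "integrable sn (\<lambda>x. x)" "(\<integral>x. x \<partial>sn) = 0" "integrable sn (\<lambda>x. x\<^sup>2)" "(\<integral>x. x\<^sup>2 \<partial>sn) = 1"
proof -
  show "integrable sn (\<lambda>x. x)" using integrable_std_normal_distribution_moment[of 1] by (simp only: power_one_right)
  show "(\<integral>x. x \<partial>sn) = 0" using integral_std_normal_distribution_moment_odd[OF odd_one] by (simp only: power_one_right)
  show "integrable sn (\<lambda>x. x\<^sup>2)" by (rule integrable_std_normal_distribution_moment)
  have "(\<integral>x. x ^ (2 * 1) \<partial>sn) = fact (2 * 1) / (2 ^ 1 * fact 1)" by (rule std_normal_distribution_even_moments(1))
  moreover have "fact (2 * 1) / (2 ^ 1 * fact 1) = (1 :: real)" by (simp add: fact_numeral)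
  ultimately show "(\<integral>x. x\<^sup>2 \<partial>sn) = 1" by (simp only: mult_1_right)
qed

lemma ident_borel: "(\<lambda>x::real. x) \<in> borel_measurable borel"
  by simp

lemma vec_nth_borel: "(\<lambda>v::real ^ 'n. v $ i) \<in> borel_measurable borel"
  by (rule borel_measurable_continuous_onI) (intro continuous_intros)

lemma sn_scaled_moments:
  "integrable sn (\<lambda>x. c * x)" "(\<integral>x. c * x \<partial>sn) = 0" "integrable sn (\<lambda>x. (c * x)\<^sup>2)" "(\<integral>x. (c * x)\<^sup>2 \<partial>sn) = c\<^sup>2"
proof -
  show "integrable sn (\<lambda>x. c * x)" by (rule integrable_mult_right) (rule sn_moments(1))
  show "(\<integral>x. c * x \<partial>sn) = 0" by (subst integral_mult_right_zero) (simp only: sn_moments(2) mult_zero_right)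
  show "integrable sn (\<lambda>x. (c * x)\<^sup>2)" unfolding power_mult_distrib by (rule integrable_mult_right) (rule sn_moments(3))
  show "(\<integral>x. (c * x)\<^sup>2 \<partial>sn) = c\<^sup>2"
    unfolding power_mult_distrib by (subst integral_mult_right_zero) (simp only: sn_moments(4) mult_1_right)
qed

lemma W_integrable:
  assumes "0 \<le> t" shows "integrable gauss (W t)" "integrable gauss (\<lambda>z. (W t z)\<^sup>2)"
proof -
  have u: "UNIV \<in> sets (hist 0)" using sets.top[of "hist 0"] by simp
  have e: "indicator UNIV z * (W t z - W 0 z) = W t z" "indicator UNIV z * (W t z - W 0 z)\<^sup>2 = (W t z)\<^sup>2" for z
    by (simp_all add: W_0)
  show "integrable gauss (W t)"
    using W_increment_expectation(1)[OF order.refl assms indicator_hist[OF u] ident_borel sn_scaled_moments(1)]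
    unfolding e .
  have "(\<lambda>x::real. x\<^sup>2) \<in> borel_measurable borel" by measurable
  from W_increment_expectation(1)[OF order.refl assms indicator_hist[OF u] this sn_scaled_moments(3)]
  show "integrable gauss (\<lambda>z. (W t z)\<^sup>2)" unfolding e .
qed

text \<open>A process is tested against the past of the Brownian motion up to the deterministic time
  change \<open>u\<close>.\<close>

definition hmart :: "(real \<Rightarrow> real) \<Rightarrow> (real \<Rightarrow> (nat \<times> nat \<Rightarrow> real) \<Rightarrow> real) \<Rightarrow> bool" where
  "hmart u Y \<longleftrightarrow> (\<forall>t\<ge>0. integrable gauss (Y t)) \<and>
    (\<forall>s t F. 0 \<le> s \<longrightarrow> s \<le> t \<longrightarrow> F \<in> sets (hist (u s)) \<longrightarrow>
      (\<integral>z. indicator F z * Y t z \<partial>gauss) = (\<integral>z. indicator F z * Y s z \<partial>gauss))"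

lemma hmartI:
  assumes "\<And>t. 0 \<le> t \<Longrightarrow> integrable gauss (Y t)"
    and "\<And>s t F. 0 \<le> s \<Longrightarrow> s \<le> t \<Longrightarrow> F \<in> sets (hist (u s)) \<Longrightarrow>
      (\<integral>z. indicator F z * Y t z \<partial>gauss) = (\<integral>z. indicator F z * Y s z \<partial>gauss)"
  shows "hmart u Y"
  unfolding hmart_def by (intro conjI allI impI assms)

lemma hmart_integrable: "hmart u Y \<Longrightarrow> 0 \<le> t \<Longrightarrow> integrable gauss (Y t)"
  by (simp add: hmart_def)

lemma hmart_eq: "hmart u Y \<Longrightarrow> 0 \<le> s \<Longrightarrow> s \<le> t \<Longrightarrow> F \<in> sets (hist (u s)) \<Longrightarrow>
      (\<integral>z. indicator F z * Y t z \<partial>gauss) = (\<integral>z. indicator F z * Y s z \<partial>gauss)"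
  unfolding hmart_def by (elim conjE allE impE)

lemma hmart_integrable_indicator:
  assumes "hmart u Y" "0 \<le> t" "F \<in> sets (hist r)"
  shows "integrable gauss (\<lambda>z. indicator F z * Y t z)"
proof -
  have "F \<in> sets gauss" using assms(3) hist_gauss by auto
  from integrable_mult_indicator[OF this hmart_integrable[OF assms(1,2)]] show ?thesis by simp
qed

lemma hmart_const: "hmart u (\<lambda>t z. c)"
  by (rule hmartI) simp_all

lemma hmart_add:
  assumes Y: "hmart u Y" and Z: "hmart u Z" shows "hmart u (\<lambda>t z. Y t z + Z t z)"
proof (rule hmartI)
  fix t :: real assume "0 \<le> t"
  then show "integrable gauss (\<lambda>z. Y t z + Z t z)" by (intro Bochner_Integration.integrable_add hmart_integrable[OF Y] hmart_integrable[OF Z])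
next
  fix s t F assume h: "0 \<le> s" "s \<le> t" "F \<in> sets (hist (u s))"
  have t: "0 \<le> t" using h by simp
  note e = hmart_eq[OF Y h] hmart_eq[OF Z h]
  show "(\<integral>z. indicator F z * (Y t z + Z t z) \<partial>gauss) = (\<integral>z. indicator F z * (Y s z + Z s z) \<partial>gauss)"
    using hmart_integrable_indicator[OF Y t h(3)] hmart_integrable_indicator[OF Z t h(3)]
      hmart_integrable_indicator[OF Y h(1,3)] hmart_integrable_indicator[OF Z h(1,3)]
    by (simp add: distrib_left e)
qed

lemma hmart_cmult:
  assumes Y: "hmart u Y" shows "hmart u (\<lambda>t z. c * Y t z)"
proof (rule hmartI)
  fix s t F assume h: "0 \<le> s" "s \<le> t" "F \<in> sets (hist (u s))"
  have "(\<integral>z. indicator F z * (c * Y r z) \<partial>gauss) = c * (\<integral>z. indicator F z * Y r z \<partial>gauss)" for r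
  proof -
    have "(\<lambda>z. indicator F z * (c * Y r z)) = (\<lambda>z. c * (indicator F z * Y r z))" by (rule ext) (simp only: mult.left_commute)
    then show ?thesis by (simp only: integral_mult_right_zero)
  qed
  then show "(\<integral>z. indicator F z * (c * Y t z) \<partial>gauss) = (\<integral>z. indicator F z * (c * Y s z) \<partial>gauss)"
    using hmart_eq[OF Y h] by simp
qed (use hmart_integrable[OF Y] in simp)

lemma hmart_W: "hmart (\<lambda>s. s) W"
proof (rule hmartI)
  fix s t F assume h: "0 \<le> s" "s \<le> t" "F \<in> sets (hist s)"
  have F: "F \<in> sets gauss" using h hist_gauss by auto
  have i: "integrable gauss (\<lambda>z. indicator F z * W r z)" if "0 \<le> r" for r
    using integrable_mult_indicator[OF F W_integrable(1)[OF that]] by simp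
  have "(\<integral>z. indicator F z * (W t z - W s z) \<partial>gauss) = (\<integral>z. indicator F z \<partial>gauss) * (\<integral>x. sqrt (t - s) * x \<partial>sn)"
    by (rule W_increment_expectation(2)[OF h(1,2) indicator_hist[OF h(3)] ident_borel sn_scaled_moments(1)])
  also have "\<dots> = 0" by (simp only: sn_scaled_moments(2) mult_zero_right)
  finally show "(\<integral>z. indicator F z * W t z \<partial>gauss) = (\<integral>z. indicator F z * W s z \<partial>gauss)"
    using i h by (simp add: right_diff_distrib)
qed (rule W_integrable)

lemma hmart_W_square: "hmart (\<lambda>s. s) (\<lambda>t z. (W t z)\<^sup>2 - t)"
proof (rule hmartI)
  fix t :: real assume "0 \<le> t"
  then show "integrable gauss (\<lambda>z. (W t z)\<^sup>2 - t)" using W_integrable(2) by simp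
next
  fix s t F assume h: "0 \<le> s" "s \<le> t" "F \<in> sets (hist s)"
  have F: "F \<in> sets gauss" using h hist_gauss by auto
  have i: "integrable gauss (\<lambda>z. indicator F z * (W r z)\<^sup>2)" if "0 \<le> r" for r
    using integrable_mult_indicator[OF F W_integrable(2)[OF that]] by simp
  have fW: "(\<lambda>z. indicator F z * W s z) \<in> borel_measurable (hist s)" "integrable gauss (\<lambda>z. indicator F z * W s z)"
    using integrable_mult_indicator[OF F W_integrable(1)[OF h(1)]]
    by (auto intro!: borel_measurable_times indicator_hist(1)[OF h(3)] W_hist[OF h(1) order.refl])
  have sq: "(\<lambda>x::real. x\<^sup>2) \<in> borel_measurable borel" by measurable
  note e1 = W_increment_expectation[OF h(1,2) indicator_hist[OF h(3)] sq sn_scaled_moments(3)]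
  note e2 = W_increment_expectation[OF h(1,2) fW ident_borel sn_scaled_moments(1)]
  have i1: "integrable gauss (\<lambda>z. indicator F z * (W t z - W s z)\<^sup>2)"
    and v1: "(\<integral>z. indicator F z * (W t z - W s z)\<^sup>2 \<partial>gauss) = (\<integral>z. indicator F z \<partial>gauss) * (t - s)"
    using e1 h(2) unfolding sn_scaled_moments(4) by simp_all
  have i2: "integrable gauss (\<lambda>z. indicator F z * W s z * (W t z - W s z))"
    and v2: "(\<integral>z. indicator F z * W s z * (W t z - W s z) \<partial>gauss) = 0"
    using e2 unfolding sn_scaled_moments(2) by simp_all
  have "indicator F z * (W t z)\<^sup>2 = indicator F z * (W s z)\<^sup>2 + (indicator F z * (W t z - W s z)\<^sup>2 + 2 * (indicator F z * W s z * (W t z - W s z)))"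
    for z by (simp add: power2_eq_square algebra_simps)
  then have "(\<integral>z. indicator F z * (W t z)\<^sup>2 \<partial>gauss) = (\<integral>z. indicator F z * (W s z)\<^sup>2 + (indicator F z * (W t z - W s z)\<^sup>2 + 2 * (indicator F z * W s z * (W t z - W s z))) \<partial>gauss)"
    by simp
  also have "\<dots> = (\<integral>z. indicator F z * (W s z)\<^sup>2 \<partial>gauss) + (\<integral>z. indicator F z \<partial>gauss) * (t - s)"
    using i[OF h(1)] i1 i2 v1 v2 by simp
  finally have eqt: "(\<integral>z. indicator F z * (W t z)\<^sup>2 \<partial>gauss) = (\<integral>z. indicator F z * (W s z)\<^sup>2 \<partial>gauss) + (\<integral>z. indicator F z \<partial>gauss) * (t - s)" .
  have "(\<integral>z. indicator F z * ((W r z)\<^sup>2 - r) \<partial>gauss) = (\<integral>z. indicator F z * (W r z)\<^sup>2 \<partial>gauss) - (\<integral>z. indicator F z \<partial>gauss) * r" if "0 \<le> r" for r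
    using i[OF that] indicator_hist(2)[OF h(3)] by (simp add: right_diff_distrib)
  note m = this
  have t: "0 \<le> t" using h by simp
  show "(\<integral>z. indicator F z * ((W t z)\<^sup>2 - t) \<partial>gauss) = (\<integral>z. indicator F z * ((W s z)\<^sup>2 - s) \<partial>gauss)"
    unfolding m[OF t] m[OF h(1)] eqt by (simp only: right_diff_distrib)
qed

lemma W_trig:
  assumes h: "0 \<le> s" "s \<le> t" "F \<in> sets (hist s)"
  shows "(\<integral>z. indicator F z * cos (k * W t z) \<partial>gauss) = exp (- k\<^sup>2 * (t - s) / 2) * (\<integral>z. indicator F z * cos (k * W s z) \<partial>gauss)"
    "(\<integral>z. indicator F z * sin (k * W t z) \<partial>gauss) = exp (- k\<^sup>2 * (t - s) / 2) * (\<integral>z. indicator F z * sin (k * W s z) \<partial>gauss)"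
proof -
  have F: "F \<in> sets gauss" using h hist_gauss by auto
  have [measurable]: "W s \<in> borel_measurable (hist s)" by (rule W_hist) (use h in auto)
  have [measurable]: "F \<in> sets (hist s)" by fact
  have bi: "integrable gauss (\<lambda>z. f (W s z))" if "f \<in> borel_measurable borel" "\<And>x. \<bar>f x\<bar> \<le> 1" for f :: "real \<Rightarrow> real"
    by (rule G.integrable_const_bound[of _ 1]) (use that in \<open>auto intro: measurable_compose[OF W_measurable]\<close>)
  have c: "(\<lambda>z. indicator F z * cos (k * W s z)) \<in> borel_measurable (hist s)" "integrable gauss (\<lambda>z. indicator F z * cos (k * W s z))"
    using integrable_mult_indicator[OF F bi[of "\<lambda>x. cos (k * x)"]] by auto
  have s: "(\<lambda>z. indicator F z * sin (k * W s z)) \<in> borel_measurable (hist s)" "integrable gauss (\<lambda>z. indicator F z * sin (k * W s z))"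
    using integrable_mult_indicator[OF F bi[of "\<lambda>x. sin (k * x)"]] by auto
  have eq: "k * (sqrt (t - s) * x) = (k * sqrt (t - s)) * x" for x by simp
  have ex: "(k * sqrt (t - s))\<^sup>2 = k\<^sup>2 * (t - s)" using h by (simp add: power_mult_distrib)
  have C: "(\<integral>x. cos (k * (sqrt (t - s) * x)) \<partial>sn) = exp (- k\<^sup>2 * (t - s) / 2)" "integrable sn (\<lambda>x. cos (k * (sqrt (t - s) * x)))"
    and S: "(\<integral>x. sin (k * (sqrt (t - s) * x)) \<partial>sn) = 0" "integrable sn (\<lambda>x. sin (k * (sqrt (t - s) * x)))"
    unfolding eq using char_sn_parts[of "k * sqrt (t - s)", unfolded ex] by simp_all
  have mc: "(\<lambda>x::real. cos (k * x)) \<in> borel_measurable borel" and ms: "(\<lambda>x::real. sin (k * x)) \<in> borel_measurable borel"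
    by measurable
  note cc = W_increment_expectation[OF h(1,2) c mc C(2)]
  note cs = W_increment_expectation[OF h(1,2) c ms S(2)]
  note sc = W_increment_expectation[OF h(1,2) s mc C(2)]
  note ss = W_increment_expectation[OF h(1,2) s ms S(2)]
  have kW: "k * W t z = k * W s z + k * (W t z - W s z)" for z by (simp add: algebra_simps)
  have "indicator F z * cos (k * W t z) = indicator F z * cos (k * W s z) * cos (k * (W t z - W s z)) - indicator F z * sin (k * W s z) * sin (k * (W t z - W s z))" for z
    unfolding kW[of z] cos_add by (simp add: algebra_simps)
  then show "(\<integral>z. indicator F z * cos (k * W t z) \<partial>gauss) = exp (- k\<^sup>2 * (t - s) / 2) * (\<integral>z. indicator F z * cos (k * W s z) \<partial>gauss)"
    using cc(1) ss(1) by (simp only: Bochner_Integration.integral_diff cc(2) ss(2) C(1) S(1)) simp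
  have "indicator F z * sin (k * W t z) = indicator F z * sin (k * W s z) * cos (k * (W t z - W s z)) + indicator F z * cos (k * W s z) * sin (k * (W t z - W s z))" for z
    unfolding kW[of z] sin_add by (simp add: algebra_simps)
  then show "(\<integral>z. indicator F z * sin (k * W t z) \<partial>gauss) = exp (- k\<^sup>2 * (t - s) / 2) * (\<integral>z. indicator F z * sin (k * W s z) \<partial>gauss)"
    using cs(1) sc(1) by (simp only: Bochner_Integration.integral_add cs(2) sc(2) C(1) S(1)) simp
qed

lemma law_martingale:
  fixes X :: "(nat \<times> nat \<Rightarrow> real) \<Rightarrow> real \<Rightarrow> 'a::{metric_space, second_countable_topology}"
  assumes X: "X \<in> measurable gauss path_borel"
    and ad: "\<And>r s. 0 \<le> r \<Longrightarrow> r \<le> s \<Longrightarrow> (\<lambda>z. X z r) \<in> borel_measurable (hist (u s))"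
    and M: "\<And>t. 0 \<le> t \<Longrightarrow> M t \<in> borel_measurable (raw_filtration t)"
    and Y: "hmart u Y" "\<And>t z. 0 \<le> t \<Longrightarrow> M t (X z) = Y t z"
  shows "martingale (distr gauss path_borel X) raw_filtration M"
proof -
  let ?P = "distr gauss path_borel X"
  have pP: "prob_space ?P" by (rule G.prob_space_distr[OF X])
  interpret filtered_prob_space ?P raw_filtration by (rule filtered_path[OF pP]) simp
  have Mb: "M t \<in> borel_measurable path_borel" if "0 \<le> t" for t
    using measurable_F_P[OF M[OF that]] by simp
  have Xh: "X -` A \<in> sets (hist (u s))" if "0 \<le> s" "A \<in> sets (raw_filtration s)" for s A
  proof -
    have "X \<in> measurable (hist (u s)) (raw_filtration s)"
    proof (rule measurable_sigma_sets[OF sets_raw_filtration])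
      show "X \<in> space (hist (u s)) \<rightarrow> path_space" using measurable_space[OF X] by auto
      fix y :: "(real \<Rightarrow> 'a) set" assume "y \<in> {{\<omega> \<in> path_space. \<omega> r \<in> B} |r B. 0 \<le> r \<and> r \<le> s \<and> B \<in> sets borel}"
      then obtain r B where y: "y = {\<omega> \<in> path_space. \<omega> r \<in> B}" "0 \<le> r" "r \<le> s" "B \<in> sets borel" by auto
      have "X -` y \<inter> space (hist (u s)) = (\<lambda>z. X z r) -` B \<inter> space (hist (u s))"
        using measurable_space[OF X] by (auto simp: y)
      then show "X -` y \<inter> space (hist (u s)) \<in> sets (hist (u s))" using measurable_sets[OF ad[OF y(2,3)] y(4)] by simp
    qed auto
    from measurable_sets[OF this that(2)] show ?thesis by simp
  qed
  show ?thesis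
  proof (rule martingaleI[OF M])
    fix t :: real assume t: "0 \<le> t"
    have "integrable gauss (\<lambda>z. M t (X z))" using hmart_integrable[OF Y(1) t] Y(2)[OF t] by simp
    then show "integrable ?P (M t)" using X Mb[OF t] by (subst integrable_distr_eq) auto
  next
    fix s t :: real and A :: "(real \<Rightarrow> 'a) set" assume h: "0 \<le> s" "s \<le> t" "A \<in> sets (raw_filtration s)"
    have t: "0 \<le> t" using h by simp
    have A: "A \<in> sets path_borel" using h(3) raw_filtration_subset_path_borel by auto
    have F: "X -` A \<in> sets (hist (u s))" by (rule Xh[OF h(1,3)])
    have "(\<integral>\<omega>. indicator A \<omega> * (M t \<omega> - M s \<omega>) \<partial>?P) = (\<integral>z. indicator A (X z) * (M t (X z) - M s (X z)) \<partial>gauss)"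
      using X A Mb[OF t] Mb[OF h(1)] by (subst integral_distr) auto
    also have "\<dots> = (\<integral>z. indicator (X -` A) z * Y t z - indicator (X -` A) z * Y s z \<partial>gauss)"
      using Y(2) t h by (simp add: right_diff_distrib indicator_vimage[symmetric])
    also have "\<dots> = 0"
      using hmart_integrable_indicator[OF Y(1) t F] hmart_integrable_indicator[OF Y(1) h(1) F] hmart_eq[OF Y(1) h(1,2) F]
      by simp
    finally show "(\<integral>\<omega>. indicator A \<omega> * (M t \<omega> - M s \<omega>) \<partial>?P) = 0" .
  qed
qed

lemma (in filtered_prob_space) martingale_local:
  assumes M: "martingale P F M" shows "local_martingale P F M"
  unfolding local_martingale_def
proof (intro conjI exI[of _ "\<lambda>n _. real n"] allI)
  show "adapted F M" using M by (simp add: martingale_def)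
  fix n :: nat
  have ad: "M t \<in> borel_measurable (F t)" if "0 \<le> t" for t using M that by (simp add: martingale_def adapted_def)
  have mono: "f \<in> borel_measurable (F t)" if "f \<in> borel_measurable (F s)" "s \<le> t" for s t and f :: "'s \<Rightarrow> real"
    using that(1) F_mono[OF that(2)] by (auto simp: measurable_def)
  have int: "integrable P (M t)" if "0 \<le> t" for t using M that by (simp add: martingale_def)
  show "martingale P F (\<lambda>t \<omega>. M (min t (real n)) \<omega> - M 0 \<omega>)"
  proof (rule martingaleI)
    fix t :: real assume t: "0 \<le> t"
    show "(\<lambda>\<omega>. M (min t (real n)) \<omega> - M 0 \<omega>) \<in> borel_measurable (F t)"
      using t by (intro borel_measurable_diff mono[OF ad]) auto
    show "integrable P (\<lambda>\<omega>. M (min t (real n)) \<omega> - M 0 \<omega>)" using t by (intro Bochner_Integration.integrable_diff int) auto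
  next
    fix s t A assume h: "0 \<le> s" "s \<le> t" "A \<in> sets (F s)"
    show "(\<integral>\<omega>. indicator A \<omega> * ((M (min t (real n)) \<omega> - M 0 \<omega>) - (M (min s (real n)) \<omega> - M 0 \<omega>)) \<partial>P) = 0"
    proof (cases "real n \<le> s")
      case True
      then have "min t (real n) = min s (real n)" using h by simp
      then show ?thesis by simp
    next
      case False
      have i: "integrable P (\<lambda>\<omega>. indicator A \<omega> * M r \<omega>)" if "0 \<le> r" for r
        using integrable_mult_indicator[OF sets_F_P[OF h(3)] int[OF that]] by simp
      have "(\<integral>\<omega>. indicator A \<omega> * M (min t (real n)) \<omega> \<partial>P) = (\<integral>\<omega>. indicator A \<omega> * M s \<omega> \<partial>P)"
        by (rule martingale_set[OF M h(1) _ h(3)]) (use False h in auto)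
      then show ?thesis using False h i[of s] i[of "min t (real n)"] by (simp add: min_absorb1 right_diff_distrib)
    qed
  qed
qed (auto simp: stopping_time_const incseq_def filterlim_real_sequentially)

lemma finite_variation_lipschitz:
  assumes "\<And>T. 0 \<le> T \<Longrightarrow> \<exists>C\<ge>0. \<forall>s t. 0 \<le> s \<longrightarrow> s \<le> t \<longrightarrow> t \<le> T \<longrightarrow> \<bar>f t - f s\<bar> \<le> C * (t - s)"
  shows "finite_variation f"
  unfolding finite_variation_def
proof (intro allI impI)
  fix T :: real assume T: "0 \<le> T"
  obtain C where C: "0 \<le> C" "\<And>s t. 0 \<le> s \<Longrightarrow> s \<le> t \<Longrightarrow> t \<le> T \<Longrightarrow> \<bar>f t - f s\<bar> \<le> C * (t - s)"
    using assms[OF T] by blast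
  show "\<exists>B. \<forall>n s. mono s \<and> range s \<subseteq> {0..T} \<longrightarrow> (\<Sum>k<n. \<bar>f (s (Suc k)) - f (s k)\<bar>) \<le> B"
  proof (intro exI allI impI)
    fix n and s :: "nat \<Rightarrow> real" assume s: "mono s \<and> range s \<subseteq> {0..T}"
    have "s k \<in> {0..T}" for k using s rangeI[of s k] by blast
    then have b: "0 \<le> s k" "s k \<le> T" for k by auto
    have "(\<Sum>k<n. \<bar>f (s (Suc k)) - f (s k)\<bar>) \<le> (\<Sum>k<n. C * (s (Suc k) - s k))"
      using s b by (intro sum_mono C(2)) (auto simp: mono_def)
    also have "\<dots> = C * (s n - s 0)" by (simp add: sum_distrib_left[symmetric] sum_lessThan_telescope)
    also have "\<dots> \<le> C * T" using C(1) b[of n] b[of 0] by (intro mult_left_mono) auto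
    finally show "(\<Sum>k<n. \<bar>f (s (Suc k)) - f (s k)\<bar>) \<le> C * T" .
  qed
qed

lemma continuous_on_lipschitz_locally:
  fixes f :: "real \<Rightarrow> real"
  assumes "\<And>T. 0 \<le> T \<Longrightarrow> \<exists>C\<ge>0. \<forall>s t. 0 \<le> s \<longrightarrow> s \<le> t \<longrightarrow> t \<le> T \<longrightarrow> \<bar>f t - f s\<bar> \<le> C * (t - s)"
  shows "continuous_on {0..} f"
  unfolding continuous_on_iff
proof (intro ballI allI impI)
  fix t e :: real assume t: "t \<in> {0..}" and e: "0 < e"
  obtain C where C: "0 \<le> C" "\<And>r s. 0 \<le> r \<Longrightarrow> r \<le> s \<Longrightarrow> s \<le> t + 1 \<Longrightarrow> \<bar>f s - f r\<bar> \<le> C * (s - r)"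
    using assms[of "t + 1"] t by auto
  have "dist (f s) (f t) < e" if s: "s \<in> {0..}" "dist s t < min 1 (e / (C + 1))" for s
  proof -
    have d: "\<bar>s - t\<bar> < 1" "\<bar>s - t\<bar> < e / (C + 1)" using s by (auto simp: dist_real_def)
    have "\<bar>f s - f t\<bar> \<le> C * \<bar>s - t\<bar>"
      using C(2)[of s t] C(2)[of t s] s t d by (cases "s \<le> t") (auto simp: abs_minus_commute)
    also have "\<dots> \<le> (C + 1) * \<bar>s - t\<bar>" by (intro mult_right_mono) auto
    also have "\<dots> < e" using d(2) C(1) by (simp add: field_simps)
    finally show ?thesis by (simp add: dist_real_def)
  qed
  then show "\<exists>d>0. \<forall>s\<in>{0..}. dist s t < d \<longrightarrow> dist (f s) (f t) < e"
    using e C(1) by (intro exI[of _ "min 1 (e / (C + 1))"]) auto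
qed

subsection \<open>Brownian motion on a line\<close>

definition on_paths :: "(real \<Rightarrow> 'a) \<Rightarrow> real \<Rightarrow> 'a" where
  "on_paths f = (\<lambda>t. if t < 0 then undefined else f t)"

lemma on_paths_in_path_space:
  assumes "continuous_on {0..} f" shows "on_paths f \<in> path_space"
proof -
  have "continuous_on {0..} (on_paths f)" by (rule continuous_on_eq[OF assms]) (auto simp: on_paths_def)
  then show ?thesis by (auto simp: path_space_def extensional_def on_paths_def)
qed

lemma on_paths_nonneg [simp]: "0 \<le> t \<Longrightarrow> on_paths f t = f t"
  by (simp add: on_paths_def)

lemma raw_coordinate:
  "0 \<le> s \<Longrightarrow> s \<le> t \<Longrightarrow> (\<lambda>\<omega>::real \<Rightarrow> 'a::{metric_space, second_countable_topology}. \<omega> s) \<in> borel_measurable (raw_filtration t)"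
  by (rule raw_measurableI[OF coordinate_measurable]) (auto simp: agree_def)

lemma raw_component:
  "0 \<le> s \<Longrightarrow> s \<le> t \<Longrightarrow> (\<lambda>\<omega>::real \<Rightarrow> real ^ 'n. \<omega> s $ i) \<in> borel_measurable (raw_filtration t)"
  using raw_coordinate[of s t] by (rule measurable_compose[OF _ vec_nth_borel])

definition line_map :: "real ^ 'n \<Rightarrow> real ^ 'n \<Rightarrow> (nat \<times> nat \<Rightarrow> real) \<Rightarrow> real \<Rightarrow> real ^ 'n" where
  "line_map x e z = on_paths (\<lambda>t. x + W t z *\<^sub>R e)"

definition line_law :: "real ^ 'n \<Rightarrow> real ^ 'n \<Rightarrow> (real \<Rightarrow> real ^ 'n) measure" where
  "line_law x e = distr gauss path_borel (line_map x e)"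

lemma line_map_path: "line_map x e z \<in> path_space"
  unfolding line_map_def by (intro on_paths_in_path_space continuous_intros W_continuous)

lemma line_map_measurable: "line_map x e \<in> measurable gauss path_borel"
  by (rule path_measurableI[OF line_map_path]) (simp add: line_map_def)

lemma line_map_hist: "0 \<le> r \<Longrightarrow> r \<le> s \<Longrightarrow> (\<lambda>z. line_map x e z r) \<in> borel_measurable (hist s)"
  using W_hist[of r s] by (simp add: line_map_def)

lemma prob_space_line_law: "prob_space (line_law x e)"
  unfolding line_law_def by (rule G.prob_space_distr[OF line_map_measurable])

lemma sets_line_law: "sets (line_law x e) = sets path_borel"
  by (simp add: line_law_def)

lemma line_law_martingale: "martingale (line_law x e) raw_filtration (\<lambda>t \<omega>. \<omega> t $ i)"
  unfolding line_law_def
proof (rule law_martingale[where u="\<lambda>s. s", OF line_map_measurable line_map_hist])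
  show "hmart (\<lambda>s. s) (\<lambda>t z. x $ i + e $ i * W t z)" by (intro hmart_add hmart_const hmart_cmult hmart_W)
qed (auto simp: line_map_def intro: raw_component)

lemma line_law_martingale2:
  "martingale (line_law x e) raw_filtration (\<lambda>t \<omega>. \<omega> t $ i * \<omega> t $ j - t * (e $ i * e $ j))"
  unfolding line_law_def
proof (rule law_martingale[where u="\<lambda>s. s", OF line_map_measurable line_map_hist])
  show "hmart (\<lambda>s. s) (\<lambda>t z. x $ i * x $ j + ((x $ i * e $ j + x $ j * e $ i) * W t z + (e $ i * e $ j) * ((W t z)\<^sup>2 - t)))"
    by (intro hmart_add hmart_const hmart_cmult hmart_W hmart_W_square)
  show "(\<lambda>\<omega>::real \<Rightarrow> real ^ 'a. \<omega> t $ i * \<omega> t $ j - t * (e $ i * e $ j)) \<in> borel_measurable (raw_filtration t)" if "0 \<le> t" for t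
    using raw_component[OF that order.refl] by (intro borel_measurable_diff borel_measurable_times) auto
  show "line_map x e z t $ i * line_map x e z t $ j - t * (e $ i * e $ j) =
    x $ i * x $ j + ((x $ i * e $ j + x $ j * e $ i) * W t z + (e $ i * e $ j) * ((W t z)\<^sup>2 - t))" if "0 \<le> t" for t z
    using that by (simp add: line_map_def power2_eq_square algebra_simps)
qed auto

lemma AE_line_law:
  assumes "{\<omega> \<in> path_space. Q \<omega>} \<in> sets path_borel" "\<And>z. Q (line_map x e z)"
  shows "AE \<omega> in line_law x e. Q \<omega>"
  unfolding line_law_def by (subst AE_distr_iff[OF line_map_measurable]) (use assms in auto)

lemma line_law_start: "AE \<omega> in line_law x e. \<omega> 0 = x"
proof (rule AE_line_law)
  have "(\<lambda>\<omega>::real \<Rightarrow> real ^ 'a. \<omega> 0) -` {x} \<inter> space path_borel \<in> sets path_borel"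
    by (rule measurable_sets[OF coordinate_measurable]) auto
  then show "{\<omega> \<in> path_space. \<omega> 0 = x} \<in> sets path_borel" by (simp add: vimage_def Int_def conj_commute)
qed (simp add: line_map_def W_0)

lemma trace_outer: "norm (e :: real ^ 'n) = 1 \<Longrightarrow> (\<Sum>i\<in>UNIV. e $ i * e $ i) = 1"
  using power2_norm_eq_inner[of e] by (simp add: inner_vec_def)

lemma line_law_bracket:
  assumes e: "norm e = 1"
  shows "is_bracket (line_law x e) raw_filtration (\<lambda>t \<omega>. \<omega> t) (\<lambda>t \<omega>. \<chi> i j. t * (e $ i * e $ j))"
  unfolding is_bracket_def
proof (intro allI conjI)
  fix i j
  interpret filtered_prob_space "line_law x e" raw_filtration
    by (rule filtered_path[OF prob_space_line_law sets_line_law])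
  have L: "\<exists>C\<ge>0. \<forall>s t. 0 \<le> s \<longrightarrow> s \<le> t \<longrightarrow> t \<le> T \<longrightarrow> \<bar>t * (e $ i * e $ j) - s * (e $ i * e $ j)\<bar> \<le> C * (t - s)" for T
    by (rule exI[of _ "\<bar>e $ i * e $ j\<bar>"]) (auto simp: left_diff_distrib[symmetric] abs_mult)
  show "adapted raw_filtration (\<lambda>t \<omega>. (\<chi> i j. t * (e $ i * e $ j)) $ i $ j)" by (simp add: adapted_def)
  show "AE \<omega> in line_law x e. (\<chi> i j. 0 * (e $ i * e $ j)) $ i $ j = 0 \<and>
     continuous_on {0..} (\<lambda>t. (\<chi> i j. t * (e $ i * e $ j)) $ i $ j) \<and>
     finite_variation (\<lambda>t. (\<chi> i j. t * (e $ i * e $ j)) $ i $ j)"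
    using finite_variation_lipschitz[OF L] by (auto intro!: continuous_intros)
  show "local_martingale (line_law x e) raw_filtration (\<lambda>t \<omega>. \<omega> t $ i * \<omega> t $ j - (\<chi> i j. t * (e $ i * e $ j)) $ i $ j)"
    using martingale_local[OF line_law_martingale2[of x e i j]] by simp
qed

lemma line_law_in_martingale_laws: "norm e = 1 \<Longrightarrow> line_law x e \<in> martingale_laws x"
  unfolding martingale_laws_def
  using prob_space_line_law[of x e] sets_line_law[of x e] line_law_martingale[of x e] line_law_start[of x e] line_law_bracket[of e x]
  by (auto simp: trace_def trace_outer sum_distrib_left[symmetric] intro!: exI[of _ "\<lambda>t \<omega>. \<chi> i j. t * (e $ i * e $ j)"])

subsection \<open>Time integrals along paths\<close>

lemma integral_eq_lebesgue:
  fixes h :: "real \<Rightarrow> real"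
  assumes "continuous_on {a..b} h"
  shows "integral {a..b} h = (\<integral>r. indicator {a..b} r * h r \<partial>lborel)"
    "integrable lborel (\<lambda>r. indicator {a..b} r * h r)"
proof -
  have s: "set_integrable lborel {a..b} h" by (rule borel_integrable_atLeastAtMost'[OF assms])
  show "integral {a..b} h = (\<integral>r. indicator {a..b} r * h r \<partial>lborel)"
    using set_borel_integral_eq_integral(2)[OF s] by (simp add: set_lebesgue_integral_def)
  show "integrable lborel (\<lambda>r. indicator {a..b} r * h r)"
    using s by (simp add: set_integrable_def)
qed

lemma integral_locally_lipschitz:
  fixes h :: "real \<Rightarrow> real"
  assumes h: "continuous_on {0..} h" and T: "0 \<le> T"
  shows "\<exists>C\<ge>0. \<forall>s t. 0 \<le> s \<longrightarrow> s \<le> t \<longrightarrow> t \<le> T \<longrightarrow> \<bar>integral {0..t} h - integral {0..s} h\<bar> \<le> C * (t - s)"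
proof -
  have "bounded (h ` {0..T})"
    by (intro compact_imp_bounded compact_continuous_image continuous_on_subset[OF h]) auto
  then obtain C where C: "0 < C" "\<And>r. r \<in> {0..T} \<Longrightarrow> \<bar>h r\<bar> \<le> C" unfolding bounded_pos by auto
  show ?thesis
  proof (intro exI[of _ C] conjI allI impI)
    fix s t :: real assume st: "0 \<le> s" "s \<le> t" "t \<le> T"
    have i: "h integrable_on {a..b}" if "0 \<le> a" for a b
      using that by (intro integrable_continuous_real continuous_on_subset[OF h]) auto
    have "integral {0..s} h + integral {s..t} h = integral {0..t} h"
      by (rule Henstock_Kurzweil_Integration.integral_combine) (use st i in auto)
    then have "\<bar>integral {0..t} h - integral {0..s} h\<bar> = \<bar>integral {s..t} h\<bar>" by simp
    also have "\<dots> \<le> C * (t - s)"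
      using integral_bound[of s t h C] st C continuous_on_subset[OF h, of "{s..t}"] by auto
    finally show "\<bar>integral {0..t} h - integral {0..s} h\<bar> \<le> C * (t - s)" .
  qed (use C in simp)
qed

lemma path_integral_raw_measurable:
  fixes \<phi> :: "real \<Rightarrow> 'a::{metric_space, second_countable_topology} \<Rightarrow> real"
  assumes m: "(\<lambda>p. \<phi> (fst p) (snd p)) \<in> borel_measurable (borel \<Otimes>\<^sub>M borel)"
    and c: "\<And>\<omega>. \<omega> \<in> path_space \<Longrightarrow> continuous_on {0..} (\<lambda>r. \<phi> r (\<omega> r))" and t: "0 \<le> t"
  shows "(\<lambda>\<omega>. integral {0..t} (\<lambda>r. \<phi> r (\<omega> r))) \<in> borel_measurable (raw_filtration t)"
proof (rule raw_measurableI[OF _ t])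
  have ev: "(\<lambda>p. fst p (max 0 (snd p))) \<in> borel_measurable ((path_borel :: (real \<Rightarrow> 'a) measure) \<Otimes>\<^sub>M (lborel :: real measure))"
    by (rule measurable_path_eval[OF measurable_fst, of "\<lambda>p. max 0 (snd p)"]) auto
  have "(\<lambda>p. (max 0 (snd p), fst p (max 0 (snd p)))) \<in> measurable ((path_borel :: (real \<Rightarrow> 'a) measure) \<Otimes>\<^sub>M (lborel :: real measure)) (borel \<Otimes>\<^sub>M borel)"
    using ev by (intro measurable_Pair) auto
  from measurable_compose[OF this m]
  have "(\<lambda>p. \<phi> (max 0 (snd p)) (fst p (max 0 (snd p)))) \<in> borel_measurable ((path_borel :: (real \<Rightarrow> 'a) measure) \<Otimes>\<^sub>M (lborel :: real measure))" by simp
  then have "(\<lambda>p. indicator {0..t} (snd p) * \<phi> (max 0 (snd p)) (fst p (max 0 (snd p)))) \<in> borel_measurable ((path_borel :: (real \<Rightarrow> 'a) measure) \<Otimes>\<^sub>M (lborel :: real measure))"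
    by (intro borel_measurable_times) auto
  then have m': "(\<lambda>\<omega>. \<integral>r. indicator {0..t} r * \<phi> (max 0 r) (\<omega> (max 0 r)) \<partial>lborel) \<in> borel_measurable path_borel"
    by (intro lborel.borel_measurable_lebesgue_integral) (simp add: case_prod_beta)
  have "integral {0..t} (\<lambda>r. \<phi> r (\<omega> r)) = (\<integral>r. indicator {0..t} r * \<phi> (max 0 r) (\<omega> (max 0 r)) \<partial>lborel)"
    if "\<omega> \<in> space path_borel" for \<omega>
  proof -
    have "continuous_on {0..t} (\<lambda>r. \<phi> r (\<omega> r))" using c[of \<omega>] that by (auto intro: continuous_on_subset)
    then have "integral {0..t} (\<lambda>r. \<phi> r (\<omega> r)) = (\<integral>r. indicator {0..t} r * \<phi> r (\<omega> r) \<partial>lborel)"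
      by (rule integral_eq_lebesgue)
    also have "\<dots> = (\<integral>r. indicator {0..t} r * \<phi> (max 0 r) (\<omega> (max 0 r)) \<partial>lborel)"
      by (rule Bochner_Integration.integral_cong) (auto simp: indicator_def max_def)
    finally show ?thesis .
  qed
  note e = this
  show "(\<lambda>\<omega>. integral {0..t} (\<lambda>r. \<phi> r (\<omega> r))) \<in> borel_measurable path_borel"
    by (rule measurable_cong[THEN iffD2, OF e m'])
  fix \<omega> \<eta> :: "real \<Rightarrow> 'a" assume "agree t \<omega> \<eta>"
  then show "integral {0..t} (\<lambda>r. \<phi> r (\<omega> r)) = integral {0..t} (\<lambda>r. \<phi> r (\<eta> r))"
    by (intro Henstock_Kurzweil_Integration.integral_cong) (auto simp: agree_def)
qed

subsection \<open>Motion along expanding circles\<close>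

definition clock :: "real \<Rightarrow> real \<Rightarrow> real" where "clock s0 t = ln (1 + t / s0)"

lemma clock:
  assumes "0 < s0" "0 \<le> s" "s \<le> t"
  shows "0 \<le> clock s0 s" "clock s0 s \<le> clock s0 t" "exp (- c * (clock s0 t - clock s0 s)) = ((s0 + s) / (s0 + t)) powr c"
proof -
  have p: "0 < 1 + s / s0" "1 + s / s0 \<le> 1 + t / s0" "1 \<le> 1 + s / s0" using assms by (auto simp: divide_right_mono add_pos_nonneg)
  show "0 \<le> clock s0 s" "clock s0 s \<le> clock s0 t" using p by (simp_all add: clock_def)
  have "1 + s / s0 = (s0 + s) / s0" "1 + t / s0 = (s0 + t) / s0" using assms by (simp_all add: add_divide_distrib)
  then have q: "(1 + s / s0) / (1 + t / s0) = (s0 + s) / (s0 + t)" using assms by simp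
  have "- c * (clock s0 t - clock s0 s) = c * ln ((1 + s / s0) / (1 + t / s0))"
    using p by (simp add: clock_def ln_div algebra_simps)
  then show "exp (- c * (clock s0 t - clock s0 s)) = ((s0 + s) / (s0 + t)) powr c"
    using assms unfolding q by (simp add: powr_def)
qed

lemma clock_continuous:
  assumes "0 < s0" shows "continuous_on {0..} (clock s0)"
proof -
  have "1 + t / s0 \<noteq> 0" "s0 \<noteq> 0" if "t \<in> {0..}" for t
    using that assms add_pos_nonneg[of 1 "t / s0"] by auto
  then show ?thesis unfolding clock_def by (intro continuous_intros) auto
qed

lemma W_clock_continuous:
  assumes "0 < s0" shows "continuous_on {0..} (\<lambda>t. W (clock s0 t) z)"
  by (rule continuous_on_compose2[OF W_continuous clock_continuous[OF assms]]) (use clock(1)[OF assms] in auto)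

lemma W_clock_joint:
  assumes "0 < s0" shows "(\<lambda>p. W (clock s0 (max 0 (snd p))) (fst p)) \<in> borel_measurable (gauss \<Otimes>\<^sub>M (lborel :: real measure))"
proof -
  have "(\<lambda>z. on_paths (\<lambda>t. W t z)) \<in> measurable gauss path_borel"
    by (rule path_measurableI[OF on_paths_in_path_space[OF W_continuous]]) simp
  from measurable_compose[OF measurable_fst this]
  have m: "(\<lambda>p. on_paths (\<lambda>t. W t (fst p))) \<in> measurable (gauss \<Otimes>\<^sub>M (lborel :: real measure)) path_borel" .
  have "(\<lambda>p. on_paths (\<lambda>t. W t (fst p)) (clock s0 (max 0 (snd p)))) \<in> borel_measurable (gauss \<Otimes>\<^sub>M (lborel :: real measure))"
  proof (rule measurable_path_eval[OF m])
    show "(\<lambda>p. clock s0 (max 0 (snd p))) \<in> borel_measurable (gauss \<Otimes>\<^sub>M (lborel :: real measure))"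
      by (simp add: clock_def)
    show "0 \<le> clock s0 (max 0 (snd p))" for p :: "(nat \<times> nat \<Rightarrow> real) \<times> real"
      using clock(1)[OF assms, of "max 0 (snd p)" "max 0 (snd p)"] by simp
  qed
  moreover have "0 \<le> clock s0 (max 0 r)" for r using clock(1)[OF assms, of "max 0 r" "max 0 r"] by simp
  ultimately show ?thesis by simp
qed

lemma hmart_circle_linear:
  assumes s0: "0 < s0" and f: "f = cos \<or> f = sin"
  shows "hmart (clock s0) (\<lambda>t z. sqrt (s0 + t) * f (W (clock s0 t) z))"
proof (rule hmartI)
  have fb: "\<bar>f x\<bar> \<le> 1" for x using f by auto
  have [measurable]: "f \<in> borel_measurable borel" using f by (elim disjE) (simp_all only:, measurable)
  fix t :: real assume "0 \<le> t"
  show "integrable gauss (\<lambda>z. sqrt (s0 + t) * f (W (clock s0 t) z))"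
    by (intro integrable_mult_right G.integrable_const_bound[of _ 1]) (use fb in auto)
next
  fix s t F assume h: "0 \<le> s" "s \<le> t" "F \<in> sets (hist (clock s0 s))"
  note c = clock[OF s0 h(1,2)]
  have p: "0 < s0 + s" "0 < s0 + t" using s0 h by auto
  have "(\<integral>z. indicator F z * f (1 * W (clock s0 t) z) \<partial>gauss) =
      exp (- 1\<^sup>2 * (clock s0 t - clock s0 s) / 2) * (\<integral>z. indicator F z * f (1 * W (clock s0 s) z) \<partial>gauss)"
    using f by (elim disjE) (simp_all only: W_trig[OF c(1,2) h(3)])
  moreover have "exp (- 1\<^sup>2 * (clock s0 t - clock s0 s) / 2) = sqrt (s0 + s) / sqrt (s0 + t)"
  proof -
    have "- 1\<^sup>2 * (clock s0 t - clock s0 s) / 2 = - (1 / 2) * (clock s0 t - clock s0 s)" by (simp add: field_simps)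
    then have "exp (- 1\<^sup>2 * (clock s0 t - clock s0 s) / 2) = ((s0 + s) / (s0 + t)) powr (1 / 2)" by (simp only: c(3))
    then show ?thesis using p by (simp add: powr_half_sqrt real_sqrt_divide)
  qed
  ultimately have e: "sqrt (s0 + t) * (\<integral>z. indicator F z * f (W (clock s0 t) z) \<partial>gauss) =
      sqrt (s0 + s) * (\<integral>z. indicator F z * f (W (clock s0 s) z) \<partial>gauss)"
    using p by simp
  have "(\<integral>z. indicator F z * (sqrt (s0 + r) * f (W (clock s0 r) z)) \<partial>gauss) = sqrt (s0 + r) * (\<integral>z. indicator F z * f (W (clock s0 r) z) \<partial>gauss)" for r
  proof -
    have "(\<lambda>z. indicator F z * (sqrt (s0 + r) * f (W (clock s0 r) z))) = (\<lambda>z. sqrt (s0 + r) * (indicator F z * f (W (clock s0 r) z)))"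
      by (rule ext) (simp only: mult.left_commute)
    then show ?thesis by (simp only: integral_mult_right_zero)
  qed
  then show "(\<integral>z. indicator F z * (sqrt (s0 + t) * f (W (clock s0 t) z)) \<partial>gauss) =
    (\<integral>z. indicator F z * (sqrt (s0 + s) * f (W (clock s0 s) z)) \<partial>gauss)" using e by (simp only:)
qed

text \<open>With \<open>\<theta>\<close> the Brownian motion run at speed \<open>1 / (s\<^sub>0 + t)\<close>, the drift of \<open>(s\<^sub>0 + t) exp (2 i \<theta>)\<close> is
  \<open>- exp (2 i \<theta>)\<close>.\<close>

lemma hmart_circle_quadratic:
  assumes s0: "0 < s0" and f: "f = cos \<or> f = sin"
  shows "hmart (clock s0) (\<lambda>t z. (s0 + t) * f (2 * W (clock s0 t) z) + integral {0..t} (\<lambda>r. f (2 * W (clock s0 r) z)))"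
proof (rule hmartI)
  have fb: "\<bar>f x\<bar> \<le> 1" for x using f by auto
  have fm [measurable]: "f \<in> borel_measurable borel" using f by (elim disjE) (simp_all only:, measurable)
  have fc: "continuous_on UNIV f" using f by (elim disjE) (auto intro!: continuous_at_imp_continuous_on)
  define g where "g = (\<lambda>r z. f (2 * W (clock s0 r) z))"
  have gm [measurable]: "g r \<in> borel_measurable gauss" for r unfolding g_def by measurable
  have gb: "\<bar>g r z\<bar> \<le> 1" for r z by (simp add: g_def fb)
  have gc: "continuous_on {0..} (\<lambda>r. g r z)" for z
    unfolding g_def by (rule continuous_on_compose2[OF fc]) (auto intro!: continuous_intros W_clock_continuous[OF s0])
  have gj: "(\<lambda>p. g (max 0 (snd p)) (fst p)) \<in> borel_measurable (gauss \<Otimes>\<^sub>M (lborel :: real measure))"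
  proof -
    have "(\<lambda>p. 2 * W (clock s0 (max 0 (snd p))) (fst p)) \<in> borel_measurable (gauss \<Otimes>\<^sub>M (lborel :: real measure))"
      by (intro borel_measurable_times W_clock_joint[OF s0]) auto
    from measurable_compose[OF this fm] show ?thesis by (simp add: g_def)
  qed
  have gint: "integral {a..b} (\<lambda>r. g r z) = (\<integral>r. indicator {a..b} r * g (max 0 r) z \<partial>lborel)" if "0 \<le> a" for a b z
  proof -
    have "integral {a..b} (\<lambda>r. g r z) = (\<integral>r. indicator {a..b} r * g r z \<partial>lborel)"
      by (rule integral_eq_lebesgue) (use that in \<open>auto intro: continuous_on_subset[OF gc]\<close>)
    also have "\<dots> = (\<integral>r. indicator {a..b} r * g (max 0 r) z \<partial>lborel)"
      by (rule Bochner_Integration.integral_cong) (use that in \<open>auto simp: indicator_def max_def\<close>)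
    finally show ?thesis .
  qed
  have im: "(\<lambda>z. integral {a..b} (\<lambda>r. g r z)) \<in> borel_measurable gauss" if "0 \<le> a" for a b
  proof -
    have "(\<lambda>p. indicator {a..b} (snd p) * g (max 0 (snd p)) (fst p)) \<in> borel_measurable (gauss \<Otimes>\<^sub>M (lborel :: real measure))"
      using gj by (intro borel_measurable_times) auto
    then show ?thesis unfolding gint[OF that]
      by (intro lborel.borel_measurable_lebesgue_integral) (simp add: case_prod_beta)
  qed
  have ib: "\<bar>integral {a..b} (\<lambda>r. g r z)\<bar> \<le> b - a" if "0 \<le> a" "a \<le> b" for a b z
    using integral_bound[of a b "\<lambda>r. g r z" 1] that gb continuous_on_subset[OF gc, of "{a..b}" z] by auto
  have ii: "integrable gauss (\<lambda>z. integral {a..b} (\<lambda>r. g r z))" if "0 \<le> a" "a \<le> b" for a b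
    by (rule G.integrable_const_bound[of _ "b - a"]) (use ib im that in auto)
  have gi: "integrable gauss (g r)" for r
    by (rule G.integrable_const_bound[of _ 1]) (use gb in auto)
  fix t :: real
  {
    assume t: "0 \<le> t"
    have "integrable gauss (\<lambda>z. (s0 + t) * g t z + integral {0..t} (\<lambda>r. g r z))"
      using gi ii[of 0 t] t by (intro Bochner_Integration.integrable_add integrable_mult_right) auto
    then show "integrable gauss (\<lambda>z. (s0 + t) * f (2 * W (clock s0 t) z) + integral {0..t} (\<lambda>r. f (2 * W (clock s0 r) z)))"
      unfolding g_def .
  }
  fix s F assume h: "0 \<le> s" "s \<le> t" "F \<in> sets (hist (clock s0 s))"
  have F: "F \<in> sets gauss" using h(3) hist_gauss by auto
  have t: "0 \<le> t" using h by simp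
  define c where "c = (\<integral>z. indicator F z * g s z \<partial>gauss)"
  have cr: "(\<integral>z. indicator F z * g r z \<partial>gauss) = ((s0 + s) / (s0 + r))\<^sup>2 * c" if r: "s \<le> r" for r
  proof -
    note k = clock[OF s0 h(1) r]
    have "(\<integral>z. indicator F z * g r z \<partial>gauss) = exp (- 2\<^sup>2 * (clock s0 r - clock s0 s) / 2) * c"
      unfolding c_def g_def using f by (elim disjE) (simp_all only: W_trig[OF k(1,2) h(3)])
    also have "exp (- 2\<^sup>2 * (clock s0 r - clock s0 s) / 2) = ((s0 + s) / (s0 + r)) powr 2"
      unfolding k(3)[of 2, symmetric] by simp
    also have "\<dots> = ((s0 + s) / (s0 + r))\<^sup>2" using s0 h r by (intro powr_numeral) auto
    finally show ?thesis .
  qed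
  have iF: "integrable gauss (\<lambda>z. indicator F z * X z)" if "integrable gauss X" for X :: "_ \<Rightarrow> real"
    using integrable_mult_indicator[OF F that] by simp
  have mid: "(\<integral>z. indicator F z * integral {s..t} (\<lambda>r. g r z) \<partial>gauss) = c * (s0 + s) - c * (s0 + s)\<^sup>2 / (s0 + t)"
  proof -
    interpret GL: pair_sigma_finite lborel gauss
      unfolding pair_sigma_finite_def using lborel.sigma_finite_measure_axioms G.sigma_finite_measure_axioms by simp
    define H where "H = (\<lambda>(r::real) z. indicator F z * (indicator {s..t} r * g (max 0 r) z))"
    have Hm: "case_prod H \<in> borel_measurable (lborel \<Otimes>\<^sub>M gauss)"
    proof -
      have "(\<lambda>p. g (max 0 (fst p)) (snd p)) \<in> borel_measurable (lborel \<Otimes>\<^sub>M gauss)"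
        using measurable_compose[OF measurable_pair_swap' gj] by (simp add: case_prod_beta)
      moreover have "(\<lambda>p. indicator F (snd p) :: real) \<in> borel_measurable ((lborel :: real measure) \<Otimes>\<^sub>M gauss)"
        using F by measurable
      ultimately show ?thesis unfolding H_def case_prod_beta by (intro borel_measurable_times) auto
    qed
    have Hi: "integrable (lborel \<Otimes>\<^sub>M gauss) (case_prod H)"
    proof (rule GL.Fubini_integrable[OF Hm])
      have b: "\<bar>(\<integral>z. norm (H r z) \<partial>gauss)\<bar> \<le> indicator {s..t} r" for r
      proof -
        have "(\<integral>z. norm (H r z) \<partial>gauss) \<le> (\<integral>z. indicator {s..t} r \<partial>gauss)"
        proof (rule integral_mono)
          show "integrable gauss (\<lambda>z. norm (H r z))"
            unfolding H_def using iF[OF gi, of "max 0 r"] by (auto simp: indicator_def intro!: integrable_norm)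
          show "norm (H r z) \<le> indicator {s..t} r" for z
            unfolding H_def using gb by (auto simp: indicator_def)
        qed simp
        moreover have "0 \<le> (\<integral>z. norm (H r z) \<partial>gauss)" by (rule Bochner_Integration.integral_nonneg) simp
        ultimately show ?thesis using G.prob_space by simp
      qed
      show "integrable lborel (\<lambda>r. \<integral>z. norm (case_prod H (r, z)) \<partial>gauss)"
      proof (rule Bochner_Integration.integrable_bound)
        show "integrable lborel (indicator {s..t} :: real \<Rightarrow> real)"
          by (rule integrable_real_indicator) (auto simp: emeasure_lborel_Icc_eq)
        show "(\<lambda>r. \<integral>z. norm (case_prod H (r, z)) \<partial>gauss) \<in> borel_measurable lborel"
          using Hm by (intro G.borel_measurable_lebesgue_integral) (simp add: case_prod_beta)
        show "AE r in lborel. norm (\<integral>z. norm (case_prod H (r, z)) \<partial>gauss) \<le> norm (indicator {s..t} r :: real)"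
          using b by simp
      qed
      show "AE r in lborel. integrable gauss (\<lambda>z. case_prod H (r, z))"
      proof (rule AE_I2)
        fix r show "integrable gauss (\<lambda>z. case_prod H (r, z))"
          unfolding H_def using iF[OF gi, of "max 0 r"] by (auto simp: indicator_def)
      qed
    qed
    have "(\<integral>z. indicator F z * integral {s..t} (\<lambda>r. g r z) \<partial>gauss) = (\<integral>z. \<integral>r. H r z \<partial>lborel \<partial>gauss)"
      unfolding gint[OF h(1)] H_def by (simp only: integral_mult_right_zero)
    also have "\<dots> = (\<integral>r. \<integral>z. H r z \<partial>gauss \<partial>lborel)" by (rule GL.Fubini_integral[OF Hi])
    also have "\<dots> = (\<integral>r. (c * (s0 + s)\<^sup>2 / (s0 + max 0 r)\<^sup>2) * indicator {s..t} r \<partial>lborel)"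
    proof (rule Bochner_Integration.integral_cong[OF refl])
      fix r :: real
      show "(\<integral>z. H r z \<partial>gauss) = (c * (s0 + s)\<^sup>2 / (s0 + max 0 r)\<^sup>2) * indicator {s..t} r"
      proof (cases "r \<in> {s..t}")
        case True
        then have "H r = (\<lambda>z. indicator F z * g r z)" using h by (auto simp: H_def max_def)
        then show ?thesis using cr[of r] True h by (simp add: power_divide max_def)
      qed (simp add: H_def)
    qed
    also have "\<dots> = (\<integral>r. (c * (s0 + s)\<^sup>2 / (s0 + \<bar>r\<bar>)\<^sup>2) * indicator {s..t} r \<partial>lborel)"
      by (rule Bochner_Integration.integral_cong[OF refl]) (use h in \<open>auto simp: indicator_def\<close>)
    also have "\<dots> = - (c * (s0 + s)\<^sup>2) / (s0 + t) - - (c * (s0 + s)\<^sup>2) / (s0 + s)"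
    proof (rule integral_FTC_Icc_real[OF h(2)])
      fix r assume r: "s \<le> r" "r \<le> t"
      have "s0 + r \<noteq> 0" "\<bar>r\<bar> = r" using r h s0 by auto
      then show "DERIV (\<lambda>r. - (c * (s0 + s)\<^sup>2) / (s0 + r)) r :> c * (s0 + s)\<^sup>2 / (s0 + \<bar>r\<bar>)\<^sup>2"
        by (auto intro!: derivative_eq_intros simp: power2_eq_square field_simps)
    next
      fix r :: real
      have "s0 + \<bar>r\<bar> \<noteq> 0" using s0 by auto
      then show "isCont (\<lambda>r. c * (s0 + s)\<^sup>2 / (s0 + \<bar>r\<bar>)\<^sup>2) r" by (intro continuous_intros) auto
    qed
    also have "\<dots> = c * (s0 + s) - c * (s0 + s)\<^sup>2 / (s0 + t)"
    proof -
      have "- (c * A\<^sup>2) / B - - (c * A\<^sup>2) / A = c * A - c * A\<^sup>2 / B" if "A \<noteq> 0" for A B :: real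
        using that by (simp add: power2_eq_square)
      from this[of "s0 + s" "s0 + t"] show ?thesis using s0 h by simp
    qed
    finally show ?thesis .
  qed
  have split: "integral {0..t} (\<lambda>r. g r z) = integral {0..s} (\<lambda>r. g r z) + integral {s..t} (\<lambda>r. g r z)" for z
    by (rule Henstock_Kurzweil_Integration.integral_combine[symmetric])
      (use h continuous_on_subset[OF gc, of "{0..t}" z] in \<open>auto intro!: integrable_continuous_real\<close>)
  have "(\<integral>z. indicator F z * ((s0 + t) * g t z + integral {0..t} (\<lambda>r. g r z)) \<partial>gauss) =
    (\<integral>z. (s0 + t) * (indicator F z * g t z) + (indicator F z * integral {0..s} (\<lambda>r. g r z) + indicator F z * integral {s..t} (\<lambda>r. g r z)) \<partial>gauss)"
    unfolding split by (simp add: algebra_simps)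
  also have "\<dots> = (s0 + t) * (\<integral>z. indicator F z * g t z \<partial>gauss) + ((\<integral>z. indicator F z * integral {0..s} (\<lambda>r. g r z) \<partial>gauss) + (\<integral>z. indicator F z * integral {s..t} (\<lambda>r. g r z) \<partial>gauss))"
    using iF[OF gi] iF[OF ii] h by simp
  also have "\<dots> = (s0 + s) * c + (\<integral>z. indicator F z * integral {0..s} (\<lambda>r. g r z) \<partial>gauss)"
  proof -
    have "B * ((A / B)\<^sup>2 * c) = c * A\<^sup>2 / B" if "B \<noteq> 0" for A B :: real
      using that by (simp add: power2_eq_square field_simps)
    from this[of "s0 + t" "s0 + s"] show ?thesis
      unfolding mid cr[OF h(2)] using s0 h by simp
  qed
  also have "\<dots> = (\<integral>z. (s0 + s) * (indicator F z * g s z) + indicator F z * integral {0..s} (\<lambda>r. g r z) \<partial>gauss)"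
    unfolding c_def using iF[OF gi] iF[OF ii] h by simp
  also have "\<dots> = (\<integral>z. indicator F z * ((s0 + s) * g s z + integral {0..s} (\<lambda>r. g r z)) \<partial>gauss)"
    by (simp add: algebra_simps)
  finally show "(\<integral>z. indicator F z * ((s0 + t) * f (2 * W (clock s0 t) z) + integral {0..t} (\<lambda>r. f (2 * W (clock s0 r) z))) \<partial>gauss) =
    (\<integral>z. indicator F z * ((s0 + s) * f (2 * W (clock s0 s) z) + integral {0..s} (\<lambda>r. f (2 * W (clock s0 r) z))) \<partial>gauss)"
    unfolding g_def .
qed

locale circle =
  fixes x e1 e2 :: "real ^ 'n" and s0 :: real
  assumes s0: "0 < s0" and e1: "norm e1 = 1" and e2: "norm e2 = 1" and e12: "e1 \<bullet> e2 = 0"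
begin

definition cmap :: "(nat \<times> nat \<Rightarrow> real) \<Rightarrow> real \<Rightarrow> real ^ 'n" where
  "cmap z = on_paths (\<lambda>t. x + (sqrt (s0 + t) * cos (W (clock s0 t) z)) *\<^sub>R e1 + (sqrt (s0 + t) * sin (W (clock s0 t) z)) *\<^sub>R e2)"

definition claw :: "(real \<Rightarrow> real ^ 'n) measure" where
  "claw = distr gauss path_borel cmap"

definition c1 :: "real ^ 'n \<Rightarrow> real" where "c1 v = (v - x) \<bullet> e1"
definition c2 :: "real ^ 'n \<Rightarrow> real" where "c2 v = (v - x) \<bullet> e2"

definition cos2 :: "real \<Rightarrow> real ^ 'n \<Rightarrow> real" where "cos2 r v = ((c1 v)\<^sup>2 - (c2 v)\<^sup>2) / (s0 + \<bar>r\<bar>)"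
definition sin2 :: "real \<Rightarrow> real ^ 'n \<Rightarrow> real" where "sin2 r v = 2 * c1 v * c2 v / (s0 + \<bar>r\<bar>)"

definition cbr :: "real \<Rightarrow> (real \<Rightarrow> real ^ 'n) \<Rightarrow> real ^ 'n ^ 'n" where
  "cbr t \<omega> = (\<chi> i j. t / 2 * (e1 $ i * e1 $ j + e2 $ i * e2 $ j)
     - integral {0..t} (\<lambda>r. cos2 r (\<omega> r)) / 2 * (e1 $ i * e1 $ j - e2 $ i * e2 $ j)
     - integral {0..t} (\<lambda>r. sin2 r (\<omega> r)) / 2 * (e1 $ i * e2 $ j + e2 $ i * e1 $ j))"

lemma cmap_path: "cmap z \<in> path_space"
  unfolding cmap_def using s0
  by (intro on_paths_in_path_space continuous_intros W_clock_continuous[OF s0])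

lemma cmap_measurable: "cmap \<in> measurable gauss path_borel"
  by (rule path_measurableI[OF cmap_path]) (simp add: cmap_def)

lemma cmap_hist: "0 \<le> r \<Longrightarrow> r \<le> s \<Longrightarrow> (\<lambda>z. cmap z r) \<in> borel_measurable (hist (clock s0 s))"
  using W_hist[OF clock(1,2)[OF s0, of r s]] by (simp add: cmap_def)

lemma prob_space_claw: "prob_space claw"
  unfolding claw_def by (rule G.prob_space_distr[OF cmap_measurable])

lemma sets_claw: "sets claw = sets path_borel"
  by (simp add: claw_def)

lemma AE_claw:
  assumes "{\<omega> \<in> path_space. Q \<omega>} \<in> sets path_borel" "\<And>z. Q (cmap z)"
  shows "AE \<omega> in claw. Q \<omega>"
  unfolding claw_def by (subst AE_distr_iff[OF cmap_measurable]) (use assms in auto)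

lemma e_self: "e1 \<bullet> e1 = 1" "e2 \<bullet> e2 = 1" "e2 \<bullet> e1 = 0"
  using power2_norm_eq_inner[of e1] power2_norm_eq_inner[of e2] e1 e2 e12 by (simp_all add: inner_commute)

lemma cmap_coords:
  assumes "0 \<le> t"
  shows "c1 (cmap z t) = sqrt (s0 + t) * cos (W (clock s0 t) z)" "c2 (cmap z t) = sqrt (s0 + t) * sin (W (clock s0 t) z)"
  using assms by (simp_all add: c1_def c2_def cmap_def inner_add_left e_self e12)

lemma cmap_double_angle:
  assumes "0 \<le> t"
  shows "cos2 t (cmap z t) = cos (2 * W (clock s0 t) z)" "sin2 t (cmap z t) = sin (2 * W (clock s0 t) z)"
proof -
  have p: "0 < s0 + t" using s0 assms by simp
  show "cos2 t (cmap z t) = cos (2 * W (clock s0 t) z)"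
    using p assms unfolding cos2_def cmap_coords[OF assms] cos_double
    by (simp add: power_mult_distrib right_diff_distrib[symmetric])
  have sq: "sqrt (s0 + t) * sqrt (s0 + t) = s0 + t" using p by simp
  have "2 * (r * c) * (r * s) = (r * r) * (2 * s * c)" for r c s :: real by simp
  from this[of "sqrt (s0 + t)" "cos (W (clock s0 t) z)" "sin (W (clock s0 t) z)"]
  have e: "2 * (sqrt (s0 + t) * cos (W (clock s0 t) z)) * (sqrt (s0 + t) * sin (W (clock s0 t) z)) =
    (s0 + t) * (2 * sin (W (clock s0 t) z) * cos (W (clock s0 t) z))" unfolding sq .
  show "sin2 t (cmap z t) = sin (2 * W (clock s0 t) z)"
    unfolding sin2_def cmap_coords[OF assms] sin_double e using p assms by simp
qed

lemma cmap_norm: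
  assumes "0 \<le> t" shows "(norm (cmap z t - x))\<^sup>2 = s0 + t"
proof -
  have p: "0 < s0 + t" using s0 assms by simp
  have "cmap z t - x = c1 (cmap z t) *\<^sub>R e1 + c2 (cmap z t) *\<^sub>R e2"
    unfolding cmap_coords[OF assms] using assms by (simp add: cmap_def)
  then have "(norm (cmap z t - x))\<^sup>2 = (c1 (cmap z t))\<^sup>2 + (c2 (cmap z t))\<^sup>2"
    unfolding power2_norm_eq_inner by (simp add: inner_add_left inner_add_right e_self e12 power2_eq_square)
  also have "\<dots> = (s0 + t) * ((cos (W (clock s0 t) z))\<^sup>2 + (sin (W (clock s0 t) z))\<^sup>2)"
    unfolding cmap_coords[OF assms]
    by (simp only: power_mult_distrib real_sqrt_pow2[OF less_imp_le[OF p]] distrib_left)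
  finally show ?thesis by simp
qed

lemma cmap_in_plane:
  assumes "0 \<le> t" shows "cmap z t - x \<in> span {e1, e2}"
  using assms by (simp add: cmap_def span_add span_scale span_base)

lemma c_measurable [measurable]: "c1 \<in> borel_measurable borel" "c2 \<in> borel_measurable borel"
  unfolding c1_def[abs_def] c2_def[abs_def] by measurable

lemma double_angle_joint:
  "(\<lambda>p. cos2 (fst p) (snd p)) \<in> borel_measurable (borel \<Otimes>\<^sub>M borel)"
  "(\<lambda>p. sin2 (fst p) (snd p)) \<in> borel_measurable (borel \<Otimes>\<^sub>M borel)"
  unfolding cos2_def sin2_def by measurable

lemma double_angle_continuous:
  assumes "\<omega> \<in> path_space"
  shows "continuous_on {0..} (\<lambda>r. cos2 r (\<omega> r))" "continuous_on {0..} (\<lambda>r. sin2 r (\<omega> r))"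
proof -
  have "s0 + \<bar>r\<bar> \<noteq> 0" for r :: real using s0 by auto
  then show "continuous_on {0..} (\<lambda>r. cos2 r (\<omega> r))" "continuous_on {0..} (\<lambda>r. sin2 r (\<omega> r))"
    unfolding cos2_def sin2_def c1_def c2_def
    by (auto intro!: continuous_intros path_space_continuous[OF assms])
qed

lemma cbr_raw:
  assumes t: "0 \<le> t" shows "(\<lambda>\<omega>. cbr t \<omega> $ i $ j) \<in> borel_measurable (raw_filtration t)"
proof -
  have [measurable]: "(\<lambda>\<omega>. integral {0..t} (\<lambda>r. cos2 r (\<omega> r))) \<in> borel_measurable (raw_filtration t)"
    "(\<lambda>\<omega>. integral {0..t} (\<lambda>r. sin2 r (\<omega> r))) \<in> borel_measurable (raw_filtration t)"
    by (rule path_integral_raw_measurable[OF double_angle_joint(1) double_angle_continuous(1) t],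
        assumption, rule path_integral_raw_measurable[OF double_angle_joint(2) double_angle_continuous(2) t])
  show ?thesis unfolding cbr_def vec_lambda_beta by measurable
qed

lemma claw_martingale: "martingale claw raw_filtration (\<lambda>t \<omega>. \<omega> t $ i)"
  unfolding claw_def
proof (rule law_martingale[where u="clock s0", OF cmap_measurable cmap_hist])
  show "hmart (clock s0) (\<lambda>t z. x $ i + (e1 $ i * (sqrt (s0 + t) * cos (W (clock s0 t) z)) + e2 $ i * (sqrt (s0 + t) * sin (W (clock s0 t) z))))"
    by (intro hmart_add hmart_const hmart_cmult hmart_circle_linear[OF s0, of cos] hmart_circle_linear[OF s0, of sin]) auto
qed (auto simp: cmap_def intro: raw_component)

lemma claw_martingale2: "martingale claw raw_filtration (\<lambda>t \<omega>. \<omega> t $ i * \<omega> t $ j - cbr t \<omega> $ i $ j)"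
  unfolding claw_def
proof (rule law_martingale[where u="clock s0", OF cmap_measurable cmap_hist])
  let ?\<theta> = "\<lambda>t z. W (clock s0 t) z"
  let ?N = "\<lambda>f t z. (s0 + t) * f (2 * ?\<theta> t z) + integral {0..t} (\<lambda>r. f (2 * ?\<theta> r z))"
  let ?Y = "\<lambda>t z. (x $ i * x $ j + s0 / 2 * (e1 $ i * e1 $ j + e2 $ i * e2 $ j)) +
     ((x $ i * e1 $ j + x $ j * e1 $ i) * (sqrt (s0 + t) * cos (?\<theta> t z)) +
     ((x $ i * e2 $ j + x $ j * e2 $ i) * (sqrt (s0 + t) * sin (?\<theta> t z)) +
     (((e1 $ i * e1 $ j - e2 $ i * e2 $ j) / 2) * ?N cos t z +
     ((e1 $ i * e2 $ j + e2 $ i * e1 $ j) / 2) * ?N sin t z)))"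
  show "hmart (clock s0) ?Y"
    by (intro hmart_add hmart_const hmart_cmult hmart_circle_linear[OF s0, of cos] hmart_circle_linear[OF s0, of sin]
      hmart_circle_quadratic[OF s0, of cos] hmart_circle_quadratic[OF s0, of sin]) auto
  show "(\<lambda>\<omega>. \<omega> t $ i * \<omega> t $ j - cbr t \<omega> $ i $ j) \<in> borel_measurable (raw_filtration t)" if "0 \<le> t" for t
    using raw_component[OF that order.refl] cbr_raw[OF that] by (intro borel_measurable_diff borel_measurable_times) auto
  show "cmap z t $ i * cmap z t $ j - cbr t (cmap z) $ i $ j = ?Y t z" if t: "0 \<le> t" for t z
  proof -
    have p: "0 < s0 + t" using s0 t by simp
    define a where "a = sqrt (s0 + t) * cos (?\<theta> t z)"
    define b where "b = sqrt (s0 + t) * sin (?\<theta> t z)"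
    define I where "I = integral {0..t} (\<lambda>r. cos (2 * ?\<theta> r z))"
    define J where "J = integral {0..t} (\<lambda>r. sin (2 * ?\<theta> r z))"
    have sq: "sqrt (s0 + t) * sqrt (s0 + t) = s0 + t" using p by simp
    have ab: "a * a = ((s0 + t) + (s0 + t) * cos (2 * ?\<theta> t z)) / 2" "b * b = ((s0 + t) - (s0 + t) * cos (2 * ?\<theta> t z)) / 2"
      "a * b = (s0 + t) * sin (2 * ?\<theta> t z) / 2"
    proof -
      have "a * a = (s0 + t) * (cos (?\<theta> t z))\<^sup>2" "b * b = (s0 + t) * (sin (?\<theta> t z))\<^sup>2" "a * b = (s0 + t) * (sin (?\<theta> t z) * cos (?\<theta> t z))"
      proof -
        have g: "(r * c) * (r * c) = (r * r) * c\<^sup>2" "(r * c) * (r * s) = (r * r) * (s * c)" for r c s :: real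
          by (simp_all add: power2_eq_square)
        show "a * a = (s0 + t) * (cos (?\<theta> t z))\<^sup>2" "b * b = (s0 + t) * (sin (?\<theta> t z))\<^sup>2" "a * b = (s0 + t) * (sin (?\<theta> t z) * cos (?\<theta> t z))"
          unfolding a_def b_def by (simp_all only: g sq)
      qed
      then show "a * a = ((s0 + t) + (s0 + t) * cos (2 * ?\<theta> t z)) / 2" "b * b = ((s0 + t) - (s0 + t) * cos (2 * ?\<theta> t z)) / 2"
        "a * b = (s0 + t) * sin (2 * ?\<theta> t z) / 2"
        by (simp_all only: cos_double_cos sin_double) (simp_all add: sin_squared_eq algebra_simps)
    qed
    have I: "integral {0..t} (\<lambda>r. cos2 r (cmap z r)) = I" "integral {0..t} (\<lambda>r. sin2 r (cmap z r)) = J"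
      unfolding I_def J_def by (auto intro!: Henstock_Kurzweil_Integration.integral_cong simp: cmap_double_angle)
    have co: "cmap z t $ k = x $ k + a * e1 $ k + b * e2 $ k" for k using t by (simp add: cmap_def a_def b_def)
    have "cmap z t $ i * cmap z t $ j = x $ i * x $ j + (x $ i * e1 $ j + x $ j * e1 $ i) * a + (x $ i * e2 $ j + x $ j * e2 $ i) * b
      + (a * a) * (e1 $ i * e1 $ j) + (b * b) * (e2 $ i * e2 $ j) + (a * b) * (e1 $ i * e2 $ j + e2 $ i * e1 $ j)"
      unfolding co by (simp add: algebra_simps)
    then show ?thesis
      unfolding cbr_def vec_lambda_beta I ab unfolding a_def[symmetric] b_def[symmetric] I_def[symmetric] J_def[symmetric]
      by (simp add: field_simps)
  qed
qed auto

lemma claw_start: "AE \<omega> in claw. \<omega> 0 = x + sqrt s0 *\<^sub>R e1"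
proof (rule AE_claw)
  have "(\<lambda>\<omega>::real \<Rightarrow> real ^ 'n. \<omega> 0) -` {x + sqrt s0 *\<^sub>R e1} \<inter> space path_borel \<in> sets path_borel"
    by (rule measurable_sets[OF coordinate_measurable]) auto
  then show "{\<omega> \<in> path_space. \<omega> 0 = x + sqrt s0 *\<^sub>R e1} \<in> sets path_borel" by (simp add: vimage_def Int_def conj_commute)
qed (simp add: cmap_def clock_def W_0)

lemma trace_cbr: "trace (cbr t \<omega>) = t"
proof -
  have "(\<Sum>i\<in>UNIV. e1 $ i * e1 $ i) = 1" "(\<Sum>i\<in>UNIV. e2 $ i * e2 $ i) = 1" "(\<Sum>i\<in>UNIV. e1 $ i * e2 $ i) = 0"
    "(\<Sum>i\<in>UNIV. e2 $ i * e1 $ i) = 0"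
    using e_self e12 by (simp_all add: inner_vec_def)
  then show ?thesis
    unfolding trace_def cbr_def vec_lambda_beta sum_subtractf sum_distrib_left[symmetric] sum.distrib by simp
qed

lemma claw_bracket: "is_bracket claw raw_filtration (\<lambda>t \<omega>. \<omega> t) cbr"
  unfolding is_bracket_def
proof (intro allI conjI)
  fix i j
  interpret filtered_prob_space claw raw_filtration
    by (rule filtered_path[OF prob_space_claw sets_claw])
  show "adapted raw_filtration (\<lambda>t \<omega>. cbr t \<omega> $ i $ j)" using cbr_raw by (simp add: adapted_def)
  show "AE \<omega> in claw. cbr 0 \<omega> $ i $ j = 0 \<and> continuous_on {0..} (\<lambda>t. cbr t \<omega> $ i $ j) \<and> finite_variation (\<lambda>t. cbr t \<omega> $ i $ j)"
  proof (rule AE_I2)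
    fix \<omega> assume "\<omega> \<in> space claw"
    then have \<omega>: "\<omega> \<in> path_space" using sets_eq_imp_space_eq[OF sets_claw] by simp
    have L: "\<exists>C\<ge>0. \<forall>s t. 0 \<le> s \<longrightarrow> s \<le> t \<longrightarrow> t \<le> T \<longrightarrow> \<bar>cbr t \<omega> $ i $ j - cbr s \<omega> $ i $ j\<bar> \<le> C * (t - s)" if T: "0 \<le> T" for T
    proof -
      define I where "I = (\<lambda>t. integral {0..t} (\<lambda>r. cos2 r (\<omega> r)))"
      define J where "J = (\<lambda>t. integral {0..t} (\<lambda>r. sin2 r (\<omega> r)))"
      define k1 where "k1 = (e1 $ i * e1 $ j + e2 $ i * e2 $ j) / 2"
      define k2 where "k2 = (e1 $ i * e1 $ j - e2 $ i * e2 $ j) / 2"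
      define k3 where "k3 = (e1 $ i * e2 $ j + e2 $ i * e1 $ j) / 2"
      obtain C1 where C1: "0 \<le> C1" "\<And>s t. 0 \<le> s \<Longrightarrow> s \<le> t \<Longrightarrow> t \<le> T \<Longrightarrow> \<bar>I t - I s\<bar> \<le> C1 * (t - s)"
        using integral_locally_lipschitz[OF double_angle_continuous(1)[OF \<omega>] T] unfolding I_def by blast
      obtain C2 where C2: "0 \<le> C2" "\<And>s t. 0 \<le> s \<Longrightarrow> s \<le> t \<Longrightarrow> t \<le> T \<Longrightarrow> \<bar>J t - J s\<bar> \<le> C2 * (t - s)"
        using integral_locally_lipschitz[OF double_angle_continuous(2)[OF \<omega>] T] unfolding J_def by blast
      have cb: "cbr t \<omega> $ i $ j = k1 * t - k2 * I t - k3 * J t" for t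
        by (simp add: cbr_def I_def J_def k1_def k2_def k3_def algebra_simps)
      show ?thesis
      proof (intro exI[of _ "\<bar>k1\<bar> + \<bar>k2\<bar> * C1 + \<bar>k3\<bar> * C2"] conjI allI impI)
        fix s t assume st: "0 \<le> s" "s \<le> t" "t \<le> T"
        have "cbr t \<omega> $ i $ j - cbr s \<omega> $ i $ j = k1 * (t - s) - k2 * (I t - I s) - k3 * (J t - J s)"
          unfolding cb by (simp add: algebra_simps)
        then have "\<bar>cbr t \<omega> $ i $ j - cbr s \<omega> $ i $ j\<bar> \<le> \<bar>k1 * (t - s)\<bar> + \<bar>k2 * (I t - I s)\<bar> + \<bar>k3 * (J t - J s)\<bar>" by linarith
        also have "\<dots> = \<bar>k1\<bar> * (t - s) + \<bar>k2\<bar> * \<bar>I t - I s\<bar> + \<bar>k3\<bar> * \<bar>J t - J s\<bar>" using st by (simp add: abs_mult)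
        also have "\<dots> \<le> \<bar>k1\<bar> * (t - s) + \<bar>k2\<bar> * (C1 * (t - s)) + \<bar>k3\<bar> * (C2 * (t - s))"
          using C1(2)[OF st] C2(2)[OF st] by (intro add_mono mult_left_mono) auto
        also have "\<dots> = (\<bar>k1\<bar> + \<bar>k2\<bar> * C1 + \<bar>k3\<bar> * C2) * (t - s)" by (simp add: algebra_simps)
        finally show "\<bar>cbr t \<omega> $ i $ j - cbr s \<omega> $ i $ j\<bar> \<le> (\<bar>k1\<bar> + \<bar>k2\<bar> * C1 + \<bar>k3\<bar> * C2) * (t - s)" .
      qed (use C1 C2 in simp)
    qed
    show "cbr 0 \<omega> $ i $ j = 0 \<and> continuous_on {0..} (\<lambda>t. cbr t \<omega> $ i $ j) \<and> finite_variation (\<lambda>t. cbr t \<omega> $ i $ j)"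
      using finite_variation_lipschitz[OF L] continuous_on_lipschitz_locally[OF L] by (simp add: cbr_def)
  qed
  show "local_martingale claw raw_filtration (\<lambda>t \<omega>. \<omega> t $ i * \<omega> t $ j - cbr t \<omega> $ i $ j)"
    by (rule martingale_local[OF claw_martingale2])
qed

lemma claw_in_martingale_laws: "claw \<in> martingale_laws (x + sqrt s0 *\<^sub>R e1)"
  unfolding martingale_laws_def
  using prob_space_claw sets_claw claw_martingale claw_start claw_bracket trace_cbr by auto

end

section \<open>Regular versions of the bracket\<close>

text \<open>Only almost every path of a bracket is continuous, so a bracket need not be jointly measurable
  in time and path. The limit along the dyadic approximations from the left is, and it is still
  adapted.\<close>

definition reg :: "(real \<Rightarrow> 's \<Rightarrow> real) \<Rightarrow> real \<Rightarrow> 's \<Rightarrow> real" where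
  "reg f t \<omega> = lim (\<lambda>n. f (dyad n t) \<omega>)"

lemma reg_eq:
  assumes "continuous_on {0..} (\<lambda>t. f t \<omega>)" "0 \<le> t" shows "reg f t \<omega> = f t \<omega>"
  unfolding reg_def by (rule limI[OF continuous_dyad_tendsto[OF assms]])

lemma reg_raw:
  assumes "\<And>t. 0 \<le> t \<Longrightarrow> f t \<in> borel_measurable (raw_filtration t)" "0 \<le> t"
  shows "reg f t \<in> borel_measurable (raw_filtration t)"
proof -
  have "f (dyad n t) \<in> borel_measurable (raw_filtration t)" for n
  proof -
    have "f (dyad n t) \<in> borel_measurable (raw_filtration (dyad n t))"
      by (rule assms(1)[OF dyad_bounds(1)[OF assms(2)]])
    then show ?thesis using raw_filtration_mono[OF dyad_bounds(2)[OF assms(2), of n]] by (auto simp: measurable_def)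
  qed
  then show ?thesis unfolding reg_def[abs_def] by (rule borel_measurable_lim_metric)
qed

definition joint :: "(real \<Rightarrow> (real \<Rightarrow> 'a::metric_space) \<Rightarrow> real) \<Rightarrow> bool" where
  "joint f \<longleftrightarrow> (\<lambda>p. f (max 0 (fst p)) (snd p)) \<in> borel_measurable (borel \<Otimes>\<^sub>M path_borel)"

lemma reg_joint:
  fixes f :: "real \<Rightarrow> (real \<Rightarrow> 'a::metric_space) \<Rightarrow> real"
  assumes "\<And>t. 0 \<le> t \<Longrightarrow> f t \<in> borel_measurable path_borel"
  shows "joint (reg f)"
  unfolding joint_def reg_def
proof (rule borel_measurable_lim_metric)
  fix n
  have "(\<lambda>p. f (real k / 2 ^ n) (snd p)) \<in> borel_measurable ((borel :: real measure) \<Otimes>\<^sub>M path_borel)" for k :: nat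
    by (rule measurable_compose[OF measurable_snd assms]) simp
  moreover have "(\<lambda>p. nat \<lfloor>2 ^ n * max 0 (fst p)\<rfloor>) \<in> measurable ((borel :: real measure) \<Otimes>\<^sub>M (path_borel :: (real \<Rightarrow> 'a) measure)) (count_space UNIV)"
    by measurable
  ultimately show "(\<lambda>p. f (dyad n (max 0 (fst p))) (snd p)) \<in> borel_measurable (borel \<Otimes>\<^sub>M path_borel)"
    unfolding dyad_def by (rule measurable_compose_countable)
qed

lemma joint_compose:
  assumes f: "joint f" and g: "g \<in> borel_measurable M" "\<And>x. x \<in> space M \<Longrightarrow> 0 \<le> g x" and G: "G \<in> measurable M path_borel"
  shows "(\<lambda>x. f (g x) (G x)) \<in> borel_measurable M"
proof -
  have "(\<lambda>x. (g x, G x)) \<in> measurable M (borel \<Otimes>\<^sub>M path_borel)" using g G by (intro measurable_Pair)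
  from measurable_compose[OF this f[unfolded joint_def]]
  have "(\<lambda>x. f (max 0 (g x)) (G x)) \<in> borel_measurable M" by simp
  then show ?thesis using g(2) by (simp add: max_def cong: measurable_cong)
qed

lemma (in filtered_prob_space) martingale_cong_AE:
  assumes M: "martingale P F M" and M': "\<And>t. 0 \<le> t \<Longrightarrow> M' t \<in> borel_measurable (F t)"
    and eq: "\<And>t. 0 \<le> t \<Longrightarrow> AE \<omega> in P. M t \<omega> = M' t \<omega>"
  shows "martingale P F M'"
proof (rule martingaleI[OF M'])
  have int: "integrable P (M t)" if "0 \<le> t" for t using M that by (simp add: martingale_def)
  have m: "M t \<in> borel_measurable P" "M' t \<in> borel_measurable P" if "0 \<le> t" for t
    using int[OF that] measurable_F_P[OF M'[OF that]] by auto
  show int': "integrable P (M' t)" if "0 \<le> t" for t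
    by (rule integrable_cong_AE_imp[OF int[OF that] m(2)[OF that]]) (use eq[OF that] in auto)
  fix s t A assume h: "0 \<le> s" "s \<le> t" "A \<in> sets (F s)"
  have t: "0 \<le> t" using h by simp
  have AP: "A \<in> sets P" using h(3) by (rule sets_F_P)
  have i: "integrable P (\<lambda>\<omega>. indicator A \<omega> * M r \<omega>)" if "0 \<le> r" for r
    using integrable_mult_indicator[OF AP int[OF that]] by simp
  have "(\<integral>\<omega>. indicator A \<omega> * (M' t \<omega> - M' s \<omega>) \<partial>P) = (\<integral>\<omega>. indicator A \<omega> * M t \<omega> - indicator A \<omega> * M s \<omega> \<partial>P)"
  proof (rule integral_cong_AE)
    show "AE \<omega> in P. indicator A \<omega> * (M' t \<omega> - M' s \<omega>) = indicator A \<omega> * M t \<omega> - indicator A \<omega> * M s \<omega>"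
      using eq[OF t] eq[OF h(1)] by eventually_elim (simp add: right_diff_distrib)
  qed (use m[OF t] m[OF h(1)] AP in auto)
  also have "\<dots> = 0" using i[OF t] i[OF h(1)] martingale_set[OF M h] by simp
  finally show "(\<integral>\<omega>. indicator A \<omega> * (M' t \<omega> - M' s \<omega>) \<partial>P) = 0" .
qed

lemma stopped_raw_measurable:
  fixes M :: "real \<Rightarrow> (real \<Rightarrow> 'a::{metric_space, second_countable_topology}) \<Rightarrow> real"
  assumes T: "stopping_time raw_filtration T"
    and ad: "\<And>\<omega> \<eta> r. 0 \<le> r \<Longrightarrow> \<omega> \<in> path_space \<Longrightarrow> \<eta> \<in> path_space \<Longrightarrow> agree r \<omega> \<eta> \<Longrightarrow> M r \<omega> = M r \<eta>"
    and T0: "\<And>\<omega>. \<omega> \<in> path_space \<Longrightarrow> 0 \<le> T \<omega>"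
    and m: "(\<lambda>\<omega>. M (min t (T \<omega>)) \<omega>) \<in> borel_measurable path_borel" and t: "0 \<le> t"
  shows "(\<lambda>\<omega>. M (min t (T \<omega>)) \<omega>) \<in> borel_measurable (raw_filtration t)"
proof (rule raw_measurableI[OF m t])
  fix \<omega> \<eta> :: "real \<Rightarrow> 'a" assume p: "\<omega> \<in> path_space" "\<eta> \<in> path_space" and a: "agree t \<omega> \<eta>"
  have e: "min t (T \<omega>) = min t (T \<eta>)"
  proof (cases "T \<omega> \<le> t")
    case True
    then show ?thesis using raw_stopping_time_agree[OF T p a] by simp
  next
    case False
    then have "\<not> T \<eta> \<le> t" using raw_stopping_time_agree[OF T p(2,1) agree_sym[OF a]] by auto
    with False show ?thesis by simp
  qed
  have "M (min t (T \<omega>)) \<omega> = M (min t (T \<omega>)) \<eta>"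
    by (rule ad[OF _ p agree_mono[OF a]]) (use T0[OF p(1)] t in auto)
  then show "M (min t (T \<omega>)) \<omega> = M (min t (T \<eta>)) \<eta>" using e by simp
qed

lemma finite_variation_cong:
  assumes "\<And>t. 0 \<le> t \<Longrightarrow> f t = g t" "finite_variation f" shows "finite_variation g"
  unfolding finite_variation_def
proof (intro allI impI)
  fix T :: real assume "0 \<le> T"
  then have "\<exists>B. \<forall>n s. mono s \<and> range s \<subseteq> {0..T} \<longrightarrow> (\<Sum>k<n. \<bar>f (s (Suc k)) - f (s k)\<bar>) \<le> B"
    using assms(2) unfolding finite_variation_def by simp
  then obtain B where B: "\<forall>n s. mono s \<and> range s \<subseteq> {0..T} \<longrightarrow> (\<Sum>k<n. \<bar>f (s (Suc k)) - f (s k)\<bar>) \<le> B"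
    by (elim exE)
  show "\<exists>B. \<forall>n s. mono s \<and> range s \<subseteq> {0..T} \<longrightarrow> (\<Sum>k<n. \<bar>g (s (Suc k)) - g (s k)\<bar>) \<le> B"
  proof (intro exI allI impI)
    fix n and s :: "nat \<Rightarrow> real" assume s: "mono s \<and> range s \<subseteq> {0..T}"
    have "s k \<in> {0..T}" for k using s rangeI[of s k] by blast
    then have "g (s k) = f (s k)" for k using assms(1)[of "s k"] by simp
    then show "(\<Sum>k<n. \<bar>g (s (Suc k)) - g (s k)\<bar>) \<le> B" using B[rule_format, OF s, of n] by simp
  qed
qed

lemma regular_bracket:
  fixes P :: "(real \<Rightarrow> real ^ 'n) measure"
  assumes P: "P \<in> martingale_laws x"
  obtains A where "is_bracket P raw_filtration (\<lambda>t \<omega>. \<omega> t) A" "AE \<omega> in P. \<forall>t\<ge>0. trace (A t \<omega>) = t"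
    "\<And>i j. joint (\<lambda>t \<omega>. A t \<omega> $ i $ j)"
    "\<And>i j t. 0 \<le> t \<Longrightarrow> (\<lambda>\<omega>. A t \<omega> $ i $ j) \<in> borel_measurable (raw_filtration t)"
proof -
  have pP: "prob_space P" and sP: "sets P = sets path_borel" using P by (auto simp: martingale_laws_def)
  obtain A0 where A0: "is_bracket P raw_filtration (\<lambda>t \<omega>. \<omega> t) A0" and tr: "AE \<omega> in P. \<forall>t\<ge>0. trace (A0 t \<omega>) = t"
    using P by (auto simp: martingale_laws_def)
  interpret filtered_prob_space P raw_filtration by (rule filtered_path[OF pP sP])
  have spP: "space P = path_space" using sets_eq_imp_space_eq[OF sP] by simp
  define A where "A = (\<lambda>t \<omega>. \<chi> i j. reg (\<lambda>t \<omega>. A0 t \<omega> $ i $ j) t \<omega>)"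
  have Aij: "A t \<omega> $ i $ j = reg (\<lambda>t \<omega>. A0 t \<omega> $ i $ j) t \<omega>" for t \<omega> i j by (simp add: A_def)
  have ad0: "(\<lambda>\<omega>. A0 t \<omega> $ i $ j) \<in> borel_measurable (raw_filtration t)" if "0 \<le> t" for t i j
    using A0 that by (simp add: is_bracket_def adapted_def)
  have ae0: "AE \<omega> in P. A0 0 \<omega> $ i $ j = 0 \<and> continuous_on {0..} (\<lambda>t. A0 t \<omega> $ i $ j) \<and> finite_variation (\<lambda>t. A0 t \<omega> $ i $ j)" for i j
    using A0 unfolding is_bracket_def by (elim allE[of _ i] allE[of _ j] conjE)
  have raw: "(\<lambda>\<omega>. A t \<omega> $ i $ j) \<in> borel_measurable (raw_filtration t)" if "0 \<le> t" for i j t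
    unfolding Aij using reg_raw[OF ad0 that] .
  have jA: "joint (\<lambda>t \<omega>. A t \<omega> $ i $ j)" for i j
    unfolding Aij
  proof (rule reg_joint)
    fix t :: real assume "0 \<le> t"
    from measurable_F_P[OF ad0[OF this]] show "(\<lambda>\<omega>. A0 t \<omega> $ i $ j) \<in> borel_measurable path_borel"
      by (simp add: measurable_cong_sets[OF sP refl])
  qed
  have eqc: "A t \<omega> $ i $ j = A0 t \<omega> $ i $ j" if "continuous_on {0..} (\<lambda>t. A0 t \<omega> $ i $ j)" "0 \<le> t" for t \<omega> i j
    unfolding Aij by (rule reg_eq[where f="\<lambda>t \<omega>. A0 t \<omega> $ i $ j", OF that])
  have "is_bracket P raw_filtration (\<lambda>t \<omega>. \<omega> t) A"
    unfolding is_bracket_def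
  proof (intro allI conjI)
    fix i j
    show "adapted raw_filtration (\<lambda>t \<omega>. A t \<omega> $ i $ j)" using raw by (simp add: adapted_def)
    show "AE \<omega> in P. A 0 \<omega> $ i $ j = 0 \<and> continuous_on {0..} (\<lambda>t. A t \<omega> $ i $ j) \<and> finite_variation (\<lambda>t. A t \<omega> $ i $ j)"
      using ae0[of i j]
    proof eventually_elim
      case (elim \<omega>)
      then have c: "continuous_on {0..} (\<lambda>t. A0 t \<omega> $ i $ j)" by simp
      show ?case
      proof (intro conjI)
        show "A 0 \<omega> $ i $ j = 0" using eqc[OF c, of 0] elim by simp
        show "continuous_on {0..} (\<lambda>t. A t \<omega> $ i $ j)" by (rule continuous_on_eq[OF c]) (simp add: eqc[OF c])
        show "finite_variation (\<lambda>t. A t \<omega> $ i $ j)" by (rule finite_variation_cong[OF eqc[OF c, symmetric]]) (use elim in auto)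
      qed
    qed
    let ?K = "\<lambda>t \<omega>. \<omega> t $ i * \<omega> t $ j - A0 t \<omega> $ i $ j"
    let ?N = "\<lambda>t (\<omega>::real \<Rightarrow> real ^ 'n). \<omega> t $ i * \<omega> t $ j - A t \<omega> $ i $ j"
    have "local_martingale P raw_filtration ?K" using A0 by (simp add: is_bracket_def)
    then obtain T where T: "\<And>n. stopping_time raw_filtration (T n)" "\<And>n \<omega>. \<omega> \<in> space P \<Longrightarrow> 0 \<le> T n \<omega>"
      "AE \<omega> in P. incseq (\<lambda>n. T n \<omega>) \<and> filterlim (\<lambda>n. T n \<omega>) at_top sequentially"
      "\<And>n. martingale P raw_filtration (\<lambda>t \<omega>. ?K (min t (T n \<omega>)) \<omega> - ?K 0 \<omega>)"
      unfolding local_martingale_def by blast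
    have Nad: "?N r \<omega> = ?N r \<eta>" if "0 \<le> r" "\<omega> \<in> path_space" "\<eta> \<in> path_space" "agree r \<omega> \<eta>" for r \<omega> \<eta>
      using raw_measurable_agree[OF raw[OF that(1)] that(2-4)] that by (simp add: agree_def)
    have N0m: "?N 0 \<in> borel_measurable (raw_filtration t)" if "0 \<le> t" for t
    proof -
      have "(\<lambda>\<omega>. A 0 \<omega> $ i $ j) \<in> borel_measurable (raw_filtration t)"
        using raw[of 0 i j] raw_filtration_mono[OF that] by (auto simp: measurable_def)
      then show ?thesis using that by (intro borel_measurable_diff borel_measurable_times raw_component) auto
    qed
    have "martingale P raw_filtration (\<lambda>t \<omega>. ?N (min t (T n \<omega>)) \<omega> - ?N 0 \<omega>)" for n
    proof (rule martingale_cong_AE[OF T(4)[of n]])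
      fix t :: real assume t: "0 \<le> t"
      have Tm: "(\<lambda>\<omega>. min t (T n \<omega>)) \<in> borel_measurable path_borel"
        using raw_stopping_time_borel[OF T(1)] by (intro borel_measurable_min) auto
      have T0: "0 \<le> min t (T n \<omega>)" if "\<omega> \<in> path_space" for \<omega> using T(2)[of \<omega> n] that t spP by simp
      have idp: "(\<lambda>\<omega>. \<omega>) \<in> measurable path_borel (path_borel :: (real \<Rightarrow> real ^ 'n) measure)" by simp
      have "(\<lambda>\<omega>::real \<Rightarrow> real ^ 'n. \<omega> (min t (T n \<omega>))) \<in> borel_measurable path_borel"
        by (rule measurable_path_eval[OF idp Tm]) (use T0 in simp)
      from measurable_compose[OF this vec_nth_borel]
      have ev: "(\<lambda>\<omega>::real \<Rightarrow> real ^ 'n. \<omega> (min t (T n \<omega>)) $ k) \<in> borel_measurable path_borel" for k .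
      have "(\<lambda>\<omega>. A (min t (T n \<omega>)) \<omega> $ i $ j) \<in> borel_measurable path_borel"
        by (rule joint_compose[OF jA Tm _ idp]) (use T0 in simp)
      with ev have b: "(\<lambda>\<omega>. ?N (min t (T n \<omega>)) \<omega>) \<in> borel_measurable path_borel"
        by (intro borel_measurable_diff borel_measurable_times)
      have "(\<lambda>\<omega>. ?N (min t (T n \<omega>)) \<omega>) \<in> borel_measurable (raw_filtration t)"
        by (rule stopped_raw_measurable[OF T(1) Nad _ b t]) (use T(2) spP in auto)
      then show "(\<lambda>\<omega>. ?N (min t (T n \<omega>)) \<omega> - ?N 0 \<omega>) \<in> borel_measurable (raw_filtration t)"
        by (rule borel_measurable_diff[OF _ N0m[OF t]])
      show "AE \<omega> in P. ?K (min t (T n \<omega>)) \<omega> - ?K 0 \<omega> = ?N (min t (T n \<omega>)) \<omega> - ?N 0 \<omega>"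
        using ae0[of i j] AE_space
      proof eventually_elim
        case (elim \<omega>)
        then have c: "continuous_on {0..} (\<lambda>t. A0 t \<omega> $ i $ j)" by simp
        have "0 \<le> min t (T n \<omega>)" using T0[of \<omega>] elim spP by simp
        then show ?case using eqc[OF c] by simp
      qed
    qed
    moreover have "adapted raw_filtration ?N"
      unfolding adapted_def using raw by (intro allI impI borel_measurable_diff borel_measurable_times raw_component) auto
    ultimately show "local_martingale P raw_filtration ?N"
      unfolding local_martingale_def using T(1-3) by blast
  qed
  moreover have "AE \<omega> in P. \<forall>t\<ge>0. trace (A t \<omega>) = t"
  proof -
    have "AE \<omega> in P. \<forall>i\<in>UNIV. \<forall>j\<in>UNIV. continuous_on {0..} (\<lambda>t. A0 t \<omega> $ i $ j)"
      by (intro AE_finite_allI finite_UNIV) (use ae0 in \<open>auto elim: eventually_mono\<close>)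
    with tr show ?thesis
    proof eventually_elim
      case (elim \<omega>)
      show ?case
      proof (intro allI impI)
        fix t :: real assume "0 \<le> t"
        then have "trace (A t \<omega>) = trace (A0 t \<omega>)" using eqc elim(2) by (simp add: trace_def)
        then show "trace (A t \<omega>) = t" using elim(1) \<open>0 \<le> t\<close> by simp
      qed
    qed
  qed
  ultimately show thesis using jA raw that by blast
qed

section \<open>Pasting laws at a hitting time\<close>

text \<open>A path \<open>w\<close> under \<open>Q\<close> is followed until it hits one of two points, and from then on the path
  \<open>\<eta> b\<close> belonging to the point that was hit.\<close>

locale paste =
  fixes Q :: "(real \<Rightarrow> real ^ 'n) measure" and P :: "bool \<Rightarrow> (real \<Rightarrow> real ^ 'n) measure"
    and p :: "bool \<Rightarrow> real ^ 'n"
  assumes Q: "prob_space Q" "sets Q = sets path_borel"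
    and P: "\<And>b. prob_space (P b)" "\<And>b. sets (P b) = sets path_borel"
    and p_neq: "p True \<noteq> p False"
    and start: "\<And>b. AE \<eta> in P b. \<eta> 0 = p b"
begin

definition C :: "(real ^ 'n) set" where "C = {p True, p False}"

lemma closed_C: "closed C" by (simp add: C_def)

definition side :: "real \<Rightarrow> (real \<Rightarrow> real ^ 'n) \<Rightarrow> bool" where
  "side t w \<longleftrightarrow> w (hit C t w) = p True"

definition R :: "(bool \<Rightarrow> real \<Rightarrow> real ^ 'n) measure" where "R = PiM UNIV P"

definition pmap :: "(real \<Rightarrow> real ^ 'n) \<times> (bool \<Rightarrow> real \<Rightarrow> real ^ 'n) \<Rightarrow> real \<Rightarrow> real ^ 'n" where
  "pmap q = on_paths (\<lambda>t. fst q (hit C t (fst q)) +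
     (snd q (side t (fst q)) (t - hit C t (fst q)) - snd q (side t (fst q)) 0))"

definition plaw :: "(real \<Rightarrow> real ^ 'n) measure" where
  "plaw = distr (Q \<Otimes>\<^sub>M R) path_borel pmap"

definition startok :: "(bool \<Rightarrow> real \<Rightarrow> real ^ 'n) \<Rightarrow> bool" where
  "startok \<eta> \<longleftrightarrow> (\<forall>b. \<eta> b \<in> path_space \<and> \<eta> b 0 = p b)"

sublocale Q: prob_space Q by (rule Q(1))

sublocale PP: product_prob_space P UNIV by (intro product_prob_spaceI P(1))

sublocale R: prob_space R unfolding R_def by (rule PP.prob_space_axioms)

sublocale QR: pair_prob_space Q R ..

lemma space_Q [simp]: "space Q = path_space"
  using sets_eq_imp_space_eq[OF Q(2)] by simp

lemma space_P [simp]: "space (P b) = path_space"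
  using sets_eq_imp_space_eq[OF P(2)] by simp

lemma space_R: "space R = {\<eta>. \<forall>b. \<eta> b \<in> path_space}"
  by (auto simp: R_def space_PiM PiE_def)

lemma measurable_Q: "measurable Q N = measurable path_borel N" "measurable N Q = measurable N path_borel"
  by (simp_all add: measurable_cong_sets[OF Q(2) refl] measurable_cong_sets[OF refl Q(2)])

lemma measurable_P: "measurable (P b) N = measurable path_borel N" "measurable N (P b) = measurable N path_borel"
  by (simp_all add: measurable_cong_sets[OF P(2) refl] measurable_cong_sets[OF refl P(2)])

lemma R_component: "(\<lambda>\<eta>. \<eta> b) \<in> measurable R path_borel"
  using measurable_component_singleton[of b UNIV P] unfolding R_def measurable_P(2) by simp

lemma distr_R: "distr R (P b) (\<lambda>\<eta>. \<eta> b) = P b"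
  unfolding R_def by (rule distr_PiM_component) (auto intro: P(1))

lemma R_integral:
  fixes f :: "(real \<Rightarrow> real ^ 'n) \<Rightarrow> real"
  assumes "f \<in> borel_measurable path_borel"
  shows "(\<integral>\<eta>. f (\<eta> b) \<partial>R) = (\<integral>\<zeta>. f \<zeta> \<partial>P b)" "integrable R (\<lambda>\<eta>. f (\<eta> b)) \<longleftrightarrow> integrable (P b) f"
proof -
  have m: "(\<lambda>\<eta>. \<eta> b) \<in> measurable R (P b)" unfolding measurable_P(2) by (rule R_component)
  have f: "f \<in> borel_measurable (P b)" unfolding measurable_P(1) by fact
  show "(\<integral>\<eta>. f (\<eta> b) \<partial>R) = (\<integral>\<zeta>. f \<zeta> \<partial>P b)"
    using integral_distr[OF m f] unfolding distr_R by simp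
  show "integrable R (\<lambda>\<eta>. f (\<eta> b)) \<longleftrightarrow> integrable (P b) f"
    using integrable_distr_eq[OF m f] unfolding distr_R by simp
qed

lemma AE_R:
  assumes "AE \<zeta> in P b. S \<zeta>" shows "AE \<eta> in R. S (\<eta> b)"
  unfolding R_def using P(1) UNIV_I assms by (rule AE_PiM_component[of UNIV P b S])

lemma AE_startok: "AE \<eta> in R. startok \<eta>"
  using AE_R[OF start[of True]] AE_R[OF start[of False]] AE_space
proof eventually_elim
  case (elim \<eta>)
  have "\<eta> b 0 = p b" for b using elim(1,2) by (cases b) auto
  then show ?case using elim(3) by (simp add: startok_def space_R)
qed

lemma hit_C_cases:
  assumes "w \<in> path_space"
  obtains (never) "\<forall>t\<ge>0. w t \<notin> C" "\<forall>t\<ge>0. hit C t w = t"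
  | (hits) \<sigma> b where "0 \<le> \<sigma>" "w \<sigma> = p b" "\<forall>s. 0 \<le> s \<and> s < \<sigma> \<longrightarrow> w s \<notin> C"
      "\<forall>t\<ge>0. hit C t w = min t \<sigma>" "\<forall>t\<ge>\<sigma>. side t w = b"
proof -
  show thesis
  proof (rule hit_cases[OF closed_C assms], goal_cases)
  case 1
  show ?case by (rule never) (use 1 in auto)
next
  case (2 \<sigma>)
  define b where "b = (w \<sigma> = p True)"
  have "w \<sigma> = p b" using 2(2) p_neq by (auto simp: b_def C_def)
  moreover have "side t w = b" if "\<sigma> \<le> t" for t
  proof -
    have "hit C t w = \<sigma>" using 2(4)[of t] 2(1) that by simp
    then show ?thesis by (simp add: side_def b_def)
  qed
  ultimately show ?case by (intro hits[of \<sigma> b]) (use 2 in auto)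
  qed
qed

lemma pmap_never:
  assumes "\<forall>t\<ge>0. hit C t w = t" "0 \<le> t" shows "pmap (w, \<eta>) t = w t"
  using assms by (simp add: pmap_def)

lemma pmap_hits:
  assumes "\<forall>t\<ge>0. hit C t w = min t \<sigma>" "\<forall>t\<ge>\<sigma>. side t w = b" "0 \<le> \<sigma>" "0 \<le> t"
  shows "pmap (w, \<eta>) t = w (min t \<sigma>) + (\<eta> b (t - min t \<sigma>) - \<eta> b 0)"
  using assms by (cases "\<sigma> \<le> t") (auto simp: pmap_def min_def)

lemma pmap_path:
  assumes w: "w \<in> path_space" and \<eta>: "\<And>b. \<eta> b \<in> path_space"
  shows "pmap (w, \<eta>) \<in> path_space"
proof -
  have ext: "pmap (w, \<eta>) \<in> extensional {0..}" by (auto simp: pmap_def on_paths_def extensional_def)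
  have "continuous_on {0..} (pmap (w, \<eta>))"
  proof (rule hit_C_cases[OF w], goal_cases)
    case 1
    show ?case by (rule continuous_on_eq[OF path_space_continuous[OF w]]) (simp add: pmap_never[OF 1(2)])
  next
    case (2 \<sigma> b)
    have "continuous_on {0..} (\<lambda>t. w (min t \<sigma>) + (\<eta> b (t - min t \<sigma>) - \<eta> b 0))"
    proof (intro continuous_on_add continuous_on_diff continuous_on_const)
      show "continuous_on {0..} (\<lambda>t. w (min t \<sigma>))"
        by (rule continuous_on_compose2[OF path_space_continuous[OF w]]) (use 2 in \<open>auto intro!: continuous_intros\<close>)
      show "continuous_on {0..} (\<lambda>t. \<eta> b (t - min t \<sigma>))"
        by (rule continuous_on_compose2[OF path_space_continuous[OF \<eta>]]) (auto intro!: continuous_intros)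
    qed
    then show ?case by (rule continuous_on_eq) (use pmap_hits[OF 2(4,5,1)] in auto)
  qed
  with ext show ?thesis by (simp add: path_space_def)
qed

lemma side_measurable: "0 \<le> t \<Longrightarrow> Measurable.pred path_borel (side t)"
proof -
  assume t: "0 \<le> t"
  have "(\<lambda>w. w (hit C t w)) \<in> borel_measurable (path_borel :: (real \<Rightarrow> real ^ 'n) measure)"
    by (rule measurable_path_eval[OF measurable_ident measurable_hit[OF closed_C t], unfolded id_def])
      (use hit_bounds[OF closed_C _ t] in auto)
  from measurable_sets[OF this, of "{p True}"] show ?thesis
    by (simp add: pred_def side_def[abs_def] vimage_def Int_def conj_commute)
qed

lemma measurable_paste_map:
  assumes w: "w \<in> measurable M path_borel" and \<eta>: "\<And>b. (\<lambda>x. \<eta> x b) \<in> measurable M path_borel"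
  shows "(\<lambda>x. pmap (w x, \<eta> x)) \<in> measurable M path_borel"
proof (rule path_measurableI)
  fix x assume "x \<in> space M"
  then show "pmap (w x, \<eta> x) \<in> path_space"
    using measurable_space[OF w] measurable_space[OF \<eta>] by (intro pmap_path) auto
next
  fix t :: real assume t: "0 \<le> t"
  note h = measurable_compose[OF w measurable_hit[OF closed_C t]]
  have b: "0 \<le> hit C t (w x)" "hit C t (w x) \<le> t" if "x \<in> space M" for x
    using hit_bounds[OF closed_C _ t] measurable_space[OF w that] by auto
  have [measurable]: "(\<lambda>x. w x (hit C t (w x))) \<in> borel_measurable M"
    by (rule measurable_path_eval[OF w h]) (use b in auto)
  have [measurable]: "(\<lambda>x. \<eta> x b (t - hit C t (w x))) \<in> borel_measurable M" for b
    by (rule measurable_path_eval[OF \<eta>]) (use b h in auto)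
  have [measurable]: "(\<lambda>x. \<eta> x b 0) \<in> borel_measurable M" for b
    by (rule measurable_path_eval[OF \<eta>, of "\<lambda>_. 0"]) auto
  have [measurable]: "Measurable.pred M (\<lambda>x. side t (w x))"
    using measurable_compose[OF w side_measurable[OF t]] .
  have e: "pmap (w x, \<eta> x) t = w x (hit C t (w x)) + (if side t (w x) then \<eta> x True (t - hit C t (w x)) - \<eta> x True 0
     else \<eta> x False (t - hit C t (w x)) - \<eta> x False 0)" for x
    using t by (cases "side t (w x)") (simp_all add: pmap_def)
  show "(\<lambda>x. pmap (w x, \<eta> x) t) \<in> borel_measurable M" unfolding e by measurable
qed

lemma pmap_measurable: "pmap \<in> measurable (Q \<Otimes>\<^sub>M R) path_borel"
proof -
  have "fst \<in> measurable (Q \<Otimes>\<^sub>M R) path_borel" using measurable_fst[of Q R] unfolding measurable_Q(2) .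
  moreover have "(\<lambda>q. snd q b) \<in> measurable (Q \<Otimes>\<^sub>M R) path_borel" for b
    by (rule measurable_compose[OF measurable_snd R_component])
  ultimately show ?thesis using measurable_paste_map[of fst "Q \<Otimes>\<^sub>M R" snd] by simp
qed

lemma prob_space_plaw: "prob_space plaw"
  unfolding plaw_def by (rule QR.prob_space_distr[OF pmap_measurable])

lemma sets_plaw: "sets plaw = sets path_borel"
  by (simp add: plaw_def)

lemma pmap_agree:
  assumes "w \<in> path_space" "0 \<le> s" "hit C s w = s" shows "agree s (pmap (w, \<eta>)) w"
  unfolding agree_def
proof (intro allI impI)
  fix r assume r: "0 \<le> r \<and> r \<le> s"
  have "hit C r w = r" using hit_min[OF closed_C assms(1), of r s] r assms(3) by simp
  then show "pmap (w, \<eta>) r = w r" using r by (simp add: pmap_def)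
qed

lemma paste_martingale:
  assumes Z: "\<And>t. 0 \<le> t \<Longrightarrow> Z t \<in> borel_measurable (raw_filtration t)"
    and dec: "\<And>t w \<eta>. 0 \<le> t \<Longrightarrow> w \<in> path_space \<Longrightarrow> startok \<eta> \<Longrightarrow> Z t (pmap (w, \<eta>)) = LQ (hit C t w) w +
      (if act w then LP (side t w) (t - hit C t w) (\<eta> (side t w)) - LP (side t w) 0 (\<eta> (side t w)) else 0)"
    and L: "\<And>b. martingale (P b) raw_filtration (LP b)"
    and LQi: "\<And>t. 0 \<le> t \<Longrightarrow> integrable Q (\<lambda>w. LQ (hit C t w) w)"
    and LQ: "\<And>s t F. 0 \<le> s \<Longrightarrow> s \<le> t \<Longrightarrow> F \<in> sets (raw_filtration s) \<Longrightarrow>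
      (\<integral>w. indicator F w * (LQ (hit C t w) w - LQ (hit C s w) w) \<partial>Q) = 0"
  shows "martingale plaw raw_filtration Z"
proof -
  interpret pl: filtered_prob_space plaw raw_filtration by (rule filtered_path[OF prob_space_plaw sets_plaw])
  have fP: "filtered_prob_space (P b) raw_filtration" for b by (rule filtered_path[OF P])
  have Zb: "Z t \<in> borel_measurable path_borel" if "0 \<le> t" for t
    using pl.measurable_F_P[OF Z[OF that]] by (simp add: measurable_cong_sets[OF sets_plaw refl])
  have Li: "integrable (P b) (LP b r)" if "0 \<le> r" for b r using L[of b] that by (simp add: martingale_def)
  have Lm: "LP b r \<in> borel_measurable path_borel" if "0 \<le> r" for b r
    using borel_measurable_integrable[OF Li[OF that, of b]] unfolding measurable_P(1) .
  define D where "D = (\<lambda>b r \<zeta>. LP b r \<zeta> - LP b 0 \<zeta>)"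
  have Dm: "D b r \<in> borel_measurable path_borel" if "0 \<le> r" for b r
    unfolding D_def using Lm[OF that] Lm[OF order.refl] by (intro borel_measurable_diff)
  have Di: "integrable (P b) (D b r)" if "0 \<le> r" for b r
    unfolding D_def using Li[OF that] Li[OF order.refl] by (intro Bochner_Integration.integrable_diff)
  have Dset: "(\<integral>\<zeta>. indicator A \<zeta> * (D b r \<zeta> - D b s \<zeta>) \<partial>P b) = 0"
    if "0 \<le> s" "s \<le> r" "A \<in> sets (raw_filtration s)" for A b r s
  proof -
    interpret f: filtered_prob_space "P b" raw_filtration by (rule fP)
    have r: "0 \<le> r" using that by simp
    have i: "integrable (P b) (\<lambda>\<zeta>. indicator A \<zeta> * LP b q \<zeta>)" if "0 \<le> q" for q
      using integrable_mult_indicator[OF f.sets_F_P[OF \<open>A \<in> sets (raw_filtration s)\<close>] Li[OF that, of b]] by simp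
    have "(\<integral>\<zeta>. indicator A \<zeta> * (D b r \<zeta> - D b s \<zeta>) \<partial>P b) = (\<integral>\<zeta>. indicator A \<zeta> * LP b r \<zeta> - indicator A \<zeta> * LP b s \<zeta> \<partial>P b)"
      by (simp add: D_def right_diff_distrib)
    also have "\<dots> = 0" using i[OF r] i[OF that(1)] f.martingale_set[OF L that] by simp
    finally show ?thesis .
  qed
  have D0: "(\<integral>\<zeta>. D b r \<zeta> \<partial>P b) = 0" if "0 \<le> r" for b r
  proof -
    have "path_space \<in> sets (raw_filtration 0 :: (real \<Rightarrow> real ^ 'n) measure)" using sets.top[of "raw_filtration 0"] by simp
    from Dset[OF order.refl that this, of b]
    have "(\<integral>\<zeta>. indicator path_space \<zeta> * D b r \<zeta> \<partial>P b) = 0" by (simp add: D_def)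
    moreover have "(\<integral>\<zeta>. indicator path_space \<zeta> * D b r \<zeta> \<partial>P b) = (\<integral>\<zeta>. D b r \<zeta> \<partial>P b)"
      by (rule Bochner_Integration.integral_cong) auto
    ultimately show ?thesis by simp
  qed
  define K where "K = (\<lambda>t. \<Sum>b\<in>UNIV. 2 * (\<integral>\<zeta>. \<bar>LP b t \<zeta>\<bar> \<partial>P b))"
  have DK: "(\<integral>\<zeta>. \<bar>D b r \<zeta>\<bar> \<partial>P b) \<le> K t" if r: "0 \<le> r" "r \<le> t" for b r t
  proof -
    interpret f: filtered_prob_space "P b" raw_filtration by (rule fP)
    have t: "0 \<le> t" using r by simp
    have m: "(\<integral>\<zeta>. \<bar>LP b q \<zeta>\<bar> \<partial>P b) \<le> (\<integral>\<zeta>. \<bar>LP b t \<zeta>\<bar> \<partial>P b)" if "0 \<le> q" "q \<le> t" for q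
    proof -
      have A: "path_space \<in> sets (raw_filtration q :: (real \<Rightarrow> real ^ 'n) measure)" using sets.top[of "raw_filtration q"] by simp
      have "(\<integral>\<zeta>. indicator path_space \<zeta> * \<bar>LP b q \<zeta>\<bar> \<partial>P b) \<le> (\<integral>\<zeta>. indicator path_space \<zeta> * \<bar>LP b t \<zeta>\<bar> \<partial>P b)"
      proof (rule f.martingale_convex(2)[OF L that A])
        have "excess 0 = (\<lambda>x. \<bar>x\<bar>)" by (rule ext) (simp add: excess_def)
        then show "convex_on UNIV (\<lambda>x::real. \<bar>x\<bar>)" using convex_excess[of 0] by simp
        show "integrable (P b) (\<lambda>\<zeta>. \<bar>LP b t \<zeta>\<bar>)" by (rule integrable_abs[OF Li[OF t]])
      qed simp_all
      moreover have "(\<integral>\<zeta>. indicator path_space \<zeta> * \<bar>LP b q \<zeta>\<bar> \<partial>P b) = (\<integral>\<zeta>. \<bar>LP b q \<zeta>\<bar> \<partial>P b)" for q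
        by (rule Bochner_Integration.integral_cong) auto
      ultimately show ?thesis by simp
    qed
    have "(\<integral>\<zeta>. \<bar>D b r \<zeta>\<bar> \<partial>P b) \<le> (\<integral>\<zeta>. \<bar>LP b r \<zeta>\<bar> + \<bar>LP b 0 \<zeta>\<bar> \<partial>P b)"
      by (rule integral_mono) (use Di[OF r(1)] Li[OF r(1)] Li[OF order.refl] in \<open>auto simp: D_def\<close>)
    also have "\<dots> = (\<integral>\<zeta>. \<bar>LP b r \<zeta>\<bar> \<partial>P b) + (\<integral>\<zeta>. \<bar>LP b 0 \<zeta>\<bar> \<partial>P b)"
      using Li[OF r(1)] Li[OF order.refl] by (intro Bochner_Integration.integral_add integrable_abs) auto
    also have "\<dots> \<le> 2 * (\<integral>\<zeta>. \<bar>LP b t \<zeta>\<bar> \<partial>P b)" using m[of r] m[of 0] r by simp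
    also have "\<dots> \<le> K t" unfolding K_def
      by (rule member_le_sum) auto
    finally show ?thesis .
  qed
  have hb: "0 \<le> hit C t w" "hit C t w \<le> t" "0 \<le> t - hit C t w" "t - hit C t w \<le> t" if "w \<in> path_space" "0 \<le> t" for t w
    using hit_bounds[OF closed_C that] by auto
  define V where "V = (\<lambda>t w \<zeta>. if act w then D (side t w) (t - hit C t w) \<zeta> else 0)"
  have Vm: "V t w \<in> borel_measurable path_borel" if "w \<in> path_space" "0 \<le> t" for t w
    unfolding V_def using Dm[OF hb(3)[OF that]] by (cases "act w") auto
  have ZV: "AE \<eta> in R. Z t (pmap (w, \<eta>)) = LQ (hit C t w) w + V t w (\<eta> (side t w))" if "w \<in> path_space" "0 \<le> t" for t w
    using AE_startok by eventually_elim (use that dec in \<open>auto simp: V_def D_def\<close>)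
  have Vi: "integrable R (\<lambda>\<eta>. V t w (\<eta> b))" "(\<integral>\<eta>. \<bar>V t w (\<eta> b)\<bar> \<partial>R) \<le> K t" "(\<integral>\<eta>. V t w (\<eta> b) \<partial>R) = 0"
    if w: "w \<in> path_space" "0 \<le> t" and b: "b = side t w" for t w b
  proof -
    have i: "integrable (P b) (V t w)" unfolding V_def b using Di[OF hb(3)[OF w]] by (cases "act w") auto
    then show "integrable R (\<lambda>\<eta>. V t w (\<eta> b))" using R_integral(2)[OF Vm[OF w], of b] by simp
    have K0: "0 \<le> K t" unfolding K_def by (intro sum_nonneg mult_nonneg_nonneg Bochner_Integration.integral_nonneg) auto
    have "(\<integral>\<eta>. \<bar>V t w (\<eta> b)\<bar> \<partial>R) = (\<integral>\<zeta>. \<bar>V t w \<zeta>\<bar> \<partial>P b)"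
      by (rule R_integral(1)) (intro borel_measurable_abs Vm[OF w])
    also have "\<dots> \<le> K t" using DK[OF hb(3,4)[OF w]] K0 by (cases "act w") (simp_all add: V_def b)
    finally show "(\<integral>\<eta>. \<bar>V t w (\<eta> b)\<bar> \<partial>R) \<le> K t" .
    have "(\<integral>\<eta>. V t w (\<eta> b) \<partial>R) = (\<integral>\<zeta>. V t w \<zeta> \<partial>P b)" by (rule R_integral(1)[OF Vm[OF w]])
    also have "\<dots> = 0" using D0[OF hb(3)[OF w]] by (cases "act w") (simp_all add: V_def b)
    finally show "(\<integral>\<eta>. V t w (\<eta> b) \<partial>R) = 0" .
  qed
  have pw: "(\<lambda>\<eta>. pmap (w, \<eta>)) \<in> measurable R path_borel" if "w \<in> path_space" for w
    by (rule measurable_paste_map) (use that R_component in auto)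
  have Zw: "(\<lambda>\<eta>. Z t (pmap (w, \<eta>))) \<in> borel_measurable R" if "w \<in> path_space" "0 \<le> t" for w t
    by (rule measurable_compose[OF pw[OF that(1)] Zb[OF that(2)]])
  have Zi: "integrable R (\<lambda>\<eta>. Z t (pmap (w, \<eta>)))" if w: "w \<in> path_space" "0 \<le> t" for t w
  proof (rule integrable_cong_AE_imp)
    show "integrable R (\<lambda>\<eta>. LQ (hit C t w) w + V t w (\<eta> (side t w)))"
      using Vi(1)[OF w refl] by simp
    show "AE \<eta> in R. LQ (hit C t w) w + V t w (\<eta> (side t w)) = Z t (pmap (w, \<eta>))" using ZV[OF w] by (auto elim: eventually_mono)
  qed (rule Zw[OF w])
  have Zn: "(\<integral>\<eta>. \<bar>Z t (pmap (w, \<eta>))\<bar> \<partial>R) \<le> \<bar>LQ (hit C t w) w\<bar> + K t" if w: "w \<in> path_space" "0 \<le> t" for t w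
  proof -
    have "(\<integral>\<eta>. \<bar>Z t (pmap (w, \<eta>))\<bar> \<partial>R) \<le> (\<integral>\<eta>. \<bar>LQ (hit C t w) w\<bar> + \<bar>V t w (\<eta> (side t w))\<bar> \<partial>R)"
      by (rule integral_mono_AE) (use Zi[OF w] Vi(1)[OF w refl] ZV[OF w] in \<open>auto elim!: eventually_mono\<close>)
    also have "\<dots> = \<bar>LQ (hit C t w) w\<bar> + (\<integral>\<eta>. \<bar>V t w (\<eta> (side t w))\<bar> \<partial>R)"
      using Vi(1)[OF w refl] R.prob_space by simp
    finally show ?thesis using Vi(2)[OF w refl] by linarith
  qed
  have Zpm: "(\<lambda>q. Z t (pmap q)) \<in> borel_measurable (Q \<Otimes>\<^sub>M R)" if "0 \<le> t" for t
    by (rule measurable_compose[OF pmap_measurable Zb[OF that]])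
  have ZQR: "integrable (Q \<Otimes>\<^sub>M R) (\<lambda>q. Z t (pmap q))" if t: "0 \<le> t" for t
  proof (rule QR.Fubini_integrable[OF Zpm[OF t]])
    show "integrable Q (\<lambda>w. \<integral>\<eta>. norm (Z t (pmap (w, \<eta>))) \<partial>R)"
    proof (rule Bochner_Integration.integrable_bound)
      show "integrable Q (\<lambda>w. \<bar>LQ (hit C t w) w\<bar> + K t)" using LQi[OF t] by simp
      show "(\<lambda>w. \<integral>\<eta>. norm (Z t (pmap (w, \<eta>))) \<partial>R) \<in> borel_measurable Q"
        using Zpm[OF t] by (intro R.borel_measurable_lebesgue_integral) (simp add: case_prod_beta)
      show "AE w in Q. norm (\<integral>\<eta>. norm (Z t (pmap (w, \<eta>))) \<partial>R) \<le> norm (\<bar>LQ (hit C t w) w\<bar> + K t)"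
      proof (rule AE_I2)
        fix w assume "w \<in> space Q"
        then have w: "w \<in> path_space" by simp
        have "0 \<le> (\<integral>\<eta>. \<bar>Z t (pmap (w, \<eta>))\<bar> \<partial>R)" by (rule Bochner_Integration.integral_nonneg) simp
        then show "norm (\<integral>\<eta>. norm (Z t (pmap (w, \<eta>))) \<partial>R) \<le> norm (\<bar>LQ (hit C t w) w\<bar> + K t)"
          using Zn[OF w t] by simp
      qed
    qed
    show "AE w in Q. integrable R (\<lambda>\<eta>. Z t (pmap (w, \<eta>)))" using Zi[OF _ t] by (intro AE_I2) simp
  qed
  show ?thesis
  proof (rule pl.martingaleI[OF Z])
    fix t :: real assume t: "0 \<le> t"
    show "integrable plaw (Z t)"
      unfolding plaw_def using ZQR[OF t] by (subst integrable_distr_eq[OF pmap_measurable Zb[OF t]])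
  next
    fix s t :: real and F :: "(real \<Rightarrow> real ^ 'n) set" assume h: "0 \<le> s" "s \<le> t" "F \<in> sets (raw_filtration s)"
    have t: "0 \<le> t" using h by simp
    have Fb: "F \<in> sets path_borel" using h(3) raw_filtration_subset_path_borel by auto
    define f where "f = (\<lambda>q. indicator F (pmap q) * (Z t (pmap q) - Z s (pmap q)))"
    have fi: "integrable (Q \<Otimes>\<^sub>M R) f"
    proof -
      have "pmap -` F \<inter> space (Q \<Otimes>\<^sub>M R) \<in> sets (Q \<Otimes>\<^sub>M R)" by (rule measurable_sets[OF pmap_measurable Fb])
      from integrable_mult_indicator[OF this Bochner_Integration.integrable_diff[OF ZQR[OF t] ZQR[OF h(1)]]]
      show ?thesis unfolding f_def
        by (rule Bochner_Integration.integrable_cong[THEN iffD1, rotated 2]) (auto simp: indicator_def)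
    qed
    have g: "(\<integral>\<eta>. f (w, \<eta>) \<partial>R) = indicator F w * (LQ (hit C t w) w - LQ (hit C s w) w)" if w: "w \<in> path_space" for w
    proof (cases "hit C s w = s")
      case True
      have "indicator F (pmap (w, \<eta>)) = (indicator F w :: real)" if "\<eta> \<in> space R" for \<eta>
      proof -
        have "pmap (w, \<eta>) \<in> path_space" using that w by (intro pmap_path) (auto simp: space_R)
        from raw_filtration_agree[OF h(3) this w pmap_agree[OF w h(1) True]] show ?thesis by (simp add: indicator_def)
      qed
      then have "(\<integral>\<eta>. f (w, \<eta>) \<partial>R) = (\<integral>\<eta>. indicator F w * (Z t (pmap (w, \<eta>)) - Z s (pmap (w, \<eta>))) \<partial>R)"
        by (intro Bochner_Integration.integral_cong) (auto simp: f_def)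
      also have "\<dots> = indicator F w * ((\<integral>\<eta>. Z t (pmap (w, \<eta>)) \<partial>R) - (\<integral>\<eta>. Z s (pmap (w, \<eta>)) \<partial>R))"
        using Zi[OF w t] Zi[OF w h(1)] by simp
      finally have e: "(\<integral>\<eta>. f (w, \<eta>) \<partial>R) = indicator F w * ((\<integral>\<eta>. Z t (pmap (w, \<eta>)) \<partial>R) - (\<integral>\<eta>. Z s (pmap (w, \<eta>)) \<partial>R))" .
      have z: "(\<integral>\<eta>. Z r (pmap (w, \<eta>)) \<partial>R) = LQ (hit C r w) w" if r: "0 \<le> r" for r
      proof -
        have "(\<integral>\<eta>. Z r (pmap (w, \<eta>)) \<partial>R) = (\<integral>\<eta>. LQ (hit C r w) w + V r w (\<eta> (side r w)) \<partial>R)"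
          by (rule integral_cong_AE) (use Zw[OF w r] Vi(1)[OF w r refl] ZV[OF w r] in auto)
        also have "\<dots> = LQ (hit C r w) w" using Vi(1,3)[OF w r refl] R.prob_space by simp
        finally show ?thesis .
      qed
      show ?thesis unfolding e z[OF t] z[OF h(1)] ..
    next
      case False
      show ?thesis
      proof (rule hit_C_cases[OF w], goal_cases)
        case 1
        then show ?case using False h(1) by simp
      next
        case (2 \<sigma> b)
        have \<sigma>: "\<sigma> < s" using False 2(4) h(1) by (cases "s \<le> \<sigma>") auto
        have ht: "hit C s w = \<sigma>" "hit C t w = \<sigma>" "side s w = b" "side t w = b" using 2 \<sigma> h by auto
        define Fw where "Fw = {\<zeta> \<in> path_space. pmap (w, \<lambda>_. \<zeta>) \<in> F}"
        have Fw: "Fw \<in> sets (raw_filtration (s - \<sigma>))"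
        proof (rule raw_filtrationI)
          have "(\<lambda>\<zeta>. pmap (w, \<lambda>_. \<zeta>)) \<in> measurable path_borel path_borel"
            by (rule measurable_paste_map) (use w in auto)
          from measurable_sets[OF this Fb] show "Fw \<in> sets path_borel"
            by (simp add: Fw_def vimage_def Int_def conj_commute)
          fix \<zeta> \<zeta>' assume z: "\<zeta> \<in> Fw" "\<zeta>' \<in> path_space" "agree (s - \<sigma>) \<zeta> \<zeta>'"
          have "agree s (pmap (w, \<lambda>_. \<zeta>)) (pmap (w, \<lambda>_. \<zeta>'))"
            using z(3) \<sigma> 2(1) by (auto simp: agree_def pmap_hits[OF 2(4,5,1)])
          from raw_filtration_agree[OF h(3) pmap_path pmap_path this] z w
          show "\<zeta>' \<in> Fw" by (simp add: Fw_def)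
        qed (use \<sigma> in simp)
        have same: "pmap (w, \<eta>) = pmap (w, \<lambda>_. \<eta> b)" if "\<And>b. \<eta> b \<in> path_space" for \<eta>
          by (rule path_space_eqI) (use that w in \<open>auto intro!: pmap_path simp: pmap_hits[OF 2(4,5,1)]\<close>)
        define k where "k = (\<lambda>\<zeta>. indicator Fw \<zeta> * (V t w \<zeta> - V s w \<zeta>))"
        have Fwb: "Fw \<in> sets path_borel" using Fw raw_filtration_subset_path_borel by auto
        have km: "k \<in> borel_measurable path_borel"
          unfolding k_def using Vm[OF w t] Vm[OF w h(1)] Fwb by (intro borel_measurable_times borel_measurable_diff) auto
        have "(\<integral>\<eta>. f (w, \<eta>) \<partial>R) = (\<integral>\<eta>. k (\<eta> b) \<partial>R)"
        proof (rule integral_cong_AE)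
          show "(\<lambda>\<eta>. f (w, \<eta>)) \<in> borel_measurable R"
            unfolding f_def using Zb[OF t] Zb[OF h(1)] Fb
            by (intro borel_measurable_times borel_measurable_diff measurable_compose[OF pw[OF w]]) auto
          show "(\<lambda>\<eta>. k (\<eta> b)) \<in> borel_measurable R" by (rule measurable_compose[OF R_component km])
          show "AE \<eta> in R. f (w, \<eta>) = k (\<eta> b)"
            using ZV[OF w t] ZV[OF w h(1)] AE_space
          proof eventually_elim
            case (elim \<eta>)
            have e: "\<And>b. \<eta> b \<in> path_space" using elim(3) by (simp add: space_R)
            have "indicator F (pmap (w, \<eta>)) = (indicator Fw (\<eta> b) :: real)"
            proof -
              have "pmap (w, \<eta>) = pmap (w, \<lambda>_. \<eta> b)" by (rule same[OF e])
              then show ?thesis using e by (simp add: Fw_def indicator_def)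
            qed
            then show ?case using elim(1,2) by (simp add: f_def k_def ht)
          qed
        qed
        also have "\<dots> = (\<integral>\<zeta>. k \<zeta> \<partial>P b)" by (rule R_integral(1)[OF km])
        also have "\<dots> = 0"
        proof (cases "act w")
          case True
          then have "k = (\<lambda>\<zeta>. indicator Fw \<zeta> * (D b (t - \<sigma>) \<zeta> - D b (s - \<sigma>) \<zeta>))" by (auto simp: k_def V_def ht)
          then show ?thesis using Dset[OF _ _ Fw, of "t - \<sigma>" b] \<sigma> h by simp
        qed (simp add: k_def V_def)
        finally show ?case by (simp add: ht)
      qed
    qed
    have "(\<integral>X. indicator F X * (Z t X - Z s X) \<partial>plaw) = (\<integral>q. f q \<partial>(Q \<Otimes>\<^sub>M R))"
      unfolding plaw_def f_def
      by (rule integral_distr[OF pmap_measurable]) (use Zb[OF t] Zb[OF h(1)] Fb in auto)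
    also have "\<dots> = (\<integral>w. \<integral>\<eta>. f (w, \<eta>) \<partial>R \<partial>Q)" by (rule QR.integral_fst'[symmetric, OF fi])
    also have "\<dots> = (\<integral>w. indicator F w * (LQ (hit C t w) w - LQ (hit C s w) w) \<partial>Q)"
      by (rule Bochner_Integration.integral_cong) (simp_all add: g)
    also have "\<dots> = 0" by (rule LQ[OF h])
    finally show "(\<integral>X. indicator F X * (Z t X - Z s X) \<partial>plaw) = 0" .
  qed
qed

end

lemma hit_le:
  fixes w :: "real \<Rightarrow> 'a::metric_space"
  assumes "closed C" "w \<in> path_space" "0 \<le> s" "s \<le> t" "w s \<in> C" shows "hit C t w \<le> s"
proof (rule hit_cases[OF assms(1,2)], goal_cases)
  case 1 then show ?case using assms by auto
next
  case (2 \<sigma>)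
  then have "\<sigma> \<le> s" using assms(3,5) by (meson not_le)
  then show ?case using 2(4)[of t] assms by simp
qed

lemma hit_in:
  fixes w :: "real \<Rightarrow> 'a::metric_space"
  assumes "closed C" "w \<in> path_space" "0 \<le> t" "hit C t w < t" shows "w (hit C t w) \<in> C"
proof (rule hit_cases[OF assms(1,2)], goal_cases)
  case 1 then show ?case using assms by auto
next
  case (2 \<sigma>) then show ?case using assms by (auto simp: min_def split: if_splits)
qed

lemma hit_first:
  fixes w :: "real \<Rightarrow> 'a::metric_space"
  assumes "closed C" "w \<in> path_space" "0 \<le> \<sigma>" "w \<sigma> \<in> C" "\<And>s. 0 \<le> s \<Longrightarrow> s < \<sigma> \<Longrightarrow> w s \<notin> C" "0 \<le> t"
  shows "hit C t w = min t \<sigma>"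
proof (rule hit_cases[OF assms(1,2)], goal_cases)
  case 1 then show ?case using assms by auto
next
  case (2 \<tau>)
  then have "\<tau> = \<sigma>" using assms(3-5) by (metis linorder_neqE_linordered_idom)
  then show ?case using 2(4)[OF assms(6)] by simp
qed

lemma hit_agree_le:
  fixes w :: "real \<Rightarrow> 'a::metric_space"
  assumes C: "closed C" and w: "w \<in> path_space" "w' \<in> path_space" and a: "agree t w w'" and t: "0 \<le> t" "t \<le> m"
    and h: "hit C m w \<le> t" "w (hit C m w) \<in> C"
  shows "hit C m w' = hit C m w"
proof -
  have m: "0 \<le> m" using t by simp
  have h0: "0 \<le> hit C m w" by (rule hit_bounds(1)[OF C w(1) m])
  have e: "hit C t w = hit C m w" using hit_min[OF C w(1) t] h by simp
  have e': "hit C t w' = hit C m w" using hit_agree[OF a] e by simp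
  have "w' (hit C m w) \<in> C" using a h h0 by (simp add: agree_def)
  then have "hit C m w' \<le> hit C m w" by (rule hit_le[OF C w(2) h0, rotated]) (use h t in simp)
  then show ?thesis using hit_min[OF C w(2) t] e' h by simp
qed

lemma stopping_time_hit:
  fixes C :: "'a::{heine_borel, second_countable_topology} set"
  assumes C: "closed C" and m: "0 \<le> m" shows "stopping_time raw_filtration (hit C m)"
proof (rule raw_stopping_timeI[OF measurable_hit[OF C m]])
  show "0 \<le> hit C m \<omega>" if "\<omega> \<in> path_space" for \<omega> by (rule hit_bounds(1)[OF C that m])
  fix t \<omega> \<eta> assume h: "0 \<le> t" "\<omega> \<in> path_space" "\<eta> \<in> path_space" "agree t \<omega> \<eta>" "hit C m \<omega> \<le> t"
  show "hit C m \<eta> \<le> t"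
  proof (cases "m \<le> t")
    case True
    then show ?thesis using hit_bounds(2)[OF C h(3) m] by simp
  next
    case False
    then have "hit C m \<omega> < m" using h(5) by simp
    from hit_agree_le[OF C h(2-4,1) _ h(5) hit_in[OF C h(2) m this]] False h(5) show ?thesis by simp
  qed
qed

lemma finite_variation_add:
  assumes "finite_variation f" "finite_variation g" shows "finite_variation (\<lambda>t. f t + g t)"
  unfolding finite_variation_def
proof (intro allI impI)
  fix T :: real assume T: "0 \<le> T"
  obtain B1 where B1: "\<forall>n s. mono s \<and> range s \<subseteq> {0..T} \<longrightarrow> (\<Sum>k<n. \<bar>f (s (Suc k)) - f (s k)\<bar>) \<le> B1"
    using assms(1)[unfolded finite_variation_def, rule_format, OF T] by (elim exE) simp
  obtain B2 where B2: "\<forall>n s. mono s \<and> range s \<subseteq> {0..T} \<longrightarrow> (\<Sum>k<n. \<bar>g (s (Suc k)) - g (s k)\<bar>) \<le> B2"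
    using assms(2)[unfolded finite_variation_def, rule_format, OF T] by (elim exE) simp
  show "\<exists>B. \<forall>n s. mono s \<and> range s \<subseteq> {0..T} \<longrightarrow> (\<Sum>k<n. \<bar>f (s (Suc k)) + g (s (Suc k)) - (f (s k) + g (s k))\<bar>) \<le> B"
  proof (intro exI[of _ "B1 + B2"] allI impI)
    fix n and s :: "nat \<Rightarrow> real" assume s: "mono s \<and> range s \<subseteq> {0..T}"
    have "(\<Sum>k<n. \<bar>f (s (Suc k)) + g (s (Suc k)) - (f (s k) + g (s k))\<bar>) \<le>
      (\<Sum>k<n. \<bar>f (s (Suc k)) - f (s k)\<bar> + \<bar>g (s (Suc k)) - g (s k)\<bar>)"
      by (rule sum_mono) linarith
    also have "\<dots> \<le> B1 + B2"
      unfolding sum.distrib by (intro add_mono B1[rule_format, OF s] B2[rule_format, OF s])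
    finally show "(\<Sum>k<n. \<bar>f (s (Suc k)) + g (s (Suc k)) - (f (s k) + g (s k))\<bar>) \<le> B1 + B2" .
  qed
qed

lemma finite_variation_delay:
  assumes "finite_variation g" "0 \<le> \<sigma>" shows "finite_variation (\<lambda>t. g (t - min t \<sigma>))"
  unfolding finite_variation_def
proof (intro allI impI)
  fix T :: real assume T: "0 \<le> T"
  obtain B where B: "\<forall>n s. mono s \<and> range s \<subseteq> {0..T} \<longrightarrow> (\<Sum>k<n. \<bar>g (s (Suc k)) - g (s k)\<bar>) \<le> B"
    using assms(1)[unfolded finite_variation_def, rule_format, OF T] by (elim exE) simp
  show "\<exists>B. \<forall>n s. mono s \<and> range s \<subseteq> {0..T} \<longrightarrow> (\<Sum>k<n. \<bar>g (s (Suc k) - min (s (Suc k)) \<sigma>) - g (s k - min (s k) \<sigma>)\<bar>) \<le> B"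
  proof (intro exI[of _ B] allI impI)
    fix n and s :: "nat \<Rightarrow> real" assume s: "mono s \<and> range s \<subseteq> {0..T}"
    have sk: "s k \<in> {0..T}" for k using s rangeI[of s k] by blast
    have "mono (\<lambda>k. s k - min (s k) \<sigma>)"
    proof (rule monoI)
      fix a b :: nat assume "a \<le> b"
      then have "s a \<le> s b" using s by (simp add: mono_def)
      then show "s a - min (s a) \<sigma> \<le> s b - min (s b) \<sigma>" by (simp add: min_def)
    qed
    moreover have "range (\<lambda>k. s k - min (s k) \<sigma>) \<subseteq> {0..T}"
    proof (rule image_subsetI)
      fix k show "s k - min (s k) \<sigma> \<in> {0..T}" using sk[of k] assms(2) by (auto simp: min_def)
    qed
    ultimately show "(\<Sum>k<n. \<bar>g (s (Suc k) - min (s (Suc k)) \<sigma>) - g (s k - min (s k) \<sigma>)\<bar>) \<le> B"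
      using B[rule_format, of "\<lambda>k. s k - min (s k) \<sigma>" n] by simp
  qed
qed

lemma joint_component: "joint (\<lambda>t (\<omega>::real \<Rightarrow> real ^ 'n). \<omega> t $ i)"
  unfolding joint_def
proof (rule measurable_compose[OF _ vec_nth_borel])
  show "(\<lambda>p. snd p (max 0 (fst p))) \<in> borel_measurable ((borel :: real measure) \<Otimes>\<^sub>M (path_borel :: (real \<Rightarrow> real ^ 'n) measure))"
    by (rule measurable_path_eval[OF measurable_snd, of "\<lambda>p. max 0 (fst p)"]) auto
qed

lemma joint_diff: "joint f \<Longrightarrow> joint g \<Longrightarrow> joint (\<lambda>t \<omega>. f t \<omega> - g t \<omega>)"
  unfolding joint_def by (rule borel_measurable_diff)

lemma joint_times: "joint f \<Longrightarrow> joint g \<Longrightarrow> joint (\<lambda>t \<omega>. f t \<omega> * g t \<omega>)"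
  unfolding joint_def by (rule borel_measurable_times)

lemma joint_time: "joint (\<lambda>t \<omega>. t * c)"
  unfolding joint_def by measurable

lemma component_continuous:
  fixes w :: "real \<Rightarrow> real ^ 'n"
  shows "w \<in> path_space \<Longrightarrow> continuous_on {0..} (\<lambda>t. w t $ i)"
  by (intro continuous_intros path_space_continuous)

locale paste_bracket = paste "line_law x e" P p for x e :: "real ^ 'n" and P p +
  fixes A :: "bool \<Rightarrow> real \<Rightarrow> (real \<Rightarrow> real ^ 'n) \<Rightarrow> real ^ 'n ^ 'n"
  assumes e: "norm e = 1"
    and PM: "\<And>b. P b \<in> martingale_laws (p b)"
    and A: "\<And>b. is_bracket (P b) raw_filtration (\<lambda>t \<omega>. \<omega> t) (A b)" "\<And>b. AE \<omega> in P b. \<forall>t\<ge>0. trace (A b t \<omega>) = t"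
      "\<And>b i j. joint (\<lambda>t \<omega>. A b t \<omega> $ i $ j)"
      "\<And>b i j t. 0 \<le> t \<Longrightarrow> (\<lambda>\<omega>. A b t \<omega> $ i $ j) \<in> borel_measurable (raw_filtration t)"
begin

lemma Lf: "filtered_prob_space (line_law x e) raw_filtration"
  by (rule filtered_path[OF Q])

lemma stop_line:
  assumes M: "martingale (line_law x e) raw_filtration M" and j: "joint M"
    and c: "\<And>w. w \<in> path_space \<Longrightarrow> continuous_on {0..} (\<lambda>t. M t w)"
    and st: "0 \<le> s" "s \<le> t" and m: "0 \<le> m" and F: "F \<in> sets (raw_filtration s)"
  shows "integrable (line_law x e) (\<lambda>w. M (min t (hit C m w)) w)"
    "(\<integral>w. indicator F w * (M (min t (hit C m w)) w - M (min s (hit C m w)) w) \<partial>line_law x e) = 0"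
proof -
  interpret L: filtered_prob_space "line_law x e" raw_filtration by (rule Lf)
  have ae: "AE w in line_law x e. continuous_on {0..} (\<lambda>t. M t w)" by (rule AE_I2) (simp add: c)
  have meas: "(\<lambda>w. M (min r (hit C m w)) w) \<in> borel_measurable (line_law x e)" if "0 \<le> r" for r
    unfolding measurable_Q(1)
    by (rule joint_compose[OF j]) (use that hit_bounds[OF closed_C _ m] measurable_hit[OF closed_C m] in auto)
  have h0: "0 \<le> hit C m w" if "w \<in> space (line_law x e)" for w using hit_bounds(1)[OF closed_C _ m] that by simp
  show "integrable (line_law x e) (\<lambda>w. M (min t (hit C m w)) w)"
    "(\<integral>w. indicator F w * (M (min t (hit C m w)) w - M (min s (hit C m w)) w) \<partial>line_law x e) = 0"
    using L.stopped_martingale_set[OF M ae stopping_time_hit[OF closed_C m] h0 meas st F] by auto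
qed

lemma stop_line_hit:
  assumes M: "martingale (line_law x e) raw_filtration M" and j: "joint M"
    and c: "\<And>w. w \<in> path_space \<Longrightarrow> continuous_on {0..} (\<lambda>t. M t w)"
    and st: "0 \<le> s" "s \<le> t" and F: "F \<in> sets (raw_filtration s)"
  shows "integrable (line_law x e) (\<lambda>w. M (hit C t w) w)"
    "(\<integral>w. indicator F w * (M (hit C t w) w - M (hit C s w) w) \<partial>line_law x e) = 0"
proof -
  have t: "0 \<le> t" using st by simp
  note r = stop_line[OF M j c st t F]
  have eq: "min t (hit C t w) = hit C t w" "min s (hit C t w) = hit C s w" if "w \<in> space (line_law x e)" for w
    using hit_bounds(2)[OF closed_C _ t, of w] hit_min[OF closed_C _ st, of w] that by auto
  show "integrable (line_law x e) (\<lambda>w. M (hit C t w) w)"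
    using r(1) by (rule Bochner_Integration.integrable_cong[THEN iffD1, rotated 2]) (auto simp: eq)
  have "(\<integral>w. indicator F w * (M (hit C t w) w - M (hit C s w) w) \<partial>line_law x e) =
    (\<integral>w. indicator F w * (M (min t (hit C t w)) w - M (min s (hit C t w)) w) \<partial>line_law x e)"
    by (rule Bochner_Integration.integral_cong) (auto simp: eq)
  then show "(\<integral>w. indicator F w * (M (hit C t w) w - M (hit C s w) w) \<partial>line_law x e) = 0" using r(2) by simp
qed

lemma plaw_martingale: "martingale plaw raw_filtration (\<lambda>t X. X t $ i)"
proof (rule paste_martingale[where LP="\<lambda>b t \<eta>. \<eta> t $ i" and LQ="\<lambda>t w. w t $ i" and act="\<lambda>_. True"])
  show "martingale (P b) raw_filtration (\<lambda>t \<eta>. \<eta> t $ i)" for b using PM[of b] by (simp add: martingale_laws_def)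
  note l = stop_line_hit[OF line_law_martingale joint_component component_continuous]
  show "integrable (line_law x e) (\<lambda>w. w (hit C t w) $ i)" if "0 \<le> t" for t
    by (rule l(1)[OF _ order.refl that, of "{}"]) auto
  show "(\<integral>w. indicator F w * (w (hit C t w) $ i - w (hit C s w) $ i) \<partial>line_law x e) = 0"
    if "0 \<le> s" "s \<le> t" "F \<in> sets (raw_filtration s)" for s t F by (rule l(2)[OF _ that])
qed (auto simp: raw_component pmap_def)

definition tsh :: "real \<Rightarrow> (real \<Rightarrow> real ^ 'n) \<Rightarrow> real \<Rightarrow> real ^ 'n" where
  "tsh t X = on_paths (\<lambda>r. X (min (hit C t X + r) t))"

definition shift :: "real \<Rightarrow> (real \<Rightarrow> real ^ 'n) \<Rightarrow> real \<Rightarrow> real ^ 'n" where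
  "shift t X = on_paths (\<lambda>r. X (hit C t X + r))"

definition B :: "real \<Rightarrow> (real \<Rightarrow> real ^ 'n) \<Rightarrow> real ^ 'n ^ 'n" where
  "B t X = (\<chi> i j. hit C t X * (e $ i * e $ j) +
     (A (side t X) (t - hit C t X) (tsh t X) $ i $ j - A (side t X) 0 (tsh t X) $ i $ j))"

lemma hit_nonneg: "X \<in> path_space \<Longrightarrow> 0 \<le> t \<Longrightarrow> 0 \<le> hit C t X \<and> hit C t X \<le> t"
  using hit_bounds[OF closed_C] by auto

lemma tsh_path:
  assumes "X \<in> path_space" "0 \<le> t" shows "tsh t X \<in> path_space"
  unfolding tsh_def
proof (rule on_paths_in_path_space, rule continuous_on_compose2[OF path_space_continuous[OF assms(1)]])
  show "continuous_on {0..} (\<lambda>r. min (hit C t X + r) t)" by (intro continuous_intros)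
  show "(\<lambda>r. min (hit C t X + r) t) ` {0..} \<subseteq> {0..}" using hit_nonneg[OF assms] assms(2) by auto
qed

lemma shift_path:
  assumes "X \<in> path_space" "0 \<le> t" shows "shift t X \<in> path_space"
  unfolding shift_def
proof (rule on_paths_in_path_space, rule continuous_on_compose2[OF path_space_continuous[OF assms(1)]])
  show "continuous_on {0..} (\<lambda>r. hit C t X + r)" by (intro continuous_intros)
  show "(\<lambda>r. hit C t X + r) ` {0..} \<subseteq> {0..}" using hit_nonneg[OF assms] by auto
qed

lemma at_hit:
  assumes "closed D" "w \<in> path_space" "0 \<le> t" "hit D t w < t \<or> w t \<in> D" shows "w (hit D t w) \<in> D"
  using hit_in[OF assms(1-3)] hit_bounds(2)[OF assms(1-3)] assms(4) by (cases "hit D t w < t") auto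

lemma pmap_hit:
  assumes w: "w \<in> path_space" and \<eta>: "startok \<eta>" and t: "0 \<le> t"
  shows "hit C t (pmap (w, \<eta>)) = hit C t w" "pmap (w, \<eta>) (hit C t w) = w (hit C t w)" "side t (pmap (w, \<eta>)) = side t w"
proof -
  have X: "pmap (w, \<eta>) \<in> path_space" using w \<eta> by (intro pmap_path) (auto simp: startok_def)
  show 1: "hit C t (pmap (w, \<eta>)) = hit C t w"
  proof (rule hit_C_cases[OF w], goal_cases)
    case 1
    show ?case using pmap_agree[OF w t] 1(2) t by (intro hit_agree) auto
  next
    case (2 \<sigma> b)
    have X': "pmap (w, \<eta>) s = w s" if "0 \<le> s" "s \<le> \<sigma>" for s
      using pmap_hits[OF 2(4,5,1) that(1)] that by simp
    have "hit C t (pmap (w, \<eta>)) = min t \<sigma>"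
    proof (rule hit_first[OF closed_C X 2(1) _ _ t])
      show "pmap (w, \<eta>) \<sigma> \<in> C" using X'[OF 2(1) order.refl] 2(2) by (cases b) (simp_all add: C_def)
      show "pmap (w, \<eta>) s \<notin> C" if "0 \<le> s" "s < \<sigma>" for s using X'[OF that(1)] 2(3) that by simp
    qed
    then show ?case using 2(4) t by simp
  qed
  have "hit C (hit C t w) w = hit C t w"
    using hit_min[OF closed_C w, of "hit C t w" t] hit_nonneg[OF w t] by simp
  then show 2: "pmap (w, \<eta>) (hit C t w) = w (hit C t w)"
    using hit_nonneg[OF w t] by (simp add: pmap_def)
  show "side t (pmap (w, \<eta>)) = side t w" by (simp add: side_def 1 2)
qed

lemma pmap_after:
  assumes w: "w \<in> path_space" and \<eta>: "startok \<eta>"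
    and h: "\<forall>t\<ge>0. hit C t w = min t \<sigma>" "\<forall>t\<ge>\<sigma>. side t w = b" "0 \<le> \<sigma>" "w \<sigma> = p b" and r: "0 \<le> r"
  shows "pmap (w, \<eta>) (\<sigma> + r) = \<eta> b r"
  using pmap_hits[OF h(1-3), of "\<sigma> + r" \<eta>] \<eta> h r by (simp add: startok_def)

lemma tsh_pmap:
  assumes w: "w \<in> path_space" and \<eta>: "startok \<eta>"
    and h: "\<forall>t\<ge>0. hit C t w = min t \<sigma>" "\<forall>t\<ge>\<sigma>. side t w = b" "0 \<le> \<sigma>" "w \<sigma> = p b" and t: "\<sigma> \<le> t"
  shows "agree (t - \<sigma>) (tsh t (pmap (w, \<eta>))) (\<eta> b)"
  unfolding agree_def
proof (intro allI impI)
  fix r assume r: "0 \<le> r \<and> r \<le> t - \<sigma>"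
  have "hit C t (pmap (w, \<eta>)) = \<sigma>" using pmap_hit(1)[OF w \<eta>, of t] h t by simp
  then have "tsh t (pmap (w, \<eta>)) r = pmap (w, \<eta>) (\<sigma> + r)" using r by (simp add: tsh_def min_absorb1)
  then show "tsh t (pmap (w, \<eta>)) r = \<eta> b r" using pmap_after[OF w \<eta> h] r by simp
qed

lemma shift_pmap:
  assumes w: "w \<in> path_space" and \<eta>: "startok \<eta>"
    and h: "\<forall>t\<ge>0. hit C t w = min t \<sigma>" "\<forall>t\<ge>\<sigma>. side t w = b" "0 \<le> \<sigma>" "w \<sigma> = p b" and t: "\<sigma> \<le> t"
  shows "shift t (pmap (w, \<eta>)) = \<eta> b"
proof (rule path_space_eqI)
  have X: "pmap (w, \<eta>) \<in> path_space" using w \<eta> by (intro pmap_path) (auto simp: startok_def)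
  show "shift t (pmap (w, \<eta>)) \<in> path_space" by (rule shift_path[OF X]) (use h t in simp)
  show "\<eta> b \<in> path_space" using \<eta> by (simp add: startok_def)
  fix r :: real assume r: "0 \<le> r"
  have "hit C t (pmap (w, \<eta>)) = \<sigma>" using pmap_hit(1)[OF w \<eta>, of t] h t by simp
  then show "shift t (pmap (w, \<eta>)) r = \<eta> b r" using pmap_after[OF w \<eta> h r] r by (simp add: shift_def)
qed

definition N :: "'n \<Rightarrow> 'n \<Rightarrow> real \<Rightarrow> (real \<Rightarrow> real ^ 'n) \<Rightarrow> real" where
  "N i j t X = X t $ i * X t $ j - B t X $ i $ j"

definition NQ :: "'n \<Rightarrow> 'n \<Rightarrow> real \<Rightarrow> (real \<Rightarrow> real ^ 'n) \<Rightarrow> real" where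
  "NQ i j t w = w t $ i * w t $ j - t * (e $ i * e $ j)"

definition NP :: "'n \<Rightarrow> 'n \<Rightarrow> bool \<Rightarrow> real \<Rightarrow> (real \<Rightarrow> real ^ 'n) \<Rightarrow> real" where
  "NP i j b t \<eta> = \<eta> t $ i * \<eta> t $ j - A b t \<eta> $ i $ j"

lemma N_pmap:
  assumes w: "w \<in> path_space" and \<eta>: "startok \<eta>" and t: "0 \<le> t"
  shows "N i j t (pmap (w, \<eta>)) = NQ i j (hit C t w) w +
    (NP i j (side t w) (t - hit C t w) (\<eta> (side t w)) - NP i j (side t w) 0 (\<eta> (side t w)))"
proof -
  note ph = pmap_hit[OF w \<eta> t]
  show ?thesis
  proof (cases "hit C t w = t")
    case True
    have "pmap (w, \<eta>) t = w t" using pmap_hit(2)[OF w \<eta> t] True by simp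
    then show ?thesis by (simp add: N_def NQ_def B_def ph True)
  next
    case False
    show ?thesis
    proof (rule hit_C_cases[OF w], goal_cases)
      case 1 then show ?case using False t by simp
    next
      case (2 \<sigma> b)
      have \<sigma>: "\<sigma> \<le> t" using False 2(4) t by (cases "t \<le> \<sigma>") auto
      have ht: "hit C t w = \<sigma>" "side t w = b" using 2 \<sigma> t by auto
      have X: "pmap (w, \<eta>) \<in> path_space" using w \<eta> by (intro pmap_path) (auto simp: startok_def)
      note ag = tsh_pmap[OF w \<eta> 2(4,5,1,2) \<sigma>]
      have e1: "A b r (tsh t (pmap (w, \<eta>))) $ i $ j = A b r (\<eta> b) $ i $ j" if "0 \<le> r" "r \<le> t - \<sigma>" for r
        by (rule raw_measurable_agree[OF A(4)[OF that(1)] tsh_path[OF X t] _ agree_mono[OF ag that(2)]])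
          (use \<eta> in \<open>simp add: startok_def\<close>)
      have Xt: "pmap (w, \<eta>) t = \<eta> b (t - \<sigma>)" using pmap_after[OF w \<eta> 2(4,5,1,2), of "t - \<sigma>"] \<sigma> by simp
      have s: "\<eta> b 0 = w \<sigma>" using \<eta> 2(2) by (simp add: startok_def)
      show ?case
        using e1[of "t - \<sigma>"] e1[of 0] \<sigma> by (simp add: N_def NQ_def NP_def B_def ph ht Xt s)
    qed
  qed
qed

lemma NQ_martingale: "martingale (line_law x e) raw_filtration (NQ i j)"
  using line_law_martingale2[of x e i j] by (simp add: NQ_def[abs_def])

lemma NQ_joint: "joint (NQ i j)"
  unfolding NQ_def[abs_def] by (intro joint_diff joint_times joint_component joint_time)

lemma NQ_continuous: "w \<in> path_space \<Longrightarrow> continuous_on {0..} (\<lambda>t. NQ i j t w)"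
  unfolding NQ_def by (intro continuous_intros component_continuous)

lemma hit_measurable_at:
  assumes f: "f \<in> borel_measurable path_borel" "\<And>X. X \<in> path_space \<Longrightarrow> 0 \<le> f X" "\<And>X. X \<in> path_space \<Longrightarrow> f X \<le> m"
    and m: "0 \<le> m"
  shows "(\<lambda>X. hit C (f X) X) \<in> borel_measurable path_borel"
    "(\<lambda>X. X (hit C (f X) X)) \<in> borel_measurable path_borel"
    "Measurable.pred path_borel (\<lambda>X. side (f X) X)"
    "(\<lambda>X. tsh (f X) X) \<in> measurable path_borel path_borel"
proof -
  have eq: "hit C (f X) X = min (f X) (hit C m X)" if "X \<in> space path_borel" for X
    using hit_min[OF closed_C _ f(2,3), of X X] that by simp
  have "(\<lambda>X. min (f X) (hit C m X)) \<in> borel_measurable path_borel"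
    using f(1) measurable_hit[OF closed_C m] by measurable
  then show h: "(\<lambda>X. hit C (f X) X) \<in> borel_measurable path_borel"
    by (rule measurable_cong[THEN iffD2, rotated]) (rule eq)
  have idp: "(\<lambda>X. X) \<in> measurable path_borel (path_borel :: (real \<Rightarrow> real ^ 'n) measure)" by simp
  show e: "(\<lambda>X. X (hit C (f X) X)) \<in> borel_measurable path_borel"
    by (rule measurable_path_eval[OF idp h]) (use hit_nonneg f(2) in auto)
  from measurable_sets[OF e, of "{p True}"] show "Measurable.pred path_borel (\<lambda>X. side (f X) X)"
    by (simp add: pred_def side_def vimage_def Int_def conj_commute)
  show "(\<lambda>X. tsh (f X) X) \<in> measurable path_borel path_borel"
  proof (rule path_measurableI)
    fix s :: real assume s: "0 \<le> s"
    have "(\<lambda>X. X (min (hit C (f X) X + s) (f X))) \<in> borel_measurable path_borel"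
      by (rule measurable_path_eval[OF idp]) (use h f s hit_nonneg in \<open>auto intro!: borel_measurable_min borel_measurable_add\<close>)
    then show "(\<lambda>X. tsh (f X) X s) \<in> borel_measurable path_borel" using s by (simp add: tsh_def)
  qed (use tsh_path f(2) in auto)
qed

lemma B_measurable_at:
  assumes f: "f \<in> borel_measurable path_borel" "\<And>X. X \<in> path_space \<Longrightarrow> 0 \<le> f X" "\<And>X. X \<in> path_space \<Longrightarrow> f X \<le> m"
    and m: "0 \<le> m"
  shows "(\<lambda>X. B (f X) X $ i $ j) \<in> borel_measurable path_borel"
proof -
  note h = hit_measurable_at[OF f m]
  have a: "(\<lambda>X. A b (f X - hit C (f X) X) (tsh (f X) X) $ i $ j) \<in> borel_measurable path_borel" for b
    by (rule joint_compose[OF A(3) _ _ h(4)]) (use f h(1) hit_nonneg in auto)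
  have a0: "(\<lambda>X. A b 0 (tsh (f X) X) $ i $ j) \<in> borel_measurable path_borel" for b
    by (rule joint_compose[OF A(3) _ _ h(4)]) auto
  have eq: "B (f X) X $ i $ j = hit C (f X) X * (e $ i * e $ j) + (if side (f X) X then
      A True (f X - hit C (f X) X) (tsh (f X) X) $ i $ j - A True 0 (tsh (f X) X) $ i $ j
    else A False (f X - hit C (f X) X) (tsh (f X) X) $ i $ j - A False 0 (tsh (f X) X) $ i $ j)" for X
    by (cases "side (f X) X") (simp_all add: B_def)
  note [measurable] = h(1,3) a a0
  show ?thesis unfolding eq by measurable
qed

lemma N_measurable_at:
  assumes f: "f \<in> borel_measurable path_borel" "\<And>X. X \<in> path_space \<Longrightarrow> 0 \<le> f X" "\<And>X. X \<in> path_space \<Longrightarrow> f X \<le> m"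
    and m: "0 \<le> m"
  shows "(\<lambda>X. N i j (f X) X) \<in> borel_measurable path_borel"
proof -
  have idp: "(\<lambda>X. X) \<in> measurable path_borel (path_borel :: (real \<Rightarrow> real ^ 'n) measure)" by simp
  have "(\<lambda>X. X (f X) $ k) \<in> borel_measurable path_borel" for k
    by (rule joint_compose[OF joint_component f(1) _ idp]) (use f(2) in simp)
  then show ?thesis unfolding N_def using B_measurable_at[OF f m] by (intro borel_measurable_diff borel_measurable_times)
qed

lemma B_agree: "agree t X Y \<Longrightarrow> X \<in> path_space \<Longrightarrow> 0 \<le> t \<Longrightarrow> B t X = B t Y"
proof -
  assume a: "agree t X Y" and X: "X \<in> path_space" and t: "0 \<le> t"
  have h: "hit C t X = hit C t Y" by (rule hit_agree[OF a])
  have s: "side t X = side t Y" using a hit_nonneg[OF X t] by (simp add: side_def h[symmetric] agree_def)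
  have "tsh t X = tsh t Y"
  proof
    fix r show "tsh t X r = tsh t Y r"
      using a hit_nonneg[OF X t] t by (cases "0 \<le> r") (auto simp: tsh_def on_paths_def h[symmetric] agree_def)
  qed
  then show ?thesis by (simp add: B_def h s)
qed

lemma N_agree: "agree t X Y \<Longrightarrow> X \<in> path_space \<Longrightarrow> 0 \<le> t \<Longrightarrow> N i j t X = N i j t Y"
  using B_agree[of t X Y] by (simp add: N_def agree_def)

lemma B_raw: "0 \<le> t \<Longrightarrow> (\<lambda>X. B t X $ i $ j) \<in> borel_measurable (raw_filtration t)"
  by (rule raw_measurableI[OF B_measurable_at[of "\<lambda>_. t" t]]) (auto simp: B_agree)

lemma N_raw: "0 \<le> t \<Longrightarrow> N i j t \<in> borel_measurable (raw_filtration t)"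
  by (rule raw_measurableI[OF N_measurable_at[of "\<lambda>_. t" t]]) (auto simp: N_agree)

end

context paste_bracket
begin

lemma shift_measurable: "0 \<le> t \<Longrightarrow> shift t \<in> measurable path_borel path_borel"
proof (rule path_measurableI)
  assume t: "0 \<le> t"
  show "X \<in> space path_borel \<Longrightarrow> shift t X \<in> path_space" for X using shift_path[OF _ t] by simp
  fix s :: real assume s: "0 \<le> s"
  have idp: "(\<lambda>X. X) \<in> measurable path_borel (path_borel :: (real \<Rightarrow> real ^ 'n) measure)" by simp
  have "(\<lambda>X. X (hit C t X + s)) \<in> borel_measurable path_borel"
    by (rule measurable_path_eval[OF idp]) (use measurable_hit[OF closed_C t] hit_nonneg[OF _ t] s in auto)
  then show "(\<lambda>X. shift t X s) \<in> borel_measurable path_borel" using s by (simp add: shift_def)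
qed

lemma at_hit_measurable: "0 \<le> t \<Longrightarrow> Measurable.pred path_borel (\<lambda>X. X (hit C t X) \<in> C)"
proof -
  assume t: "0 \<le> t"
  have "C \<in> sets borel" using closed_C by (rule borel_closed)
  from measurable_sets[OF hit_measurable_at(2)[of "\<lambda>_. t" t] this] t show ?thesis
    by (simp add: pred_def vimage_def Int_def conj_commute)
qed

definition loc :: "(bool \<Rightarrow> nat \<Rightarrow> (real \<Rightarrow> real ^ 'n) \<Rightarrow> real) \<Rightarrow> nat \<Rightarrow> (real \<Rightarrow> real ^ 'n) \<Rightarrow> real" where
  "loc T n X = hit C (real n) X + (if X (hit C (real n) X) \<in> C then T (side (real n) X) n (shift (real n) X) else 0)"

lemma loc_nonneg:
  assumes T: "\<And>b n \<eta>. \<eta> \<in> path_space \<Longrightarrow> 0 \<le> T b n \<eta>" and X: "X \<in> path_space"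
  shows "0 \<le> loc T n X"
  using hit_nonneg[OF X, of "real n"] T[OF shift_path[OF X, of "real n"], of "side (real n) X" n] by (simp add: loc_def)

lemma loc_measurable:
  assumes T: "\<And>b. T b n \<in> borel_measurable path_borel"
  shows "loc T n \<in> borel_measurable path_borel"
proof -
  have n: "0 \<le> real n" by simp
  note [measurable] = measurable_hit[OF closed_C n] at_hit_measurable[OF n] side_measurable[OF n]
  have [measurable]: "(\<lambda>X. T b n (shift (real n) X)) \<in> borel_measurable path_borel" for b
    by (rule measurable_compose[OF shift_measurable[OF n] T])
  have eq: "loc T n X = hit C (real n) X + (if X (hit C (real n) X) \<in> C then (if side (real n) X then T True n (shift (real n) X) else T False n (shift (real n) X)) else 0)" for X
    by (cases "side (real n) X") (simp_all add: loc_def)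
  have "(\<lambda>X. hit C (real n) X + (if X (hit C (real n) X) \<in> C then (if side (real n) X then T True n (shift (real n) X) else T False n (shift (real n) X)) else 0)) \<in> borel_measurable path_borel"
    by measurable
  then show ?thesis unfolding eq[abs_def] .
qed

lemma loc_stopping:
  assumes T: "\<And>b n. stopping_time raw_filtration (T b n)" "\<And>b n \<eta>. \<eta> \<in> path_space \<Longrightarrow> 0 \<le> T b n \<eta>"
  shows "stopping_time raw_filtration (loc T n)"
proof (rule raw_stopping_timeI)
  show "loc T n \<in> borel_measurable path_borel" by (rule loc_measurable) (rule raw_stopping_time_borel[OF T(1)])
  show "0 \<le> loc T n X" if "X \<in> path_space" for X by (rule loc_nonneg[OF T(2) that])
  fix t X Y assume h: "0 \<le> t" "X \<in> path_space" "Y \<in> path_space" "agree t X Y" "loc T n X \<le> t"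
  have n: "0 \<le> real n" by simp
  note hX = hit_nonneg[OF h(2) n]
  show "loc T n Y \<le> t"
  proof (cases "X (hit C (real n) X) \<in> C")
    case False
    have "hit C (real n) X = real n" using at_hit[OF closed_C h(2) n] hX False by force
    then have nt: "real n \<le> t" using h(5) False by (simp add: loc_def)
    have e: "hit C (real n) Y = hit C (real n) X" using hit_agree[OF agree_mono[OF h(4) nt]] by simp
    then have "Y (hit C (real n) Y) = X (hit C (real n) X)" using h(4) hX nt by (simp add: agree_def)
    then show ?thesis using False e hX nt by (simp add: loc_def)
  next
    case True
    let ?b = "side (real n) X" and ?\<sigma> = "hit C (real n) X"
    have Tn: "T ?b n (shift (real n) X) \<le> t - ?\<sigma>" using h(5) True by (simp add: loc_def)
    have T0: "0 \<le> T ?b n (shift (real n) X)" by (rule T(2)[OF shift_path[OF h(2) n]])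
    have st: "?\<sigma> \<le> t" using Tn T0 by simp
    have e: "hit C (real n) Y = ?\<sigma>"
    proof (cases "t \<le> real n")
      case le: True
      show ?thesis by (rule hit_agree_le[OF closed_C h(2-4,1) le st True])
    next
      case False
      then show ?thesis using hit_agree[OF agree_mono[OF h(4), of "real n"]] by simp
    qed
    have v: "Y ?\<sigma> = X ?\<sigma>" using h(4) hX st by (simp add: agree_def)
    have sd: "side (real n) Y = ?b" by (simp add: side_def e v)
    have "agree (t - ?\<sigma>) (shift (real n) X) (shift (real n) Y)"
      unfolding agree_def using h(4) hX by (auto simp: shift_def e agree_def)
    then have "T ?b n (shift (real n) Y) = T ?b n (shift (real n) X)"
      by (rule raw_stopping_time_agree[of "T ?b n", OF T(1)[of ?b n] shift_path[OF h(2) n] shift_path[OF h(3) n] _ Tn])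
    then show ?thesis using h(5) True by (simp add: loc_def e v sd)
  qed
qed

lemma AE_plaw:
  assumes S: "{X \<in> path_space. S X} \<in> sets path_borel"
    and U: "AE w in line_law x e. U w" and V: "\<And>b. AE \<zeta> in P b. V b \<zeta>"
    and UV: "\<And>w \<eta>. w \<in> path_space \<Longrightarrow> U w \<Longrightarrow> startok \<eta> \<Longrightarrow> (\<And>b. V b (\<eta> b)) \<Longrightarrow> S (pmap (w, \<eta>))"
  shows "AE X in plaw. S X"
proof -
  have S': "{X \<in> space path_borel. S X} \<in> sets path_borel" using S by simp
  have pm: "{q \<in> space (line_law x e \<Otimes>\<^sub>M R). S (pmap q)} \<in> sets (line_law x e \<Otimes>\<^sub>M R)"
    using measurable_sets[OF pmap_measurable S'] measurable_space[OF pmap_measurable]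
    by (auto simp: vimage_def Int_def conj_commute elim!: back_subst[of "\<lambda>S. S \<in> sets (line_law x e \<Otimes>\<^sub>M R)"])
  have VR: "AE \<eta> in R. V b (\<eta> b)" for b by (rule AE_R[OF V])
  have "AE w in line_law x e. AE \<eta> in R. S (pmap (w, \<eta>))"
    using U AE_space
  proof eventually_elim
    case (elim w)
    show ?case using AE_startok VR[of True] VR[of False]
    proof eventually_elim
      case (elim \<eta>)
      have "V b (\<eta> b)" for b using elim(2,3) by (cases b) auto
      then show ?case using UV[of w \<eta>] \<open>U w\<close> \<open>w \<in> space (line_law x e)\<close> elim(1) by simp
    qed
  qed
  then show ?thesis unfolding plaw_def by (subst AE_distr_iff[OF pmap_measurable S'], rule QR.AE_pair_measure[OF pm])
qed

lemma shift_pmap_at: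
  assumes w: "w \<in> path_space" and \<eta>: "startok \<eta>" and h: "w (hit C (real n) w) \<in> C"
  shows "shift (real n) (pmap (w, \<eta>)) = \<eta> (side (real n) w)"
proof (rule hit_C_cases[OF w], goal_cases)
  case 1
  then show ?case using h by simp
next
  case (2 \<sigma> b)
  have s: "\<sigma> \<le> real n"
  proof (rule ccontr)
    assume "\<not> \<sigma> \<le> real n"
    then have "hit C (real n) w = real n" "w (real n) \<notin> C" using 2 by auto
    then show False using h by simp
  qed
  then show ?case using shift_pmap[OF w \<eta> 2(4,5,1,2) s] 2(5) by simp
qed

lemma loc_pmap:
  assumes w: "w \<in> path_space" and \<eta>: "startok \<eta>"
  shows "loc T n (pmap (w, \<eta>)) = hit C (real n) w +
    (if w (hit C (real n) w) \<in> C then T (side (real n) w) n (\<eta> (side (real n) w)) else 0)"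
proof (cases "w (hit C (real n) w) \<in> C")
  case False
  then show ?thesis using pmap_hit[OF w \<eta>, of "real n"] by (simp add: loc_def)
next
  case True
  then show ?thesis using pmap_hit[OF w \<eta>, of "real n"] shift_pmap_at[OF w \<eta>, of n] by (simp add: loc_def)
qed

lemma NP_local: "local_martingale (P b) raw_filtration (NP i j b)"
proof -
  have "local_martingale (P b) raw_filtration (\<lambda>t \<omega>. \<omega> t $ i * \<omega> t $ j - A b t \<omega> $ i $ j)"
    using A(1)[of b] unfolding is_bracket_def by (elim allE[of _ i] allE[of _ j] conjE)
  then show ?thesis by (simp only: NP_def[abs_def])
qed

lemma N_local: "local_martingale plaw raw_filtration (N i j)"
proof -
  have "\<forall>b. \<exists>T :: nat \<Rightarrow> (real \<Rightarrow> real ^ 'n) \<Rightarrow> real.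
        (\<forall>n. stopping_time raw_filtration (T n) \<and> (\<forall>\<omega>\<in>space (P b). 0 \<le> T n \<omega>)) \<and>
        (AE \<omega> in P b. incseq (\<lambda>n. T n \<omega>) \<and> filterlim (\<lambda>n. T n \<omega>) at_top sequentially) \<and>
        (\<forall>n. martingale (P b) raw_filtration (\<lambda>t \<omega>. NP i j b (min t (T n \<omega>)) \<omega> - NP i j b 0 \<omega>))"
    using NP_local[of _ i j] unfolding local_martingale_def by simp
  from choice[OF this] obtain T where T': "\<forall>b. (\<forall>n. stopping_time raw_filtration (T b n) \<and> (\<forall>\<omega>\<in>space (P b). 0 \<le> T b n \<omega>)) \<and>
        (AE \<omega> in P b. incseq (\<lambda>n. T b n \<omega>) \<and> filterlim (\<lambda>n. T b n \<omega>) at_top sequentially) \<and>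
        (\<forall>n. martingale (P b) raw_filtration (\<lambda>t \<omega>. NP i j b (min t (T b n \<omega>)) \<omega> - NP i j b 0 \<omega>))" by (elim exE)
  have T: "\<And>b n. stopping_time raw_filtration (T b n)" "\<And>b n \<eta>. \<eta> \<in> path_space \<Longrightarrow> 0 \<le> T b n \<eta>"
    "\<And>b. AE \<omega> in P b. incseq (\<lambda>n. T b n \<omega>) \<and> filterlim (\<lambda>n. T b n \<omega>) at_top sequentially"
    "\<And>b n. martingale (P b) raw_filtration (\<lambda>t \<omega>. NP i j b (min t (T b n \<omega>)) \<omega> - NP i j b 0 \<omega>)"
    using T' by auto
  have U: "stopping_time raw_filtration (loc T n)" for n by (rule loc_stopping) (use T(1,2) in auto)
  have U0: "0 \<le> loc T n X" if "X \<in> path_space" for n X by (rule loc_nonneg[OF _ that]) (rule T(2))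
  have Um: "loc T n \<in> borel_measurable path_borel" for n by (rule raw_stopping_time_borel[OF U])
  have mart: "martingale plaw raw_filtration (\<lambda>t X. N i j (min t (loc T n X)) X - N i j 0 X)" for n
  proof (rule paste_martingale[where LP="\<lambda>b t \<eta>. NP i j b (min t (T b n \<eta>)) \<eta> - NP i j b 0 \<eta>"
        and LQ="\<lambda>t w. NQ i j (min t (real n)) w - NQ i j 0 w" and act="\<lambda>w. w (hit C (real n) w) \<in> C", OF _ _ T(4)])
    fix t :: real assume t: "0 \<le> t"
    have m: "(\<lambda>X. N i j (min t (loc T n X)) X) \<in> borel_measurable path_borel"
    proof (rule N_measurable_at[OF _ _ _ t])
      show "(\<lambda>X. min t (loc T n X)) \<in> borel_measurable path_borel" using Um[of n] by measurable
    qed (use t U0 in auto)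
    have "(\<lambda>X. N i j (min t (loc T n X)) X) \<in> borel_measurable (raw_filtration t)"
      by (rule stopped_raw_measurable[where T="loc T n" and M="N i j", OF U[of n] _ _ m t]) (use N_agree U0 in auto)
    moreover have "N i j 0 \<in> borel_measurable (raw_filtration t)"
      using N_raw[of 0 i j] raw_filtration_mono[OF t] by (auto simp: measurable_def)
    ultimately show "(\<lambda>X. N i j (min t (loc T n X)) X - N i j 0 X) \<in> borel_measurable (raw_filtration t)"
      by (rule borel_measurable_diff)
  next
    fix t :: real and w :: "real \<Rightarrow> real ^ 'n" and \<eta> assume t: "0 \<le> t" and w: "w \<in> path_space" and \<eta>: "startok \<eta>"
    have n: "0 \<le> real n" by simp
    have h0: "hit C 0 w = 0" using hit_nonneg[OF w order.refl] by simp
    have N0: "N i j 0 (pmap (w, \<eta>)) = NQ i j 0 w" using N_pmap[OF w \<eta> order.refl] h0 by simp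
    show "N i j (min t (loc T n (pmap (w, \<eta>)))) (pmap (w, \<eta>)) - N i j 0 (pmap (w, \<eta>)) =
      NQ i j (min (hit C t w) (real n)) w - NQ i j 0 w +
      (if w (hit C (real n) w) \<in> C then
        NP i j (side t w) (min (t - hit C t w) (T (side t w) n (\<eta> (side t w)))) (\<eta> (side t w)) - NP i j (side t w) 0 (\<eta> (side t w)) -
        (NP i j (side t w) (min 0 (T (side t w) n (\<eta> (side t w)))) (\<eta> (side t w)) - NP i j (side t w) 0 (\<eta> (side t w))) else 0)"
    proof (cases "w (hit C (real n) w) \<in> C")
      case False
      have hn: "hit C (real n) w = real n" using at_hit[OF closed_C w n] hit_nonneg[OF w n] False by force
      define m where "m = min t (real n)"
      have m: "0 \<le> m" "m \<le> real n" using t by (auto simp: m_def)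
      have hm: "hit C m w = m" using hit_min[OF closed_C w m] m hn by simp
      have "min (hit C t w) (real n) = m"
      proof (cases "t \<le> real n")
        case True
        then show ?thesis using hm by (simp add: m_def)
      next
        case False
        have "real n = min (real n) (hit C t w)" using hit_min[OF closed_C w n, of t] hn False by simp
        then show ?thesis using False by (simp add: m_def min_def split: if_splits)
      qed
      moreover have "min t (loc T n (pmap (w, \<eta>))) = m" using loc_pmap[OF w \<eta>, of T n] False hn by (simp add: m_def)
      ultimately show ?thesis using N_pmap[OF w \<eta> m(1), of i j] False by (simp add: hm N0)
    next
      case True
      show ?thesis
      proof (rule hit_C_cases[OF w], goal_cases)
        case 1
        then show ?case using True by simp
      next
        case (2 \<sigma> b)
        have s: "\<sigma> \<le> real n"
        proof (rule ccontr)
          assume "\<not> \<sigma> \<le> real n"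
          then have "hit C (real n) w = real n" "w (real n) \<notin> C" using 2 by auto
          then show False using True by simp
        qed
        then have hn: "hit C (real n) w = \<sigma>" "side (real n) w = b" using 2 by auto
        define \<tau> where "\<tau> = T b n (\<eta> b)"
        have \<tau>: "0 \<le> \<tau>" unfolding \<tau>_def by (rule T(2)) (use \<eta> in \<open>simp add: startok_def\<close>)
        have loc: "loc T n (pmap (w, \<eta>)) = \<sigma> + \<tau>" using loc_pmap[OF w \<eta>, of T n] True by (simp add: hn \<tau>_def)
        show ?case
        proof (cases "t \<le> \<sigma>")
          case le: True
          have "hit C t w = t" using 2(4) t le by simp
          moreover have "min t (\<sigma> + \<tau>) = t" "min t (real n) = t" using le \<tau> s by auto
          moreover have "min 0 (T b n \<zeta>) = 0" if "\<zeta> \<in> path_space" for b \<zeta> using T(2)[OF that] by simp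
          moreover have "\<eta> b \<in> path_space" for b using \<eta> by (simp add: startok_def)
          ultimately show ?thesis using N_pmap[OF w \<eta> t, of i j] True by (simp add: loc N0)
        next
          case gt: False
          have ht: "hit C t w = \<sigma>" "side t w = b" using 2 gt t by auto
          define m where "m = min t (\<sigma> + \<tau>)"
          have m: "\<sigma> \<le> m" "0 \<le> m" using gt \<tau> 2(1) by (auto simp: m_def)
          have hm: "hit C m w = \<sigma>" "side m w = b" using 2 m by auto
          have d: "m - \<sigma> = min (t - \<sigma>) \<tau>" by (auto simp: m_def min_def)
          have "min \<sigma> (real n) = \<sigma>" "min 0 \<tau> = 0" using s \<tau> by auto
          then show ?thesis
            using N_pmap[OF w \<eta> m(2), of i j] True
            by (simp add: loc N0 ht hm d m_def[symmetric] \<tau>_def[symmetric])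
        qed
      qed
    qed
  next
    have n: "0 \<le> real n" by simp
    have eq: "min (hit C t w) (real n) = min t (hit C (real n) w)" if "w \<in> space (line_law x e)" "0 \<le> t" for w t
    proof (cases "t \<le> real n")
      case True
      then have "hit C t w = min t (hit C (real n) w)" using hit_min[OF closed_C, of w t "real n"] that by simp
      then show ?thesis using True by simp
    next
      case False
      then have "hit C (real n) w = min (real n) (hit C t w)" using hit_min[OF closed_C, of w "real n" t] that by simp
      then show ?thesis using False by (simp add: min.commute)
    qed
    note l = stop_line[OF NQ_martingale NQ_joint NQ_continuous]
    have i0: "integrable (line_law x e) (NQ i j 0)" using NQ_martingale[of i j] by (simp add: martingale_def)
    show "integrable (line_law x e) (\<lambda>w. NQ i j (min (hit C t w) (real n)) w - NQ i j 0 w)" if t: "0 \<le> t" for t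
    proof -
      have "integrable (line_law x e) (\<lambda>w. NQ i j (min t (hit C (real n) w)) w)"
        by (rule l(1)[OF _ order.refl t n, of "{}"]) auto
      from Bochner_Integration.integrable_diff[OF this i0]
      show ?thesis by (rule Bochner_Integration.integrable_cong[THEN iffD1, rotated 2]) (auto simp: eq t)
    qed
    show "(\<integral>w. indicator F w * (NQ i j (min (hit C t w) (real n)) w - NQ i j 0 w - (NQ i j (min (hit C s w) (real n)) w - NQ i j 0 w)) \<partial>line_law x e) = 0"
      if h: "0 \<le> s" "s \<le> t" "F \<in> sets (raw_filtration s)" for s t F
    proof -
      have "(\<integral>w. indicator F w * (NQ i j (min (hit C t w) (real n)) w - NQ i j 0 w - (NQ i j (min (hit C s w) (real n)) w - NQ i j 0 w)) \<partial>line_law x e) =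
        (\<integral>w. indicator F w * (NQ i j (min t (hit C (real n) w)) w - NQ i j (min s (hit C (real n) w)) w) \<partial>line_law x e)"
        by (rule Bochner_Integration.integral_cong) (use eq h in auto)
      also have "\<dots> = 0" by (rule l(2)[OF _ h(1,2) n h(3)])
      finally show ?thesis .
    qed
  qed
  have good: "AE X in plaw. incseq (\<lambda>n. loc T n X) \<and> filterlim (\<lambda>n. loc T n X) at_top sequentially"
  proof -
    have fl: "filterlim f at_top sequentially \<longleftrightarrow> (\<forall>k::nat. \<exists>N. \<forall>m\<ge>N. real k \<le> f m)" for f :: "nat \<Rightarrow> real"
    proof
      assume "filterlim f at_top sequentially"
      then show "\<forall>k::nat. \<exists>N. \<forall>m\<ge>N. real k \<le> f m" by (simp add: filterlim_at_top eventually_sequentially)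
    next
      assume r: "\<forall>k::nat. \<exists>N. \<forall>m\<ge>N. real k \<le> f m"
      show "filterlim f at_top sequentially"
        unfolding filterlim_at_top eventually_sequentially
      proof
        fix Z :: real
        obtain k :: nat where k: "Z \<le> real k" using real_arch_simple by blast
        obtain M where "\<forall>m\<ge>M. real k \<le> f m" using r by blast
        then show "\<exists>M. \<forall>m\<ge>M. Z \<le> f m" using k by (meson order_trans)
      qed
    qed
    have ms: "{X \<in> space path_borel. (\<forall>n. loc T n X \<le> loc T (Suc n) X) \<and> (\<forall>k::nat. \<exists>N. \<forall>m\<ge>N. real k \<le> loc T m X)} \<in> sets path_borel"
    proof -
      have "{X \<in> space M. (\<forall>n. f n X \<le> f (Suc n) X) \<and> (\<forall>k::nat. \<exists>N. \<forall>m\<ge>N. real k \<le> f m X)} \<in> sets M"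
        if f: "\<And>n. f n \<in> borel_measurable M" for f :: "nat \<Rightarrow> (real \<Rightarrow> real ^ 'n) \<Rightarrow> real" and M
        by (intro sets.sets_Collect_conj sets.sets_Collect_countable_All sets.sets_Collect_countable_Ex
            sets.sets_Collect_imp sets.sets_Collect_const borel_measurable_le f borel_measurable_const)
      from this[OF Um] show ?thesis .
    qed
    have "AE X in plaw. (\<forall>n. loc T n X \<le> loc T (Suc n) X) \<and> (\<forall>k::nat. \<exists>N. \<forall>m\<ge>N. real k \<le> loc T m X)"
    proof (rule AE_plaw[OF _ AE_I2[of _ "\<lambda>w. True"] T(3)], goal_cases)
      case 1 show ?case using ms by simp
    next
      case 2 show ?case ..
    next
      case (3 w \<eta>)
          note w = 3(1) and st = 3(3)
          have inc: "T b n (\<eta> b) \<le> T b (Suc n) (\<eta> b)" for b n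
            using 3(4)[of b] by (auto simp: incseq_Suc_iff)
          have lim: "\<exists>N. \<forall>m\<ge>N. real k \<le> T b m (\<eta> b)" for b and k :: nat
            using 3(4)[of b] fl by auto
          have T0: "0 \<le> T b n (\<eta> b)" for b n using T(2) st by (simp add: startok_def)
          show ?case
            unfolding loc_pmap[OF w st]
          proof (rule hit_C_cases[OF w], goal_cases)
            case 1
            have h: "hit C (real n) w = real n" "w (real n) \<notin> C" for n using 1 by simp_all
            show ?case by (simp add: h del: of_nat_Suc) (auto intro!: exI)
          next
            case (2 \<sigma> b)
            have before: "hit C (real n) w = real n" "w (real n) \<notin> C" if "real n < \<sigma>" for n using 2(3,4) that by simp_all
            have after: "hit C (real n) w = \<sigma>" "side (real n) w = b" if "\<sigma> \<le> real n" for n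
              using 2 that by (auto simp: min_absorb2)
            have in_C: "w \<sigma> \<in> C" using 2(2) by (cases b) (auto simp: C_def)
            show ?case
            proof (intro conjI allI)
              fix n
              show "hit C (real n) w + (if w (hit C (real n) w) \<in> C then T (side (real n) w) n (\<eta> (side (real n) w)) else 0) \<le>
                hit C (real (Suc n)) w + (if w (hit C (real (Suc n)) w) \<in> C then T (side (real (Suc n)) w) (Suc n) (\<eta> (side (real (Suc n)) w)) else 0)"
              proof (cases "\<sigma> \<le> real n")
                case True
                then have "\<sigma> \<le> real (Suc n)" by simp
                then show ?thesis using inc by (simp add: after[OF True] after[OF \<open>\<sigma> \<le> real (Suc n)\<close>] in_C del: of_nat_Suc)
              next
                case False
                then have n: "real n < \<sigma>" by simp
                show ?thesis
                proof (cases "\<sigma> \<le> real (Suc n)")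
                  case True
                  then show ?thesis using before[OF n] n T0[of b "Suc n"] by (simp add: after[OF True] in_C del: of_nat_Suc)
                next
                  case False
                  then show ?thesis using before[OF n] before[of "Suc n"] by simp
                qed
              qed
            next
              fix k :: nat
              obtain N where N: "\<forall>m\<ge>N. real k \<le> T b m (\<eta> b)" using lim by blast
              show "\<exists>N. \<forall>m\<ge>N. real k \<le> hit C (real m) w + (if w (hit C (real m) w) \<in> C then T (side (real m) w) m (\<eta> (side (real m) w)) else 0)"
              proof (intro exI[of _ "max N (nat \<lceil>\<sigma>\<rceil>)"] allI impI)
                fix m assume m: "max N (nat \<lceil>\<sigma>\<rceil>) \<le> m"
                then have "\<sigma> \<le> real m" by linarith
                from after[OF this] in_C N m 2(1) show "real k \<le> hit C (real m) w + (if w (hit C (real m) w) \<in> C then T (side (real m) w) m (\<eta> (side (real m) w)) else 0)"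
                  by (simp add: add_increasing)
              qed
            qed
          qed
    qed
    then show ?thesis by eventually_elim (simp add: incseq_Suc_iff fl)
  qed
  show ?thesis
    unfolding local_martingale_def
  proof (intro conjI exI[of _ "loc T"] allI)
    show "adapted raw_filtration (N i j)" using N_raw by (simp add: adapted_def)
    show "stopping_time raw_filtration (loc T n)" for n by (rule U)
    show "\<forall>\<omega>\<in>space plaw. 0 \<le> loc T n \<omega>" for n using U0 sets_eq_imp_space_eq[OF sets_plaw] by simp
  qed (use good mart in auto)
qed

end

lemma path_start_measurable: "{X \<in> path_space. X 0 = (x :: 'a::metric_space)} \<in> sets path_borel"
proof -
  have "(\<lambda>X::real \<Rightarrow> 'a. X 0) -` {x} \<inter> space path_borel \<in> sets path_borel"
    by (rule measurable_sets[OF coordinate_measurable]) auto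
  then show ?thesis by (simp add: vimage_def Int_def conj_commute)
qed

context paste_bracket
begin

lemma plaw_start: "AE X in plaw. X 0 = x"
proof (rule AE_plaw[OF path_start_measurable line_law_start AE_I2[of _ "\<lambda>_. True"]], goal_cases)
  case (2 w \<eta>)
  then have "hit C 0 w = 0" using hit_nonneg[of w 0] by simp
  then show ?case using 2 by (simp add: pmap_def)
qed simp

definition regular :: "bool \<Rightarrow> (real \<Rightarrow> real ^ 'n) \<Rightarrow> bool" where
  "regular b \<eta> \<longleftrightarrow> (\<forall>i j. A b 0 \<eta> $ i $ j = 0 \<and> continuous_on {0..} (\<lambda>t. A b t \<eta> $ i $ j) \<and>
     finite_variation (\<lambda>t. A b t \<eta> $ i $ j)) \<and> (\<forall>t\<ge>0. trace (A b t \<eta>) = t)"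

lemma AE_regular: "AE \<eta> in P b. regular b \<eta>"
proof -
  have "AE \<eta> in P b. A b 0 \<eta> $ i $ j = 0 \<and> continuous_on {0..} (\<lambda>t. A b t \<eta> $ i $ j) \<and>
     finite_variation (\<lambda>t. A b t \<eta> $ i $ j)" for i j
    using A(1)[of b] unfolding is_bracket_def by (elim allE[of _ i] allE[of _ j] conjE)
  then have "AE \<eta> in P b. \<forall>i j. A b 0 \<eta> $ i $ j = 0 \<and> continuous_on {0..} (\<lambda>t. A b t \<eta> $ i $ j) \<and>
     finite_variation (\<lambda>t. A b t \<eta> $ i $ j)" unfolding AE_all_countable by blast
  with A(2)[of b] show ?thesis by eventually_elim (simp add: regular_def)
qed

lemma B_regular_after:
  assumes X: "X \<in> path_space" and h: "\<forall>t\<ge>0. hit C t X = min t \<sigma>" "\<forall>t\<ge>\<sigma>. side t X = b" "0 \<le> \<sigma>" "\<sigma> \<le> real n"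
    and r: "regular b (shift (real n) X)"
  shows "(\<forall>i j. B 0 X $ i $ j = 0 \<and> continuous_on {0..} (\<lambda>t. B t X $ i $ j) \<and>
     finite_variation (\<lambda>t. B t X $ i $ j)) \<and> (\<forall>t\<ge>0. trace (B t X) = t)"
proof -
  define \<eta> where "\<eta> = shift (real n) X"
  have \<eta>: "\<eta> \<in> path_space" "\<And>r. 0 \<le> r \<Longrightarrow> \<eta> r = X (\<sigma> + r)"
    using shift_path[OF X, of "real n"] h by (auto simp: \<eta>_def shift_def min_absorb2)
  have r0: "A b 0 \<eta> $ i $ j = 0" and rc: "continuous_on {0..} (\<lambda>t. A b t \<eta> $ i $ j)"
    and rf: "finite_variation (\<lambda>t. A b t \<eta> $ i $ j)" and rt: "\<And>t. 0 \<le> t \<Longrightarrow> trace (A b t \<eta>) = t" for i j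
    using r unfolding \<eta>_def[symmetric] regular_def by blast+
  have eq: "min t \<sigma> * (e $ i * e $ j) + A b (t - min t \<sigma>) \<eta> $ i $ j = B t X $ i $ j" if t: "0 \<le> t" for t i j
  proof (cases "t \<le> \<sigma>")
    case True
    then show ?thesis using h t r0 by (simp add: B_def)
  next
    case False
    then have ht: "hit C t X = \<sigma>" "side t X = b" using h t by auto
    have ag: "agree (t - \<sigma>) (tsh t X) \<eta>" unfolding agree_def using \<eta>(2) ht by (auto simp: tsh_def min_absorb1)
    have "A b q (tsh t X) $ i $ j = A b q \<eta> $ i $ j" if "0 \<le> q" "q \<le> t - \<sigma>" for q
      by (rule raw_measurable_agree[OF A(4)[OF that(1)] tsh_path[OF X t] \<eta>(1) agree_mono[OF ag that(2)]])
    from this[of 0] this[of "t - \<sigma>"] False show ?thesis by (simp add: B_def ht r0)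
  qed
  have "B 0 X $ i $ j = 0" for i j using eq[of 0 i j] h(3) r0 by simp
  moreover have "continuous_on {0..} (\<lambda>t. B t X $ i $ j)" for i j
  proof (rule continuous_on_eq)
    show "continuous_on {0..} (\<lambda>t. min t \<sigma> * (e $ i * e $ j) + A b (t - min t \<sigma>) \<eta> $ i $ j)"
      by (intro continuous_on_add continuous_on_mult continuous_on_const continuous_on_compose2[OF rc] continuous_intros) auto
  qed (use eq in auto)
  moreover have "finite_variation (\<lambda>t. B t X $ i $ j)" for i j
  proof (rule finite_variation_cong[OF eq])
    have "finite_variation (\<lambda>t. min t \<sigma> * (e $ i * e $ j))"
    proof (rule finite_variation_lipschitz)
      fix T :: real
      have "\<bar>min t \<sigma> * c - min s \<sigma> * c\<bar> \<le> \<bar>c\<bar> * (t - s)" if "s \<le> t" for s t c :: real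
      proof -
        have "\<bar>min t \<sigma> * c - min s \<sigma> * c\<bar> = \<bar>c\<bar> * \<bar>min t \<sigma> - min s \<sigma>\<bar>" by (simp add: left_diff_distrib[symmetric] abs_mult)
        also have "\<dots> \<le> \<bar>c\<bar> * (t - s)" by (rule mult_left_mono) (use that in auto)
        finally show ?thesis .
      qed
      then show "\<exists>D\<ge>0. \<forall>s t. 0 \<le> s \<longrightarrow> s \<le> t \<longrightarrow> t \<le> T \<longrightarrow>
        \<bar>min t \<sigma> * (e $ i * e $ j) - min s \<sigma> * (e $ i * e $ j)\<bar> \<le> D * (t - s)"
        by (intro exI[of _ "\<bar>e $ i * e $ j\<bar>"]) auto
    qed
    then show "finite_variation (\<lambda>t. min t \<sigma> * (e $ i * e $ j) + A b (t - min t \<sigma>) \<eta> $ i $ j)"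
      by (rule finite_variation_add) (rule finite_variation_delay[OF rf h(3)])
  qed
  moreover have "trace (B t X) = t" if t: "0 \<le> t" for t
  proof -
    have ee: "(\<Sum>i\<in>UNIV. e $ i * e $ i) = 1" using e by (simp add: norm_eq_1 inner_vec_def)
    have "trace (B t X) = (\<Sum>i\<in>UNIV. min t \<sigma> * (e $ i * e $ i) + A b (t - min t \<sigma>) \<eta> $ i $ i)"
      unfolding trace_def by (rule sum.cong) (simp_all add: eq[OF t])
    also have "\<dots> = min t \<sigma> * 1 + trace (A b (t - min t \<sigma>) \<eta>)"
      by (simp only: sum.distrib sum_distrib_left[symmetric] ee trace_def)
    also have "\<dots> = t" using rt[of "t - min t \<sigma>"] by simp
    finally show ?thesis .
  qed
  ultimately show ?thesis by blast
qed

lemma B_regular_never: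
  assumes h: "\<forall>t\<ge>0. hit C t X = t"
  shows "(\<forall>i j. B 0 X $ i $ j = 0 \<and> continuous_on {0..} (\<lambda>t. B t X $ i $ j) \<and>
     finite_variation (\<lambda>t. B t X $ i $ j)) \<and> (\<forall>t\<ge>0. trace (B t X) = t)"
proof -
  have eq: "t * (e $ i * e $ j) = B t X $ i $ j" if "0 \<le> t" for t i j using h that by (simp add: B_def)
  have "continuous_on {0..} (\<lambda>t. B t X $ i $ j)" for i j
    by (rule continuous_on_eq[of _ "\<lambda>t. t * (e $ i * e $ j)"]) (auto intro!: continuous_intros simp: eq)
  moreover have "finite_variation (\<lambda>t. B t X $ i $ j)" for i j
  proof (rule finite_variation_cong[OF eq], assumption, rule finite_variation_lipschitz)
    fix T :: real
    have "\<bar>t * c - s * c\<bar> \<le> \<bar>c\<bar> * (t - s)" if "s \<le> t" for s t c :: real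
      using that by (simp add: left_diff_distrib[symmetric] abs_mult)
    then show "\<exists>D\<ge>0. \<forall>s t. 0 \<le> s \<longrightarrow> s \<le> t \<longrightarrow> t \<le> T \<longrightarrow>
      \<bar>t * (e $ i * e $ j) - s * (e $ i * e $ j)\<bar> \<le> D * (t - s)"
      by (intro exI[of _ "\<bar>e $ i * e $ j\<bar>"]) auto
  qed
  moreover have "trace (B t X) = t" if t: "0 \<le> t" for t
  proof -
    have ee: "(\<Sum>i\<in>UNIV. e $ i * e $ i) = 1" using e by (simp add: norm_eq_1 inner_vec_def)
    have "trace (B t X) = (\<Sum>i\<in>UNIV. t * (e $ i * e $ i))"
      unfolding trace_def by (rule sum.cong) (simp_all add: eq[OF t])
    then show ?thesis by (simp only: sum_distrib_left[symmetric] ee mult_1_right)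
  qed
  moreover have "B 0 X $ i $ j = 0" for i j using eq[of 0 i j] by simp
  ultimately show ?thesis by blast
qed

lemma AE_B_regular: "AE X in plaw. (\<forall>i j. B 0 X $ i $ j = 0 \<and> continuous_on {0..} (\<lambda>t. B t X $ i $ j) \<and>
     finite_variation (\<lambda>t. B t X $ i $ j)) \<and> (\<forall>t\<ge>0. trace (B t X) = t)"
proof -
  have "\<exists>G. G \<in> sets path_borel \<and> (\<forall>\<eta>\<in>G. regular b \<eta>) \<and> (AE \<eta> in P b. \<eta> \<in> G)" for b
  proof -
    obtain Z where Z: "{\<eta> \<in> space (P b). \<not> regular b \<eta>} \<subseteq> Z" "emeasure (P b) Z = 0" "Z \<in> sets (P b)"
      using AE_E[OF AE_regular] by blast
    have "AE \<eta> in P b. \<eta> \<notin> Z" by (rule AE_not_in) (use Z in \<open>simp add: null_sets_def\<close>)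
    then have "AE \<eta> in P b. \<eta> \<in> path_space - Z" using AE_space by eventually_elim simp
    moreover have "path_space - Z \<in> sets path_borel" using sets.compl_sets[OF Z(3)] P(2)[of b] by simp
    ultimately show ?thesis using Z(1) by (intro exI[of _ "path_space - Z"] conjI) auto
  qed
  then obtain G where G: "\<And>b. G b \<in> sets path_borel" "\<And>b \<eta>. \<eta> \<in> G b \<Longrightarrow> regular b \<eta>" "\<And>b. AE \<eta> in P b. \<eta> \<in> G b"
    by metis
  have m: "{X \<in> path_space. \<forall>n::nat. X (hit C (real n) X) \<in> C \<longrightarrow> shift (real n) X \<in> G (side (real n) X)} \<in> sets path_borel"
  proof -
    have [measurable]: "Measurable.pred path_borel (\<lambda>X. X (hit C (real n) X) \<in> C)"
      "Measurable.pred path_borel (side (real n))" for n :: nat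
      by (rule at_hit_measurable side_measurable, simp)+
    have [measurable]: "Measurable.pred path_borel (\<lambda>X. shift (real n) X \<in> G b)" for n :: nat and b
    proof -
      have "shift (real n) -` G b \<inter> space path_borel \<in> sets path_borel"
        by (rule measurable_sets[OF shift_measurable G(1)]) simp
      then show ?thesis by (simp add: pred_def vimage_def Int_def conj_commute)
    qed
    have "{X \<in> space path_borel. \<forall>n::nat. X (hit C (real n) X) \<in> C \<longrightarrow>
      (if side (real n) X then shift (real n) X \<in> G True else shift (real n) X \<in> G False)} \<in> sets path_borel"
      by measurable
    moreover have "(if side (real n) X then shift (real n) X \<in> G True else shift (real n) X \<in> G False) =
      (shift (real n) X \<in> G (side (real n) X))" for n :: nat and X by simp
    ultimately show ?thesis by simp
  qed
  have "AE X in plaw. \<forall>n::nat. X (hit C (real n) X) \<in> C \<longrightarrow> shift (real n) X \<in> G (side (real n) X)"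
  proof (rule AE_plaw[OF m AE_I2[of _ "\<lambda>w. True"] G(3)], goal_cases)
    case (2 w \<eta>)
    show ?case
    proof (intro allI impI)
      fix n :: nat
      assume "pmap (w, \<eta>) (hit C (real n) (pmap (w, \<eta>))) \<in> C"
      then have "w (hit C (real n) w) \<in> C" using pmap_hit[OF 2(1,3), of "real n"] by simp
      from shift_pmap_at[OF 2(1,3) this] show "shift (real n) (pmap (w, \<eta>)) \<in> G (side (real n) (pmap (w, \<eta>)))"
        using pmap_hit(3)[OF 2(1,3), of "real n"] 2(4) by simp
    qed
  qed simp
  then show ?thesis using AE_space
  proof eventually_elim
    case (elim X)
    then have X: "X \<in> path_space" using sets_eq_imp_space_eq[OF sets_plaw] by simp
    show ?case
    proof (rule hit_C_cases[OF X], goal_cases)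
      case 1
      then show ?case by (intro B_regular_never)
    next
      case (2 \<sigma> b)
      obtain n :: nat where n: "\<sigma> \<le> real n" using real_arch_simple by blast
      have "X (hit C (real n) X) \<in> C" "side (real n) X = b" using 2 n by (cases b; auto simp: C_def min_absorb2)+
      with elim(1) have "shift (real n) X \<in> G b" by blast
      then show ?case by (intro B_regular_after[OF X 2(4,5,1) n] G(2))
    qed
  qed
qed

lemma plaw_in_martingale_laws: "plaw \<in> martingale_laws x"
  unfolding martingale_laws_def
proof (intro CollectI conjI allI exI[of _ B])
  show "AE X in plaw. \<forall>t\<ge>0. trace (B t X) = t" using AE_B_regular by eventually_elim blast
  show "is_bracket plaw raw_filtration (\<lambda>t X. X t) B"
    unfolding is_bracket_def
  proof (intro allI conjI)
    fix i j
    show "adapted raw_filtration (\<lambda>t X. B t X $ i $ j)" using B_raw by (simp add: adapted_def)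
    show "AE X in plaw. B 0 X $ i $ j = 0 \<and> continuous_on {0..} (\<lambda>t. B t X $ i $ j) \<and> finite_variation (\<lambda>t. B t X $ i $ j)"
      using AE_B_regular by eventually_elim blast
    show "local_martingale plaw raw_filtration (\<lambda>t X. X t $ i * X t $ j - B t X $ i $ j)"
      using N_local[of i j] by (simp only: N_def[abs_def])
  qed
qed (rule prob_space_plaw sets_plaw plaw_martingale plaw_start)+

lemma plaw_survives:
  assumes K: "closed K" "convex K" "\<And>b. p b \<in> K" and ab: "0 < a" "0 < d" "p True = x + a *\<^sub>R e" "p False = x - d *\<^sub>R e"
    and surv: "\<And>b. AE \<eta> in P b. \<forall>s. 0 \<le> s \<and> s < c \<longrightarrow> \<eta> s \<in> K"
  shows "AE X in plaw. \<forall>s. 0 \<le> s \<and> s < c \<longrightarrow> X s \<in> K"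
proof -
  have ee: "e \<bullet> e = 1" using e by (simp add: norm_eq_1)
  define L where "L = {v. v - x = ((v - x) \<bullet> e) *\<^sub>R e}"
  have L: "closed L" unfolding L_def by (intro closed_Collect_eq continuous_intros)
  have "AE w in line_law x e. \<forall>s. 0 \<le> s \<and> s < real n \<longrightarrow> w s \<in> L" for n :: nat
    by (rule AE_line_law[OF measurable_stays[OF L]]) (simp add: line_map_def L_def ee)
  then have "AE w in line_law x e. \<forall>n::nat. \<forall>s. 0 \<le> s \<and> s < real n \<longrightarrow> w s \<in> L" unfolding AE_all_countable by blast
  with line_law_start[of x e] have U: "AE w in line_law x e. w 0 = x \<and> (\<forall>s\<ge>0. w s \<in> L)"
  proof eventually_elim
    case (elim w)
    show ?case
    proof (intro conjI allI impI elim(1))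
      fix s :: real assume "0 \<le> s"
      moreover obtain n :: nat where "s < real n" using reals_Archimedean2 by blast
      ultimately show "w s \<in> L" using elim(2) by blast
    qed
  qed
  show ?thesis
  proof (rule AE_plaw[OF measurable_stays[OF K(1)] U surv], goal_cases)
    case (1 w \<eta>)
    note w = 1(1) and \<eta> = 1(3)
    have before: "w s \<in> K" if s: "0 \<le> s" "\<And>r. 0 \<le> r \<Longrightarrow> r < s \<Longrightarrow> w r \<notin> C" for s
    proof -
      define g where "g = (\<lambda>r. (w r - x) \<bullet> e)"
      have g: "w r = x + g r *\<^sub>R e" if "0 \<le> r" for r
      proof -
        have "w r - x = g r *\<^sub>R e" using 1(2) that by (simp add: L_def g_def)
        then show ?thesis by (simp add: algebra_simps)
      qed
      have gc: "continuous_on {0..s} g" unfolding g_def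
        by (intro continuous_intros continuous_on_subset[OF path_space_continuous[OF w]]) auto
      have g0: "g 0 = 0" using 1(2) by (simp add: g_def)
      have "g s \<le> a"
      proof (rule ccontr)
        assume "\<not> g s \<le> a"
        then obtain r where r: "0 \<le> r" "r \<le> s" "g r = a" using IVT'[of g 0 a s] gc g0 ab(1) s(1) by auto
        then have "r \<noteq> s" using \<open>\<not> g s \<le> a\<close> by auto
        moreover have "w r \<in> C" using g[OF r(1)] r(3) ab by (simp add: C_def)
        ultimately show False using s(2)[of r] r by simp
      qed
      moreover have "- d \<le> g s"
      proof (rule ccontr)
        assume "\<not> - d \<le> g s"
        then obtain r where r: "0 \<le> r" "r \<le> s" "g r = - d" using IVT2'[of g s "- d" 0] gc g0 ab(2) s(1) by auto
        then have "r \<noteq> s" using \<open>\<not> - d \<le> g s\<close> by auto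
        moreover have "w r \<in> C" using g[OF r(1)] r(3) ab by (simp add: C_def)
        ultimately show False using s(2)[of r] r by simp
      qed
      ultimately have u: "0 \<le> (g s + d) / (a + d)" "(g s + d) / (a + d) \<le> 1" using ab by (auto simp: field_simps)
      have "(1 - (g s + d) / (a + d)) *\<^sub>R p False + ((g s + d) / (a + d)) *\<^sub>R p True \<in> K"
        by (rule convexD_alt[OF K(2) K(3) K(3) u])
      moreover have "(1 - (g s + d) / (a + d)) *\<^sub>R p False + ((g s + d) / (a + d)) *\<^sub>R p True = w s"
      proof -
        have "(1 - v) *\<^sub>R (x - d *\<^sub>R e) + v *\<^sub>R (x + a *\<^sub>R e) = x + (v * (a + d) - d) *\<^sub>R e" for v
          by (simp add: algebra_simps)
        then show ?thesis unfolding g[OF s(1)] ab(3,4) using ab(1,2) by simp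
      qed
      ultimately show ?thesis by simp
    qed
    show ?case
    proof (rule hit_C_cases[OF w], goal_cases)
      case 1
      then show ?case using before pmap_never by auto
    next
      case (2 \<sigma> b)
      show ?case
      proof (intro allI impI)
        fix s assume s: "0 \<le> s \<and> s < c"
        show "pmap (w, \<eta>) s \<in> K"
        proof (cases "s \<le> \<sigma>")
          case True
          then show ?thesis using before[of s] 2 pmap_hits[OF 2(4,5,1), of s \<eta>] s by simp
        next
          case False
          have "pmap (w, \<eta>) (\<sigma> + (s - \<sigma>)) = \<eta> b (s - \<sigma>)"
            by (rule pmap_after[OF w \<eta> 2(4,5,1,2)]) (use False in simp)
          then show ?thesis using 1(4)[of b] s False 2(1) by simp
        qed
      qed
    qed
  qed
qed

end

lemma martingale_laws_between:
  fixes y z :: "real ^ 'n"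
  assumes K: "closed K" "convex K" "y \<in> K" "z \<in> K" and u: "0 < u" "u < 1" and yz: "y \<noteq> z"
    and Y: "PY \<in> martingale_laws y" "AE \<eta> in PY. \<forall>s. 0 \<le> s \<and> s < c \<longrightarrow> \<eta> s \<in> K"
    and Z: "PZ \<in> martingale_laws z" "AE \<eta> in PZ. \<forall>s. 0 \<le> s \<and> s < c \<longrightarrow> \<eta> s \<in> K"
  obtains P where "P \<in> martingale_laws ((1 - u) *\<^sub>R y + u *\<^sub>R z)" "AE \<eta> in P. \<forall>s. 0 \<le> s \<and> s < c \<longrightarrow> \<eta> s \<in> K"
proof -
  define P where "P = (\<lambda>b. if b then PZ else PY)"
  define p where "p = (\<lambda>b. if b then z else y)"
  define x where "x = (1 - u) *\<^sub>R y + u *\<^sub>R z"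
  define e where "e = (z - y) /\<^sub>R norm (z - y)"
  have PM: "P b \<in> martingale_laws (p b)" for b using Y Z by (simp add: P_def p_def)
  have PK: "AE \<eta> in P b. \<forall>s. 0 \<le> s \<and> s < c \<longrightarrow> \<eta> s \<in> K" for b unfolding P_def using Y(2) Z(2) by (cases b) simp_all
  have "\<forall>b. \<exists>A. is_bracket (P b) raw_filtration (\<lambda>t \<omega>. \<omega> t) A \<and> (AE \<omega> in P b. \<forall>t\<ge>0. trace (A t \<omega>) = t) \<and>
    (\<forall>i j. joint (\<lambda>t \<omega>. A t \<omega> $ i $ j)) \<and>
    (\<forall>i j t. 0 \<le> t \<longrightarrow> (\<lambda>\<omega>. A t \<omega> $ i $ j) \<in> borel_measurable (raw_filtration t))"
    by (rule allI, rule regular_bracket[OF PM]) blast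
  from choice[OF this] obtain A where A': "\<forall>b. is_bracket (P b) raw_filtration (\<lambda>t \<omega>. \<omega> t) (A b) \<and>
    (AE \<omega> in P b. \<forall>t\<ge>0. trace (A b t \<omega>) = t) \<and> (\<forall>i j. joint (\<lambda>t \<omega>. A b t \<omega> $ i $ j)) \<and>
    (\<forall>i j t. 0 \<le> t \<longrightarrow> (\<lambda>\<omega>. A b t \<omega> $ i $ j) \<in> borel_measurable (raw_filtration t))" by (elim exE)
  have A: "\<And>b. is_bracket (P b) raw_filtration (\<lambda>t \<omega>. \<omega> t) (A b)"
    "\<And>b. AE \<omega> in P b. \<forall>t\<ge>0. trace (A b t \<omega>) = t" "\<And>b i j. joint (\<lambda>t \<omega>. A b t \<omega> $ i $ j)"
    "\<And>b i j t. 0 \<le> t \<Longrightarrow> (\<lambda>\<omega>. A b t \<omega> $ i $ j) \<in> borel_measurable (raw_filtration t)"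
    using A' by blast+
  have ne: "norm (z - y) \<noteq> 0" using yz by simp
  have e: "norm e = 1" using ne by (simp add: e_def)
  interpret paste_bracket x e P p A
  proof (rule paste_bracket.intro)
    have "prob_space (P b)" "sets (P b) = sets path_borel" "AE \<eta> in P b. \<eta> 0 = p b" for b
      using PM[of b] by (simp_all add: martingale_laws_def)
    moreover have "p True \<noteq> p False" using yz by (simp add: p_def)
    ultimately show "paste (line_law x e) P p" by (intro paste.intro prob_space_line_law sets_line_law)
    show "paste_bracket_axioms e P p A" using e PM A by (rule paste_bracket_axioms.intro)
  qed
  have "AE X in plaw. \<forall>s. 0 \<le> s \<and> s < c \<longrightarrow> X s \<in> K"
  proof (rule plaw_survives[OF K(1,2) _ _ _ _ _ PK])
    show "p b \<in> K" for b using K by (simp add: p_def)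
    show "0 < (1 - u) * norm (z - y)" "0 < u * norm (z - y)" using u ne by auto
    have "norm (z - y) *\<^sub>R e = z - y" using ne by (simp add: e_def)
    then have ne: "(r * norm (z - y)) *\<^sub>R e = r *\<^sub>R (z - y)" for r by (metis scaleR_scaleR)
    show "p True = x + ((1 - u) * norm (z - y)) *\<^sub>R e" "p False = x - (u * norm (z - y)) *\<^sub>R e"
      unfolding ne by (simp_all add: p_def x_def algebra_simps)
  qed
  with plaw_in_martingale_laws show ?thesis unfolding x_def by (rule that)
qed

section \<open>Laws that stay on a line segment\<close>

lemma AE_all_times:
  fixes P :: "(real \<Rightarrow> 'a::metric_space) measure"
  assumes P: "sets P = sets path_borel" and S: "closed S" and ae: "\<And>s. 0 \<le> s \<Longrightarrow> s \<le> u \<Longrightarrow> AE X in P. X s \<in> S"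
  shows "AE X in P. \<forall>s. 0 \<le> s \<and> s \<le> u \<longrightarrow> X s \<in> S"
proof -
  have "AE X in P. 0 \<le> real_of_rat q \<and> real_of_rat q \<le> u \<longrightarrow> X (real_of_rat q) \<in> S" for q
    using ae[of "real_of_rat q"] by (cases "0 \<le> real_of_rat q \<and> real_of_rat q \<le> u") auto
  then have "AE X in P. \<forall>q. 0 \<le> real_of_rat q \<and> real_of_rat q \<le> u \<longrightarrow> X (real_of_rat q) \<in> S"
    unfolding AE_all_countable by blast
  then show ?thesis using AE_space
  proof eventually_elim
    case (elim X)
    then have X: "X \<in> path_space" using sets_eq_imp_space_eq[OF P] by simp
    show ?case
    proof (intro allI impI)
      fix s assume s: "0 \<le> s \<and> s \<le> u"
      have d: "dyad n s \<in> \<rat>" for n by (simp add: dyad_def)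
      have "X (dyad n s) \<in> S" for n
      proof -
        obtain q where "dyad n s = real_of_rat q" using d Rats_cases by blast
        then show ?thesis using elim(1) dyad_bounds(1,2)[of s n] s by (metis order_trans)
      qed
      moreover have "(\<lambda>n. X (dyad n s)) \<longlonglongrightarrow> X s"
        by (rule continuous_dyad_tendsto[OF path_space_continuous[OF X]]) (use s in simp)
      ultimately show "X s \<in> S" using S by (meson closed_sequentially)
    qed
  qed
qed

lemma stopping_time_Min:
  fixes T :: "'i::finite \<Rightarrow> 's \<Rightarrow> real"
  assumes "\<And>i. stopping_time F (T i)"
  shows "stopping_time F (\<lambda>\<omega>. Min (range (\<lambda>i. T i \<omega>)))"
  unfolding stopping_time_def
proof
  fix t
  have [measurable]: "Measurable.pred (F t) (\<lambda>\<omega>. T i \<omega> \<le> t)" for i using assms[of i] by (simp add: stopping_time_def)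
  have "Measurable.pred (F t) (\<lambda>\<omega>. \<exists>i. T i \<omega> \<le> t)" by measurable
  moreover have "(Min (range (\<lambda>i. T i \<omega>)) \<le> t) = (\<exists>i. T i \<omega> \<le> t)" for \<omega> by (subst Min_le_iff) auto
  ultimately show "Measurable.pred (F t) (\<lambda>\<omega>. Min (range (\<lambda>i. T i \<omega>)) \<le> t)" by simp
qed

lemma path_eval_measurable:
  fixes \<sigma> :: "(real \<Rightarrow> 'a::{metric_space, second_countable_topology}) \<Rightarrow> real"
  assumes "\<sigma> \<in> borel_measurable path_borel" "\<And>X. X \<in> path_space \<Longrightarrow> 0 \<le> \<sigma> X"
  shows "(\<lambda>X. X (\<sigma> X)) \<in> borel_measurable path_borel"
  by (rule measurable_path_eval[OF _ assms(1)]) (use assms(2) in auto)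

lemma martingale_laws_stop:
  fixes P :: "(real \<Rightarrow> real ^ 'n) measure"
  assumes P: "P \<in> martingale_laws x" and st: "stopping_time raw_filtration \<sigma>"
    and \<sigma>: "\<And>X. X \<in> path_space \<Longrightarrow> t \<le> \<sigma> X \<and> \<sigma> X \<le> h" and t: "0 \<le> t" "t \<le> h" and B: "B \<in> sets (raw_filtration t)"
  shows "integrable P (\<lambda>X. indicator B X * (X (\<sigma> X) $ i - X t $ i))"
    "(\<integral>X. indicator B X * (X (\<sigma> X) $ i - X t $ i) \<partial>P) = 0"
proof -
  have pP: "prob_space P" and sP: "sets P = sets path_borel" and M: "martingale P raw_filtration (\<lambda>t X. X t $ i)"
    using P by (auto simp: martingale_laws_def)
  interpret filtered_prob_space P raw_filtration by (rule filtered_path[OF pP sP])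
  have spP: "space P = path_space" using sets_eq_imp_space_eq[OF sP] by simp
  have s0: "0 \<le> \<sigma> X" if "X \<in> path_space" for X using \<sigma>[OF that] t by simp
  have m: "(\<lambda>X. X (min r (\<sigma> X)) $ i) \<in> borel_measurable P" if "0 \<le> r" for r
    unfolding measurable_cong_sets[OF sP refl]
    by (rule measurable_compose[OF path_eval_measurable vec_nth_borel])
      (use raw_stopping_time_borel[OF st] s0 that in auto)
  have c: "AE X in P. continuous_on {0..} (\<lambda>t. X t $ i)" by (rule AE_I2) (simp add: component_continuous spP)
  have s0P: "0 \<le> \<sigma> X" if "X \<in> space P" for X using s0[of X] that spP by simp
  note r = stopped_martingale_set[OF M c st s0P m]
  have e: "X (min h (\<sigma> X)) $ i = X (\<sigma> X) $ i" "X (min t (\<sigma> X)) $ i = X t $ i" if "X \<in> space P" for X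
    using \<sigma>[of X] that spP by (simp_all add: min_absorb1 min_absorb2)
  have h: "0 \<le> h" using t by simp
  have i1: "integrable P (\<lambda>X. X (\<sigma> X) $ i)"
    by (subst Bochner_Integration.integrable_cong[OF refl e(1)[symmetric]], assumption, rule r(1)[OF _ _ h order.refl, of B])
      (use B raw_filtration_mono[OF t(2)] in auto)
  have i2: "integrable P (\<lambda>X. X t $ i)" using M t by (simp add: martingale_def)
  show "integrable P (\<lambda>X. indicator B X * (X (\<sigma> X) $ i - X t $ i))"
    using integrable_mult_indicator[OF sets_F_P[OF B] Bochner_Integration.integrable_diff[OF i1 i2]] by simp
  have "(\<integral>X. indicator B X * (X (\<sigma> X) $ i - X t $ i) \<partial>P) = (\<integral>X. indicator B X * (X (min h (\<sigma> X)) $ i - X (min t (\<sigma> X)) $ i) \<partial>P)"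
    by (rule Bochner_Integration.integral_cong) (simp_all add: e)
  then show "(\<integral>X. indicator B X * (X (\<sigma> X) $ i - X t $ i) \<partial>P) = 0" using r(2)[OF _ _ t B] by simp
qed

lemma martingale_laws_trace_stop:
  fixes P :: "(real \<Rightarrow> real ^ 'n) measure"
  assumes P: "P \<in> martingale_laws x" and st: "stopping_time raw_filtration \<sigma>"
    and \<sigma>: "\<And>X. X \<in> path_space \<Longrightarrow> t \<le> \<sigma> X \<and> \<sigma> X \<le> h" and t: "0 \<le> t" "t \<le> h" and B: "B \<in> sets (raw_filtration t)"
    and bd: "AE X in P. \<forall>s. 0 \<le> s \<and> s \<le> h \<longrightarrow> norm (X s) \<le> D"
  shows "(\<integral>X. indicator B X * ((X (\<sigma> X) \<bullet> X (\<sigma> X) - \<sigma> X) - (X t \<bullet> X t - t)) \<partial>P) = 0"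
proof -
  have pP: "prob_space P" and sP: "sets P = sets path_borel" using P by (auto simp: martingale_laws_def)
  interpret filtered_prob_space P raw_filtration by (rule filtered_path[OF pP sP])
  have spP: "space P = path_space" using sets_eq_imp_space_eq[OF sP] by simp
  have s0: "0 \<le> \<sigma> X" if "X \<in> path_space" for X using \<sigma>[OF that] t by simp
  have h: "0 \<le> h" using t by simp
  note mP = measurable_cong_sets[OF sP refl]
  obtain A where A: "is_bracket P raw_filtration (\<lambda>t \<omega>. \<omega> t) A" and tr: "AE \<omega> in P. \<forall>t\<ge>0. trace (A t \<omega>) = t"
    and jA: "\<And>i j. joint (\<lambda>t \<omega>. A t \<omega> $ i $ j)"
    by (rule regular_bracket[OF P]) blast
  define V where "V = (\<lambda>i s (X :: real \<Rightarrow> real ^ 'n). X s $ i * X s $ i - A s X $ i $ i)"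
  have jV: "joint (V i)" for i unfolding V_def by (intro joint_diff joint_times joint_component jA)
  have "\<forall>i. \<exists>T :: nat \<Rightarrow> (real \<Rightarrow> real ^ 'n) \<Rightarrow> real.
        (\<forall>n. stopping_time raw_filtration (T n) \<and> (\<forall>\<omega>\<in>space P. 0 \<le> T n \<omega>)) \<and>
        (AE \<omega> in P. incseq (\<lambda>n. T n \<omega>) \<and> filterlim (\<lambda>n. T n \<omega>) at_top sequentially) \<and>
        (\<forall>n. martingale P raw_filtration (\<lambda>t \<omega>. V i (min t (T n \<omega>)) \<omega> - V i 0 \<omega>))"
  proof
    fix i
    have "local_martingale P raw_filtration (V i)"
      using A unfolding is_bracket_def V_def by (elim allE[of _ i] conjE)
    then show "\<exists>T :: nat \<Rightarrow> (real \<Rightarrow> real ^ 'n) \<Rightarrow> real.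
        (\<forall>n. stopping_time raw_filtration (T n) \<and> (\<forall>\<omega>\<in>space P. 0 \<le> T n \<omega>)) \<and>
        (AE \<omega> in P. incseq (\<lambda>n. T n \<omega>) \<and> filterlim (\<lambda>n. T n \<omega>) at_top sequentially) \<and>
        (\<forall>n. martingale P raw_filtration (\<lambda>t \<omega>. V i (min t (T n \<omega>)) \<omega> - V i 0 \<omega>))"
      unfolding local_martingale_def by blast
  qed
  from choice[OF this] obtain T where T': "\<forall>i. (\<forall>n. stopping_time raw_filtration (T i n) \<and> (\<forall>\<omega>\<in>space P. 0 \<le> T i n \<omega>)) \<and>
        (AE \<omega> in P. incseq (\<lambda>n. T i n \<omega>) \<and> filterlim (\<lambda>n. T i n \<omega>) at_top sequentially) \<and>
        (\<forall>n. martingale P raw_filtration (\<lambda>t \<omega>. V i (min t (T i n \<omega>)) \<omega> - V i 0 \<omega>))" by (elim exE)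
  have T: "\<And>i n. stopping_time raw_filtration (T i n)" "\<And>i n X. X \<in> path_space \<Longrightarrow> 0 \<le> T i n X"
    "\<And>i. AE X in P. filterlim (\<lambda>n. T i n X) at_top sequentially"
    "\<And>i n. martingale P raw_filtration (\<lambda>t X. V i (min t (T i n X)) X - V i 0 X)"
    using T' spP by auto
  define S where "S = (\<lambda>n X. Min (range (\<lambda>i. T i n X)))"
  have S: "stopping_time raw_filtration (S n)" for n unfolding S_def by (rule stopping_time_Min) (rule T)
  have S0: "0 \<le> S n X" if "X \<in> path_space" for n X unfolding S_def using T(2)[OF that] by (subst Min_ge_iff) auto
  have SleT: "S n X \<le> T i n X" for i n X unfolding S_def by (rule Min_le) auto
  define \<rho> where "\<rho> = (\<lambda>n X. min (\<sigma> X) (S n X))"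
  have \<rho>: "stopping_time raw_filtration (\<rho> n)" for n unfolding \<rho>_def by (intro stopping_time_min st S)
  have \<rho>0: "0 \<le> \<rho> n X" if "X \<in> path_space" for n X using s0[OF that] S0[OF that] by (simp add: \<rho>_def)
  have \<rho>b: "\<rho> n \<in> borel_measurable path_borel" "T i n \<in> borel_measurable path_borel" for n i
    by (intro raw_stopping_time_borel \<rho> T)+
  have step: "integrable P (\<lambda>X. indicator B X * (V i (\<rho> n X) X - V i (min t (S n X)) X))"
    "(\<integral>X. indicator B X * (V i (\<rho> n X) X - V i (min t (S n X)) X) \<partial>P) = 0" for i n
  proof -
    let ?M = "\<lambda>s X. V i (min s (T i n X)) X - V i 0 X"
    have "AE X in P. continuous_on {0..} (\<lambda>t. A t X $ i $ i)"
      using A unfolding is_bracket_def by (elim allE[of _ i] conjE) (erule eventually_mono, blast)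
    then have c: "AE X in P. continuous_on {0..} (\<lambda>s. ?M s X)" using AE_space
    proof eventually_elim
      case (elim X)
      have X: "X \<in> path_space" using elim(2) spP by simp
      have cV: "continuous_on {0..} (\<lambda>s. V i s X)" unfolding V_def by (intro continuous_intros component_continuous X elim(1))
      have "continuous_on {0..} (\<lambda>s. V i (min s (T i n X)) X)"
        by (rule continuous_on_compose2[OF cV]) (use T(2)[OF X] in \<open>auto intro!: continuous_intros\<close>)
      then show ?case by (rule continuous_on_diff[OF _ continuous_on_const])
    qed
    have Vm: "(\<lambda>X. V i (g X) X) \<in> borel_measurable P" if "g \<in> borel_measurable path_borel" "\<And>X. X \<in> path_space \<Longrightarrow> 0 \<le> g X" for g
      unfolding mP by (rule joint_compose[OF jV that(1)]) (use that in auto)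
    have meas: "(\<lambda>X. ?M (min r (\<rho> n X)) X) \<in> borel_measurable P" if r: "0 \<le> r" for r
      by (intro borel_measurable_diff Vm borel_measurable_min borel_measurable_const \<rho>b) (use r \<rho>0 T(2) in auto)
    have \<rho>P: "0 \<le> \<rho> n X" if "X \<in> space P" for X using \<rho>0[of X] that spP by simp
    note q = stopped_martingale_set[OF T(4)[of i n] c \<rho>[of n] \<rho>P meas]
    have e: "?M (min h (\<rho> n X)) X = V i (\<rho> n X) X - V i 0 X" "?M (min t (\<rho> n X)) X = V i (min t (S n X)) X - V i 0 X" if "X \<in> space P" for X
    proof -
      have "min (min h (\<rho> n X)) (T i n X) = \<rho> n X" "min (min t (\<rho> n X)) (T i n X) = min t (S n X)"
        using \<sigma>[of X] that SleT[of n X i] by (auto simp: \<rho>_def spP min_def)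
      then show "?M (min h (\<rho> n X)) X = V i (\<rho> n X) X - V i 0 X" "?M (min t (\<rho> n X)) X = V i (min t (S n X)) X - V i 0 X" by simp_all
    qed
    have eq: "indicator B X * (V i (\<rho> n X) X - V i (min t (S n X)) X) = indicator B X * (?M (min h (\<rho> n X)) X - ?M (min t (\<rho> n X)) X)"
      if "X \<in> space P" for X unfolding e[OF that] by simp
    have i1: "integrable P (\<lambda>X. ?M (min h (\<rho> n X)) X)" by (rule q(1)[OF _ _ h order.refl, of B]) (use B raw_filtration_mono[OF t(2)] in auto)
    have i2: "integrable P (\<lambda>X. ?M (min t (\<rho> n X)) X)" by (rule q(1)[OF _ _ t(1) order.refl B])
    have "integrable P (\<lambda>X. indicator B X * (?M (min h (\<rho> n X)) X - ?M (min t (\<rho> n X)) X))"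
      using integrable_mult_indicator[OF sets_F_P[OF B] Bochner_Integration.integrable_diff[OF i1 i2]] by simp
    then show "integrable P (\<lambda>X. indicator B X * (V i (\<rho> n X) X - V i (min t (S n X)) X))"
      by (subst Bochner_Integration.integrable_cong[OF refl eq]) auto
    show "(\<integral>X. indicator B X * (V i (\<rho> n X) X - V i (min t (S n X)) X) \<partial>P) = 0"
      using q(2)[OF _ _ t B] by (subst Bochner_Integration.integral_cong[OF refl eq]) auto
  qed
  define U where "U = (\<lambda>s (X :: real \<Rightarrow> real ^ 'n). X s \<bullet> X s - s)"
  have Um: "(\<lambda>X. U (g X) X) \<in> borel_measurable P" if g: "g \<in> borel_measurable path_borel" "\<And>X. X \<in> path_space \<Longrightarrow> 0 \<le> g X" for g
    unfolding mP U_def using path_eval_measurable[OF g] g(1) by measurable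
  define f where "f = (\<lambda>n X. indicator B X * (U (\<rho> n X) X - U (min t (S n X)) X))"
  have fm: "f n \<in> borel_measurable P" for n
    unfolding f_def
    by (intro borel_measurable_times borel_measurable_indicator sets_F_P[OF B] borel_measurable_diff Um)
      (use \<rho>b \<rho>0 S0 t(1) raw_stopping_time_borel[OF S] in auto)
  have f0: "(\<integral>X. f n X \<partial>P) = 0" for n
  proof -
    have "AE X in P. f n X = (\<Sum>i\<in>UNIV. indicator B X * (V i (\<rho> n X) X - V i (min t (S n X)) X))"
      using tr AE_space
    proof eventually_elim
      case (elim X)
      have X: "X \<in> path_space" using elim spP by simp
      have "U s X = (\<Sum>i\<in>UNIV. V i s X)" if "0 \<le> s" for s
        using elim(1) that by (simp add: U_def V_def sum_subtractf inner_vec_def trace_def)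
      then show ?case using \<rho>0[OF X] S0[OF X] t(1) by (simp add: f_def sum_subtractf sum_distrib_left[symmetric])
    qed
    then have "(\<integral>X. f n X \<partial>P) = (\<integral>X. (\<Sum>i\<in>UNIV. indicator B X * (V i (\<rho> n X) X - V i (min t (S n X)) X)) \<partial>P)"
      by (rule integral_cong_AE[OF fm borel_measurable_sum[OF borel_measurable_integrable[OF step(1)]]])
    also have "\<dots> = 0" by (subst Bochner_Integration.integral_sum) (simp_all only: step sum.neutral_const)
    finally show ?thesis .
  qed
  have "(\<lambda>n. \<integral>X. f n X \<partial>P) \<longlonglongrightarrow> (\<integral>X. indicator B X * (U (\<sigma> X) X - U t X) \<partial>P)"
  proof (rule integral_dominated_convergence[where w="\<lambda>_. 2 * (D\<^sup>2 + h)"])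
    show "(\<lambda>X. indicator B X * (U (\<sigma> X) X - U t X)) \<in> borel_measurable P"
      by (intro borel_measurable_times borel_measurable_indicator sets_F_P[OF B] borel_measurable_diff Um raw_stopping_time_borel st)
        (use s0 t(1) in \<open>auto intro: stopping_time_const\<close>)
    have "AE X in P. \<forall>i. filterlim (\<lambda>n. T i n X) at_top sequentially" using T(3) unfolding AE_all_countable by blast
    then show "AE X in P. (\<lambda>n. f n X) \<longlonglongrightarrow> indicator B X * (U (\<sigma> X) X - U t X)" using AE_space
    proof eventually_elim
      case (elim X)
      have X: "X \<in> path_space" using elim spP by simp
      have "eventually (\<lambda>n. \<forall>i. h \<le> T i n X) sequentially"
        using elim(1) by (intro eventually_all_finite) (simp add: filterlim_at_top)
      then have "eventually (\<lambda>n. indicator B X * (U (\<sigma> X) X - U t X) = f n X) sequentially"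
      proof eventually_elim
        case (elim n)
        have "h \<le> S n X" unfolding S_def using elim by (subst Min_ge_iff) auto
        then show ?case using \<sigma>[OF X] t by (simp add: f_def \<rho>_def min_absorb1)
      qed
      then show ?case by (rule Lim_transform_eventually[OF tendsto_const])
    qed
    show "AE X in P. norm (f n X) \<le> 2 * (D\<^sup>2 + h)" for n using bd AE_space
    proof eventually_elim
      case (elim X)
      have X: "X \<in> path_space" using elim spP by simp
      have u: "\<bar>U s X\<bar> \<le> D\<^sup>2 + h" if "0 \<le> s" "s \<le> h" for s
      proof -
        have "norm (X s) \<le> D" using elim(1) that by blast
        then have "(norm (X s))\<^sup>2 \<le> D\<^sup>2" by (intro power_mono) auto
        then have "0 \<le> X s \<bullet> X s" "X s \<bullet> X s \<le> D\<^sup>2" by (simp_all add: power2_norm_eq_inner)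
        then show ?thesis using that zero_le_power2[of D] unfolding U_def abs_le_iff by (intro conjI; linarith)
      qed
      have "\<bar>U (\<rho> n X) X\<bar> \<le> D\<^sup>2 + h" by (rule u) (use \<rho>0[OF X] \<sigma>[OF X] in \<open>auto simp: \<rho>_def\<close>)
      moreover have "\<bar>U (min t (S n X)) X\<bar> \<le> D\<^sup>2 + h" by (rule u) (use S0[OF X] t in auto)
      moreover have "\<bar>a - b\<bar> \<le> 2 * c" if "\<bar>a\<bar> \<le> c" "\<bar>b\<bar> \<le> c" for a b c :: real using that by linarith
      ultimately have "\<bar>U (\<rho> n X) X - U (min t (S n X)) X\<bar> \<le> 2 * (D\<^sup>2 + h)" by blast
      then show ?case by (cases "X \<in> B") (auto simp: f_def)
    qed
  qed (use fm in auto)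
  then have "(\<integral>X. indicator B X * (U (\<sigma> X) X - U t X) \<partial>P) = 0" unfolding f0 by (simp add: LIMSEQ_const_iff)
  then show ?thesis by (simp add: U_def)
qed

definition drop_time :: "(real ^ 'n) set \<Rightarrow> real \<Rightarrow> real \<Rightarrow> (real \<Rightarrow> real ^ 'n) \<Rightarrow> real" where
  "drop_time C t d X = t + hit C d (on_paths (\<lambda>s. X (t + s)))"

lemma later_path:
  fixes X :: "real \<Rightarrow> 'a::metric_space"
  assumes "X \<in> path_space" "0 \<le> t" shows "on_paths (\<lambda>s. X (t + s)) \<in> path_space"
proof -
  have "continuous_on {0..} (\<lambda>s. X (t + s))"
    by (rule continuous_on_compose2[OF path_space_continuous[OF assms(1)]]) (use assms(2) in \<open>auto intro!: continuous_intros\<close>)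
  then have "continuous_on {0..} (on_paths (\<lambda>s. X (t + s)))"
    by (rule continuous_on_eq) simp
  then show ?thesis by (auto simp: path_space_def on_paths_def extensional_def)
qed

lemma stopping_time_drop:
  fixes C :: "(real ^ 'n) set"
  assumes C: "closed C" and t: "0 \<le> t" and d: "0 \<le> d"
  shows "stopping_time raw_filtration (drop_time C t d)"
proof (rule raw_stopping_timeI)
  have "(\<lambda>X :: real \<Rightarrow> real ^ 'n. on_paths (\<lambda>s. X (t + s))) \<in> measurable path_borel path_borel"
  proof (rule path_measurableI)
    fix s :: real assume "0 \<le> s"
    then show "(\<lambda>X :: real \<Rightarrow> real ^ 'n. on_paths (\<lambda>s. X (t + s)) s) \<in> borel_measurable path_borel"
      using coordinate_measurable[of "t + s"] t by simp
  qed (use later_path t in auto)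
  from measurable_compose[OF this measurable_hit[OF C d]]
  show "drop_time C t d \<in> borel_measurable path_borel" unfolding drop_time_def by measurable
  show "0 \<le> drop_time C t d X" if "X \<in> path_space" for X
    using hit_bounds(1)[OF C later_path[OF that t] d] t by (simp add: drop_time_def)
  fix q X Y assume h: "0 \<le> q" "X \<in> path_space" "Y \<in> path_space" "agree q X Y" "drop_time C t d X \<le> q"
  let ?X = "on_paths (\<lambda>s. X (t + s))" and ?Y = "on_paths (\<lambda>s. Y (t + s))"
  note p = later_path[OF h(2) t] later_path[OF h(3) t]
  have b: "0 \<le> hit C d ?X" "hit C d ?X \<le> q - t" using hit_bounds(1)[OF C p(1) d] h(5) by (auto simp: drop_time_def)
  show "drop_time C t d Y \<le> q"
  proof (cases "d \<le> q - t")
    case True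
    then show ?thesis using hit_bounds(2)[OF C p(2) d] by (simp add: drop_time_def)
  next
    case False
    have "agree (q - t) ?X ?Y" using h(4) t by (simp add: agree_def)
    moreover have "?X (hit C d ?X) \<in> C" by (rule hit_in[OF C p(1) d]) (use False b in simp)
    ultimately have "hit C d ?Y = hit C d ?X" by (intro hit_agree_le[OF C p]) (use b False in auto)
    then show ?thesis using h(5) by (simp add: drop_time_def)
  qed
qed

text \<open>A law on a line segment whose quadratic variation grows at unit speed must raise the
  essential supremum of its position by \<open>r\<close> within \<open>5 r\<^sup>2\<close> units of time. Otherwise, started within \<open>r\<close>
  of the supremum and stopped on dropping \<open>2 r\<close> below it, the position has variance at most \<open>2 r\<^sup>2\<close>;
  but the drop has probability at most one half, so that the expected time run is at least \<open>5 r\<^sup>2 / 2\<close>.\<close>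

locale confined =
  fixes P :: "(real \<Rightarrow> real ^ 'n) measure" and x e :: "real ^ 'n" and h L :: real
  assumes P: "P \<in> martingale_laws x" and e: "norm e = 1" and h: "0 < h"
    and line: "AE X in P. \<forall>s. 0 \<le> s \<and> s \<le> h \<longrightarrow> X s = x + ((X s - x) \<bullet> e) *\<^sub>R e \<and> \<bar>(X s - x) \<bullet> e\<bar> \<le> L"
begin

lemma filtered: "filtered_prob_space P raw_filtration"
  using P by (intro filtered_path) (auto simp: martingale_laws_def)

sublocale filtered_prob_space P raw_filtration by (rule filtered)

lemma sets_P: "sets P = sets path_borel" using P by (simp add: martingale_laws_def)

lemma space_P [simp]: "space P = path_space" using sets_eq_imp_space_eq[OF sets_P] by simp

lemma position_stop:
  assumes "stopping_time raw_filtration \<sigma>" "\<And>X. X \<in> path_space \<Longrightarrow> t \<le> \<sigma> X \<and> \<sigma> X \<le> u" "0 \<le> t" "t \<le> u" "B \<in> sets (raw_filtration t)"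
  shows "integrable P (\<lambda>X. indicator B X * ((X (\<sigma> X) - X t) \<bullet> e))"
    "(\<integral>X. indicator B X * ((X (\<sigma> X) - X t) \<bullet> e) \<partial>P) = 0"
proof -
  note r = martingale_laws_stop[OF P assms]
  have eq: "indicator B X * ((X (\<sigma> X) - X t) \<bullet> e) = (\<Sum>i\<in>UNIV. (indicator B X * (X (\<sigma> X) $ i - X t $ i)) * e $ i)" for X
    by (simp add: inner_vec_def sum_distrib_left mult.assoc)
  show "integrable P (\<lambda>X. indicator B X * ((X (\<sigma> X) - X t) \<bullet> e))"
    unfolding eq by (intro Bochner_Integration.integrable_sum integrable_mult_left r(1))
  show "(\<integral>X. indicator B X * ((X (\<sigma> X) - X t) \<bullet> e) \<partial>P) = 0"
    unfolding eq by (subst Bochner_Integration.integral_sum) (simp_all only: integrable_mult_left r integral_mult_left_zero mult_zero_left sum.neutral_const)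
qed

lemma level_raw:
  assumes "0 \<le> t" shows "{X \<in> path_space. b < (X t - x) \<bullet> e} \<in> sets (raw_filtration t)"
proof -
  have "(\<lambda>X. (X t - x) \<bullet> e) \<in> borel_measurable (raw_filtration t)"
    using raw_coordinate[OF assms order.refl] by (intro borel_measurable_inner borel_measurable_diff) auto
  from measurable_sets[OF this, of "{b<..}"] show ?thesis by (simp add: vimage_def Int_def conj_commute)
qed

lemma bound_earlier:
  assumes st: "0 \<le> s" "s \<le> u" and ae: "AE X in P. (X u - x) \<bullet> e \<le> b"
  shows "AE X in P. (X s - x) \<bullet> e \<le> b"
proof -
  define B where "B = {X \<in> path_space. b < (X s - x) \<bullet> e}"
  have B: "B \<in> sets (raw_filtration s)" unfolding B_def by (rule level_raw[OF st(1)])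

  have i: "integrable P (\<lambda>X. indicator B X * ((X u - X s) \<bullet> e))" "(\<integral>X. indicator B X * ((X u - X s) \<bullet> e) \<partial>P) = 0"
    using position_stop[of "\<lambda>_. u" s u B] st B stopping_time_const by auto
  have neg: "AE X in P. 0 \<le> - (indicator B X * ((X u - X s) \<bullet> e))" using ae
  proof eventually_elim
    case (elim X)
    then show ?case by (cases "X \<in> B") (auto simp: B_def inner_diff_left)
  qed
  have "AE X in P. - (indicator B X * ((X u - X s) \<bullet> e)) = 0"
    using integral_nonneg_eq_0_iff_AE[OF Bochner_Integration.integrable_minus[OF i(1)] neg] i(2) by simp
  then show ?thesis using ae AE_space
  proof eventually_elim
    case (elim X)
    show ?case
    proof (rule ccontr)
      assume n: "\<not> (X s - x) \<bullet> e \<le> b"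
      then have "X \<in> B" using elim(3) by (simp add: B_def)
      then show False using elim(1,2) n by (simp add: inner_diff_left)
    qed
  qed
qed

lemma confined_step:
  assumes t: "0 \<le> t" "t + 5 * r\<^sup>2 \<le> h" and r: "0 < r" and ae: "AE X in P. (X (t + 5 * r\<^sup>2) - x) \<bullet> e \<le> a + r"
  shows "AE X in P. (X t - x) \<bullet> e \<le> a"
proof (rule ccontr)
  define \<delta> where "\<delta> = 5 * r\<^sup>2"
  have d: "0 < \<delta>" "0 \<le> \<delta>" using r by (auto simp: \<delta>_def)
  have td: "t + \<delta> \<le> h" "t \<le> t + \<delta>" using t(2) d by (simp_all add: \<delta>_def)
  assume not: "\<not> (AE X in P. (X t - x) \<bullet> e \<le> a)"
  define Q where "Q = (\<lambda>j::nat. AE X in P. (X t - x) \<bullet> e \<le> a + real j * r)"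
  obtain j where j: "\<not> Q j" "Q (Suc j)"
  proof -
    obtain n :: nat where n: "(L - a) / r \<le> real n" using real_arch_simple by blast
    then have n': "L \<le> a + real n * r" using r by (simp add: field_simps)
    have "Q n" unfolding Q_def using line
    proof eventually_elim
      case (elim X)
      have "\<bar>(X t - x) \<bullet> e\<bar> \<le> L" using elim t td d by simp
      then show ?case using n' by simp
    qed
    moreover have "\<not> Q 0" using not by (simp add: Q_def)
    ultimately show ?thesis using that by (induction n) blast+
  qed
  define m where "m = a + real (Suc j) * r"
  have mr: "m - r = a + real j * r" by (simp add: m_def algebra_simps)
  define B where "B = {X \<in> path_space. m - r < (X t - x) \<bullet> e}"
  have B: "B \<in> sets (raw_filtration t)" unfolding B_def by (rule level_raw[OF t(1)])
  have BP: "B \<in> sets P" by (rule sets_F_P[OF B])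
  have BI [simp]: "B \<inter> path_space = B" by (auto simp: B_def)
  have p: "0 < prob B"
  proof (rule ccontr)
    assume "\<not> 0 < prob B"
    then have "prob B = 0" using measure_nonneg[of P B] by linarith
    then have "AE X in P. X \<notin> B" by (intro AE_not_in) (simp add: null_sets_def BP emeasure_eq_measure)
    then have "AE X in P. (X t - x) \<bullet> e \<le> a + real j * r" using AE_space
      by eventually_elim (simp add: B_def mr not_less)
    then show False using j(1) by (simp add: Q_def)
  qed
  define C where "C = {v. (v - x) \<bullet> e \<le> m - 2 * r}"
  have C: "closed C" unfolding C_def by (intro closed_Collect_le continuous_intros)
  define \<sigma> where "\<sigma> = drop_time C t \<delta>"
  have st: "stopping_time raw_filtration \<sigma>" unfolding \<sigma>_def by (rule stopping_time_drop[OF C t(1) d(2)])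
  have \<sigma>: "t \<le> \<sigma> X \<and> \<sigma> X \<le> t + \<delta>" if "X \<in> path_space" for X
    using hit_bounds[OF C later_path[OF that t(1)] d(2)] by (simp add: \<sigma>_def drop_time_def)
  have stopped: "X (\<sigma> X) = on_paths (\<lambda>s. X (t + s)) (hit C \<delta> (on_paths (\<lambda>s. X (t + s))))" if "X \<in> path_space" for X
    using hit_bounds(1)[OF C later_path[OF that t(1)] d(2)] by (simp add: \<sigma>_def drop_time_def)
  have dropped: "(X (\<sigma> X) - x) \<bullet> e \<le> m - 2 * r" if "X \<in> path_space" "\<sigma> X < t + \<delta>" for X
  proof -
    have "X (\<sigma> X) \<in> C" unfolding stopped[OF that(1)]
      by (rule hit_in[OF C later_path[OF that(1) t(1)] d(2)]) (use that(2) in \<open>simp add: \<sigma>_def drop_time_def\<close>)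
    then show ?thesis by (simp add: C_def)
  qed
  have low: "m - 2 * r \<le> (X (\<sigma> X) - x) \<bullet> e" if "X \<in> B" for X
  proof (rule ccontr)
    assume n: "\<not> m - 2 * r \<le> (X (\<sigma> X) - x) \<bullet> e"
    have X: "X \<in> path_space" "m - r < (X t - x) \<bullet> e" using that by (auto simp: B_def)
    let ?X = "on_paths (\<lambda>s. X (t + s))"
    note p = later_path[OF X(1) t(1)]
    define g where "g = (\<lambda>s. (?X s - x) \<bullet> e)"
    let ?u = "hit C \<delta> ?X"
    have u: "0 \<le> ?u" "?u \<le> \<delta>" using hit_bounds[OF C p d(2)] by auto
    have gc: "continuous_on {0..?u} g" unfolding g_def
      by (intro continuous_intros continuous_on_subset[OF path_space_continuous[OF p]]) auto
    have g0: "m - 2 * r \<le> g 0" using X(2) r by (simp add: g_def)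
    have gu: "g ?u < m - 2 * r" using n stopped[OF X(1)] by (simp add: g_def)
    obtain s where s: "0 \<le> s" "s \<le> ?u" "g s = m - 2 * r" using IVT2'[of g ?u "m - 2 * r" 0] gu g0 u gc by auto
    have "?X s \<in> C" using s(3) by (simp add: C_def g_def)
    then have "?u \<le> s" using hit_le[OF C p s(1) _, of \<delta>] s u by simp
    then show False using s gu by (metis order_antisym less_irrefl)
  qed
  have "AE X in P. \<forall>s. 0 \<le> s \<and> s \<le> t + \<delta> \<longrightarrow> X s \<in> {v. (v - x) \<bullet> e \<le> a + r}"
  proof (rule AE_all_times[OF sets_P])
    show "closed {v. (v - x) \<bullet> e \<le> a + r}" by (intro closed_Collect_le continuous_intros)
    show "AE X in P. X s \<in> {v. (v - x) \<bullet> e \<le> a + r}" if "0 \<le> s" "s \<le> t + \<delta>" for s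
      using bound_earlier[OF that, of "a + r"] ae by (simp add: \<delta>_def)
  qed
  then have high: "AE X in P. (X (\<sigma> X) - x) \<bullet> e \<le> m" using AE_space
  proof eventually_elim
    case (elim X)
    have "(X (\<sigma> X) - x) \<bullet> e \<le> a + r" using elim \<sigma>[of X] t(1) by simp
    also have "\<dots> \<le> m" using r by (simp add: m_def algebra_simps)
    finally show ?case .
  qed
  have start: "AE X in P. (X t - x) \<bullet> e \<le> m" using j(2) by (simp add: Q_def m_def)
  have bd: "AE X in P. \<forall>s. 0 \<le> s \<and> s \<le> t + \<delta> \<longrightarrow> norm (X s) \<le> norm x + L" using line
  proof eventually_elim
    case (elim X)
    show ?case
    proof (intro allI impI)
      fix s assume "0 \<le> s \<and> s \<le> t + \<delta>"
      then have "X s = x + ((X s - x) \<bullet> e) *\<^sub>R e" "\<bar>(X s - x) \<bullet> e\<bar> \<le> L" using elim td by auto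
      then show "norm (X s) \<le> norm x + L" using norm_triangle_ineq[of x "((X s - x) \<bullet> e) *\<^sub>R e"] e by simp
    qed
  qed
  note pos = position_stop[OF st \<sigma> t(1) td(2) B]
  note var = martingale_laws_trace_stop[OF P st \<sigma> t(1) td(2) B bd]
  define Y where "Y = (\<lambda>X. indicator B X * (\<sigma> X - t))"
  define Z where "Z = (\<lambda>X. indicator B X * ((X (\<sigma> X) - X t) \<bullet> e))"
  have sm: "\<sigma> \<in> borel_measurable P"
    unfolding measurable_cong_sets[OF sets_P refl] by (rule raw_stopping_time_borel[OF st])
  have Yi: "integrable P Y"
  proof (rule integrable_const_bound[where B=\<delta>])
    have "norm (Y X) \<le> \<delta>" if "X \<in> space P" for X using \<sigma>[of X] that d by (cases "X \<in> B") (auto simp: Y_def)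
    then show "AE X in P. norm (Y X) \<le> \<delta>" by (rule AE_I2)
    show "Y \<in> borel_measurable P" unfolding Y_def using sm BP by measurable
  qed
  have Zi: "integrable P Z" "(\<integral>X. Z X \<partial>P) = 0" unfolding Z_def by (rule pos; simp)+
  have Bi: "integrable P (\<lambda>X. c * indicator B X)" "(\<integral>X. c * indicator B X \<partial>P) = c * prob B" for c :: real
    using BP by (auto simp: emeasure_eq_measure)
  define U where "U = (\<lambda>X. indicator B X * ((X (\<sigma> X) \<bullet> X (\<sigma> X) - \<sigma> X) - (X t \<bullet> X t - t)))"
  have U0: "(\<integral>X. U X \<partial>P) = 0" unfolding U_def by (rule var; simp)
  have Um: "U \<in> borel_measurable P"
  proof -
    have "(\<lambda>X. X (\<sigma> X)) \<in> borel_measurable P" "(\<lambda>X. X t) \<in> borel_measurable P"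
      unfolding measurable_cong_sets[OF sets_P refl]
      using path_eval_measurable[of \<sigma>] raw_stopping_time_borel[OF st] \<sigma> t(1) path_eval_measurable[of "\<lambda>_. t"]
      by (force intro: order_trans)+
    then show ?thesis unfolding U_def using sm BP
      by (intro borel_measurable_times borel_measurable_diff borel_measurable_inner borel_measurable_indicator) auto
  qed
  have Ui: "integrable P U"
  proof (rule integrable_const_bound[where B="2 * ((norm x + L)\<^sup>2 + h)", OF _ Um])
    show "AE X in P. norm (U X) \<le> 2 * ((norm x + L)\<^sup>2 + h)" using bd AE_space
    proof eventually_elim
      case (elim X)
      have q: "\<bar>X s \<bullet> X s - s\<bar> \<le> (norm x + L)\<^sup>2 + h" if "0 \<le> s" "s \<le> t + \<delta>" for s
      proof -
        have "norm (X s) \<le> norm x + L" using elim(1) that by blast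
        then have "(norm (X s))\<^sup>2 \<le> (norm x + L)\<^sup>2" by (intro power_mono) auto
        then have "0 \<le> X s \<bullet> X s" "X s \<bullet> X s \<le> (norm x + L)\<^sup>2" by (simp_all add: power2_norm_eq_inner)
        then show ?thesis using that td zero_le_power2[of "norm x + L"] unfolding abs_le_iff by (intro conjI; linarith)
      qed
      have "\<bar>X (\<sigma> X) \<bullet> X (\<sigma> X) - \<sigma> X\<bar> \<le> (norm x + L)\<^sup>2 + h" "\<bar>X t \<bullet> X t - t\<bar> \<le> (norm x + L)\<^sup>2 + h"
        using q[of "\<sigma> X"] q[of t] \<sigma>[of X] elim(2) t(1) td by auto
      moreover have "\<bar>a - b\<bar> \<le> 2 * c" if "\<bar>a\<bar> \<le> c" "\<bar>b\<bar> \<le> c" for a b c :: real using that by linarith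
      ultimately have "\<bar>(X (\<sigma> X) \<bullet> X (\<sigma> X) - \<sigma> X) - (X t \<bullet> X t - t)\<bar> \<le> 2 * ((norm x + L)\<^sup>2 + h)" by blast
      then show ?case by (cases "X \<in> B") (auto simp: U_def)
    qed
  qed
  have "AE X in P. U X + Y X - (2 * (x \<bullet> e) + (2 * m - 2 * r)) * Z X \<le> 2 * r\<^sup>2 * indicator B X"
    using line start high AE_space
  proof eventually_elim
    case (elim X)
    show ?case
    proof (cases "X \<in> B")
      case True
      have X: "X \<in> path_space" using elim by simp
      define n0 where "n0 = (X t - x) \<bullet> e"
      define n1 where "n1 = (X (\<sigma> X) - x) \<bullet> e"
      have ee: "e \<bullet> e = 1" using e by (simp add: norm_eq_1)
      have sq: "(x + n *\<^sub>R e) \<bullet> (x + n *\<^sub>R e) = x \<bullet> x + 2 * (x \<bullet> e) * n + n\<^sup>2" for n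
        by (simp add: inner_add_left inner_add_right ee inner_commute[of e x] power2_eq_square algebra_simps)
      have x0: "X t = x + n0 *\<^sub>R e" using elim(1) t(1) td unfolding n0_def by auto
      have x1: "X (\<sigma> X) = x + n1 *\<^sub>R e" using elim(1) \<sigma>[OF X] t(1) td unfolding n1_def by auto
      have b: "m - 2 * r \<le> n1" "n1 \<le> m" "m - r \<le> n0" "n0 \<le> m"
        using low[OF True] elim(2,3) True by (auto simp: n0_def n1_def B_def)
      have "(n1 - (m - 2 * r)) * (m - n1) \<ge> 0" using b by (intro mult_nonneg_nonneg) auto
      moreover have "(n0 - (m - 2 * r)) * (m - n0) \<le> (2 * r) * r" using b r by (intro mult_mono) auto
      ultimately have "n1\<^sup>2 - n0\<^sup>2 - (2 * m - 2 * r) * (n1 - n0) \<le> 2 * r\<^sup>2"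
        by (simp add: algebra_simps power2_eq_square)
      moreover have "Z X = n1 - n0" using True by (simp add: Z_def n0_def n1_def inner_diff_left)
      ultimately show ?thesis using True by (simp add: U_def Y_def x0 x1 sq[unfolded x0 x1]) (simp add: algebra_simps)
    qed (simp add: U_def Y_def Z_def)
  qed
  then have "(\<integral>X. U X + Y X - (2 * (x \<bullet> e) + (2 * m - 2 * r)) * Z X \<partial>P) \<le> (\<integral>X. 2 * r\<^sup>2 * indicator B X \<partial>P)"
    using Ui Yi Zi(1) Bi(1)[of "2 * r\<^sup>2"] by (intro integral_mono_AE) auto
  then have upper: "(\<integral>X. Y X \<partial>P) \<le> 2 * r\<^sup>2 * prob B"
    using Ui Yi Zi Bi(2)[of "2 * r\<^sup>2"] U0 by simp
  have "AE X in P. 2 * r * indicator B X - 2 * r / \<delta> * Y X \<le> r * indicator B X - Z X"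
    using start high AE_space
  proof eventually_elim
    case (elim X)
    show ?case
    proof (cases "X \<in> B")
      case True
      have X: "X \<in> path_space" using elim by simp
      have z: "Z X = ((X (\<sigma> X) - x) \<bullet> e) - (X t - x) \<bullet> e" using True by (simp add: Z_def inner_diff_left)
      have b: "m - r \<le> (X t - x) \<bullet> e" using True by (simp add: B_def)
      have y: "Y X = \<sigma> X - t" "0 \<le> \<sigma> X - t" "\<sigma> X - t \<le> \<delta>" using True \<sigma>[OF X] by (auto simp: Y_def)
      show ?thesis
      proof (cases "\<sigma> X < t + \<delta>")
        case lt: True
        have "0 \<le> 2 * r / \<delta> * Y X" using y r d by simp
        then show ?thesis using True z b dropped[OF X lt] by simp
      next
        case False
        then have "Y X = \<delta>" using y by simp
        then have "2 * r / \<delta> * Y X = 2 * r" using d by simp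
        then show ?thesis using True z b elim(2) by simp
      qed
    qed (simp add: Y_def Z_def)
  qed
  then have "(\<integral>X. 2 * r * indicator B X - 2 * r / \<delta> * Y X \<partial>P) \<le> (\<integral>X. r * indicator B X - Z X \<partial>P)"
    using Yi Zi(1) Bi(1)[of r] Bi(1)[of "2 * r"] by (intro integral_mono_AE) auto
  moreover have "(\<integral>X. 2 * r * indicator B X - 2 * r / \<delta> * Y X \<partial>P) = 2 * r * prob B - 2 * r / \<delta> * (\<integral>X. Y X \<partial>P)"
    using Yi Bi[of "2 * r"] by (subst Bochner_Integration.integral_diff) simp_all
  moreover have "(\<integral>X. r * indicator B X - Z X \<partial>P) = r * prob B"
    using Zi Bi[of r] by (subst Bochner_Integration.integral_diff) simp_all
  ultimately have "2 * r * prob B - 2 * r / \<delta> * (\<integral>X. Y X \<partial>P) \<le> r * prob B" by simp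
  then have "r * prob B \<le> 2 * r / \<delta> * (\<integral>X. Y X \<partial>P)" by simp
  also have "\<dots> \<le> 2 * r / \<delta> * (2 * r\<^sup>2 * prob B)" using upper r d by (intro mult_left_mono) auto
  also have "\<dots> = 4 / 5 * (r * prob B)" using r by (simp add: \<delta>_def field_simps power2_eq_square)
  finally show False using mult_pos_pos[OF r p] by simp
qed

lemma confined_False: False
proof -
  define k where "k = Suc (nat \<lceil>5 * L\<^sup>2 / h\<rceil>)"
  define r where "r = sqrt (h / (5 * real k))"
  have k: "5 * L\<^sup>2 / h < real k" "0 < real k" unfolding k_def by linarith+
  have r: "0 < r" "5 * r\<^sup>2 * real k = h" using h k(2) by (simp_all add: r_def)
  have L0: "0 \<le> L"
  proof -
    have "AE X in P. 0 \<le> L" using line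
    proof eventually_elim
      case (elim X)
      have "\<bar>(X 0 - x) \<bullet> e\<bar> \<le> L" using elim h by simp
      then show ?case using abs_ge_zero order_trans by blast
    qed
    then show ?thesis by simp
  qed
  have "AE X in P. (X (h - real j * (5 * r\<^sup>2)) - x) \<bullet> e \<le> L - real j * r" if "j \<le> k" for j
    using that
  proof (induction j)
    case 0
    show ?case using line by eventually_elim (use h in \<open>auto simp: abs_le_iff\<close>)
  next
    case (Suc j)
    have "real (Suc j) * (5 * r\<^sup>2) \<le> real k * (5 * r\<^sup>2)" using Suc.prems by (intro mult_right_mono) auto
    then have t: "0 \<le> h - real (Suc j) * (5 * r\<^sup>2)" using r(2) by (simp add: mult.commute)
    have eq: "h - real (Suc j) * (5 * r\<^sup>2) + 5 * r\<^sup>2 = h - real j * (5 * r\<^sup>2)" "L - real (Suc j) * r + r = L - real j * r"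
      by (simp_all add: algebra_simps)
    show ?case by (rule confined_step[OF t _ r(1)], unfold eq) (use Suc in auto)
  qed
  from this[of k] have "AE X in P. (X 0 - x) \<bullet> e \<le> L - real k * r" using r(2) by (simp add: mult.commute)
  moreover have "AE X in P. X 0 = x" using P by (simp add: martingale_laws_def)
  ultimately have "AE X in P. 0 \<le> L - real k * r" by eventually_elim simp
  then have "real k * r \<le> L" by simp
  then have "(real k * r)\<^sup>2 \<le> L\<^sup>2" using r(1) by (intro power_mono) auto
  moreover have "5 * (real k * r)\<^sup>2 = real k * h" unfolding r(2)[symmetric] by (simp add: power2_eq_square)
  ultimately have "real k * h \<le> 5 * L\<^sup>2" by simp
  then show False using k(1) h by (simp add: field_simps)
qed

end

section \<open>The value function\<close>

lemma exit_time_ge: "ereal c \<le> exit_time K X \<longleftrightarrow> (\<forall>s. 0 \<le> s \<and> s < c \<longrightarrow> X s \<in> K)"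
  unfolding exit_time_def le_Inf_iff by (auto simp: not_le[symmetric])

lemma value_fun_ge:
  fixes K :: "(real ^ 'n) set"
  assumes P: "P \<in> martingale_laws x" and K: "closed K" and s: "AE X in P. \<forall>s. 0 \<le> s \<and> s < c \<longrightarrow> X s \<in> K"
  shows "ereal c \<le> value_fun K x"
proof -
  interpret prob_space P using P by (simp add: martingale_laws_def)
  have sP: "sets P = sets path_borel" using P by (simp add: martingale_laws_def)
  have spP: "space P = path_space" using sets_eq_imp_space_eq[OF sP] by simp
  have "measure P {X \<in> space P. ereal c \<le> exit_time K X} = 1"
    using s measurable_stays[OF K, of c] by (subst prob_Collect_eq_1) (simp_all add: exit_time_ge sP spP)
  then have "ereal c \<le> ess_inf P (exit_time K)" unfolding ess_inf_def by (intro Sup_upper) simp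
  then show ?thesis unfolding value_fun_def by (rule SUP_upper2[OF P])
qed

lemma value_fun_greater:
  fixes K :: "(real ^ 'n) set"
  assumes "ereal c < value_fun K x"
  obtains P where "P \<in> martingale_laws x" "AE X in P. \<forall>s. 0 \<le> s \<and> s < c \<longrightarrow> X s \<in> K"
proof -
  obtain P b where P: "P \<in> martingale_laws x" and b: "ereal c < b" "measure P {X \<in> space P. b \<le> exit_time K X} = 1"
    using assms by (auto simp: value_fun_def ess_inf_def less_SUP_iff less_Sup_iff)
  interpret prob_space P using P by (simp add: martingale_laws_def)
  have "AE X in P. X \<in> {X \<in> space P. b \<le> exit_time K X}" by (rule AE_prob_1[OF b(2)])
  then have "AE X in P. \<forall>s. 0 \<le> s \<and> s < c \<longrightarrow> X s \<in> K"
  proof eventually_elim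
    case (elim X)
    then have "ereal c \<le> exit_time K X" using b(1) by (auto intro: less_imp_le less_le_trans)
    then show ?case by (simp only: exit_time_ge)
  qed
  with P show ?thesis by (rule that)
qed

lemma value_fun_nonneg:
  fixes K :: "(real ^ 'n) set"
  assumes "closed K" shows "0 \<le> value_fun K x"
proof -
  have "line_law x (axis (SOME i. True) 1) \<in> martingale_laws x" by (rule line_law_in_martingale_laws) simp
  then have "ereal 0 \<le> value_fun K x" by (rule value_fun_ge[OF _ assms]) (intro AE_I2, linarith)
  then show ?thesis by (simp add: zero_ereal_def)
qed

lemma value_fun_mem:
  assumes "P \<in> martingale_laws x" "AE X in P. \<forall>s. 0 \<le> s \<and> s < c \<longrightarrow> X s \<in> K" "0 < c"
  shows "x \<in> K"
proof -
  interpret prob_space P using assms by (simp add: martingale_laws_def)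
  have "AE X in P. X 0 = x" using assms by (simp add: martingale_laws_def)
  with assms(2) have "AE X in P. x \<in> K"
  proof eventually_elim
    case (elim X)
    then show ?case using assms(3) by (metis order.refl)
  qed
  then show ?thesis by simp
qed

lemma convex_superlevel:
  fixes K :: "(real ^ 'n) set"
  assumes K: "closed K" "convex K" shows "convex {x. ereal c \<le> value_fun K x}"
  unfolding convex_alt
proof (intro ballI allI impI)
  fix x y u assume h: "x \<in> {x. ereal c \<le> value_fun K x}" "y \<in> {x. ereal c \<le> value_fun K x}" "0 \<le> u \<and> u \<le> (1::real)"
  let ?z = "(1 - u) *\<^sub>R x + u *\<^sub>R y"
  show "?z \<in> {x. ereal c \<le> value_fun K x}"
  proof (cases "u = 0 \<or> u = 1 \<or> x = y")
    case True
    have "(1 - u) *\<^sub>R y + u *\<^sub>R y = y" by (simp add: scaleR_left_diff_distrib)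
    then show ?thesis using True h by auto
  next
    case False
    have "ereal c \<le> value_fun K ?z"
    proof (rule ccontr)
      assume "\<not> ereal c \<le> value_fun K ?z"
      then obtain r where r: "value_fun K ?z < ereal r" "ereal r < ereal c" using ereal_dense2 not_le by metis
      have "0 < ereal r" using value_fun_nonneg[OF K(1)] r(1) by (rule order.strict_trans1)
      then have r0: "0 < r" by simp
      have xy: "ereal r < value_fun K x" "ereal r < value_fun K y" using h(1,2) less_le_trans[OF r(2)] by simp_all
      obtain PX where PX: "PX \<in> martingale_laws x" "AE X in PX. \<forall>s. 0 \<le> s \<and> s < r \<longrightarrow> X s \<in> K"
        by (rule value_fun_greater[OF xy(1)])
      obtain PY where PY: "PY \<in> martingale_laws y" "AE X in PY. \<forall>s. 0 \<le> s \<and> s < r \<longrightarrow> X s \<in> K"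
        by (rule value_fun_greater[OF xy(2)])
      have u: "0 < u" "u < 1" "x \<noteq> y" using False h(3) by auto
      obtain PZ where "PZ \<in> martingale_laws ?z" "AE X in PZ. \<forall>s. 0 \<le> s \<and> s < r \<longrightarrow> X s \<in> K"
        by (rule martingale_laws_between[OF K value_fun_mem[OF PX r0] value_fun_mem[OF PY r0] u PX PY])
      from value_fun_ge[OF this(1) K(1) this(2)] r(1) show False by simp
    qed
    then show ?thesis by simp
  qed
qed

lemma (in prob_space) face_of_mean:
  fixes K :: "'v::euclidean_space set"
  assumes K: "convex K" and x: "x \<in> K" and Y: "AE \<omega> in M. Y \<omega> \<in> K"
    and m: "\<And>a. integrable M (\<lambda>\<omega>. a \<bullet> Y \<omega>)" "\<And>a. (\<integral>\<omega>. a \<bullet> Y \<omega> \<partial>M) = a \<bullet> x"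
  obtains G where "G face_of K" "x \<in> rel_interior G" "AE \<omega> in M. Y \<omega> \<in> G"
proof -
  define good where "good = (\<lambda>G. G face_of K \<and> x \<in> G \<and> (AE \<omega> in M. Y \<omega> \<in> G))"
  have "good K" using face_of_refl[OF K] x Y by (simp add: good_def)
  then obtain G where G: "good G" "\<And>G'. good G' \<Longrightarrow> nat (aff_dim G + 1) \<le> nat (aff_dim G' + 1)"
    using ex_has_least_nat[of good K "\<lambda>G. nat (aff_dim G + 1)"] by blast
  have GK: "G face_of K" "x \<in> G" "AE \<omega> in M. Y \<omega> \<in> G" using G(1) by (auto simp: good_def)
  have cG: "convex G" by (rule face_of_imp_convex[OF GK(1)])
  have "x \<in> rel_interior G"
  proof (rule ccontr)
    assume n: "x \<notin> rel_interior G"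
    obtain a where a: "a \<noteq> 0" "\<And>y. y \<in> G \<Longrightarrow> a \<bullet> x \<le> a \<bullet> y" "\<And>y. y \<in> rel_interior G \<Longrightarrow> a \<bullet> x < a \<bullet> y"
      using supporting_hyperplane_rel_boundary[OF cG GK(2) n] by blast
    define G' where "G' = G \<inter> {y. a \<bullet> y = a \<bullet> x}"
    have f: "G' face_of G" unfolding G'_def by (rule face_of_Int_supporting_hyperplane_ge[OF cG a(2)])
    have "AE \<omega> in M. 0 \<le> a \<bullet> Y \<omega> - a \<bullet> x" using GK(3) by eventually_elim (simp add: a(2))
    moreover have "integrable M (\<lambda>\<omega>. a \<bullet> Y \<omega> - a \<bullet> x)" "(\<integral>\<omega>. a \<bullet> Y \<omega> - a \<bullet> x \<partial>M) = 0"
      using m[of a] by (simp_all add: prob_space)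
    ultimately have "AE \<omega> in M. a \<bullet> Y \<omega> - a \<bullet> x = 0" by (subst integral_nonneg_eq_0_iff_AE[symmetric])
    with GK(3) have "AE \<omega> in M. Y \<omega> \<in> G'" by eventually_elim (simp add: G'_def)
    then have "good G'" using face_of_trans[OF f GK(1)] GK(2) by (simp add: good_def G'_def)
    then have le: "nat (aff_dim G + 1) \<le> nat (aff_dim G' + 1)" by (rule G(2))
    obtain y where "y \<in> rel_interior G" using rel_interior_eq_empty[OF cG] GK(2) by blast
    then have "y \<in> G" "y \<notin> G'" using a(3) rel_interior_subset by (fastforce simp: G'_def)+
    then have "aff_dim G' < aff_dim G" using face_of_aff_dim_lt[OF cG f] by blast
    then show False using le aff_dim_geq[of G'] by linarith
  qed
  then show ?thesis using GK(1,3) that by blast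
qed

lemma value_fun_face:
  fixes K :: "(real ^ 'n) set"
  assumes K: "compact K" "convex K" and F: "F face_of K" "aff_dim F \<le> 1" and x: "x \<in> F"
  shows "value_fun K x = 0"
proof (rule antisym[OF _ value_fun_nonneg[OF compact_imp_closed[OF K(1)]]], rule ccontr)
  assume "\<not> value_fun K x \<le> 0"
  then obtain c where c: "0 < ereal c" "ereal c < value_fun K x" using ereal_dense2 not_le by metis
  then obtain P where P: "P \<in> martingale_laws x" and s: "AE X in P. \<forall>s. 0 \<le> s \<and> s < c \<longrightarrow> X s \<in> K"
    using value_fun_greater by blast
  have c0: "0 < c" using c by simp
  have sP: "sets P = sets path_borel" and pP: "prob_space P" and x0: "AE X in P. X 0 = x"
    using P by (auto simp: martingale_laws_def)
  interpret filtered_prob_space P raw_filtration by (rule filtered_path[OF pP sP])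
  have spP: "space P = path_space" using sets_eq_imp_space_eq[OF sP] by simp
  have xK: "x \<in> K" using x F(1) face_of_imp_subset by blast
  have comp: "integrable P (\<lambda>X. X t $ i)" "(\<integral>X. X t $ i \<partial>P) = x $ i" if t: "0 \<le> t" for t i
  proof -
    have M: "martingale P raw_filtration (\<lambda>t X. X t $ i)" using P by (simp add: martingale_laws_def)
    then show i: "integrable P (\<lambda>X. X t $ i)" using t by (simp add: martingale_def)
    have "path_space \<in> sets (raw_filtration 0 :: (real \<Rightarrow> real ^ 'n) measure)" using sets.top[of "raw_filtration 0"] by simp
    from martingale_set[OF M order.refl t this]
    have "(\<integral>X. indicator (space P) X * X t $ i \<partial>P) = (\<integral>X. indicator (space P) X * X 0 $ i \<partial>P)" by (simp only: spP)
    moreover have "(\<integral>X. indicator (space P) X * f X \<partial>P) = (\<integral>X. f X \<partial>P)" for f :: "_ \<Rightarrow> real"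
      by (rule Bochner_Integration.integral_cong) auto
    ultimately have "(\<integral>X. X t $ i \<partial>P) = (\<integral>X. X 0 $ i \<partial>P)" by simp
    also have "\<dots> = (\<integral>X. x $ i \<partial>P)"
    proof (rule integral_cong_AE)
      show "(\<lambda>X. X 0 $ i) \<in> borel_measurable P" using M by (auto simp: martingale_def)
      show "AE X in P. X 0 $ i = x $ i" using x0 by eventually_elim simp
    qed simp
    finally show "(\<integral>X. X t $ i \<partial>P) = x $ i" by (simp add: prob_space)
  qed
  have "AE X in P. X t \<in> F" if t: "0 \<le> t" "t \<le> c / 2" for t
  proof -
    have tK: "AE X in P. X t \<in> K" using s by eventually_elim (use t c0 in auto)
    have m: "integrable P (\<lambda>X. a \<bullet> X t)" "(\<integral>X. a \<bullet> X t \<partial>P) = a \<bullet> x" for a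
      using comp[OF t(1)] by (simp_all add: inner_vec_def)
    obtain G where G: "G face_of K" "x \<in> rel_interior G" "AE X in P. X t \<in> G"
      by (rule face_of_mean[OF K(2) xK tK m])
    have "G \<subseteq> F" by (rule subset_of_face_of[OF F(1) face_of_imp_subset[OF G(1)]]) (use G(2) x in blast)
    then show ?thesis using G(3) by (auto elim: eventually_mono)
  qed
  then have stay: "AE X in P. \<forall>s. 0 \<le> s \<and> s \<le> c / 2 \<longrightarrow> X s \<in> F"
    by (rule AE_all_times[OF sP face_of_imp_closed[OF K(2) compact_imp_closed[OF K(1)] F(1)]])
  have "collinear F" using F(2) by (simp add: collinear_aff_dim)
  then obtain u where u: "\<And>y. y \<in> F \<Longrightarrow> \<exists>r. y - x = r *\<^sub>R u" using x unfolding collinear_def by blast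
  define e where "e = (if u = 0 then axis (SOME i. True) 1 else u /\<^sub>R norm u)"
  have e: "norm e = 1" by (simp add: e_def)
  then have ee: "e \<bullet> e = 1" by (simp add: norm_eq_1)
  have line: "y = x + ((y - x) \<bullet> e) *\<^sub>R e" if "y \<in> F" for y
  proof -
    obtain r where r: "y - x = r *\<^sub>R u" using u \<open>y \<in> F\<close> by blast
    have "u = norm u *\<^sub>R e" by (simp add: e_def)
    then have "y - x = (r * norm u) *\<^sub>R e" using r by (metis scaleR_scaleR)
    then have "y - x = ((y - x) \<bullet> e) *\<^sub>R e" using ee by simp
    then show ?thesis by (simp add: algebra_simps)
  qed
  have "bounded F" using compact_imp_bounded[OF face_of_imp_compact[OF K(2,1) F(1)]] .
  then obtain D where D: "\<And>y. y \<in> F \<Longrightarrow> norm (y - x) \<le> D"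
    using bounded_iff bounded_translation[of F "- x"] by (metis (no_types, lifting) imageI uminus_add_conv_diff)
  interpret confined P x e "c / 2" D
  proof
    show "P \<in> martingale_laws x" "norm e = 1" "0 < c / 2" using P e c0 by auto
    show "AE X in P. \<forall>s. 0 \<le> s \<and> s \<le> c / 2 \<longrightarrow> X s = x + ((X s - x) \<bullet> e) *\<^sub>R e \<and> \<bar>(X s - x) \<bullet> e\<bar> \<le> D"
      using stay
    proof eventually_elim
      case (elim X)
      have "\<bar>(y - x) \<bullet> e\<bar> \<le> D" if "y \<in> F" for y
        using Cauchy_Schwarz_ineq2[of "y - x" e] D[OF that] e by simp
      then show ?case using elim line by blast
    qed
  qed
  show False by (rule confined_False)
qed

lemma disc_in_face:
  fixes x :: "'v::euclidean_space"
  assumes x: "x \<in> rel_interior G" and d: "2 \<le> aff_dim G"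
  obtains e1 e2 R where "norm e1 = 1" "norm e2 = 1" "e1 \<bullet> e2 = 0" "0 < R"
    "\<And>v. v \<in> span {e1, e2} \<Longrightarrow> norm v \<le> R \<Longrightarrow> x + v \<in> G"
proof -
  have xG: "x \<in> affine hull G" using x rel_interior_subset hull_subset[of G affine] by blast
  let ?S = "span ((\<lambda>y. - x + y) ` G)"
  obtain E where E: "E \<subseteq> ?S" "pairwise orthogonal E" "\<And>v. v \<in> E \<Longrightarrow> norm v = 1" "card E = dim ?S" "span E = ?S"
    using orthonormal_basis_subspace[OF subspace_span] by metis
  have "2 \<le> card E" using d aff_dim_eq_dim[OF xG] E(4) by (simp add: dim_span)
  then obtain e1 e2 where e12: "e1 \<in> E" "e2 \<in> E" "e1 \<noteq> e2"
    by (metis card_le_Suc0_iff_eq card.infinite not_less_eq_eq numeral_2_eq_2 zero_le)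
  obtain R where R: "0 < R" "cball x R \<inter> affine hull G \<subseteq> G" using x unfolding mem_rel_interior_cball by blast
  show ?thesis
  proof
    show "norm e1 = 1" "norm e2 = 1" using E(3) e12 by auto
    show "e1 \<bullet> e2 = 0" using E(2) e12 by (simp add: pairwise_def orthogonal_def)
    show "0 < R" by fact
    fix v assume v: "v \<in> span {e1, e2}" "norm v \<le> R"
    have "v \<in> ?S" using v(1) span_mono[of "{e1, e2}" E] e12 E(5) by blast
    then have "x + v \<in> affine hull G" unfolding affine_hull_span_gen[OF xG] by blast
    moreover have "x + v \<in> cball x R" using v(2) by (simp add: dist_norm)
    ultimately show "x + v \<in> G" using R(2) by blast
  qed
qed

lemma value_fun_circle:
  fixes K :: "(real ^ 'n) set"
  assumes K: "closed K" and e: "norm e1 = 1" "norm e2 = 1" "e1 \<bullet> e2 = 0" and r: "0 < r" and R: "0 \<le> R"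
    and disc: "\<And>v. v \<in> span {e1, e2} \<Longrightarrow> norm v \<le> R \<Longrightarrow> x + v \<in> K"
  shows "ereal (R\<^sup>2 - r\<^sup>2) \<le> value_fun K (x + r *\<^sub>R e1)"
proof -
  interpret circle x e1 e2 "r\<^sup>2" by unfold_locales (use e r in auto)
  have "AE X in claw. \<forall>s. 0 \<le> s \<and> s < R\<^sup>2 - r\<^sup>2 \<longrightarrow> X s \<in> K"
  proof (rule AE_claw[OF measurable_stays[OF K]], intro allI impI)
    fix z s assume s: "0 \<le> s \<and> s < R\<^sup>2 - r\<^sup>2"
    have "(norm (cmap z s - x))\<^sup>2 \<le> R\<^sup>2" using cmap_norm[of s z] s by simp
    then have "norm (cmap z s - x) \<le> R" using R by (rule power2_le_imp_le)
    from disc[OF cmap_in_plane this] s show "cmap z s \<in> K" by simp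
  qed
  from value_fun_ge[OF claw_in_martingale_laws K this] r show ?thesis by simp
qed

lemma value_fun_pos:
  fixes K :: "(real ^ 'n) set"
  assumes K: "compact K" "convex K" and x: "x \<in> K"
    and no: "\<And>F. F face_of K \<Longrightarrow> x \<in> F \<Longrightarrow> aff_dim F \<noteq> 0 \<and> aff_dim F \<noteq> 1"
  shows "0 < value_fun K x"
proof -

  obtain G where G: "G face_of K" "x \<in> rel_interior G"
    by (rule prob_space.face_of_mean[OF prob_space_measure_pmf[of "return_pmf x"] K(2) x, of "\<lambda>y. y"]) (use x in \<open>simp_all add: integrable_measure_pmf_finite AE_measure_pmf_iff\<close>)
  have xG: "x \<in> G" using G(2) rel_interior_subset by blast
  then have "aff_dim G \<noteq> - 1" using aff_dim_empty[of G] by blast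
  then have "0 \<le> aff_dim G" using aff_dim_geq[of G] by linarith
  then have "2 \<le> aff_dim G" using no[OF G(1) xG] by linarith
  then obtain e1 e2 R where e: "norm e1 = 1" "norm e2 = 1" "e1 \<bullet> e2 = 0" and R: "0 < R"
    and disc: "\<And>v. v \<in> span {e1, e2} \<Longrightarrow> norm v \<le> R \<Longrightarrow> x + v \<in> G"
    using disc_in_face[OF G(2)] by metis
  have disc': "x + v \<in> K" if "v \<in> span {e1, e2}" "norm v \<le> R" for v
    using disc[OF that] face_of_imp_subset[OF G(1)] by blast
  have "span {- e1, e2} \<subseteq> span {e1, e2}"
    by (rule span_minimal) (auto intro: span_neg span_base)
  then have disc'': "x + v \<in> K" if "v \<in> span {- e1, e2}" "norm v \<le> R" for v using disc' that by blast
  have K': "closed K" using K(1) by (rule compact_imp_closed)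
  let ?c = "R\<^sup>2 - (R / 2)\<^sup>2"
  have "x + (R / 2) *\<^sub>R e1 \<in> {y. ereal ?c \<le> value_fun K y}"
    using value_fun_circle[OF K' e _ _ disc', where r="R / 2"] R by simp
  moreover have "x + (R / 2) *\<^sub>R (- e1) \<in> {y. ereal ?c \<le> value_fun K y}"
    by (rule CollectI, rule value_fun_circle[OF K' _ e(2) _ _ _ disc'']) (use R e in auto)
  ultimately have "(1 / 2) *\<^sub>R (x + (R / 2) *\<^sub>R e1) + (1 / 2) *\<^sub>R (x + (R / 2) *\<^sub>R (- e1)) \<in> {y. ereal ?c \<le> value_fun K y}"
    by (rule convexD[OF convex_superlevel[OF K' K(2)]]) auto
  moreover have "(1 / 2) *\<^sub>R (x + v) + (1 / 2) *\<^sub>R (x - v) = x" for v :: "real ^ 'n"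
  proof -
    have "(1 / 2) *\<^sub>R x + (1 / 2) *\<^sub>R x = x" by (simp flip: scaleR_left_distrib)
    then show ?thesis by (simp add: scaleR_add_right scaleR_diff_right)
  qed
  ultimately have "ereal ?c \<le> value_fun K x" by simp
  moreover have "0 < ereal ?c" using R by (simp add: power2_eq_square)
  ultimately show ?thesis by (rule less_le_trans[rotated])
qed

theorem theorem1p5:
  fixes K :: "(real ^ 'n) set"
  assumes "CARD('n) \<ge> 2"
    and "K \<noteq> {}" and "compact K" and "convex K"
  shows "(\<forall>c::real. convex {x. ereal c \<le> value_fun K x}) \<and>
    (\<forall>F. F face_of K \<and> (aff_dim F = 0 \<or> aff_dim F = 1) \<longrightarrow> (\<forall>x\<in>F. value_fun K x = 0)) \<and>
    (\<forall>x\<in>K. (\<nexists>F. F face_of K \<and> (aff_dim F = 0 \<or> aff_dim F = 1) \<and> x \<in> F)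
       \<longrightarrow> 0 < value_fun K x)"
proof (intro conjI allI impI ballI)
  show "convex {x. ereal c \<le> value_fun K x}" for c
    by (rule convex_superlevel[OF compact_imp_closed[OF assms(3)] assms(4)])
  show "value_fun K x = 0" if "F face_of K \<and> (aff_dim F = 0 \<or> aff_dim F = 1)" "x \<in> F" for F x
    by (rule value_fun_face[OF assms(3,4)]) (use that in auto)
  show "0 < value_fun K x" if "x \<in> K" "\<nexists>F. F face_of K \<and> (aff_dim F = 0 \<or> aff_dim F = 1) \<and> x \<in> F" for x
    by (rule value_fun_pos[OF assms(3,4) that(1)]) (use that(2) in blast)
qed

end
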